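(* Let $T$ be a theory. The 2-category $\mathcal{C}$ of small pseudo $T$-algebras admits bitensor products: for every small category $J$ and every small pseudo $T$-algebra $F$ there exists a bitensor product $J*F$ of $J$ and $F$ in $\mathcal{C}$.
   Context: Bitensor products. For a 2-category $\mathcal{C}$, a small category $J$ and an object $F$ of $\mathcal{C}$, an object $J*F$ of $\mathcal{C}$ is a bitensor product of $J$ and $F$ if the strict 2-functors $\mathcal{C}\to Cat$, $C\mapsto\mathcal{C}(J*F,C)$ and $C\mapsto Cat(J,\mathcal{C}(F,C))$, are equivalent in the 2-category $Hom[\mathcal{C},Cat]$ of pseudo functors, pseudo natural transformations (invertible coherence 2-cells) and modifications. Equivalently, there is a functor $\pi:J\to\mathcal{C}(F,J*F)$ such that for every object $C$ the functor $\mathcal{C}(J*F,C)\to Cat(J,\mathcal{C}(F,C))$, $b\mapsto\mathcal{C}(F,b)\circ\pi$, $\alpha\mapsto\mathcal{C}(F,\alpha)*i_\pi$, is an equivalence of categories. Theories. A theory $T$ is a category with objects $0,1,2,\dots$ in which $n$ is the product of $n$ copies of $1$, with chosen projections $pr_i:n\to 1$. Put $T(n)=Mor_T(n,1)$ (words of arity $n$). For a function $f:\{1,\dots,k\}\to\{1,\dots,\ell\}$ let $f':\ell\to k$ be the morphism with $pr_i f'=pr_{f(i)}$, and for $w\in T(k)$ put $w_f=w\circ f'\in T(\ell)$. For $w\in T(k)$, $w_i\in T(n_i)$ put $\gamma(w,w_1,\dots,w_k)=w\circ(w_1,\dots,w_k)\in T(n_1+\dots+n_k)$, where $(w_1,\dots,w_k):n_1+\dots+n_k\to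 k$ has $i$-th component $(w_i)_{\iota_i}$, $\iota_i$ being the inclusion onto the $i$-th block. The unit $1\in T(1)$ is the projection $pr_1:1\to1$. For a category $X$, $End(X)$ is the theory with $End(X)(n)=Functors(X^n,X)$; there $\gamma(F,F_1,\dots,F_k)=F\circ(F_1\times\dots\times F_k)$, $F_f(x_1,\dots,x_\ell)=F(x_{f1},\dots,x_{fk})$, and the unit is $1_X$; these operations also apply to natural transformations. Pseudo $T$-algebras. A pseudo $T$-algebra is a category $X$ with functions $\Phi:T(n)\to Functors(X^n,X)$ for all $n\ge 0$ and natural isomorphisms $c_{w,w_1,\dots,w_k}:\Phi(\gamma(w,w_1,\dots,w_k))\Rightarrow\gamma(\Phi(w),\Phi(w_1),\dots,\Phi(w_k))$, $I:\Phi(1)\Rightarrow 1_X$, $s_{w,f}:\Phi(w_f)\Rightarrow\Phi(w)_f$, such that (vertical composition written $\circ$, $i$ = identity 2-cell): (1) $\gamma(c_{w,w_1,\dots,w_k},i,\dots,i)\circ c_{\gamma(w,w_1,\dots,w_k),w_{11},\dots,w_{kn_k}}=\gamma(i_{\Phi(w)},c_{w_1,w_{11},\dots,w_{1n_1}},\dots,c_{w_k,w_{k1},\dots,w_{kn_k}})\circ c_{w,\gamma(w_1,w_{11},\dots),\dots,\gamma(w_k,w_{k1},\dots)}$; (2) $\gamma(i_{\Phi(w)},I,\dots,I)\circ c_{w,1,\dots,1}=i$; (3) $\gamma(I,i_{\Phi(w)})\circ c_{1,w}=i$; (4) for $f:\{1,\dots,k\}\to\{1,\dots,\ell\}$, $w\in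 T(k)$, $w_j\in T(n_j)$ ($1\le j\le\ell$), with $\bar f:\{1,\dots,n_{f1}+\dots+n_{fk}\}\to\{1,\dots,n_1+\dots+n_\ell\}$ carrying the $i$-th block identically onto the $f(i)$-th block: $(c_{w,w_{f1},\dots,w_{fk}})_{\bar f}\circ s_{\gamma(w,w_{f1},\dots,w_{fk}),\bar f}=\gamma(s_{w,f},i,\dots,i)\circ c_{w_f,w_1,\dots,w_\ell}$; (5) for functions $g_i:\{1,\dots,n_i\}\to\{1,\dots,n_i'\}$ with block sum $g=g_1+\dots+g_k$: $(c_{w,w_1,\dots,w_k})_g\circ s_{\gamma(w,w_1,\dots,w_k),g}=\gamma(i_{\Phi(w)},s_{w_1,g_1},\dots,s_{w_k,g_k})\circ c_{w,(w_1)_{g_1},\dots,(w_k)_{g_k}}$; (6) $(s_{w,f})_g\circ s_{w_f,g}=s_{w,g\circ f}$; (7) $s_{w,id}$ is the identity. A morphism $H:(X,\Phi)\to(Y,\Psi)$ of pseudo $T$-algebras is a functor with natural isomorphisms $\rho_w:H\circ\Phi(w)\Rightarrow\Psi(w)\circ(H,\dots,H)$ for all words $w$ such that $(c*i)\circ\rho_{\gamma(w,w_1,\dots,w_k)}=(i_{\Psi(w)}*(\rho_{w_1},\dots,\rho_{w_k}))\circ(\rho_w*i)\circ(i_H*c)$, $(I*i_H)\circ\rho_1=i_H*I$, and $(s_{w,f}*i)\circ\rho_{w_f}=(\rho_w)_f\circ(i_H*s_{w,f})$. Composites have $\rho^{HG}_w=(\rho^H_w*i)\circ(i_H*\rho^G_w)$.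 A 2-cell $\alpha:G\Rightarrow H$ is a natural transformation with $\rho^H_w\circ(\alpha*i_{\Phi(w)})=(i_{\Psi(w)}*(\alpha,\dots,\alpha))\circ\rho^G_w$ for all $w$. *)

theory Defs
  imports Main "HOL-Library.FuncSet" "HOL-Library.Equipollence" "HOL-Library.Countable_Set"
begin

section \<open>Categories, functors, natural transformations\<close>

record ('o, 'a) cat =
  Obj :: "'o set"
  Arr :: "'a set"
  Dom :: "'a \<Rightarrow> 'o"
  Cod :: "'a \<Rightarrow> 'o"
  Idn :: "'o \<Rightarrow> 'a"
  Cmp :: "'a \<Rightarrow> 'a \<Rightarrow> 'a"   \<comment> \<open>\<open>Cmp C g f\<close> is the composite of \<open>f\<close> followed by \<open>g\<close>\<close>

definition arrows :: "('o, 'a) cat \<Rightarrow> 'o \<Rightarrow> 'o \<Rightarrow> 'a set" where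
  "arrows C x y = {f \<in> Arr C. Dom C f = x \<and> Cod C f = y}"

definition category :: "('o, 'a) cat \<Rightarrow> bool" where
  "category C \<longleftrightarrow>
     (\<forall>f\<in>Arr C. Dom C f \<in> Obj C \<and> Cod C f \<in> Obj C) \<and>
     (\<forall>x\<in>Obj C. Idn C x \<in> arrows C x x) \<and>
     (\<forall>f\<in>Arr C. \<forall>g\<in>Arr C. Cod C f = Dom C g \<longrightarrow> Cmp C g f \<in> arrows C (Dom C f) (Cod C g)) \<and>
     (\<forall>f\<in>Arr C. Cmp C f (Idn C (Dom C f)) = f \<and> Cmp C (Idn C (Cod C f)) f = f) \<and>
     (\<forall>f\<in>Arr C. \<forall>g\<in>Arr C. \<forall>h\<in>Arr C. Cod C f = Dom C g \<longrightarrow> Cod C g = Dom C h \<longrightarrow>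
        Cmp C h (Cmp C g f) = Cmp C (Cmp C h g) f)"

definition invertible_arrow :: "('o, 'a) cat \<Rightarrow> 'a \<Rightarrow> bool" where
  "invertible_arrow C f \<longleftrightarrow> f \<in> Arr C \<and>
     (\<exists>g\<in>arrows C (Cod C f) (Dom C f).
        Cmp C g f = Idn C (Dom C f) \<and> Cmp C f g = Idn C (Cod C f))"

text \<open>All maps are extensional (\<^const>\<open>undefined\<close> off their domain), so that HOL
  equality of functors and of natural transformations is the mathematical one.\<close>

record ('o, 'a, 'p, 'b) ftor =
  ob_map :: "'o \<Rightarrow> 'p"
  ar_map :: "'a \<Rightarrow> 'b"

definition is_functor ::
    "('o, 'a) cat \<Rightarrow> ('p, 'b) cat \<Rightarrow> ('o, 'a, 'p, 'b) ftor \<Rightarrow> bool" where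
  "is_functor C D F \<longleftrightarrow>
     ob_map F \<in> Obj C \<rightarrow>\<^sub>E Obj D \<and> ar_map F \<in> Arr C \<rightarrow>\<^sub>E Arr D \<and>
     (\<forall>f\<in>Arr C. ar_map F f \<in> arrows D (ob_map F (Dom C f)) (ob_map F (Cod C f))) \<and>
     (\<forall>x\<in>Obj C. ar_map F (Idn C x) = Idn D (ob_map F x)) \<and>
     (\<forall>f\<in>Arr C. \<forall>g\<in>Arr C. Cod C f = Dom C g \<longrightarrow>
        ar_map F (Cmp C g f) = Cmp D (ar_map F g) (ar_map F f))"

definition fid :: "('o, 'a) cat \<Rightarrow> ('o, 'a, 'o, 'a) ftor" where
  "fid C = \<lparr>ob_map = (\<lambda>x\<in>Obj C. x), ar_map = (\<lambda>f\<in>Arr C. f)\<rparr>"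

definition fcmp :: "('o, 'a) cat \<Rightarrow> ('p, 'b, 'q, 'c) ftor \<Rightarrow> ('o, 'a, 'p, 'b) ftor
    \<Rightarrow> ('o, 'a, 'q, 'c) ftor" where
  "fcmp C G F = \<lparr>ob_map = (\<lambda>x\<in>Obj C. ob_map G (ob_map F x)),
                  ar_map = (\<lambda>f\<in>Arr C. ar_map G (ar_map F f))\<rparr>"

record ('o, 'a, 'p, 'b) ntrans =
  nsrc :: "('o, 'a, 'p, 'b) ftor"
  ntgt :: "('o, 'a, 'p, 'b) ftor"
  cpt :: "'o \<Rightarrow> 'b"

definition is_ntrans ::
    "('o, 'a) cat \<Rightarrow> ('p, 'b) cat \<Rightarrow> ('o, 'a, 'p, 'b) ntrans \<Rightarrow> bool" where
  "is_ntrans C D \<alpha> \<longleftrightarrow>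
     is_functor C D (nsrc \<alpha>) \<and> is_functor C D (ntgt \<alpha>) \<and> cpt \<alpha> \<in> extensional (Obj C) \<and>
     (\<forall>x\<in>Obj C. cpt \<alpha> x \<in> arrows D (ob_map (nsrc \<alpha>) x) (ob_map (ntgt \<alpha>) x)) \<and>
     (\<forall>f\<in>Arr C. Cmp D (cpt \<alpha> (Cod C f)) (ar_map (nsrc \<alpha>) f)
              = Cmp D (ar_map (ntgt \<alpha>) f) (cpt \<alpha> (Dom C f)))"

definition is_niso :: "('o, 'a) cat \<Rightarrow> ('p, 'b) cat \<Rightarrow> ('o, 'a, 'p, 'b) ftor
    \<Rightarrow> ('o, 'a, 'p, 'b) ftor \<Rightarrow> ('o, 'a, 'p, 'b) ntrans \<Rightarrow> bool" where
  "is_niso C D F G \<alpha> \<longleftrightarrow> is_ntrans C D \<alpha> \<and> nsrc \<alpha> = F \<and> ntgt \<alpha> = G \<and>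
     (\<forall>x\<in>Obj C. invertible_arrow D (cpt \<alpha> x))"

definition nid :: "('o, 'a) cat \<Rightarrow> ('p, 'b) cat \<Rightarrow> ('o, 'a, 'p, 'b) ftor
    \<Rightarrow> ('o, 'a, 'p, 'b) ntrans" where
  "nid C D F = \<lparr>nsrc = F, ntgt = F, cpt = (\<lambda>x\<in>Obj C. Idn D (ob_map F x))\<rparr>"

definition vcomp :: "('o, 'a) cat \<Rightarrow> ('p, 'b) cat \<Rightarrow> ('o, 'a, 'p, 'b) ntrans
    \<Rightarrow> ('o, 'a, 'p, 'b) ntrans \<Rightarrow> ('o, 'a, 'p, 'b) ntrans" where
  "vcomp C D \<beta> \<alpha> = \<lparr>nsrc = nsrc \<alpha>, ntgt = ntgt \<beta>,
                    cpt = (\<lambda>x\<in>Obj C. Cmp D (cpt \<beta> x) (cpt \<alpha> x))\<rparr>"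

text \<open>\<open>hcomp C E \<beta> \<alpha>\<close> is the horizontal composite \<open>\<beta> * \<alpha>\<close> for \<open>\<alpha>\<close> between functors
  \<open>C \<rightarrow> D\<close> and \<open>\<beta>\<close> between functors \<open>D \<rightarrow> E\<close>.\<close>

definition hcomp :: "('o, 'a) cat \<Rightarrow> ('q, 'c) cat \<Rightarrow> ('p, 'b, 'q, 'c) ntrans
    \<Rightarrow> ('o, 'a, 'p, 'b) ntrans \<Rightarrow> ('o, 'a, 'q, 'c) ntrans" where
  "hcomp C E \<beta> \<alpha> = \<lparr>nsrc = fcmp C (nsrc \<beta>) (nsrc \<alpha>), ntgt = fcmp C (ntgt \<beta>) (ntgt \<alpha>),
     cpt = (\<lambda>x\<in>Obj C. Cmp E (cpt \<beta> (ob_map (ntgt \<alpha>) x)) (ar_map (nsrc \<beta>) (cpt \<alpha> x)))\<rparr>"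

definition fun_cat :: "('o, 'a) cat \<Rightarrow> ('p, 'b) cat
    \<Rightarrow> (('o, 'a, 'p, 'b) ftor, ('o, 'a, 'p, 'b) ntrans) cat" where
  "fun_cat C D = \<lparr>Obj = {F. is_functor C D F}, Arr = {\<alpha>. is_ntrans C D \<alpha>},
     Dom = nsrc, Cod = ntgt, Idn = nid C D, Cmp = vcomp C D\<rparr>"


section \<open>2-categories, 2-functors to Cat, bitensor products\<close>

text \<open>A 2-category is given by its objects, its hom-categories, identity 1-cells, and
  horizontal composition of 1-cells and of 2-cells; \<open>Cmp1 K A B C g f\<close> is \<open>g \<circ> f\<close> for
  \<open>f : A \<rightarrow> B\<close>, \<open>g : B \<rightarrow> C\<close>, and similarly for \<open>Cmp2\<close>.\<close>

record ('o, 'f, 'c) twocat =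
  Obj0 :: "'o set"
  HomC :: "'o \<Rightarrow> 'o \<Rightarrow> ('f, 'c) cat"
  Idn1 :: "'o \<Rightarrow> 'f"
  Cmp1 :: "'o \<Rightarrow> 'o \<Rightarrow> 'o \<Rightarrow> 'f \<Rightarrow> 'f \<Rightarrow> 'f"
  Cmp2 :: "'o \<Rightarrow> 'o \<Rightarrow> 'o \<Rightarrow> 'c \<Rightarrow> 'c \<Rightarrow> 'c"

text \<open>Data of a strict 2-functor from a 2-category to Cat. The indices of \<open>F1 G A B\<close> and
  \<open>F2 G A B\<close> are the source and target objects of the 1-cell or 2-cell acted upon.\<close>

record ('o, 'f, 'c, 'x, 'y) cat_functor =
  F0 :: "'o \<Rightarrow> ('x, 'y) cat"
  F1 :: "'o \<Rightarrow> 'o \<Rightarrow> 'f \<Rightarrow> ('x, 'y, 'x, 'y) ftor"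
  F2 :: "'o \<Rightarrow> 'o \<Rightarrow> 'c \<Rightarrow> ('x, 'y, 'x, 'y) ntrans"

definition representable :: "('o, 'f, 'c) twocat \<Rightarrow> 'o \<Rightarrow> ('o, 'f, 'c, 'f, 'c) cat_functor" where
  "representable K P = \<lparr>
     F0 = HomC K P,
     F1 = (\<lambda>A B f. \<lparr>
        ob_map = (\<lambda>b\<in>Obj (HomC K P A). Cmp1 K P A B f b),
        ar_map = (\<lambda>\<beta>\<in>Arr (HomC K P A). Cmp2 K P A B (Idn (HomC K A B) f) \<beta>)\<rparr>),
     F2 = (\<lambda>A B \<phi>. \<lparr>
        nsrc = \<lparr>
          ob_map = (\<lambda>b\<in>Obj (HomC K P A). Cmp1 K P A B (Dom (HomC K A B) \<phi>) b),
          ar_map = (\<lambda>\<beta>\<in>Arr (HomC K P A).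
             Cmp2 K P A B (Idn (HomC K A B) (Dom (HomC K A B) \<phi>)) \<beta>)\<rparr>,
        ntgt = \<lparr>
          ob_map = (\<lambda>b\<in>Obj (HomC K P A). Cmp1 K P A B (Cod (HomC K A B) \<phi>) b),
          ar_map = (\<lambda>\<beta>\<in>Arr (HomC K P A).
             Cmp2 K P A B (Idn (HomC K A B) (Cod (HomC K A B) \<phi>)) \<beta>)\<rparr>,
        cpt = (\<lambda>b\<in>Obj (HomC K P A). Cmp2 K P A B \<phi> (Idn (HomC K P A) b))\<rparr>)\<rparr>"

text \<open>The 2-functor \<open>A \<mapsto> Cat(J, G A)\<close>, acting by postcomposition.\<close>

definition diagrams_in :: "('i, 'm) cat \<Rightarrow> ('o, 'f, 'c, 'x, 'y) cat_functor
    \<Rightarrow> ('o, 'f, 'c, ('i, 'm, 'x, 'y) ftor, ('i, 'm, 'x, 'y) ntrans) cat_functor" where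
  "diagrams_in J G =
    (let post1 = (\<lambda>A B H. \<lparr>
        ob_map = (\<lambda>D\<in>Obj (fun_cat J (F0 G A)). fcmp J H D),
        ar_map = (\<lambda>\<delta>\<in>Arr (fun_cat J (F0 G A)).
                    hcomp J (F0 G B) (nid (F0 G A) (F0 G B) H) \<delta>)\<rparr>)
     in \<lparr>
     F0 = (\<lambda>A. fun_cat J (F0 G A)),
     F1 = (\<lambda>A B f. post1 A B (F1 G A B f)),
     F2 = (\<lambda>A B \<phi>. \<lparr>
        nsrc = post1 A B (nsrc (F2 G A B \<phi>)),
        ntgt = post1 A B (ntgt (F2 G A B \<phi>)),
        cpt = (\<lambda>D\<in>Obj (fun_cat J (F0 G A)).
                hcomp J (F0 G B) (F2 G A B \<phi>) (nid J (F0 G A) D))\<rparr>)\<rparr>)"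

text \<open>Pseudo natural transformations and modifications, i.e. the 1-cells and 2-cells of
  Hom[K,Cat], between strict 2-functors; the constraint cells of the 2-functors are
  identities and are therefore omitted from the coherence conditions.
  For \<open>f : A \<rightarrow> B\<close> the cell \<open>p1 \<sigma> A B f\<close> goes from \<open>H f \<circ> \<sigma>\<^sub>A\<close> to \<open>\<sigma>\<^sub>B \<circ> G f\<close>.\<close>

record ('o, 'f, 'x, 'y, 'z, 'w) pnat =
  p0 :: "'o \<Rightarrow> ('x, 'y, 'z, 'w) ftor"
  p1 :: "'o \<Rightarrow> 'o \<Rightarrow> 'f \<Rightarrow> ('x, 'y, 'z, 'w) ntrans"

definition pseudo_natural :: "('o, 'f, 'c) twocat \<Rightarrow> ('o, 'f, 'c, 'x, 'y) cat_functor
    \<Rightarrow> ('o, 'f, 'c, 'z, 'w) cat_functor \<Rightarrow> ('o, 'f, 'x, 'y, 'z, 'w) pnat \<Rightarrow> bool" where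
  "pseudo_natural K G H \<sigma> \<longleftrightarrow>
     (\<forall>A\<in>Obj0 K. is_functor (F0 G A) (F0 H A) (p0 \<sigma> A)) \<and>
     (\<forall>A\<in>Obj0 K. \<forall>B\<in>Obj0 K. \<forall>f\<in>Obj (HomC K A B).
        is_niso (F0 G A) (F0 H B)
          (fcmp (F0 G A) (F1 H A B f) (p0 \<sigma> A)) (fcmp (F0 G A) (p0 \<sigma> B) (F1 G A B f))
          (p1 \<sigma> A B f)) \<and>
     (\<forall>A\<in>Obj0 K. \<forall>B\<in>Obj0 K. \<forall>\<phi>\<in>Arr (HomC K A B).
        vcomp (F0 G A) (F0 H B)
          (hcomp (F0 G A) (F0 H B) (nid (F0 G B) (F0 H B) (p0 \<sigma> B)) (F2 G A B \<phi>))
          (p1 \<sigma> A B (Dom (HomC K A B) \<phi>))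
        = vcomp (F0 G A) (F0 H B)
          (p1 \<sigma> A B (Cod (HomC K A B) \<phi>))
          (hcomp (F0 G A) (F0 H B) (F2 H A B \<phi>) (nid (F0 G A) (F0 H A) (p0 \<sigma> A)))) \<and>
     (\<forall>A\<in>Obj0 K. p1 \<sigma> A A (Idn1 K A) = nid (F0 G A) (F0 H A) (p0 \<sigma> A)) \<and>
     (\<forall>A\<in>Obj0 K. \<forall>B\<in>Obj0 K. \<forall>C\<in>Obj0 K. \<forall>f\<in>Obj (HomC K A B). \<forall>g\<in>Obj (HomC K B C).
        p1 \<sigma> A C (Cmp1 K A B C g f)
        = vcomp (F0 G A) (F0 H C)
          (hcomp (F0 G A) (F0 H C) (p1 \<sigma> B C g) (nid (F0 G A) (F0 G B) (F1 G A B f)))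
          (hcomp (F0 G A) (F0 H C) (nid (F0 H B) (F0 H C) (F1 H B C g)) (p1 \<sigma> A B f)))"

definition pn_id :: "('o, 'f, 'c, 'x, 'y) cat_functor \<Rightarrow> ('o, 'f, 'x, 'y, 'x, 'y) pnat" where
  "pn_id G = \<lparr>p0 = (\<lambda>A. fid (F0 G A)), p1 = (\<lambda>A B f. nid (F0 G A) (F0 G B) (F1 G A B f))\<rparr>"

definition pn_comp :: "('o, 'f, 'c, 'x, 'y) cat_functor \<Rightarrow> ('o, 'f, 'c, 'z, 'w) cat_functor
    \<Rightarrow> ('o, 'f, 'c, 'u, 'v) cat_functor \<Rightarrow> ('o, 'f, 'z, 'w, 'u, 'v) pnat
    \<Rightarrow> ('o, 'f, 'x, 'y, 'z, 'w) pnat \<Rightarrow> ('o, 'f, 'x, 'y, 'u, 'v) pnat" where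
  "pn_comp G H L \<tau> \<sigma> = \<lparr>
     p0 = (\<lambda>A. fcmp (F0 G A) (p0 \<tau> A) (p0 \<sigma> A)),
     p1 = (\<lambda>A B f. vcomp (F0 G A) (F0 L B)
        (hcomp (F0 G A) (F0 L B) (nid (F0 H B) (F0 L B) (p0 \<tau> B)) (p1 \<sigma> A B f))
        (hcomp (F0 G A) (F0 L B) (p1 \<tau> A B f) (nid (F0 G A) (F0 H A) (p0 \<sigma> A))))\<rparr>"

definition invertible_modification :: "('o, 'f, 'c) twocat
    \<Rightarrow> ('o, 'f, 'c, 'x, 'y) cat_functor \<Rightarrow> ('o, 'f, 'c, 'z, 'w) cat_functor
    \<Rightarrow> ('o, 'f, 'x, 'y, 'z, 'w) pnat \<Rightarrow> ('o, 'f, 'x, 'y, 'z, 'w) pnat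
    \<Rightarrow> ('o \<Rightarrow> ('x, 'y, 'z, 'w) ntrans) \<Rightarrow> bool" where
  "invertible_modification K G H \<sigma> \<tau> \<Gamma> \<longleftrightarrow>
     (\<forall>A\<in>Obj0 K. is_niso (F0 G A) (F0 H A) (p0 \<sigma> A) (p0 \<tau> A) (\<Gamma> A)) \<and>
     (\<forall>A\<in>Obj0 K. \<forall>B\<in>Obj0 K. \<forall>f\<in>Obj (HomC K A B).
        vcomp (F0 G A) (F0 H B)
          (hcomp (F0 G A) (F0 H B) (\<Gamma> B) (nid (F0 G A) (F0 G B) (F1 G A B f))) (p1 \<sigma> A B f)
        = vcomp (F0 G A) (F0 H B)
          (p1 \<tau> A B f) (hcomp (F0 G A) (F0 H B) (nid (F0 H A) (F0 H B) (F1 H A B f)) (\<Gamma> A)))"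

definition equivalent_cat_functors :: "('o, 'f, 'c) twocat
    \<Rightarrow> ('o, 'f, 'c, 'x, 'y) cat_functor \<Rightarrow> ('o, 'f, 'c, 'z, 'w) cat_functor \<Rightarrow> bool" where
  "equivalent_cat_functors K G H \<longleftrightarrow>
     (\<exists>\<sigma> \<tau> \<Gamma> \<Delta>. pseudo_natural K G H \<sigma> \<and> pseudo_natural K H G \<tau> \<and>
        invertible_modification K G G (pn_comp G H G \<tau> \<sigma>) (pn_id G) \<Gamma> \<and>
        invertible_modification K H H (pn_comp H G H \<sigma> \<tau>) (pn_id H) \<Delta>)"

definition bitensor_product ::
    "('o, 'f, 'c) twocat \<Rightarrow> ('i, 'm) cat \<Rightarrow> 'o \<Rightarrow> 'o \<Rightarrow> bool" where
  "bitensor_product K J F P \<longleftrightarrow> P \<in> Obj0 K \<and>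
     equivalent_cat_functors K (representable K P) (diagrams_in J (representable K F))"


section \<open>Theories\<close>

text \<open>Indices start at 0: \<open>{1,\<dots>,k}\<close> becomes \<open>{..<k}\<close>. A function \<open>f : {..<k} \<rightarrow> {..<l}\<close> is
  represented by the list \<open>[f 0, \<dots>, f (k - 1)]\<close>, and \<open>g \<circ> f\<close> is then \<open>map ((!) g) f\<close>.\<close>

definition index_map :: "nat \<Rightarrow> nat \<Rightarrow> nat list \<Rightarrow> bool" where
  "index_map k l f \<longleftrightarrow> length f = k \<and> set f \<subseteq> {..<l}"

definition offset :: "nat list \<Rightarrow> nat \<Rightarrow> nat" where
  "offset ns i = sum_list (take i ns)"

text \<open>\<open>\<iota>\<^sub>i\<close>, the inclusion onto the \<open>i\<close>-th block of \<open>n\<^sub>0 + \<dots> + n\<^sub>k\<^sub>-\<^sub>1\<close>.\<close>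

definition block_incl :: "nat list \<Rightarrow> nat \<Rightarrow> nat list" where
  "block_incl ns i = [offset ns i ..< offset ns i + ns ! i]"

text \<open>The map \<open>\<bar>f\<close> taking the \<open>i\<close>-th block identically onto the \<open>f(i)\<close>-th block.\<close>

definition block_map :: "nat list \<Rightarrow> nat list \<Rightarrow> nat list" where
  "block_map ns f = concat (map (block_incl ns) f)"

text \<open>\<open>g\<^sub>0 + \<dots> + g\<^sub>k\<^sub>-\<^sub>1\<close>, where \<open>n'\<^sub>i\<close> is the size of the codomain of \<open>g\<^sub>i\<close>.\<close>

definition block_sum :: "nat list \<Rightarrow> nat list list \<Rightarrow> nat list" where
  "block_sum ns' gs = concat (map (\<lambda>i. map (\<lambda>j. offset ns' i + j) (gs ! i)) [0..<length gs])"

record 't thy_data =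
  tcat :: "(nat, 't) cat"
  pr :: "nat \<Rightarrow> nat \<Rightarrow> 't"    \<comment> \<open>\<open>pr T n i : n \<rightarrow> 1\<close> for \<open>i < n\<close>\<close>

definition is_theory :: "'t thy_data \<Rightarrow> bool" where
  "is_theory T \<longleftrightarrow> category (tcat T) \<and> Obj (tcat T) = UNIV \<and>
     (\<forall>n. \<forall>i<n. pr T n i \<in> arrows (tcat T) n 1) \<and>
     (\<forall>m n hs. length hs = n \<and> set hs \<subseteq> arrows (tcat T) m 1 \<longrightarrow>
        (\<exists>!h. h \<in> arrows (tcat T) m n \<and> (\<forall>i<n. Cmp (tcat T) (pr T n i) h = hs ! i)))"

definition tuple :: "'t thy_data \<Rightarrow> nat \<Rightarrow> 't list \<Rightarrow> 't" where
  "tuple T m hs = (THE h. h \<in> arrows (tcat T) m (length hs) \<and>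
     (\<forall>i<length hs. Cmp (tcat T) (pr T (length hs) i) h = hs ! i))"

definition words :: "'t thy_data \<Rightarrow> 't set" where
  "words T = {w \<in> Arr (tcat T). Cod (tcat T) w = 1}"

abbreviation arity :: "'t thy_data \<Rightarrow> 't \<Rightarrow> nat" where
  "arity T w \<equiv> Dom (tcat T) w"

text \<open>\<open>tsub T w l f\<close> is \<open>w\<^sub>f = w \<circ> f'\<close> for \<open>f\<close> with codomain \<open>{..<l}\<close>.\<close>

definition tsub :: "'t thy_data \<Rightarrow> 't \<Rightarrow> nat \<Rightarrow> nat list \<Rightarrow> 't" where
  "tsub T w l f = Cmp (tcat T) w (tuple T l (map (pr T l) f))"

definition tgamma :: "'t thy_data \<Rightarrow> 't \<Rightarrow> 't list \<Rightarrow> 't" where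
  "tgamma T w ws =
    (let ns = map (arity T) ws; N = sum_list ns
     in Cmp (tcat T) w (tuple T N (map (\<lambda>i. tsub T (ws ! i) N (block_incl ns i)) [0..<length ws])))"

definition tunit :: "'t thy_data \<Rightarrow> 't" where
  "tunit T = pr T 1 0"

definition fits :: "'t thy_data \<Rightarrow> 't \<Rightarrow> 't list \<Rightarrow> bool" where
  "fits T w ws \<longleftrightarrow> w \<in> words T \<and> set ws \<subseteq> words T \<and> length ws = arity T w"


section \<open>Powers of a category and the endomorphism theory\<close>

text \<open>Objects and arrows of \<open>X\<^sup>n\<close> are lists of length \<open>n\<close>.\<close>

definition pow :: "nat \<Rightarrow> ('o, 'a) cat \<Rightarrow> ('o list, 'a list) cat" where
  "pow n X = \<lparr>Obj = {xs. length xs = n \<and> set xs \<subseteq> Obj X},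
     Arr = {fs. length fs = n \<and> set fs \<subseteq> Arr X},
     Dom = map (Dom X), Cod = map (Cod X), Idn = map (Idn X), Cmp = map2 (Cmp X)\<rparr>"

fun blocks :: "nat list \<Rightarrow> 'x list \<Rightarrow> 'x list list" where
  "blocks [] xs = []"
| "blocks (n # ns) xs = take n xs # blocks ns (drop n xs)"

text \<open>\<open>F\<^sub>1 \<times> \<dots> \<times> F\<^sub>k\<close> on \<open>X\<^bsup>n\<^sub>1+\<dots>+n\<^sub>k\<^esup>\<close>, where \<open>F\<^sub>i\<close> is defined on \<open>X\<^bsup>n\<^sub>i\<^esup>\<close>; the same for
  natural transformations.\<close>

definition fprod :: "('o, 'a) cat \<Rightarrow> nat list \<Rightarrow> ('o list, 'a list, 'p, 'b) ftor list
    \<Rightarrow> ('o list, 'a list, 'p list, 'b list) ftor" where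
  "fprod X ns Fs = \<lparr>
     ob_map = (\<lambda>xs\<in>Obj (pow (sum_list ns) X). map2 ob_map Fs (blocks ns xs)),
     ar_map = (\<lambda>fs\<in>Arr (pow (sum_list ns) X). map2 ar_map Fs (blocks ns fs))\<rparr>"

definition nprod :: "('o, 'a) cat \<Rightarrow> nat list \<Rightarrow> ('o list, 'a list, 'p, 'b) ntrans list
    \<Rightarrow> ('o list, 'a list, 'p list, 'b list) ntrans" where
  "nprod X ns \<alpha>s = \<lparr>nsrc = fprod X ns (map nsrc \<alpha>s), ntgt = fprod X ns (map ntgt \<alpha>s),
     cpt = (\<lambda>xs\<in>Obj (pow (sum_list ns) X). map2 cpt \<alpha>s (blocks ns xs))\<rparr>"

text \<open>\<open>(H, \<dots>, H)\<close> and \<open>(\<alpha>, \<dots>, \<alpha>)\<close> on \<open>X\<^sup>n\<close>.\<close>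

definition fpow :: "('o, 'a) cat \<Rightarrow> nat \<Rightarrow> ('o, 'a, 'p, 'b) ftor
    \<Rightarrow> ('o list, 'a list, 'p list, 'b list) ftor" where
  "fpow X n H = \<lparr>ob_map = (\<lambda>xs\<in>Obj (pow n X). map (ob_map H) xs),
                 ar_map = (\<lambda>fs\<in>Arr (pow n X). map (ar_map H) fs)\<rparr>"

definition npow :: "('o, 'a) cat \<Rightarrow> nat \<Rightarrow> ('o, 'a, 'p, 'b) ntrans
    \<Rightarrow> ('o list, 'a list, 'p list, 'b list) ntrans" where
  "npow X n \<alpha> = \<lparr>nsrc = fpow X n (nsrc \<alpha>), ntgt = fpow X n (ntgt \<alpha>),
                 cpt = (\<lambda>xs\<in>Obj (pow n X). map (cpt \<alpha>) xs)\<rparr>"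

text \<open>The functor \<open>X\<^sup>l \<rightarrow> X\<^sup>k\<close>, \<open>(x\<^sub>1,\<dots>,x\<^sub>l) \<mapsto> (x\<^bsub>f1\<^esub>,\<dots>,x\<^bsub>fk\<^esub>)\<close>.\<close>

definition reindex :: "('o, 'a) cat \<Rightarrow> nat \<Rightarrow> nat list
    \<Rightarrow> ('o list, 'a list, 'o list, 'a list) ftor" where
  "reindex X l f = \<lparr>ob_map = (\<lambda>xs\<in>Obj (pow l X). map ((!) xs) f),
                    ar_map = (\<lambda>hs\<in>Arr (pow l X). map ((!) hs) f)\<rparr>"

text \<open>The operations of \<open>End(X)\<close> on functors and (suffix \<open>N\<close>) on natural transformations.
  The list \<open>ns\<close> holds the arities of \<open>F\<^sub>1,\<dots>,F\<^sub>k\<close>. Substitution is also used for functors and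
  natural transformations from a power of \<open>X\<close> to another category \<open>Y\<close>.\<close>

definition egamma :: "('o, 'a) cat \<Rightarrow> nat list \<Rightarrow> ('o list, 'a list, 'o, 'a) ftor
    \<Rightarrow> ('o list, 'a list, 'o, 'a) ftor list \<Rightarrow> ('o list, 'a list, 'o, 'a) ftor" where
  "egamma X ns F Fs = fcmp (pow (sum_list ns) X) F (fprod X ns Fs)"

definition egammaN :: "('o, 'a) cat \<Rightarrow> nat list \<Rightarrow> ('o list, 'a list, 'o, 'a) ntrans
    \<Rightarrow> ('o list, 'a list, 'o, 'a) ntrans list \<Rightarrow> ('o list, 'a list, 'o, 'a) ntrans" where
  "egammaN X ns \<alpha> \<alpha>s = hcomp (pow (sum_list ns) X) X \<alpha> (nprod X ns \<alpha>s)"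

definition esub :: "('o, 'a) cat \<Rightarrow> ('o list, 'a list, 'p, 'b) ftor \<Rightarrow> nat \<Rightarrow> nat list
    \<Rightarrow> ('o list, 'a list, 'p, 'b) ftor" where
  "esub X F l f = fcmp (pow l X) F (reindex X l f)"

definition esubN :: "('o, 'a) cat \<Rightarrow> ('p, 'b) cat \<Rightarrow> ('o list, 'a list, 'p, 'b) ntrans
    \<Rightarrow> nat \<Rightarrow> nat list \<Rightarrow> ('o list, 'a list, 'p, 'b) ntrans" where
  "esubN X Y \<alpha> l f =
     hcomp (pow l X) Y \<alpha> (nid (pow l X) (pow (length f) X) (reindex X l f))"

definition eunit :: "('o, 'a) cat \<Rightarrow> ('o list, 'a list, 'o, 'a) ftor" where
  "eunit X = \<lparr>ob_map = (\<lambda>xs\<in>Obj (pow 1 X). hd xs), ar_map = (\<lambda>fs\<in>Arr (pow 1 X). hd fs)\<rparr>"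


section \<open>Pseudo algebras\<close>

text \<open>\<open>acmp A w ws\<close> is \<open>c\<^bsub>w,w\<^sub>1,\<dots>,w\<^sub>k\<^esub>\<close>, \<open>auni A\<close> is \<open>I\<close>, and \<open>asub A w l f\<close> is \<open>s\<^bsub>w,f\<^esub>\<close> for \<open>f\<close> with
  codomain \<open>{..<l}\<close>. The values outside the index ranges of these families are irrelevant.\<close>

record ('t, 'o, 'a) palg =
  acat :: "('o, 'a) cat"
  aop :: "'t \<Rightarrow> ('o list, 'a list, 'o, 'a) ftor"
  acmp :: "'t \<Rightarrow> 't list \<Rightarrow> ('o list, 'a list, 'o, 'a) ntrans"
  auni :: "('o list, 'a list, 'o, 'a) ntrans"
  asub :: "'t \<Rightarrow> nat \<Rightarrow> nat list \<Rightarrow> ('o list, 'a list, 'o, 'a) ntrans"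

definition pseudo_algebra :: "'t thy_data \<Rightarrow> ('t, 'o, 'a) palg \<Rightarrow> bool" where
  "pseudo_algebra T A \<longleftrightarrow>
    (let X = acat A; \<Phi> = aop A; c = acmp A; I = auni A; s = asub A;
         ar = arity T; W = words T; \<gamma> = tgamma T; sub = tsub T; u = tunit T;
         i = (\<lambda>w. nid (pow (ar w) X) X (\<Phi> w))
     in category X \<and>
      (\<forall>w\<in>W. is_functor (pow (ar w) X) X (\<Phi> w)) \<and>
      (\<forall>w ws. fits T w ws \<longrightarrow>
         is_niso (pow (sum_list (map ar ws)) X) X
           (\<Phi> (\<gamma> w ws)) (egamma X (map ar ws) (\<Phi> w) (map \<Phi> ws)) (c w ws)) \<and>
      is_niso (pow 1 X) X (\<Phi> u) (eunit X) I \<and>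
      (\<forall>w\<in>W. \<forall>l f. index_map (ar w) l f \<longrightarrow>
         is_niso (pow l X) X (\<Phi> (sub w l f)) (esub X (\<Phi> w) l f) (s w l f)) \<and>
      (\<forall>w ws wss. fits T w ws \<and> list_all2 (fits T) ws wss \<longrightarrow>
         (let nss = map (map ar) wss; XN = pow (sum_list (concat nss)) X
          in vcomp XN X (egammaN X (concat nss) (c w ws) (map i (concat wss)))
                        (c (\<gamma> w ws) (concat wss))
           = vcomp XN X (egammaN X (map sum_list nss) (i w) (map2 c ws wss))
                        (c w (map2 \<gamma> ws wss)))) \<and>
      (\<forall>w\<in>W. vcomp (pow (ar w) X) X
          (egammaN X (replicate (ar w) 1) (i w) (replicate (ar w) I)) (c w (replicate (ar w) u))
        = i w) \<and>
      (\<forall>w\<in>W. vcomp (pow (ar w) X) X (egammaN X [ar w] I [i w]) (c u [w]) = i w) \<and>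
      (\<forall>w\<in>W. \<forall>ws f. set ws \<subseteq> W \<and> index_map (ar w) (length ws) f \<longrightarrow>
         (let ns = map ar ws; N = sum_list ns; wf = map ((!) ws) f; f' = block_map ns f
          in vcomp (pow N X) X (esubN X X (c w wf) N f') (s (\<gamma> w wf) N f')
           = vcomp (pow N X) X (egammaN X ns (s w (length ws) f) (map i ws))
                               (c (sub w (length ws) f) ws))) \<and>
      (\<forall>w ws ns' gs. fits T w ws \<and> length ns' = length ws \<and> length gs = length ws \<and>
           (\<forall>j<length ws. index_map (ar (ws ! j)) (ns' ! j) (gs ! j)) \<longrightarrow>
         (let N = sum_list ns'; g = block_sum ns' gs; js = [0..<length ws]
          in vcomp (pow N X) X (esubN X X (c w ws) N g) (s (\<gamma> w ws) N g)
           = vcomp (pow N X) X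
               (egammaN X ns' (i w) (map (\<lambda>j. s (ws ! j) (ns' ! j) (gs ! j)) js))
               (c w (map (\<lambda>j. sub (ws ! j) (ns' ! j) (gs ! j)) js)))) \<and>
      (\<forall>w\<in>W. \<forall>l m f g. index_map (ar w) l f \<and> index_map l m g \<longrightarrow>
         vcomp (pow m X) X (esubN X X (s w l f) m g) (s (sub w l f) m g)
         = s w m (map ((!) g) f)) \<and>
      (\<forall>w\<in>W. s w (ar w) [0..<ar w] = i w))"

text \<open>A morphism \<open>(H, \<rho>)\<close>; the family \<open>\<rho>\<close> is extensional on the set of words.\<close>

record ('t, 'o, 'a) pmor =
  mfun :: "('o, 'a, 'o, 'a) ftor"
  mrho :: "'t \<Rightarrow> ('o list, 'a list, 'o, 'a) ntrans"

definition pseudo_morphism :: "'t thy_data \<Rightarrow> ('t, 'o, 'a) palg \<Rightarrow> ('t, 'o, 'a) palg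
    \<Rightarrow> ('t, 'o, 'a) pmor \<Rightarrow> bool" where
  "pseudo_morphism T A B h \<longleftrightarrow>
    (let X = acat A; Y = acat B; \<Phi> = aop A; \<Psi> = aop B; H = mfun h; \<rho> = mrho h;
         ar = arity T; W = words T; \<gamma> = tgamma T; sub = tsub T; u = tunit T;
         iH = nid X Y H;
         iHn = (\<lambda>n. nid (pow n X) (pow n Y) (fpow X n H))
     in is_functor X Y H \<and> \<rho> \<in> extensional W \<and>
      (\<forall>w\<in>W. is_niso (pow (ar w) X) Y
         (fcmp (pow (ar w) X) H (\<Phi> w)) (fcmp (pow (ar w) X) (\<Psi> w) (fpow X (ar w) H)) (\<rho> w)) \<and>
      (\<forall>w ws. fits T w ws \<longrightarrow>
         (let ns = map ar ws; N = sum_list ns; k = ar w; XN = pow N X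
          in vcomp XN Y (hcomp XN Y (acmp B w ws) (iHn N)) (\<rho> (\<gamma> w ws))
           = vcomp XN Y
              (hcomp XN Y (nid (pow k Y) Y (\<Psi> w)) (nprod X ns (map \<rho> ws)))
              (vcomp XN Y
                (hcomp XN Y (\<rho> w) (nid XN (pow k X) (fprod X ns (map \<Phi> ws))))
                (hcomp XN Y iH (acmp A w ws))))) \<and>
      vcomp (pow 1 X) Y (hcomp (pow 1 X) Y (auni B) (iHn 1)) (\<rho> u)
        = hcomp (pow 1 X) Y iH (auni A) \<and>
      (\<forall>w\<in>W. \<forall>l f. index_map (ar w) l f \<longrightarrow>
         vcomp (pow l X) Y (hcomp (pow l X) Y (asub B w l f) (iHn l)) (\<rho> (sub w l f))
         = vcomp (pow l X) Y (esubN X Y (\<rho> w) l f) (hcomp (pow l X) Y iH (asub A w l f))))"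

definition mor_id :: "'t thy_data \<Rightarrow> ('t, 'o, 'a) palg \<Rightarrow> ('t, 'o, 'a) pmor" where
  "mor_id T A = \<lparr>mfun = fid (acat A),
     mrho = (\<lambda>w\<in>words T. nid (pow (arity T w) (acat A)) (acat A) (aop A w))\<rparr>"

text \<open>\<open>mor_comp T A B C h g\<close> is \<open>h \<circ> g\<close> for \<open>g : A \<rightarrow> B\<close> and \<open>h : B \<rightarrow> C\<close>.\<close>

definition mor_comp :: "'t thy_data \<Rightarrow> ('t, 'o, 'a) palg \<Rightarrow> ('t, 'o, 'a) palg
    \<Rightarrow> ('t, 'o, 'a) palg \<Rightarrow> ('t, 'o, 'a) pmor \<Rightarrow> ('t, 'o, 'a) pmor \<Rightarrow> ('t, 'o, 'a) pmor" where
  "mor_comp T A B C h g = \<lparr>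
     mfun = fcmp (acat A) (mfun h) (mfun g),
     mrho = (\<lambda>w\<in>words T.
       (let n = arity T w; X = acat A; Y = acat B; Z = acat C
        in vcomp (pow n X) Z
            (hcomp (pow n X) Z (mrho h w) (nid (pow n X) (pow n Y) (fpow X n (mfun g))))
            (hcomp (pow n X) Z (nid Y Z (mfun h)) (mrho g w))))\<rparr>"

text \<open>A 2-cell records its source and target 1-cells, which are not determined by the
  underlying natural transformation.\<close>

record ('t, 'o, 'a) pcell =
  csrc :: "('t, 'o, 'a) pmor"
  ctgt :: "('t, 'o, 'a) pmor"
  cnat :: "('o, 'a, 'o, 'a) ntrans"

definition pseudo_cell :: "'t thy_data \<Rightarrow> ('t, 'o, 'a) palg \<Rightarrow> ('t, 'o, 'a) palg
    \<Rightarrow> ('t, 'o, 'a) pcell \<Rightarrow> bool" where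
  "pseudo_cell T A B \<alpha> \<longleftrightarrow>
    (let X = acat A; Y = acat B; ar = arity T; g = csrc \<alpha>; h = ctgt \<alpha>
     in pseudo_morphism T A B g \<and> pseudo_morphism T A B h \<and>
      is_ntrans X Y (cnat \<alpha>) \<and> nsrc (cnat \<alpha>) = mfun g \<and> ntgt (cnat \<alpha>) = mfun h \<and>
      (\<forall>w\<in>words T.
         (let Xn = pow (ar w) X; Yn = pow (ar w) Y
          in vcomp Xn Y (mrho h w) (hcomp Xn Y (cnat \<alpha>) (nid Xn X (aop A w)))
           = vcomp Xn Y (hcomp Xn Y (nid Yn Y (aop B w)) (npow X (ar w) (cnat \<alpha>))) (mrho g w))))"

definition hom_PsAlg :: "'t thy_data \<Rightarrow> ('t, 'o, 'a) palg \<Rightarrow> ('t, 'o, 'a) palg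
    \<Rightarrow> (('t, 'o, 'a) pmor, ('t, 'o, 'a) pcell) cat" where
  "hom_PsAlg T A B = \<lparr>Obj = {h. pseudo_morphism T A B h}, Arr = {\<alpha>. pseudo_cell T A B \<alpha>},
     Dom = csrc, Cod = ctgt,
     Idn = (\<lambda>h. \<lparr>csrc = h, ctgt = h, cnat = nid (acat A) (acat B) (mfun h)\<rparr>),
     Cmp = (\<lambda>\<beta> \<alpha>. \<lparr>csrc = csrc \<alpha>, ctgt = ctgt \<beta>,
                   cnat = vcomp (acat A) (acat B) (cnat \<beta>) (cnat \<alpha>)\<rparr>)\<rparr>"

text \<open>The type \<open>'u\<close> plays the role of the universe: small categories have their objects and
  arrows in \<open>'u\<close>, and a set is small if its cardinality is strictly below that of \<open>'u\<close>. If
  \<open>'u\<close> is in bijection with a Grothendieck universe \<open>U\<close>, the small sets are, up to bijection,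
  the elements of \<open>U\<close>.\<close>

definition small :: "'u itself \<Rightarrow> 'x set \<Rightarrow> bool" where
  "small u S \<longleftrightarrow> S \<prec> (UNIV :: 'u set)"

definition small_category :: "('u, 'u) cat \<Rightarrow> bool" where
  "small_category X \<longleftrightarrow>
     category X \<and> small TYPE('u) (Obj X) \<and> small TYPE('u) (Arr X)"

definition PsAlg :: "'t thy_data \<Rightarrow>
    (('t, 'u, 'u) palg, ('t, 'u, 'u) pmor, ('t, 'u, 'u) pcell) twocat" where
  "PsAlg T = \<lparr>
     Obj0 = {A. pseudo_algebra T A \<and> small_category (acat A)},
     HomC = hom_PsAlg T,
     Idn1 = mor_id T,
     Cmp1 = mor_comp T,
     Cmp2 = (\<lambda>A B C \<beta> \<alpha>. \<lparr>
       csrc = mor_comp T A B C (csrc \<beta>) (csrc \<alpha>),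
       ctgt = mor_comp T A B C (ctgt \<beta>) (ctgt \<alpha>),
       cnat = hcomp (acat A) (acat C) (cnat \<beta>) (cnat \<alpha>)\<rparr>)\<rparr>"

end

theory Submission
  imports Defs
begin

text \<open>Objects of \<open>J * F\<close> are formal terms built with the words of \<open>T\<close> from generators \<open>(j, x)\<close>, where \<open>j\<close>
  is an object of \<open>J\<close> and \<open>x\<close> an object of \<open>F\<close>. Call a pseudo algebra \<open>A\<close> with a functor
  \<open>D : J \<rightarrow> C(F, A)\<close> a model; every term has a value in every model. An arrow of \<open>J * F\<close> is a pair of
  terms together with a family of arrows between their values, one in each model. The admissible
  families are generated by the structure isomorphisms, the images of the arrows of \<open>F\<close> and of \<open>J\<close>,
  the coherence isomorphisms of the morphisms \<open>\<pi> j\<close>, composition, the operations and inverses. Since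
  equality of arrows is tested in the models, every coherence law holds in \<open>J * F\<close> because it holds
  in each model, and no quotient is needed.

  Evaluation at a model \<open>(A, D)\<close> is a morphism \<open>J * F \<rightarrow> A\<close> whose composite with \<open>\<pi>\<close> is exactly \<open>D\<close>.
  A 2-cell is determined by its components at the generators, and extends along the terms because
  the \<open>\<rho>\<close> are invertible. The comparison functors are therefore surjective on objects and fully
  faithful, and they are strictly natural, so they form an equivalence of pseudo functors.

  Smallness: a set obtained from a small set by finitary operations with a small set of labels is
  small because \<open>'u\<close> is uncountable. The families of arrows are indexed by a large set of models,
  but only those generated in this way are used.\<close>

section \<open>Categories, functors and natural transformations\<close>

text \<open>Formal arrow expressions would have to be divided by the congruence generated by all
  coherence laws, with every construction shown well defined on classes. Taking an arrow to be the
  family of its values removes the congruence, but such families do not have type \<open>'u\<close>;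
  they are cut down to a generated, hence small, set and then encoded in \<open>'u\<close>. Inverses
  have to be a generating operation, because invertibility in every model does not by itself put the
  inverse family among the generated ones.

  The objects stay free: \<open>app\<close> is formal, so evaluation respects the operations on the
  nose and has identity constraints, while \<open>c\<close>, \<open>I\<close> and \<open>s\<close>
  remain genuine isomorphisms in \<open>J * F\<close>.

  Models only yield morphisms out of \<open>J * F\<close>. In the statement about 2-cells the two
  ends are arbitrary morphisms and not evaluations, so naturality of the extended 2-cell is proved
  by induction over the generation of arrows.

  The preimages under the comparison functors are chosen separately for each algebra. The comparison
  itself is strictly natural, but the inverse built from these choices is only pseudo
  natural.\<close>

lemma arrows_iff: "f \<in> arrows C x y \<longleftrightarrow> f \<in> Arr C \<and> Dom C f = x \<and> Cod C f = y"
  by (simp add: arrows_def)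

lemma cat_dom [simp]: "category C \<Longrightarrow> f \<in> Arr C \<Longrightarrow> Dom C f \<in> Obj C"
  and cat_cod [simp]: "category C \<Longrightarrow> f \<in> Arr C \<Longrightarrow> Cod C f \<in> Obj C"
  and cat_id_arr [simp]: "category C \<Longrightarrow> x \<in> Obj C \<Longrightarrow> Idn C x \<in> Arr C"
  and cat_id_dom [simp]: "category C \<Longrightarrow> x \<in> Obj C \<Longrightarrow> Dom C (Idn C x) = x"
  and cat_id_cod [simp]: "category C \<Longrightarrow> x \<in> Obj C \<Longrightarrow> Cod C (Idn C x) = x"
  and cat_cmp_arr [simp]: "category C \<Longrightarrow> f \<in> Arr C \<Longrightarrow> g \<in> Arr C \<Longrightarrow> Cod C f = Dom C g \<Longrightarrow> Cmp C g f \<in> Arr C"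
  and cat_cmp_dom [simp]: "category C \<Longrightarrow> f \<in> Arr C \<Longrightarrow> g \<in> Arr C \<Longrightarrow> Cod C f = Dom C g \<Longrightarrow> Dom C (Cmp C g f) = Dom C f"
  and cat_cmp_cod [simp]: "category C \<Longrightarrow> f \<in> Arr C \<Longrightarrow> g \<in> Arr C \<Longrightarrow> Cod C f = Dom C g \<Longrightarrow> Cod C (Cmp C g f) = Cod C g"
  and cat_id_right [simp]: "category C \<Longrightarrow> f \<in> Arr C \<Longrightarrow> Dom C f = x \<Longrightarrow> Cmp C f (Idn C x) = f"
  and cat_id_left [simp]: "category C \<Longrightarrow> f \<in> Arr C \<Longrightarrow> Cod C f = x \<Longrightarrow> Cmp C (Idn C x) f = f"
  by (auto simp: category_def arrows_iff)

lemma cat_assoc: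
  "category C \<Longrightarrow> f \<in> Arr C \<Longrightarrow> g \<in> Arr C \<Longrightarrow> h \<in> Arr C \<Longrightarrow> Cod C f = Dom C g \<Longrightarrow> Cod C g = Dom C h \<Longrightarrow>
    Cmp C (Cmp C h g) f = Cmp C h (Cmp C g f)"
  unfolding category_def by metis

lemma categoryI:
  assumes "\<And>f. f \<in> Arr C \<Longrightarrow> Dom C f \<in> Obj C" "\<And>f. f \<in> Arr C \<Longrightarrow> Cod C f \<in> Obj C"
    and "\<And>x. x \<in> Obj C \<Longrightarrow> Idn C x \<in> arrows C x x"
    and "\<And>f g. f \<in> Arr C \<Longrightarrow> g \<in> Arr C \<Longrightarrow> Cod C f = Dom C g \<Longrightarrow> Cmp C g f \<in> arrows C (Dom C f) (Cod C g)"
    and "\<And>f. f \<in> Arr C \<Longrightarrow> Cmp C f (Idn C (Dom C f)) = f"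
    and "\<And>f. f \<in> Arr C \<Longrightarrow> Cmp C (Idn C (Cod C f)) f = f"
    and "\<And>f g h. f \<in> Arr C \<Longrightarrow> g \<in> Arr C \<Longrightarrow> h \<in> Arr C \<Longrightarrow> Cod C f = Dom C g \<Longrightarrow> Cod C g = Dom C h \<Longrightarrow>
        Cmp C h (Cmp C g f) = Cmp C (Cmp C h g) f"
  shows "category C"
  unfolding category_def using assms by blast

section \<open>Invertible arrows and cancellation\<close>

lemma inv_arrowE:
  assumes "invertible_arrow C f"
  obtains g where "f \<in> Arr C" "g \<in> Arr C" "Dom C g = Cod C f" "Cod C g = Dom C f"
    "Cmp C g f = Idn C (Dom C f)" "Cmp C f g = Idn C (Cod C f)"
  using assms by (auto simp: invertible_arrow_def arrows_iff)

lemma inv_arrowI: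
  assumes "f \<in> Arr C" "g \<in> Arr C" "Dom C g = Cod C f" "Cod C g = Dom C f"
    "Cmp C g f = Idn C (Dom C f)" "Cmp C f g = Idn C (Cod C f)"
  shows "invertible_arrow C f"
  using assms by (auto simp: invertible_arrow_def arrows_iff)

lemma inv_arrow_arr [simp]: "invertible_arrow C f \<Longrightarrow> f \<in> Arr C"
  by (simp add: invertible_arrow_def)

lemma inv_arrow_id [simp]: "category C \<Longrightarrow> x \<in> Obj C \<Longrightarrow> invertible_arrow C (Idn C x)"
  by (rule inv_arrowI[where g="Idn C x"]) auto

lemma inv_arrow_cmp:
  assumes "category C" "invertible_arrow C f" "invertible_arrow C g" "Cod C f = Dom C g"
  shows "invertible_arrow C (Cmp C g f)"
proof -
  obtain f' where f: "f \<in> Arr C" "f' \<in> Arr C" "Dom C f' = Cod C f" "Cod C f' = Dom C f"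
    "Cmp C f' f = Idn C (Dom C f)" "Cmp C f f' = Idn C (Cod C f)" using assms(2) by (rule inv_arrowE)
  obtain g' where g: "g \<in> Arr C" "g' \<in> Arr C" "Dom C g' = Cod C g" "Cod C g' = Dom C g"
    "Cmp C g' g = Idn C (Dom C g)" "Cmp C g g' = Idn C (Cod C g)" using assms(3) by (rule inv_arrowE)
  have "Cmp C (Cmp C f' g') (Cmp C g f) = Cmp C f' (Cmp C (Cmp C g' g) f)"
    using f(1-4) g(1-4) assms by (simp add: cat_assoc)
  moreover have "Cmp C (Cmp C g f) (Cmp C f' g') = Cmp C g (Cmp C (Cmp C f f') g')"
    using f(1-4) g(1-4) assms by (simp add: cat_assoc)
  ultimately show ?thesis
    by (intro inv_arrowI[where g="Cmp C f' g'"]) (use f g assms in auto)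
qed

lemma mono_cancel:
  assumes "category C" "invertible_arrow C h" "f \<in> Arr C" "g \<in> Arr C" "Cod C f = Dom C h" "Cod C g = Dom C h"
    "Cmp C h f = Cmp C h g"
  shows "f = g"
proof -
  obtain k where k: "h \<in> Arr C" "k \<in> Arr C" "Dom C k = Cod C h" "Cod C k = Dom C h"
    "Cmp C k h = Idn C (Dom C h)" using assms(2) by (rule inv_arrowE)
  have "Cmp C (Cmp C k h) f = Cmp C (Cmp C k h) g"
    using assms k(1-4) by (simp add: cat_assoc)
  then show ?thesis using assms k by simp
qed

lemma epi_cancel:
  assumes "category C" "invertible_arrow C h" "f \<in> Arr C" "g \<in> Arr C" "Dom C f = Cod C h" "Dom C g = Cod C h"
    "Cmp C f h = Cmp C g h"
  shows "f = g"
proof -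
  obtain k where k: "h \<in> Arr C" "k \<in> Arr C" "Dom C k = Cod C h" "Cod C k = Dom C h"
    "Cmp C h k = Idn C (Cod C h)" using assms(2) by (rule inv_arrowE)
  have "Cmp C f (Cmp C h k) = Cmp C g (Cmp C h k)"
    using assms k(1-4) by (simp flip: cat_assoc)
  then show ?thesis using assms k by simp
qed

text \<open>A chosen inverse as a function of the arrow. The inverse of a family of arrows indexed
  by models is later formed model by model, which takes a function rather than a bare existence
  statement.\<close>

definition inverse_arrow :: "('o, 'a) cat \<Rightarrow> 'a \<Rightarrow> 'a" where
  "inverse_arrow C f = (SOME g. g \<in> Arr C \<and> Dom C g = Cod C f \<and> Cod C g = Dom C f \<and>
    Cmp C g f = Idn C (Dom C f) \<and> Cmp C f g = Idn C (Cod C f))"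

lemma inverse_arrow:
  assumes "invertible_arrow C f"
  shows "inverse_arrow C f \<in> Arr C" "Dom C (inverse_arrow C f) = Cod C f" "Cod C (inverse_arrow C f) = Dom C f"
    "Cmp C (inverse_arrow C f) f = Idn C (Dom C f)" "Cmp C f (inverse_arrow C f) = Idn C (Cod C f)"
proof -
  have "\<exists>g. g \<in> Arr C \<and> Dom C g = Cod C f \<and> Cod C g = Dom C f \<and>
    Cmp C g f = Idn C (Dom C f) \<and> Cmp C f g = Idn C (Cod C f)"
    using assms by (metis inv_arrowE)
  from someI_ex[OF this] show "inverse_arrow C f \<in> Arr C" "Dom C (inverse_arrow C f) = Cod C f" "Cod C (inverse_arrow C f) = Dom C f"
    "Cmp C (inverse_arrow C f) f = Idn C (Dom C f)" "Cmp C f (inverse_arrow C f) = Idn C (Cod C f)"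
    by (auto simp: inverse_arrow_def)
qed

section \<open>Functors and their composition\<close>

lemma ftor_ob [simp]: "is_functor C D F \<Longrightarrow> x \<in> Obj C \<Longrightarrow> ob_map F x \<in> Obj D"
  and ftor_ar [simp]: "is_functor C D F \<Longrightarrow> f \<in> Arr C \<Longrightarrow> ar_map F f \<in> Arr D"
  and ftor_dom [simp]: "is_functor C D F \<Longrightarrow> f \<in> Arr C \<Longrightarrow> Dom D (ar_map F f) = ob_map F (Dom C f)"
  and ftor_cod [simp]: "is_functor C D F \<Longrightarrow> f \<in> Arr C \<Longrightarrow> Cod D (ar_map F f) = ob_map F (Cod C f)"
  and ftor_id [simp]: "is_functor C D F \<Longrightarrow> x \<in> Obj C \<Longrightarrow> ar_map F (Idn C x) = Idn D (ob_map F x)"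
  and ftor_cmp: "is_functor C D F \<Longrightarrow> f \<in> Arr C \<Longrightarrow> g \<in> Arr C \<Longrightarrow> Cod C f = Dom C g \<Longrightarrow>
        ar_map F (Cmp C g f) = Cmp D (ar_map F g) (ar_map F f)"
  and ftor_ob_ext: "is_functor C D F \<Longrightarrow> ob_map F \<in> extensional (Obj C)"
  and ftor_ar_ext: "is_functor C D F \<Longrightarrow> ar_map F \<in> extensional (Arr C)"
  by (auto simp: is_functor_def arrows_iff PiE_def)

lemma is_functorI:
  assumes "ob_map F \<in> extensional (Obj C)" "ar_map F \<in> extensional (Arr C)"
    and "\<And>x. x \<in> Obj C \<Longrightarrow> ob_map F x \<in> Obj D"
    and "\<And>f. f \<in> Arr C \<Longrightarrow> ar_map F f \<in> Arr D"
    and "\<And>f. f \<in> Arr C \<Longrightarrow> Dom D (ar_map F f) = ob_map F (Dom C f)"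
    and "\<And>f. f \<in> Arr C \<Longrightarrow> Cod D (ar_map F f) = ob_map F (Cod C f)"
    and "\<And>x. x \<in> Obj C \<Longrightarrow> ar_map F (Idn C x) = Idn D (ob_map F x)"
    and "\<And>f g. f \<in> Arr C \<Longrightarrow> g \<in> Arr C \<Longrightarrow> Cod C f = Dom C g \<Longrightarrow>
        ar_map F (Cmp C g f) = Cmp D (ar_map F g) (ar_map F f)"
  shows "is_functor C D F"
  unfolding is_functor_def using assms by (auto simp: arrows_iff PiE_def)

text \<open>Asks for extensionality alone, so that it applies to raw composites such as
  \<open>fcmp C G F\<close> before anything is known about \<open>G\<close> and
  \<open>F\<close>.\<close>

lemma ftor_eqI:
  assumes "ob_map F \<in> extensional (Obj C)" "ar_map F \<in> extensional (Arr C)"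
    "ob_map G \<in> extensional (Obj C)" "ar_map G \<in> extensional (Arr C)"
    and "\<And>x. x \<in> Obj C \<Longrightarrow> ob_map F x = ob_map G x"
    and "\<And>f. f \<in> Arr C \<Longrightarrow> ar_map F f = ar_map G f"
  shows "F = (G :: ('a,'b,'c,'d) ftor)"
  by (rule ftor.equality) (use assms in \<open>auto intro: extensionalityI\<close>)

lemma functor_eqI:
  assumes "is_functor C D F" "is_functor C D' G"
    and "\<And>x. x \<in> Obj C \<Longrightarrow> ob_map F x = ob_map G x"
    and "\<And>f. f \<in> Arr C \<Longrightarrow> ar_map F f = ar_map G f"
  shows "F = G"
  by (rule ftor_eqI) (use assms ftor_ob_ext ftor_ar_ext in blast)+

lemma ntrans_eqI:
  assumes "cpt \<alpha> \<in> extensional (Obj C)" "cpt \<beta> \<in> extensional (Obj C)"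
    "nsrc \<alpha> = nsrc \<beta>" "ntgt \<alpha> = ntgt \<beta>" "\<And>x. x \<in> Obj C \<Longrightarrow> cpt \<alpha> x = cpt \<beta> x"
  shows "\<alpha> = (\<beta> :: ('a,'b,'c,'d) ntrans)"
  by (rule ntrans.equality) (use assms in \<open>auto intro: extensionalityI\<close>)

lemma invertible_arrow_functor:
  assumes "is_functor C D F" "category C" "category D" "invertible_arrow C f"
  shows "invertible_arrow D (ar_map F f)"
proof -
  obtain g where g: "f \<in> Arr C" "g \<in> Arr C" "Dom C g = Cod C f" "Cod C g = Dom C f"
    "Cmp C g f = Idn C (Dom C f)" "Cmp C f g = Idn C (Cod C f)" using assms(4) by (rule inv_arrowE)
  have "Cmp D (ar_map F g) (ar_map F f) = ar_map F (Cmp C g f)" "Cmp D (ar_map F f) (ar_map F g) = ar_map F (Cmp C f g)"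
    using assms g(1-4) by (simp_all add: ftor_cmp[OF assms(1)])
  then show ?thesis using assms g
    by (intro inv_arrowI[where g="ar_map F g"]) simp_all
qed

lemma fid_simps [simp]: "x \<in> Obj C \<Longrightarrow> ob_map (fid C) x = x" "f \<in> Arr C \<Longrightarrow> ar_map (fid C) f = f"
  by (auto simp: fid_def)

lemma fcmp_simps [simp]: "x \<in> Obj C \<Longrightarrow> ob_map (fcmp C G F) x = ob_map G (ob_map F x)"
  "f \<in> Arr C \<Longrightarrow> ar_map (fcmp C G F) f = ar_map G (ar_map F f)"
  by (auto simp: fcmp_def)

lemma fcmp_ext [simp]: "ob_map (fcmp C G F) \<in> extensional (Obj C)" "ar_map (fcmp C G F) \<in> extensional (Arr C)"
  by (auto simp: fcmp_def)

lemma fid_functor [simp]: "category C \<Longrightarrow> is_functor C C (fid C)"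
  by (rule is_functorI) (auto simp: fid_def)

lemma fcmp_functor: "category C \<Longrightarrow> is_functor C D F \<Longrightarrow> is_functor D E G \<Longrightarrow> is_functor C E (fcmp C G F)"
  by (rule is_functorI) (auto simp: ftor_cmp)

lemma fcmp_assoc: "is_functor C D F \<Longrightarrow> fcmp C (fcmp D H G) F = fcmp C H (fcmp C G F)"
  by (rule ftor_eqI[where C=C]) auto

lemma fcmp_fid_left: "is_functor C D F \<Longrightarrow> fcmp C (fid D) F = F"
  by (rule ftor_eqI[where C=C]) (auto intro: ftor_ob_ext ftor_ar_ext)

lemma fcmp_fid_right: "category C \<Longrightarrow> is_functor C D F \<Longrightarrow> fcmp C F (fid C) = F"
  by (rule ftor_eqI[where C=C]) (auto intro: ftor_ob_ext ftor_ar_ext)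

section \<open>Natural transformations and their two compositions\<close>

lemma nt_src [simp]: "is_ntrans C D \<alpha> \<Longrightarrow> is_functor C D (nsrc \<alpha>)"
  and nt_tgt [simp]: "is_ntrans C D \<alpha> \<Longrightarrow> is_functor C D (ntgt \<alpha>)"
  and nt_ext: "is_ntrans C D \<alpha> \<Longrightarrow> cpt \<alpha> \<in> extensional (Obj C)"
  and nt_arr [simp]: "is_ntrans C D \<alpha> \<Longrightarrow> x \<in> Obj C \<Longrightarrow> cpt \<alpha> x \<in> Arr D"
  and nt_dom [simp]: "is_ntrans C D \<alpha> \<Longrightarrow> x \<in> Obj C \<Longrightarrow> Dom D (cpt \<alpha> x) = ob_map (nsrc \<alpha>) x"
  and nt_cod [simp]: "is_ntrans C D \<alpha> \<Longrightarrow> x \<in> Obj C \<Longrightarrow> Cod D (cpt \<alpha> x) = ob_map (ntgt \<alpha>) x"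
  and nt_nat: "is_ntrans C D \<alpha> \<Longrightarrow> f \<in> Arr C \<Longrightarrow>
    Cmp D (cpt \<alpha> (Cod C f)) (ar_map (nsrc \<alpha>) f) = Cmp D (ar_map (ntgt \<alpha>) f) (cpt \<alpha> (Dom C f))"
  by (auto simp: is_ntrans_def arrows_iff)

text \<open>The functor rules with the premise \<open>is_ntrans\<close> in place of
  \<open>is_functor\<close>: the simplifier can then type the source functor straight from the
  hypothesis on the transformation. The next lemma does the same for the target.\<close>

lemma nsrc_ob [simp]: "is_ntrans C D \<alpha> \<Longrightarrow> x \<in> Obj C \<Longrightarrow> ob_map (nsrc \<alpha>) x \<in> Obj D"
  and nsrc_ar [simp]: "is_ntrans C D \<alpha> \<Longrightarrow> f \<in> Arr C \<Longrightarrow> ar_map (nsrc \<alpha>) f \<in> Arr D"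
  and nsrc_dom [simp]: "is_ntrans C D \<alpha> \<Longrightarrow> f \<in> Arr C \<Longrightarrow> Dom D (ar_map (nsrc \<alpha>) f) = ob_map (nsrc \<alpha>) (Dom C f)"
  and nsrc_cod [simp]: "is_ntrans C D \<alpha> \<Longrightarrow> f \<in> Arr C \<Longrightarrow> Cod D (ar_map (nsrc \<alpha>) f) = ob_map (nsrc \<alpha>) (Cod C f)"
  and nsrc_id [simp]: "is_ntrans C D \<alpha> \<Longrightarrow> x \<in> Obj C \<Longrightarrow> ar_map (nsrc \<alpha>) (Idn C x) = Idn D (ob_map (nsrc \<alpha>) x)"
  using ftor_ob[of C D "nsrc \<alpha>"] ftor_ar[of C D "nsrc \<alpha>"] ftor_dom[of C D "nsrc \<alpha>"] ftor_cod[of C D "nsrc \<alpha>"]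
    ftor_id[of C D "nsrc \<alpha>"] by simp_all

lemma ntgt_ob [simp]: "is_ntrans C D \<alpha> \<Longrightarrow> x \<in> Obj C \<Longrightarrow> ob_map (ntgt \<alpha>) x \<in> Obj D"
  and ntgt_ar [simp]: "is_ntrans C D \<alpha> \<Longrightarrow> f \<in> Arr C \<Longrightarrow> ar_map (ntgt \<alpha>) f \<in> Arr D"
  and ntgt_dom [simp]: "is_ntrans C D \<alpha> \<Longrightarrow> f \<in> Arr C \<Longrightarrow> Dom D (ar_map (ntgt \<alpha>) f) = ob_map (ntgt \<alpha>) (Dom C f)"
  and ntgt_cod [simp]: "is_ntrans C D \<alpha> \<Longrightarrow> f \<in> Arr C \<Longrightarrow> Cod D (ar_map (ntgt \<alpha>) f) = ob_map (ntgt \<alpha>) (Cod C f)"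
  and ntgt_id [simp]: "is_ntrans C D \<alpha> \<Longrightarrow> x \<in> Obj C \<Longrightarrow> ar_map (ntgt \<alpha>) (Idn C x) = Idn D (ob_map (ntgt \<alpha>) x)"
  using ftor_ob[of C D "ntgt \<alpha>"] ftor_ar[of C D "ntgt \<alpha>"] ftor_dom[of C D "ntgt \<alpha>"] ftor_cod[of C D "ntgt \<alpha>"]
    ftor_id[of C D "ntgt \<alpha>"] by simp_all

lemma is_ntransI:
  assumes "is_functor C D (nsrc \<alpha>)" "is_functor C D (ntgt \<alpha>)" "cpt \<alpha> \<in> extensional (Obj C)"
    "\<And>x. x \<in> Obj C \<Longrightarrow> cpt \<alpha> x \<in> Arr D"
    "\<And>x. x \<in> Obj C \<Longrightarrow> Dom D (cpt \<alpha> x) = ob_map (nsrc \<alpha>) x"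
    "\<And>x. x \<in> Obj C \<Longrightarrow> Cod D (cpt \<alpha> x) = ob_map (ntgt \<alpha>) x"
    "\<And>f. f \<in> Arr C \<Longrightarrow> Cmp D (cpt \<alpha> (Cod C f)) (ar_map (nsrc \<alpha>) f) = Cmp D (ar_map (ntgt \<alpha>) f) (cpt \<alpha> (Dom C f))"
  shows "is_ntrans C D \<alpha>"
  unfolding is_ntrans_def using assms by (auto simp: arrows_iff)

lemma nid_simps [simp]: "nsrc (nid C D F) = F" "ntgt (nid C D F) = F" "x \<in> Obj C \<Longrightarrow> cpt (nid C D F) x = Idn D (ob_map F x)"
  "cpt (nid C D F) \<in> extensional (Obj C)"
  by (auto simp: nid_def)

lemma vcomp_simps [simp]: "nsrc (vcomp C D \<beta> \<alpha>) = nsrc \<alpha>" "ntgt (vcomp C D \<beta> \<alpha>) = ntgt \<beta>"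
  "x \<in> Obj C \<Longrightarrow> cpt (vcomp C D \<beta> \<alpha>) x = Cmp D (cpt \<beta> x) (cpt \<alpha> x)"
  "cpt (vcomp C D \<beta> \<alpha>) \<in> extensional (Obj C)"
  by (auto simp: vcomp_def)

lemma hcomp_simps [simp]: "nsrc (hcomp C D \<beta> \<alpha>) = fcmp C (nsrc \<beta>) (nsrc \<alpha>)" "ntgt (hcomp C D \<beta> \<alpha>) = fcmp C (ntgt \<beta>) (ntgt \<alpha>)"
  "x \<in> Obj C \<Longrightarrow> cpt (hcomp C D \<beta> \<alpha>) x = Cmp D (cpt \<beta> (ob_map (ntgt \<alpha>) x)) (ar_map (nsrc \<beta>) (cpt \<alpha> x))"
  "cpt (hcomp C D \<beta> \<alpha>) \<in> extensional (Obj C)"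
  by (auto simp: hcomp_def)

lemma nid_ntrans [simp]: "category C \<Longrightarrow> category D \<Longrightarrow> is_functor C D F \<Longrightarrow> is_ntrans C D (nid C D F)"
  by (rule is_ntransI) auto

lemma vcomp_ntrans:
  assumes "category C" "category D" "is_ntrans C D \<alpha>" "is_ntrans C D \<beta>" "ntgt \<alpha> = nsrc \<beta>"
  shows "is_ntrans C D (vcomp C D \<beta> \<alpha>)"
proof (rule is_ntransI)
  fix f assume f: "f \<in> Arr C"
  have "Cmp D (Cmp D (cpt \<beta> (Cod C f)) (cpt \<alpha> (Cod C f))) (ar_map (nsrc \<alpha>) f)
     = Cmp D (cpt \<beta> (Cod C f)) (Cmp D (ar_map (nsrc \<beta>) f) (cpt \<alpha> (Dom C f)))"
    using assms f nt_nat[OF assms(3) f] by (subst cat_assoc) auto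
  also have "\<dots> = Cmp D (Cmp D (cpt \<beta> (Cod C f)) (ar_map (nsrc \<beta>) f)) (cpt \<alpha> (Dom C f))"
    using assms f by (subst cat_assoc) auto
  also have "\<dots> = Cmp D (ar_map (ntgt \<beta>) f) (Cmp D (cpt \<beta> (Dom C f)) (cpt \<alpha> (Dom C f)))"
    unfolding nt_nat[OF assms(4) f] using assms f by (subst cat_assoc) auto
  finally show "Cmp D (cpt (vcomp C D \<beta> \<alpha>) (Cod C f)) (ar_map (nsrc (vcomp C D \<beta> \<alpha>)) f) =
         Cmp D (ar_map (ntgt (vcomp C D \<beta> \<alpha>)) f) (cpt (vcomp C D \<beta> \<alpha>) (Dom C f))"
    using assms f by simp
qed (use assms in auto)

text \<open>The square splits into the image of a naturality square of \<alpha> under the source of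
  \<beta>, and the naturality square of \<beta> at an arrow in the image of the target of
  \<alpha>.\<close>

lemma hcomp_ntrans:
  assumes "category C" "category D" "category E" "is_ntrans C D \<alpha>" "is_ntrans D E \<beta>"
  shows "is_ntrans C E (hcomp C E \<beta> \<alpha>)"
proof (rule is_ntransI)
  fix f assume f: "f \<in> Arr C"
  let ?B = "cpt \<beta>" and ?F = "ar_map (nsrc \<alpha>)" and ?F' = "ar_map (ntgt \<alpha>)"
  let ?G = "ar_map (nsrc \<beta>)" and ?G' = "ar_map (ntgt \<beta>)" and ?x = "Dom C f" and ?y = "Cod C f"
  have "Cmp E (Cmp E (?B (ob_map (ntgt \<alpha>) ?y)) (?G (cpt \<alpha> ?y))) (?G (?F f))
     = Cmp E (?B (ob_map (ntgt \<alpha>) ?y)) (?G (Cmp D (cpt \<alpha> ?y) (?F f)))"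
    using assms f by (subst cat_assoc) (auto simp: ftor_cmp[OF nt_src[OF assms(5)]])
  also have "\<dots> = Cmp E (Cmp E (?B (ob_map (ntgt \<alpha>) ?y)) (?G (?F' f))) (?G (cpt \<alpha> ?x))"
    unfolding nt_nat[OF assms(4) f] using assms f
    by (subst cat_assoc) (auto simp: ftor_cmp[OF nt_src[OF assms(5)]])
  also have "Cmp E (?B (ob_map (ntgt \<alpha>) ?y)) (?G (?F' f)) = Cmp E (?G' (?F' f)) (?B (ob_map (ntgt \<alpha>) ?x))"
    using nt_nat[OF assms(5), of "?F' f"] assms f by simp
  also have "Cmp E \<dots> (?G (cpt \<alpha> ?x)) = Cmp E (?G' (?F' f)) (Cmp E (?B (ob_map (ntgt \<alpha>) ?x)) (?G (cpt \<alpha> ?x)))"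
    using assms f by (subst cat_assoc) auto
  finally show "Cmp E (cpt (hcomp C E \<beta> \<alpha>) ?y) (ar_map (nsrc (hcomp C E \<beta> \<alpha>)) f) =
         Cmp E (ar_map (ntgt (hcomp C E \<beta> \<alpha>)) f) (cpt (hcomp C E \<beta> \<alpha>) ?x)"
    using assms f by simp
qed (use assms in \<open>auto intro: fcmp_functor[of C D _ E]\<close>)

lemma is_nisoD: "is_niso C D F G \<alpha> \<Longrightarrow> is_ntrans C D \<alpha>" "is_niso C D F G \<alpha> \<Longrightarrow> nsrc \<alpha> = F"
    "is_niso C D F G \<alpha> \<Longrightarrow> ntgt \<alpha> = G" "is_niso C D F G \<alpha> \<Longrightarrow> x \<in> Obj C \<Longrightarrow> invertible_arrow D (cpt \<alpha> x)"
  by (auto simp: is_niso_def)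

lemma nid_niso: "category C \<Longrightarrow> category D \<Longrightarrow> is_functor C D F \<Longrightarrow> is_niso C D F F (nid C D F)"
  by (auto simp: is_niso_def)

lemma vcomp_niso:
  "category C \<Longrightarrow> category D \<Longrightarrow> is_niso C D F G \<alpha> \<Longrightarrow> is_niso C D G H \<beta> \<Longrightarrow> is_niso C D F H (vcomp C D \<beta> \<alpha>)"
  unfolding is_niso_def by (auto intro!: vcomp_ntrans inv_arrow_cmp)

lemma hcomp_niso:
  assumes "category C" "category D" "category E" "is_niso C D F G \<alpha>" "is_niso D E F' G' \<beta>"
  shows "is_niso C E (fcmp C F' F) (fcmp C G' G) (hcomp C E \<beta> \<alpha>)"
proof -
  note * = is_nisoD[OF assms(4)] is_nisoD[OF assms(5)]
  have FG: "is_functor C D F" "is_functor C D G" "is_functor D E F'" "is_functor D E G'"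
    using nt_src[OF *(1)] nt_tgt[OF *(1)] nt_src[OF *(5)] nt_tgt[OF *(5)] * by auto
  have "invertible_arrow E (cpt (hcomp C E \<beta> \<alpha>) x)" if x: "x \<in> Obj C" for x
    using FG x * assms
    by (auto intro!: inv_arrow_cmp invertible_arrow_functor[OF nt_src[OF *(5)]])
  then show ?thesis using hcomp_ntrans[OF assms(1-3) *(1) *(5)] *
    by (auto simp: is_niso_def)
qed

text \<open>An invertible transformation determines its target from its source, so the targets need not
  be compared.\<close>

lemma niso_eqI:
  assumes "category C" "category D" "is_niso C D F G \<alpha>" "is_niso C D F H \<beta>"
    "\<And>x. x \<in> Obj C \<Longrightarrow> cpt \<alpha> x = cpt \<beta> x"
  shows "\<alpha> = \<beta>"
proof -
  note a = is_nisoD[OF assms(3)] and b = is_nisoD[OF assms(4)]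
  have "ob_map G x = ob_map H x" if x: "x \<in> Obj C" for x
    using nt_cod[OF a(1) x] nt_cod[OF b(1) x] assms(5)[OF x] a b by simp
  \<comment> \<open>Naturality expresses both arrows, composed with
    \<open>cpt \<alpha> (Dom C f)\<close>, by the same source data, and this component is
    epi.\<close>
  moreover have "ar_map G f = ar_map H f" if f: "f \<in> Arr C" for f
  proof (rule epi_cancel)
    have x: "Dom C f \<in> Obj C" "Cod C f \<in> Obj C" using assms f by auto
    show "invertible_arrow D (cpt \<alpha> (Dom C f))" using a x by simp
    show "category D" by fact
    show "ar_map G f \<in> Arr D" "ar_map H f \<in> Arr D"
      using ftor_ar[OF nt_tgt[OF a(1)] f] ftor_ar[OF nt_tgt[OF b(1)] f] a b by auto
    show "Dom D (ar_map G f) = Cod D (cpt \<alpha> (Dom C f))"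
      using ftor_dom[OF nt_tgt[OF a(1)] f] x a(1,2,3) by (simp)
    show "Dom D (ar_map H f) = Cod D (cpt \<alpha> (Dom C f))"
      using ftor_dom[OF nt_tgt[OF b(1)] f] x b(1,2,3) assms(5) by simp
    show "Cmp D (ar_map G f) (cpt \<alpha> (Dom C f)) = Cmp D (ar_map H f) (cpt \<alpha> (Dom C f))"
      using nt_nat[OF a(1) f] nt_nat[OF b(1) f] assms(5) x a b by simp
  qed
  ultimately have "G = H"
    using functor_eqI[of C D G D H] nt_tgt[OF a(1)] nt_tgt[OF b(1)] a b by auto
  then show ?thesis
    by (intro ntrans_eqI[where C=C]) (use a b assms(5) in \<open>auto intro: nt_ext\<close>)
qed

section \<open>Functor categories\<close>

lemma fun_cat_simps [simp]: "Obj (fun_cat C D) = {F. is_functor C D F}" "Arr (fun_cat C D) = {\<alpha>. is_ntrans C D \<alpha>}"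
     "Dom (fun_cat C D) = nsrc" "Cod (fun_cat C D) = ntgt" "Idn (fun_cat C D) = nid C D" "Cmp (fun_cat C D) = vcomp C D"
  by (auto simp: fun_cat_def)

lemma fun_cat_category:
  assumes "category C" "category D"
  shows "category (fun_cat C D)"
proof (rule categoryI)
  fix \<alpha> assume a: "\<alpha> \<in> Arr (fun_cat C D)"
  show "Cmp (fun_cat C D) \<alpha> (Idn (fun_cat C D) (Dom (fun_cat C D) \<alpha>)) = \<alpha>"
    using assms a by (auto intro!: ntrans_eqI[where C=C] intro: nt_ext)
  show "Cmp (fun_cat C D) (Idn (fun_cat C D) (Cod (fun_cat C D) \<alpha>)) \<alpha> = \<alpha>"
    using assms a by (auto intro!: ntrans_eqI[where C=C] intro: nt_ext)
next
  fix \<alpha> \<beta> \<gamma> assume "\<alpha> \<in> Arr (fun_cat C D)" "\<beta> \<in> Arr (fun_cat C D)" "\<gamma> \<in> Arr (fun_cat C D)"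
    "Cod (fun_cat C D) \<alpha> = Dom (fun_cat C D) \<beta>" "Cod (fun_cat C D) \<beta> = Dom (fun_cat C D) \<gamma>"
  then show "Cmp (fun_cat C D) \<gamma> (Cmp (fun_cat C D) \<beta> \<alpha>) = Cmp (fun_cat C D) (Cmp (fun_cat C D) \<gamma> \<beta>) \<alpha>"
    using assms by (auto intro!: ntrans_eqI[where C=C] simp: cat_assoc)
qed (use assms in \<open>auto simp: arrows_iff vcomp_ntrans\<close>)

section \<open>Strictly natural equivalences\<close>

definition strict_cat_functor :: "('o, 'f, 'c) twocat \<Rightarrow> ('o, 'f, 'c, 'x, 'y) cat_functor \<Rightarrow> bool" where
  "strict_cat_functor K G \<longleftrightarrow>
     (\<forall>A\<in>Obj0 K. category (F0 G A)) \<and>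
     (\<forall>A\<in>Obj0 K. \<forall>B\<in>Obj0 K. \<forall>f\<in>Obj (HomC K A B). is_functor (F0 G A) (F0 G B) (F1 G A B f)) \<and>
     (\<forall>A\<in>Obj0 K. \<forall>B\<in>Obj0 K. \<forall>\<phi>\<in>Arr (HomC K A B). is_ntrans (F0 G A) (F0 G B) (F2 G A B \<phi>) \<and>
        nsrc (F2 G A B \<phi>) = F1 G A B (Dom (HomC K A B) \<phi>) \<and> ntgt (F2 G A B \<phi>) = F1 G A B (Cod (HomC K A B) \<phi>)) \<and>
     (\<forall>A\<in>Obj0 K. F1 G A A (Idn1 K A) = fid (F0 G A)) \<and>
     (\<forall>A\<in>Obj0 K. \<forall>B\<in>Obj0 K. \<forall>C\<in>Obj0 K. \<forall>f\<in>Obj (HomC K A B). \<forall>g\<in>Obj (HomC K B C).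
        F1 G A C (Cmp1 K A B C g f) = fcmp (F0 G A) (F1 G B C g) (F1 G A B f))"

text \<open>\<open>s\<close> is a strict transformation whose components are fully faithful and onto
  on objects, and \<open>t A\<close> picks preimages of objects. The sections \<open>t A\<close> for
  different \<open>A\<close> are unrelated, so an inverse built from them need not be strictly
  natural.\<close>

locale strict_cat_functor_pair =
  fixes K :: "('o, 'f, 'c) twocat" and G :: "('o, 'f, 'c, 'x, 'y) cat_functor"
    and H :: "('o, 'f, 'c, 'z, 'w) cat_functor" and s :: "'o \<Rightarrow> ('x, 'y, 'z, 'w) ftor"
    and t :: "'o \<Rightarrow> 'z \<Rightarrow> 'x"
  assumes hom_cat: "A \<in> Obj0 K \<Longrightarrow> B \<in> Obj0 K \<Longrightarrow> category (HomC K A B)"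
    and id1: "A \<in> Obj0 K \<Longrightarrow> Idn1 K A \<in> Obj (HomC K A A)"
    and cmp1: "A \<in> Obj0 K \<Longrightarrow> B \<in> Obj0 K \<Longrightarrow> C \<in> Obj0 K \<Longrightarrow> f \<in> Obj (HomC K A B) \<Longrightarrow> g \<in> Obj (HomC K B C) \<Longrightarrow>
       Cmp1 K A B C g f \<in> Obj (HomC K A C)"
    and G: "strict_cat_functor K G" and H: "strict_cat_functor K H"
    and s: "A \<in> Obj0 K \<Longrightarrow> is_functor (F0 G A) (F0 H A) (s A)"
    and s_nat: "A \<in> Obj0 K \<Longrightarrow> B \<in> Obj0 K \<Longrightarrow> f \<in> Obj (HomC K A B) \<Longrightarrow>
       fcmp (F0 G A) (s B) (F1 G A B f) = fcmp (F0 G A) (F1 H A B f) (s A)"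
    and s_nat2: "A \<in> Obj0 K \<Longrightarrow> B \<in> Obj0 K \<Longrightarrow> \<phi> \<in> Arr (HomC K A B) \<Longrightarrow> b \<in> Obj (F0 G A) \<Longrightarrow>
       ar_map (s B) (cpt (F2 G A B \<phi>) b) = cpt (F2 H A B \<phi>) (ob_map (s A) b)"
    and t: "A \<in> Obj0 K \<Longrightarrow> D \<in> Obj (F0 H A) \<Longrightarrow> t A D \<in> Obj (F0 G A)"
    and st: "A \<in> Obj0 K \<Longrightarrow> D \<in> Obj (F0 H A) \<Longrightarrow> ob_map (s A) (t A D) = D"
    and ff: "A \<in> Obj0 K \<Longrightarrow> b \<in> Obj (F0 G A) \<Longrightarrow> b' \<in> Obj (F0 G A) \<Longrightarrow> \<delta> \<in> arrows (F0 H A) (ob_map (s A) b) (ob_map (s A) b')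
       \<Longrightarrow> \<exists>!\<beta>. \<beta> \<in> arrows (F0 G A) b b' \<and> ar_map (s A) \<beta> = \<delta>"
begin

lemma G_cat [simp]: "A \<in> Obj0 K \<Longrightarrow> category (F0 G A)"
  and H_cat [simp]: "A \<in> Obj0 K \<Longrightarrow> category (F0 H A)"
  and G_F1 [simp]: "A \<in> Obj0 K \<Longrightarrow> B \<in> Obj0 K \<Longrightarrow> f \<in> Obj (HomC K A B) \<Longrightarrow> is_functor (F0 G A) (F0 G B) (F1 G A B f)"
  and H_F1 [simp]: "A \<in> Obj0 K \<Longrightarrow> B \<in> Obj0 K \<Longrightarrow> f \<in> Obj (HomC K A B) \<Longrightarrow> is_functor (F0 H A) (F0 H B) (F1 H A B f)"
  and G_F2 [simp]: "A \<in> Obj0 K \<Longrightarrow> B \<in> Obj0 K \<Longrightarrow> \<phi> \<in> Arr (HomC K A B) \<Longrightarrow> is_ntrans (F0 G A) (F0 G B) (F2 G A B \<phi>)"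
    "A \<in> Obj0 K \<Longrightarrow> B \<in> Obj0 K \<Longrightarrow> \<phi> \<in> Arr (HomC K A B) \<Longrightarrow> nsrc (F2 G A B \<phi>) = F1 G A B (Dom (HomC K A B) \<phi>)"
    "A \<in> Obj0 K \<Longrightarrow> B \<in> Obj0 K \<Longrightarrow> \<phi> \<in> Arr (HomC K A B) \<Longrightarrow> ntgt (F2 G A B \<phi>) = F1 G A B (Cod (HomC K A B) \<phi>)"
  and H_F2 [simp]: "A \<in> Obj0 K \<Longrightarrow> B \<in> Obj0 K \<Longrightarrow> \<phi> \<in> Arr (HomC K A B) \<Longrightarrow> is_ntrans (F0 H A) (F0 H B) (F2 H A B \<phi>)"
    "A \<in> Obj0 K \<Longrightarrow> B \<in> Obj0 K \<Longrightarrow> \<phi> \<in> Arr (HomC K A B) \<Longrightarrow> nsrc (F2 H A B \<phi>) = F1 H A B (Dom (HomC K A B) \<phi>)"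
    "A \<in> Obj0 K \<Longrightarrow> B \<in> Obj0 K \<Longrightarrow> \<phi> \<in> Arr (HomC K A B) \<Longrightarrow> ntgt (F2 H A B \<phi>) = F1 H A B (Cod (HomC K A B) \<phi>)"
  and G_id: "A \<in> Obj0 K \<Longrightarrow> F1 G A A (Idn1 K A) = fid (F0 G A)"
  and H_id: "A \<in> Obj0 K \<Longrightarrow> F1 H A A (Idn1 K A) = fid (F0 H A)"
  and G_comp: "A \<in> Obj0 K \<Longrightarrow> B \<in> Obj0 K \<Longrightarrow> C \<in> Obj0 K \<Longrightarrow> f \<in> Obj (HomC K A B) \<Longrightarrow> g \<in> Obj (HomC K B C) \<Longrightarrow>
       F1 G A C (Cmp1 K A B C g f) = fcmp (F0 G A) (F1 G B C g) (F1 G A B f)"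
  and H_comp: "A \<in> Obj0 K \<Longrightarrow> B \<in> Obj0 K \<Longrightarrow> C \<in> Obj0 K \<Longrightarrow> f \<in> Obj (HomC K A B) \<Longrightarrow> g \<in> Obj (HomC K B C) \<Longrightarrow>
       F1 H A C (Cmp1 K A B C g f) = fcmp (F0 H A) (F1 H B C g) (F1 H A B f)"
  using G H by (auto simp: strict_cat_functor_def)

declare hom_cat [simp] id1 [simp] cmp1 [simp] s [simp] t [simp] st [simp]

lemma s_nat_ob: "A \<in> Obj0 K \<Longrightarrow> B \<in> Obj0 K \<Longrightarrow> f \<in> Obj (HomC K A B) \<Longrightarrow> b \<in> Obj (F0 G A) \<Longrightarrow>
    ob_map (s B) (ob_map (F1 G A B f) b) = ob_map (F1 H A B f) (ob_map (s A) b)"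
  using arg_cong[OF s_nat, of A B f "\<lambda>F. ob_map F b"] by simp

lemma s_nat_ar: "A \<in> Obj0 K \<Longrightarrow> B \<in> Obj0 K \<Longrightarrow> f \<in> Obj (HomC K A B) \<Longrightarrow> \<beta> \<in> Arr (F0 G A) \<Longrightarrow>
    ar_map (s B) (ar_map (F1 G A B f) \<beta>) = ar_map (F1 H A B f) (ar_map (s A) \<beta>)"
  using arg_cong[OF s_nat, of A B f "\<lambda>F. ar_map F \<beta>"] by simp

lemma Gf [simp]: assumes "A \<in> Obj0 K" "B \<in> Obj0 K" "f \<in> Obj (HomC K A B)"
  shows "x \<in> Obj (F0 G A) \<Longrightarrow> ob_map (F1 G A B f) x \<in> Obj (F0 G B)"
    "\<beta> \<in> Arr (F0 G A) \<Longrightarrow> ar_map (F1 G A B f) \<beta> \<in> Arr (F0 G B)"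
    "\<beta> \<in> Arr (F0 G A) \<Longrightarrow> Dom (F0 G B) (ar_map (F1 G A B f) \<beta>) = ob_map (F1 G A B f) (Dom (F0 G A) \<beta>)"
    "\<beta> \<in> Arr (F0 G A) \<Longrightarrow> Cod (F0 G B) (ar_map (F1 G A B f) \<beta>) = ob_map (F1 G A B f) (Cod (F0 G A) \<beta>)"
    "x \<in> Obj (F0 G A) \<Longrightarrow> ar_map (F1 G A B f) (Idn (F0 G A) x) = Idn (F0 G B) (ob_map (F1 G A B f) x)"
  using G_F1[OF assms] by auto

lemma Hf [simp]: assumes "A \<in> Obj0 K" "B \<in> Obj0 K" "f \<in> Obj (HomC K A B)"
  shows "x \<in> Obj (F0 H A) \<Longrightarrow> ob_map (F1 H A B f) x \<in> Obj (F0 H B)"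
    "\<beta> \<in> Arr (F0 H A) \<Longrightarrow> ar_map (F1 H A B f) \<beta> \<in> Arr (F0 H B)"
    "\<beta> \<in> Arr (F0 H A) \<Longrightarrow> Dom (F0 H B) (ar_map (F1 H A B f) \<beta>) = ob_map (F1 H A B f) (Dom (F0 H A) \<beta>)"
    "\<beta> \<in> Arr (F0 H A) \<Longrightarrow> Cod (F0 H B) (ar_map (F1 H A B f) \<beta>) = ob_map (F1 H A B f) (Cod (F0 H A) \<beta>)"
    "x \<in> Obj (F0 H A) \<Longrightarrow> ar_map (F1 H A B f) (Idn (F0 H A) x) = Idn (F0 H B) (ob_map (F1 H A B f) x)"
  using H_F1[OF assms] by auto

lemma sA [simp]: assumes "A \<in> Obj0 K"
  shows "x \<in> Obj (F0 G A) \<Longrightarrow> ob_map (s A) x \<in> Obj (F0 H A)"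
    "\<beta> \<in> Arr (F0 G A) \<Longrightarrow> ar_map (s A) \<beta> \<in> Arr (F0 H A)"
    "\<beta> \<in> Arr (F0 G A) \<Longrightarrow> Dom (F0 H A) (ar_map (s A) \<beta>) = ob_map (s A) (Dom (F0 G A) \<beta>)"
    "\<beta> \<in> Arr (F0 G A) \<Longrightarrow> Cod (F0 H A) (ar_map (s A) \<beta>) = ob_map (s A) (Cod (F0 G A) \<beta>)"
    "x \<in> Obj (F0 G A) \<Longrightarrow> ar_map (s A) (Idn (F0 G A) x) = Idn (F0 H A) (ob_map (s A) x)"
    "\<beta> \<in> Arr (F0 G A) \<Longrightarrow> \<gamma> \<in> Arr (F0 G A) \<Longrightarrow> Cod (F0 G A) \<beta> = Dom (F0 G A) \<gamma> \<Longrightarrow>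
      ar_map (s A) (Cmp (F0 G A) \<gamma> \<beta>) = Cmp (F0 H A) (ar_map (s A) \<gamma>) (ar_map (s A) \<beta>)"
  using s[OF assms] by (auto simp: ftor_cmp)

lemma G2 [simp]: assumes "A \<in> Obj0 K" "B \<in> Obj0 K" "\<phi> \<in> Arr (HomC K A B)" "x \<in> Obj (F0 G A)"
  shows "cpt (F2 G A B \<phi>) x \<in> Arr (F0 G B)"
    "Dom (F0 G B) (cpt (F2 G A B \<phi>) x) = ob_map (F1 G A B (Dom (HomC K A B) \<phi>)) x"
    "Cod (F0 G B) (cpt (F2 G A B \<phi>) x) = ob_map (F1 G A B (Cod (HomC K A B) \<phi>)) x"
  using nt_arr[OF G_F2(1)] nt_dom[OF G_F2(1)] nt_cod[OF G_F2(1)] assms by simp_all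

lemma H2 [simp]: assumes "A \<in> Obj0 K" "B \<in> Obj0 K" "\<phi> \<in> Arr (HomC K A B)" "x \<in> Obj (F0 H A)"
  shows "cpt (F2 H A B \<phi>) x \<in> Arr (F0 H B)"
    "Dom (F0 H B) (cpt (F2 H A B \<phi>) x) = ob_map (F1 H A B (Dom (HomC K A B) \<phi>)) x"
    "Cod (F0 H B) (cpt (F2 H A B \<phi>) x) = ob_map (F1 H A B (Cod (HomC K A B) \<phi>)) x"
  using nt_arr[OF H_F2(1)] nt_dom[OF H_F2(1)] nt_cod[OF H_F2(1)] assms by simp_all

section \<open>Lifting arrows along the fully faithful components\<close>

definition lift where "lift A b b' \<delta> = (THE \<beta>. \<beta> \<in> arrows (F0 G A) b b' \<and> ar_map (s A) \<beta> = \<delta>)"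

lemma lift:
  assumes "A \<in> Obj0 K" "b \<in> Obj (F0 G A)" "b' \<in> Obj (F0 G A)"
    "\<delta> \<in> Arr (F0 H A)" "Dom (F0 H A) \<delta> = ob_map (s A) b" "Cod (F0 H A) \<delta> = ob_map (s A) b'"
  shows "lift A b b' \<delta> \<in> Arr (F0 G A)" "Dom (F0 G A) (lift A b b' \<delta>) = b" "Cod (F0 G A) (lift A b b' \<delta>) = b'"
    "ar_map (s A) (lift A b b' \<delta>) = \<delta>"
  using theI'[OF ff[of A b b' \<delta>]] assms unfolding lift_def[symmetric] by (auto simp: arrows_iff)

lemma faith:
  assumes "A \<in> Obj0 K" "\<beta> \<in> Arr (F0 G A)" "\<gamma> \<in> Arr (F0 G A)" "Dom (F0 G A) \<beta> = Dom (F0 G A) \<gamma>"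
    "Cod (F0 G A) \<beta> = Cod (F0 G A) \<gamma>" "ar_map (s A) \<beta> = ar_map (s A) \<gamma>"
  shows "\<beta> = \<gamma>"
proof -
  have "\<exists>!x. x \<in> arrows (F0 G A) (Dom (F0 G A) \<beta>) (Cod (F0 G A) \<beta>) \<and> ar_map (s A) x = ar_map (s A) \<beta>"
    by (rule ff) (use assms in \<open>auto simp: arrows_iff\<close>)
  then show ?thesis using assms by (auto simp: arrows_iff)
qed

text \<open>Two preimages of one object are canonically isomorphic: its identity lifts in both
  directions, and the lifts are mutually inverse by faithfulness. The cells of \<open>tau\<close>
  and of \<open>gam\<close> are all of this form.\<close>

lemma lift_invertible:
  assumes "A \<in> Obj0 K" "b \<in> Obj (F0 G A)" "b' \<in> Obj (F0 G A)" "ob_map (s A) b = D" "ob_map (s A) b' = D"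
  shows "invertible_arrow (F0 G A) (lift A b b' (Idn (F0 H A) D))"
proof -
  have D: "D \<in> Obj (F0 H A)" using assms sA(1) by blast
  let ?f = "lift A b b' (Idn (F0 H A) D)" and ?g = "lift A b' b (Idn (F0 H A) D)"
  have f: "?f \<in> Arr (F0 G A)" "Dom (F0 G A) ?f = b" "Cod (F0 G A) ?f = b'" "ar_map (s A) ?f = Idn (F0 H A) D"
    using lift[of A b b' "Idn (F0 H A) D"] assms D by simp_all
  have g: "?g \<in> Arr (F0 G A)" "Dom (F0 G A) ?g = b'" "Cod (F0 G A) ?g = b" "ar_map (s A) ?g = Idn (F0 H A) D"
    using lift[of A b' b "Idn (F0 H A) D"] assms D by simp_all
  show ?thesis
    by (rule inv_arrowI[where g="?g"]) (use f g assms D in \<open>auto intro!: faith[of A]\<close>)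
qed

section \<open>The inverse functors and the coherence cells\<close>

definition bak :: "'o \<Rightarrow> ('z, 'w, 'x, 'y) ftor" where
  "bak A = \<lparr>ob_map = (\<lambda>D\<in>Obj (F0 H A). t A D),
     ar_map = (\<lambda>\<delta>\<in>Arr (F0 H A). lift A (t A (Dom (F0 H A) \<delta>)) (t A (Cod (F0 H A) \<delta>)) \<delta>)\<rparr>"

lemma back_ob [simp]: "A \<in> Obj0 K \<Longrightarrow> D \<in> Obj (F0 H A) \<Longrightarrow> ob_map (bak A) D = t A D"
  by (simp add: bak_def)

lemma back_ar [simp]:
  assumes "A \<in> Obj0 K" "\<delta> \<in> Arr (F0 H A)"
  shows "ar_map (bak A) \<delta> \<in> Arr (F0 G A)" "Dom (F0 G A) (ar_map (bak A) \<delta>) = t A (Dom (F0 H A) \<delta>)"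
    "Cod (F0 G A) (ar_map (bak A) \<delta>) = t A (Cod (F0 H A) \<delta>)" "ar_map (s A) (ar_map (bak A) \<delta>) = \<delta>"
  using lift[of A "t A (Dom (F0 H A) \<delta>)" "t A (Cod (F0 H A) \<delta>)" \<delta>] assms by (simp_all add: bak_def)

lemma back_functor [simp]:
  assumes A: "A \<in> Obj0 K"
  shows "is_functor (F0 H A) (F0 G A) (bak A)"
proof (rule is_functorI)
  show "ob_map (bak A) \<in> extensional (Obj (F0 H A))" "ar_map (bak A) \<in> extensional (Arr (F0 H A))"
    by (auto simp: bak_def)
  fix D assume "D \<in> Obj (F0 H A)"
  then show "ar_map (bak A) (Idn (F0 H A) D) = Idn (F0 G A) (ob_map (bak A) D)"
    using A by (intro faith[of A]) auto
next
  fix \<delta> \<epsilon> assume "\<delta> \<in> Arr (F0 H A)" "\<epsilon> \<in> Arr (F0 H A)" "Cod (F0 H A) \<delta> = Dom (F0 H A) \<epsilon>"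
  then show "ar_map (bak A) (Cmp (F0 H A) \<epsilon> \<delta>) = Cmp (F0 G A) (ar_map (bak A) \<epsilon>) (ar_map (bak A) \<delta>)"
    using A by (intro faith[of A]) auto
qed (use A in auto)

definition sigma :: "('o, 'f, 'x, 'y, 'z, 'w) pnat" where
  "sigma = \<lparr>p0 = s, p1 = (\<lambda>A B f. nid (F0 G A) (F0 H B) (fcmp (F0 G A) (F1 H A B f) (s A)))\<rparr>"

text \<open>The constraint at \<open>D\<close> compares \<open>f\<close> applied to the chosen
  preimage of \<open>D\<close> with the chosen preimage of the image of \<open>D\<close> under
  \<open>f\<close>. Strict naturality of \<open>s\<close> puts both over the same object, so the
  identity of that object can be lifted between them.\<close>

definition tau :: "('o, 'f, 'z, 'w, 'x, 'y) pnat" where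
  "tau = \<lparr>p0 = bak, p1 = (\<lambda>A B f. \<lparr>nsrc = fcmp (F0 H A) (F1 G A B f) (bak A), ntgt = fcmp (F0 H A) (bak B) (F1 H A B f),
     cpt = (\<lambda>D\<in>Obj (F0 H A). lift B (ob_map (F1 G A B f) (t A D)) (t B (ob_map (F1 H A B f) D))
        (Idn (F0 H B) (ob_map (F1 H A B f) D)))\<rparr>)\<rparr>"

definition gam :: "'o \<Rightarrow> ('x, 'y, 'x, 'y) ntrans" where
  "gam A = \<lparr>nsrc = fcmp (F0 G A) (bak A) (s A), ntgt = fid (F0 G A),
     cpt = (\<lambda>b\<in>Obj (F0 G A). lift A (t A (ob_map (s A) b)) b (Idn (F0 H A) (ob_map (s A) b)))\<rparr>"

lemma tau_cpt [simp]:
  assumes "A \<in> Obj0 K" "B \<in> Obj0 K" "f \<in> Obj (HomC K A B)" "D \<in> Obj (F0 H A)"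
  shows "cpt (p1 tau A B f) D \<in> Arr (F0 G B)"
    "Dom (F0 G B) (cpt (p1 tau A B f) D) = ob_map (F1 G A B f) (t A D)"
    "Cod (F0 G B) (cpt (p1 tau A B f) D) = t B (ob_map (F1 H A B f) D)"
    "ar_map (s B) (cpt (p1 tau A B f) D) = Idn (F0 H B) (ob_map (F1 H A B f) D)"
    "invertible_arrow (F0 G B) (cpt (p1 tau A B f) D)"
  using lift[of B "ob_map (F1 G A B f) (t A D)" "t B (ob_map (F1 H A B f) D)" "Idn (F0 H B) (ob_map (F1 H A B f) D)"] assms
    lift_invertible[of B "ob_map (F1 G A B f) (t A D)" "t B (ob_map (F1 H A B f) D)" "ob_map (F1 H A B f) D"]
  by (simp_all add: tau_def s_nat_ob)

lemma tau_simps [simp]: "p0 tau = bak" "nsrc (p1 tau A B f) = fcmp (F0 H A) (F1 G A B f) (bak A)"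
  "ntgt (p1 tau A B f) = fcmp (F0 H A) (bak B) (F1 H A B f)"
  "cpt (p1 tau A B f) \<in> extensional (Obj (F0 H A))"
  by (auto simp: tau_def)

lemma sigma_simps [simp]: "p0 sigma = s" "p1 sigma A B f = nid (F0 G A) (F0 H B) (fcmp (F0 G A) (F1 H A B f) (s A))"
  by (auto simp: sigma_def)

lemma gam_cpt [simp]:
  assumes "A \<in> Obj0 K" "b \<in> Obj (F0 G A)"
  shows "cpt (gam A) b \<in> Arr (F0 G A)"
    "Dom (F0 G A) (cpt (gam A) b) = t A (ob_map (s A) b)"
    "Cod (F0 G A) (cpt (gam A) b) = b"
    "ar_map (s A) (cpt (gam A) b) = Idn (F0 H A) (ob_map (s A) b)"
    "invertible_arrow (F0 G A) (cpt (gam A) b)"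
  using lift[of A "t A (ob_map (s A) b)" b "Idn (F0 H A) (ob_map (s A) b)"] assms
    lift_invertible[of A "t A (ob_map (s A) b)" b "ob_map (s A) b"]
  by (simp_all add: gam_def)

lemma gam_simps [simp]: "nsrc (gam A) = fcmp (F0 G A) (bak A) (s A)" "ntgt (gam A) = fid (F0 G A)"
  "cpt (gam A) \<in> extensional (Obj (F0 G A))"
  by (auto simp: gam_def)

section \<open>The two transformations and the equivalence between them\<close>

lemma sigma_pseudo_natural: "pseudo_natural K G H sigma"
  unfolding pseudo_natural_def
proof (intro conjI ballI)
  fix A B f assume A: "A \<in> Obj0 K" "B \<in> Obj0 K" "f \<in> Obj (HomC K A B)"
  show "is_niso (F0 G A) (F0 H B) (fcmp (F0 G A) (F1 H A B f) (p0 sigma A))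
        (fcmp (F0 G A) (p0 sigma B) (F1 G A B f)) (p1 sigma A B f)"
    using A by (auto simp: s_nat intro!: nid_niso fcmp_functor[of _ "F0 H A"])
next
  fix A B \<phi> assume A: "A \<in> Obj0 K" "B \<in> Obj0 K" "\<phi> \<in> Arr (HomC K A B)"
  show "vcomp (F0 G A) (F0 H B) (hcomp (F0 G A) (F0 H B) (nid (F0 G B) (F0 H B) (p0 sigma B)) (F2 G A B \<phi>))
          (p1 sigma A B (Dom (HomC K A B) \<phi>)) =
         vcomp (F0 G A) (F0 H B) (p1 sigma A B (Cod (HomC K A B) \<phi>))
          (hcomp (F0 G A) (F0 H B) (F2 H A B \<phi>) (nid (F0 G A) (F0 H A) (p0 sigma A)))"
    using A by (intro ntrans_eqI[where C="F0 G A"]) (simp_all add: s_nat s_nat_ob s_nat2)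
next
  fix A assume A: "A \<in> Obj0 K"
  show "p1 sigma A A (Idn1 K A) = nid (F0 G A) (F0 H A) (p0 sigma A)"
    using A by (simp add: H_id fcmp_fid_left[OF s])
next
  fix A B C f g assume A: "A \<in> Obj0 K" "B \<in> Obj0 K" "C \<in> Obj0 K" "f \<in> Obj (HomC K A B)" "g \<in> Obj (HomC K B C)"
  show "p1 sigma A C (Cmp1 K A B C g f) =
       vcomp (F0 G A) (F0 H C)
        (hcomp (F0 G A) (F0 H C) (p1 sigma B C g) (nid (F0 G A) (F0 G B) (F1 G A B f)))
        (hcomp (F0 G A) (F0 H C) (nid (F0 H B) (F0 H C) (F1 H B C g)) (p1 sigma A B f))"
    using A by (intro ntrans_eqI[where C="F0 G A"])
      (auto simp: H_comp s_nat_ob fcmp_assoc[OF s] fcmp_assoc[OF G_F1] s_nat)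
qed simp

text \<open>Each law is an equation of parallel arrows and may be checked after applying the
  faithful \<open>s\<close>. There the constraints become identities, and strict naturality of
  \<open>s\<close> on 1-cells and 2-cells makes both sides agree.\<close>

lemma tau_pseudo_natural: "pseudo_natural K H G tau"
  unfolding pseudo_natural_def
proof (intro conjI ballI)
  fix A B f assume A: "A \<in> Obj0 K" "B \<in> Obj0 K" "f \<in> Obj (HomC K A B)"
  have "is_ntrans (F0 H A) (F0 G B) (p1 tau A B f)"
  proof (rule is_ntransI)
    fix \<delta> assume d: "\<delta> \<in> Arr (F0 H A)"
    show "Cmp (F0 G B) (cpt (p1 tau A B f) (Cod (F0 H A) \<delta>)) (ar_map (nsrc (p1 tau A B f)) \<delta>) =
         Cmp (F0 G B) (ar_map (ntgt (p1 tau A B f)) \<delta>) (cpt (p1 tau A B f) (Dom (F0 H A) \<delta>))"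
      using A d by (intro faith[of B]) (simp_all add: s_nat_ar)
  qed (use A in \<open>auto intro!: fcmp_functor[of _ "F0 G A"] fcmp_functor[of _ "F0 H B"]\<close>)
  then show "is_niso (F0 H A) (F0 G B) (fcmp (F0 H A) (F1 G A B f) (p0 tau A))
        (fcmp (F0 H A) (p0 tau B) (F1 H A B f)) (p1 tau A B f)"
    using A by (simp add: is_niso_def)
next
  fix A B \<phi> assume A: "A \<in> Obj0 K" "B \<in> Obj0 K" "\<phi> \<in> Arr (HomC K A B)"
  show "vcomp (F0 H A) (F0 G B) (hcomp (F0 H A) (F0 G B) (nid (F0 H B) (F0 G B) (p0 tau B)) (F2 H A B \<phi>))
          (p1 tau A B (Dom (HomC K A B) \<phi>)) =
         vcomp (F0 H A) (F0 G B) (p1 tau A B (Cod (HomC K A B) \<phi>))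
          (hcomp (F0 H A) (F0 G B) (F2 G A B \<phi>) (nid (F0 H A) (F0 G A) (p0 tau A)))"
    using A by (intro ntrans_eqI[where C="F0 H A"]) (simp_all, intro faith[of B], simp_all add: s_nat2)
next
  fix A assume A: "A \<in> Obj0 K"
  show "p1 tau A A (Idn1 K A) = nid (F0 H A) (F0 G A) (p0 tau A)"
    using A by (intro ntrans_eqI[where C="F0 H A"])
      (simp_all add: H_id G_id fcmp_fid_left[OF back_functor] fcmp_fid_right[OF H_cat back_functor], intro faith[of A], simp_all add: H_id G_id)
next
  fix A B C f g assume A: "A \<in> Obj0 K" "B \<in> Obj0 K" "C \<in> Obj0 K" "f \<in> Obj (HomC K A B)" "g \<in> Obj (HomC K B C)"
  show "p1 tau A C (Cmp1 K A B C g f) =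
       vcomp (F0 H A) (F0 G C)
        (hcomp (F0 H A) (F0 G C) (p1 tau B C g) (nid (F0 H A) (F0 H B) (F1 H A B f)))
        (hcomp (F0 H A) (F0 G C) (nid (F0 G B) (F0 G C) (F1 G B C g)) (p1 tau A B f))"
    using A by (intro ntrans_eqI[where C="F0 H A"])
      (simp_all add: H_comp G_comp fcmp_assoc[OF back_functor] fcmp_assoc[OF H_F1], intro faith[of C], simp_all add: H_comp G_comp s_nat_ar)
qed simp

lemma equivalent: "equivalent_cat_functors K G H"
  unfolding equivalent_cat_functors_def
proof (intro exI conjI)
  show "pseudo_natural K G H sigma" "pseudo_natural K H G tau"
    by (rule sigma_pseudo_natural tau_pseudo_natural)+
  show "invertible_modification K G G (pn_comp G H G tau sigma) (pn_id G) gam"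
    unfolding invertible_modification_def
  proof (intro conjI ballI)
    fix A assume A: "A \<in> Obj0 K"
    have "is_ntrans (F0 G A) (F0 G A) (gam A)"
    proof (rule is_ntransI)
      fix \<delta> assume d: "\<delta> \<in> Arr (F0 G A)"
      show "Cmp (F0 G A) (cpt (gam A) (Cod (F0 G A) \<delta>)) (ar_map (nsrc (gam A)) \<delta>) =
         Cmp (F0 G A) (ar_map (ntgt (gam A)) \<delta>) (cpt (gam A) (Dom (F0 G A) \<delta>))"
        using A d by (intro faith[of A]) simp_all
    qed (use A in \<open>auto intro!: fcmp_functor[of _ "F0 H A"]\<close>)
    then show "is_niso (F0 G A) (F0 G A) (p0 (pn_comp G H G tau sigma) A) (p0 (pn_id G) A) (gam A)"
      using A by (simp add: is_niso_def pn_comp_def pn_id_def)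
  next
    fix A B f assume A: "A \<in> Obj0 K" "B \<in> Obj0 K" "f \<in> Obj (HomC K A B)"
    show "vcomp (F0 G A) (F0 G B) (hcomp (F0 G A) (F0 G B) (gam B) (nid (F0 G A) (F0 G B) (F1 G A B f)))
          (p1 (pn_comp G H G tau sigma) A B f) =
         vcomp (F0 G A) (F0 G B) (p1 (pn_id G) A B f)
          (hcomp (F0 G A) (F0 G B) (nid (F0 G A) (F0 G B) (F1 G A B f)) (gam A))"
      using A by (intro ntrans_eqI[where C="F0 G A"])
       (simp_all add: pn_comp_def pn_id_def fcmp_assoc[OF s] fcmp_fid_left[OF G_F1] fcmp_fid_right[OF G_cat G_F1],
        intro faith[of B], simp_all add: s_nat_ob s_nat_ar)
  qed
  \<comment> \<open>In this direction the composite is the identity on the nose, since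
    \<open>t\<close> is a strict section of \<open>s\<close> on objects and lifts are mapped back to
    the given arrows. So the identity modification serves.\<close>
  show "invertible_modification K H H (pn_comp H G H sigma tau) (pn_id H) (\<lambda>A. nid (F0 H A) (F0 H A) (fid (F0 H A)))"
    unfolding invertible_modification_def
  proof (intro conjI ballI)
    fix A assume A: "A \<in> Obj0 K"
    have "fcmp (F0 H A) (s A) (bak A) = fid (F0 H A)"
      using A by (intro functor_eqI[of "F0 H A" "F0 H A" _ "F0 H A"] fcmp_functor[of _ "F0 G A"]) auto
    then show "is_niso (F0 H A) (F0 H A) (p0 (pn_comp H G H sigma tau) A) (p0 (pn_id H) A) (nid (F0 H A) (F0 H A) (fid (F0 H A)))"
      using A by (simp add: pn_comp_def pn_id_def nid_niso)
  next
    fix A B f assume A: "A \<in> Obj0 K" "B \<in> Obj0 K" "f \<in> Obj (HomC K A B)"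
    have e: "fcmp (F0 H A) (s A) (bak A) = fid (F0 H A)"
      using A by (intro functor_eqI[of "F0 H A" "F0 H A" _ "F0 H A"] fcmp_functor[of _ "F0 G A"]) auto
    show "vcomp (F0 H A) (F0 H B) (hcomp (F0 H A) (F0 H B) (nid (F0 H B) (F0 H B) (fid (F0 H B))) (nid (F0 H A) (F0 H B) (F1 H A B f)))
          (p1 (pn_comp H G H sigma tau) A B f) =
         vcomp (F0 H A) (F0 H B) (p1 (pn_id H) A B f)
          (hcomp (F0 H A) (F0 H B) (nid (F0 H A) (F0 H B) (F1 H A B f)) (nid (F0 H A) (F0 H A) (fid (F0 H A))))"
      using A by (intro ntrans_eqI[where C="F0 H A"])
       (simp_all add: pn_comp_def pn_id_def fcmp_assoc[OF back_functor] e fcmp_fid_left[OF H_F1] fcmp_fid_right[OF H_cat H_F1] s_nat_ob)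
  qed
qed

end

section \<open>A criterion for bitensor products\<close>

text \<open>The 2-category laws are collected abstractly so that the criterion for bitensor products
  is proved without opening up pseudo algebras.\<close>

locale strict_twocat =
  fixes K :: "('o, 'f, 'c) twocat"
  assumes hom_cat [simp]: "A \<in> Obj0 K \<Longrightarrow> B \<in> Obj0 K \<Longrightarrow> category (HomC K A B)"
    and id1 [simp]: "A \<in> Obj0 K \<Longrightarrow> Idn1 K A \<in> Obj (HomC K A A)"
    and cmp1 [simp]: "A \<in> Obj0 K \<Longrightarrow> B \<in> Obj0 K \<Longrightarrow> C \<in> Obj0 K \<Longrightarrow> f \<in> Obj (HomC K A B) \<Longrightarrow> g \<in> Obj (HomC K B C) \<Longrightarrow>
       Cmp1 K A B C g f \<in> Obj (HomC K A C)"
    and cmp2: "A \<in> Obj0 K \<Longrightarrow> B \<in> Obj0 K \<Longrightarrow> C \<in> Obj0 K \<Longrightarrow> \<alpha> \<in> Arr (HomC K A B) \<Longrightarrow> \<beta> \<in> Arr (HomC K B C) \<Longrightarrow>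
       Cmp2 K A B C \<beta> \<alpha> \<in> arrows (HomC K A C) (Cmp1 K A B C (Dom (HomC K B C) \<beta>) (Dom (HomC K A B) \<alpha>))
         (Cmp1 K A B C (Cod (HomC K B C) \<beta>) (Cod (HomC K A B) \<alpha>))"
    and cmp2_id: "A \<in> Obj0 K \<Longrightarrow> B \<in> Obj0 K \<Longrightarrow> C \<in> Obj0 K \<Longrightarrow> f \<in> Obj (HomC K A B) \<Longrightarrow> g \<in> Obj (HomC K B C) \<Longrightarrow>
       Cmp2 K A B C (Idn (HomC K B C) g) (Idn (HomC K A B) f) = Idn (HomC K A C) (Cmp1 K A B C g f)"
    and interchange: "A \<in> Obj0 K \<Longrightarrow> B \<in> Obj0 K \<Longrightarrow> C \<in> Obj0 K \<Longrightarrow> \<alpha> \<in> Arr (HomC K A B) \<Longrightarrow> \<alpha>' \<in> Arr (HomC K A B) \<Longrightarrow>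
       \<beta> \<in> Arr (HomC K B C) \<Longrightarrow> \<beta>' \<in> Arr (HomC K B C) \<Longrightarrow> Cod (HomC K A B) \<alpha> = Dom (HomC K A B) \<alpha>' \<Longrightarrow>
       Cod (HomC K B C) \<beta> = Dom (HomC K B C) \<beta>' \<Longrightarrow>
       Cmp2 K A B C (Cmp (HomC K B C) \<beta>' \<beta>) (Cmp (HomC K A B) \<alpha>' \<alpha>) =
         Cmp (HomC K A C) (Cmp2 K A B C \<beta>' \<alpha>') (Cmp2 K A B C \<beta> \<alpha>)"
    and assoc1: "A \<in> Obj0 K \<Longrightarrow> B \<in> Obj0 K \<Longrightarrow> C \<in> Obj0 K \<Longrightarrow> D \<in> Obj0 K \<Longrightarrow> f \<in> Obj (HomC K A B) \<Longrightarrow> g \<in> Obj (HomC K B C) \<Longrightarrow>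
       h \<in> Obj (HomC K C D) \<Longrightarrow> Cmp1 K A B D (Cmp1 K B C D h g) f = Cmp1 K A C D h (Cmp1 K A B C g f)"
    and assoc2: "A \<in> Obj0 K \<Longrightarrow> B \<in> Obj0 K \<Longrightarrow> C \<in> Obj0 K \<Longrightarrow> D \<in> Obj0 K \<Longrightarrow> \<alpha> \<in> Arr (HomC K A B) \<Longrightarrow> \<beta> \<in> Arr (HomC K B C) \<Longrightarrow>
       \<gamma> \<in> Arr (HomC K C D) \<Longrightarrow> Cmp2 K A B D (Cmp2 K B C D \<gamma> \<beta>) \<alpha> = Cmp2 K A C D \<gamma> (Cmp2 K A B C \<beta> \<alpha>)"
    and unit1: "A \<in> Obj0 K \<Longrightarrow> B \<in> Obj0 K \<Longrightarrow> f \<in> Obj (HomC K A B) \<Longrightarrow> Cmp1 K A B B (Idn1 K B) f = f"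
    and unit2: "A \<in> Obj0 K \<Longrightarrow> B \<in> Obj0 K \<Longrightarrow> \<alpha> \<in> Arr (HomC K A B) \<Longrightarrow>
       Cmp2 K A B B (Idn (HomC K B B) (Idn1 K B)) \<alpha> = \<alpha>"
begin

lemma cmp2_simps [simp]:
  assumes "A \<in> Obj0 K" "B \<in> Obj0 K" "C \<in> Obj0 K" "\<alpha> \<in> Arr (HomC K A B)" "\<beta> \<in> Arr (HomC K B C)"
  shows "Cmp2 K A B C \<beta> \<alpha> \<in> Arr (HomC K A C)"
    "Dom (HomC K A C) (Cmp2 K A B C \<beta> \<alpha>) = Cmp1 K A B C (Dom (HomC K B C) \<beta>) (Dom (HomC K A B) \<alpha>)"
    "Cod (HomC K A C) (Cmp2 K A B C \<beta> \<alpha>) = Cmp1 K A B C (Cod (HomC K B C) \<beta>) (Cod (HomC K A B) \<alpha>)"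
  using cmp2[OF assms] by (auto simp: arrows_iff)

lemma whisker_left_comp:
  assumes "A \<in> Obj0 K" "B \<in> Obj0 K" "C \<in> Obj0 K" "\<alpha> \<in> Arr (HomC K A B)" "\<alpha>' \<in> Arr (HomC K A B)"
    "Cod (HomC K A B) \<alpha> = Dom (HomC K A B) \<alpha>'" "g \<in> Obj (HomC K B C)"
  shows "Cmp2 K A B C (Idn (HomC K B C) g) (Cmp (HomC K A B) \<alpha>' \<alpha>) =
    Cmp (HomC K A C) (Cmp2 K A B C (Idn (HomC K B C) g) \<alpha>') (Cmp2 K A B C (Idn (HomC K B C) g) \<alpha>)"
  using interchange[of A B C \<alpha> \<alpha>' "Idn (HomC K B C) g" "Idn (HomC K B C) g"] assms by simp

lemma whisker_right_comp:
  assumes "A \<in> Obj0 K" "B \<in> Obj0 K" "C \<in> Obj0 K" "\<beta> \<in> Arr (HomC K B C)" "\<beta>' \<in> Arr (HomC K B C)"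
    "Cod (HomC K B C) \<beta> = Dom (HomC K B C) \<beta>'" "f \<in> Obj (HomC K A B)"
  shows "Cmp2 K A B C (Cmp (HomC K B C) \<beta>' \<beta>) (Idn (HomC K A B) f) =
    Cmp (HomC K A C) (Cmp2 K A B C \<beta>' (Idn (HomC K A B) f)) (Cmp2 K A B C \<beta> (Idn (HomC K A B) f))"
  using interchange[of A B C "Idn (HomC K A B) f" "Idn (HomC K A B) f" \<beta> \<beta>'] assms by simp

text \<open>Interchange with identities on either side. The equality of the two composites is the
  naturality square of \<open>F2 (representable K P) A B \<phi>\<close>.\<close>

lemma cmp2_eq_whiskers:
  assumes "A \<in> Obj0 K" "B \<in> Obj0 K" "C \<in> Obj0 K" "\<alpha> \<in> Arr (HomC K A B)" "\<beta> \<in> Arr (HomC K B C)"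
  shows "Cmp (HomC K A C) (Cmp2 K A B C \<beta> (Idn (HomC K A B) (Cod (HomC K A B) \<alpha>)))
      (Cmp2 K A B C (Idn (HomC K B C) (Dom (HomC K B C) \<beta>)) \<alpha>) = Cmp2 K A B C \<beta> \<alpha>"
    "Cmp (HomC K A C) (Cmp2 K A B C (Idn (HomC K B C) (Cod (HomC K B C) \<beta>)) \<alpha>)
      (Cmp2 K A B C \<beta> (Idn (HomC K A B) (Dom (HomC K A B) \<alpha>))) = Cmp2 K A B C \<beta> \<alpha>"
  using assms by (simp_all flip: interchange)

section \<open>Representable 2-functors\<close>

lemma rep_F0 [simp]: "F0 (representable K P) A = HomC K P A"
  by (simp add: representable_def)

lemma rep_F1 [simp]:
  "b \<in> Obj (HomC K P A) \<Longrightarrow> ob_map (F1 (representable K P) A B f) b = Cmp1 K P A B f b"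
  "\<beta> \<in> Arr (HomC K P A) \<Longrightarrow> ar_map (F1 (representable K P) A B f) \<beta> = Cmp2 K P A B (Idn (HomC K A B) f) \<beta>"
  by (simp_all add: representable_def)

lemma rep_F2 [simp]:
  "nsrc (F2 (representable K P) A B \<phi>) = F1 (representable K P) A B (Dom (HomC K A B) \<phi>)"
  "ntgt (F2 (representable K P) A B \<phi>) = F1 (representable K P) A B (Cod (HomC K A B) \<phi>)"
  "b \<in> Obj (HomC K P A) \<Longrightarrow> cpt (F2 (representable K P) A B \<phi>) b = Cmp2 K P A B \<phi> (Idn (HomC K P A) b)"
  "cpt (F2 (representable K P) A B \<phi>) \<in> extensional (Obj (HomC K P A))"
  by (simp_all add: representable_def)

lemma rep_F1_functor:
  assumes "P \<in> Obj0 K" "A \<in> Obj0 K" "B \<in> Obj0 K" "f \<in> Obj (HomC K A B)"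
  shows "is_functor (HomC K P A) (HomC K P B) (F1 (representable K P) A B f)"
  by (rule is_functorI) (use assms in \<open>auto simp: cmp2_id whisker_left_comp\<close>, auto simp: representable_def)

lemma representable_strict:
  assumes P: "P \<in> Obj0 K"
  shows "strict_cat_functor K (representable K P)"
  unfolding strict_cat_functor_def
proof (intro conjI ballI)
  fix A B \<phi> assume A: "A \<in> Obj0 K" "B \<in> Obj0 K" "\<phi> \<in> Arr (HomC K A B)"
  show "is_ntrans (F0 (representable K P) A) (F0 (representable K P) B) (F2 (representable K P) A B \<phi>)"
    by (rule is_ntransI) (use A P in \<open>auto simp: rep_F1_functor cmp2_eq_whiskers\<close>)
next
  fix A assume A: "A \<in> Obj0 K"
  show "F1 (representable K P) A A (Idn1 K A) = fid (F0 (representable K P) A)"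
    using A P by (intro functor_eqI[of "HomC K P A" "HomC K P A" _ "HomC K P A"])
      (auto simp: rep_F1_functor unit1 unit2)
next
  fix A B C f g assume A: "A \<in> Obj0 K" "B \<in> Obj0 K" "C \<in> Obj0 K" "f \<in> Obj (HomC K A B)" "g \<in> Obj (HomC K B C)"
  have "Cmp2 K P A C (Idn (HomC K A C) (Cmp1 K A B C g f)) \<beta> =
     Cmp2 K P B C (Idn (HomC K B C) g) (Cmp2 K P A B (Idn (HomC K A B) f) \<beta>)" if "\<beta> \<in> Arr (HomC K P A)" for \<beta>
    using that A P by (simp flip: cmp2_id add: assoc2)
  then show "F1 (representable K P) A C (Cmp1 K A B C g f) =
       fcmp (F0 (representable K P) A) (F1 (representable K P) B C g) (F1 (representable K P) A B f)"
    using A P by (intro functor_eqI[of "HomC K P A" "HomC K P C" _ "HomC K P C"])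
      (auto simp: rep_F1_functor assoc1 intro!: fcmp_functor[of _ "HomC K P B"])
qed (use P in \<open>auto simp: rep_F1_functor\<close>)

end

section \<open>The 2-functors of diagrams\<close>

lemma diag_F0 [simp]: "F0 (diagrams_in J G) A = fun_cat J (F0 G A)"
  by (simp add: diagrams_in_def)

lemma diag_F1 [simp]:
  "is_functor J (F0 G A) D \<Longrightarrow> ob_map (F1 (diagrams_in J G) A B f) D = fcmp J (F1 G A B f) D"
  "is_ntrans J (F0 G A) \<delta> \<Longrightarrow> ar_map (F1 (diagrams_in J G) A B f) \<delta> = hcomp J (F0 G B) (nid (F0 G A) (F0 G B) (F1 G A B f)) \<delta>"
  by (simp_all add: diagrams_in_def)

lemma diag_F1_ext: "ob_map (F1 (diagrams_in J G) A B f) \<in> extensional (Obj (fun_cat J (F0 G A)))"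
  "ar_map (F1 (diagrams_in J G) A B f) \<in> extensional (Arr (fun_cat J (F0 G A)))"
  by (simp_all add: diagrams_in_def)

text \<open>The 1-cells \<open>f\<close> and \<open>g\<close> are parameters because
  \<open>diagrams_in\<close> builds source and target from \<open>nsrc\<close> and
  \<open>ntgt\<close> of the given transformation and not from the ends of \<open>\<phi>\<close>;
  the premises identify the two.\<close>

lemma diag_F2:
  assumes "nsrc (F2 G A B \<phi>) = F1 G A B f" "ntgt (F2 G A B \<phi>) = F1 G A B g"
  shows
  "nsrc (F2 (diagrams_in J G) A B \<phi>) = F1 (diagrams_in J G) A B f"
  "ntgt (F2 (diagrams_in J G) A B \<phi>) = F1 (diagrams_in J G) A B g"
  "is_functor J (F0 G A) D \<Longrightarrow> cpt (F2 (diagrams_in J G) A B \<phi>) D = hcomp J (F0 G B) (F2 G A B \<phi>) (nid J (F0 G A) D)"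
  "cpt (F2 (diagrams_in J G) A B \<phi>) \<in> extensional (Obj (fun_cat J (F0 G A)))"
  using assms by (simp_all add: diagrams_in_def)

lemma diag_F1_functor:
  assumes J: "category J" and "category (F0 G A)" "category (F0 G B)"
    and f: "is_functor (F0 G A) (F0 G B) (F1 G A B f)"
  shows "is_functor (fun_cat J (F0 G A)) (fun_cat J (F0 G B)) (F1 (diagrams_in J G) A B f)"
proof (rule is_functorI)
  fix D assume "D \<in> Obj (fun_cat J (F0 G A))"
  then show "ar_map (F1 (diagrams_in J G) A B f) (Idn (fun_cat J (F0 G A)) D)
    = Idn (fun_cat J (F0 G B)) (ob_map (F1 (diagrams_in J G) A B f) D)"
    using assms by (auto intro!: ntrans_eqI[where C=J])
next
  fix \<delta> \<epsilon> assume "\<delta> \<in> Arr (fun_cat J (F0 G A))" "\<epsilon> \<in> Arr (fun_cat J (F0 G A))"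
    and *: "Cod (fun_cat J (F0 G A)) \<delta> = Dom (fun_cat J (F0 G A)) \<epsilon>"
  then have de: "is_ntrans J (F0 G A) \<delta>" "is_ntrans J (F0 G A) \<epsilon>" "is_ntrans J (F0 G A) (vcomp J (F0 G A) \<epsilon> \<delta>)"
    using assms by (auto intro: vcomp_ntrans)
  show "ar_map (F1 (diagrams_in J G) A B f) (Cmp (fun_cat J (F0 G A)) \<epsilon> \<delta>) =
    Cmp (fun_cat J (F0 G B)) (ar_map (F1 (diagrams_in J G) A B f) \<epsilon>) (ar_map (F1 (diagrams_in J G) A B f) \<delta>)"
    using de * assms by (auto intro!: ntrans_eqI[where C=J] simp: ftor_cmp[OF f])
qed (use assms in \<open>auto simp: diag_F1_ext[unfolded fun_cat_simps] intro: fcmp_functor[OF J] hcomp_ntrans[OF J]\<close>)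

lemma diagrams_strict:
  assumes J: "category J" and G: "strict_cat_functor K G"
    and c1: "\<And>A B. A \<in> Obj0 K \<Longrightarrow> B \<in> Obj0 K \<Longrightarrow> category (HomC K A B)"
  shows "strict_cat_functor K (diagrams_in J G)"
  unfolding strict_cat_functor_def
proof (intro conjI ballI)
  have Gc [simp]: "A \<in> Obj0 K \<Longrightarrow> category (F0 G A)" for A using G by (auto simp: strict_cat_functor_def)
  have GF [simp]: "A \<in> Obj0 K \<Longrightarrow> B \<in> Obj0 K \<Longrightarrow> f \<in> Obj (HomC K A B) \<Longrightarrow> is_functor (F0 G A) (F0 G B) (F1 G A B f)" for A B f
    using G by (auto simp: strict_cat_functor_def)
  {
    fix A assume A: "A \<in> Obj0 K"
    then show "category (F0 (diagrams_in J G) A)" using J by (simp add: fun_cat_category)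
    have e: "F1 G A A (Idn1 K A) = fid (F0 G A)" using G A by (auto simp: strict_cat_functor_def)
    show "F1 (diagrams_in J G) A A (Idn1 K A) = fid (F0 (diagrams_in J G) A)"
      unfolding diag_F0
      using A J diag_F1_ext[of J G A A "Idn1 K A"]
      by (intro ftor_eqI[where C="fun_cat J (F0 G A)"])
        (auto simp: e fid_def[of "fun_cat J (F0 G A)"] fcmp_fid_left intro!: ntrans_eqI[where C=J] intro: nt_ext)
    fix B assume B: "B \<in> Obj0 K"
    {
      fix f assume f: "f \<in> Obj (HomC K A B)"
      show "is_functor (F0 (diagrams_in J G) A) (F0 (diagrams_in J G) B) (F1 (diagrams_in J G) A B f)"
        using A B f J by (simp add: diag_F1_functor)
      fix C g assume C: "C \<in> Obj0 K" and g: "g \<in> Obj (HomC K B C)"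
      have e: "F1 G A C (Cmp1 K A B C g f) = fcmp (F0 G A) (F1 G B C g) (F1 G A B f)"
        using G A B C f g by (auto simp: strict_cat_functor_def)
      have gf: "is_functor (F0 G A) (F0 G B) (F1 G A B f)" "is_functor (F0 G B) (F0 G C) (F1 G B C g)"
        using A B C f g by auto
      have h: "is_ntrans J (F0 G B) (hcomp J (F0 G B) (nid (F0 G A) (F0 G B) (F1 G A B f)) \<delta>)"
        if "is_ntrans J (F0 G A) \<delta>" for \<delta>
        using that A B gf J by (auto intro!: hcomp_ntrans[OF J, of "F0 G A"])
      show "F1 (diagrams_in J G) A C (Cmp1 K A B C g f) =
         fcmp (F0 (diagrams_in J G) A) (F1 (diagrams_in J G) B C g) (F1 (diagrams_in J G) A B f)"
        unfolding diag_F0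
        using A B C J gf diag_F1_ext[of J G A C "Cmp1 K A B C g f"]
          fcmp_ext[of "fun_cat J (F0 G A)" "F1 (diagrams_in J G) B C g" "F1 (diagrams_in J G) A B f"]
        by (intro ftor_eqI[where C="fun_cat J (F0 G A)"])
          (auto simp: e h fcmp_assoc fcmp_functor[OF J _ gf(1)] intro!: ntrans_eqI[where C=J])
    }
    fix \<phi> assume p: "\<phi> \<in> Arr (HomC K A B)"
    let ?f = "Dom (HomC K A B) \<phi>" and ?g = "Cod (HomC K A B) \<phi>"
    have n: "is_ntrans (F0 G A) (F0 G B) (F2 G A B \<phi>)" "nsrc (F2 G A B \<phi>) = F1 G A B ?f" "ntgt (F2 G A B \<phi>) = F1 G A B ?g"
      using p A B G by (auto simp: strict_cat_functor_def)
    have fg: "is_functor (F0 G A) (F0 G B) (F1 G A B ?f)" "is_functor (F0 G A) (F0 G B) (F1 G A B ?g)"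
      using p A B c1 by auto
    note d = diag_F2[where G=G and A=A and B=B and \<phi>=\<phi> and J=J, OF n(2,3)]
    show "nsrc (F2 (diagrams_in J G) A B \<phi>) = F1 (diagrams_in J G) A B ?f"
      "ntgt (F2 (diagrams_in J G) A B \<phi>) = F1 (diagrams_in J G) A B ?g"
      using d by auto
    have "is_ntrans J (F0 G B) (hcomp J (F0 G B) (F2 G A B \<phi>) (nid J (F0 G A) D))" if "is_functor J (F0 G A) D" for D
      using that n A B J by (auto intro!: hcomp_ntrans[OF J, of "F0 G A"])
    \<comment> \<open>Naturality in the diagram: at each object of \<open>J\<close> the square is
      the naturality square of \<open>F2 G A B \<phi>\<close> at the component of
      \<open>\<delta>\<close>.\<close>
    moreover have "vcomp J (F0 G B) (hcomp J (F0 G B) (F2 G A B \<phi>) (nid J (F0 G A) (ntgt \<delta>)))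
        (hcomp J (F0 G B) (nid (F0 G A) (F0 G B) (F1 G A B ?f)) \<delta>) =
        vcomp J (F0 G B) (hcomp J (F0 G B) (nid (F0 G A) (F0 G B) (F1 G A B ?g)) \<delta>)
        (hcomp J (F0 G B) (F2 G A B \<phi>) (nid J (F0 G A) (nsrc \<delta>)))" if "is_ntrans J (F0 G A) \<delta>" for \<delta>
    proof -
      have "Cmp (F0 G B) (cpt (F2 G A B \<phi>) (ob_map (ntgt \<delta>) x)) (ar_map (F1 G A B ?f) (cpt \<delta> x)) =
        Cmp (F0 G B) (ar_map (F1 G A B ?g) (cpt \<delta> x)) (cpt (F2 G A B \<phi>) (ob_map (nsrc \<delta>) x))" if "x \<in> Obj J" for x
        using nt_nat[OF n(1), of "cpt \<delta> x"] \<open>is_ntrans J (F0 G A) \<delta>\<close> that n by simp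
      then show ?thesis
        using that A B J n fg by (auto intro!: ntrans_eqI[where C=J])
    qed
    ultimately show "is_ntrans (F0 (diagrams_in J G) A) (F0 (diagrams_in J G) B) (F2 (diagrams_in J G) A B \<phi>)"
      using A B J d n fg by (auto intro!: is_ntransI simp: diag_F1_functor)
  }
qed

context strict_twocat
begin

text \<open>The comparison functors form a strict transformation because \<open>Cmp1\<close> and
  \<open>Cmp2\<close> are strictly associative, so \<open>strict_cat_functor_pair\<close> leaves
  only surjectivity on objects and full faithfulness. Both are stated through values at objects and
  arrows of \<open>J\<close>, which spares the user of the criterion the functor category over
  \<open>J\<close>.\<close>

lemma bitensor_productI:
  assumes J: "category J" and F: "F \<in> Obj0 K" and P: "P \<in> Obj0 K" and \<pi>: "is_functor J (HomC K F P) \<pi>"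
    and surj: "\<And>A D. A \<in> Obj0 K \<Longrightarrow> is_functor J (HomC K F A) D \<Longrightarrow>
      \<exists>b\<in>Obj (HomC K P A). (\<forall>j\<in>Obj J. Cmp1 K F P A b (ob_map \<pi> j) = ob_map D j) \<and>
        (\<forall>m\<in>Arr J. Cmp2 K F P A (Idn (HomC K P A) b) (ar_map \<pi> m) = ar_map D m)"
    and ff: "\<And>A b b' \<delta>. A \<in> Obj0 K \<Longrightarrow> b \<in> Obj (HomC K P A) \<Longrightarrow> b' \<in> Obj (HomC K P A) \<Longrightarrow>
      (\<forall>j\<in>Obj J. \<delta> j \<in> arrows (HomC K F A) (Cmp1 K F P A b (ob_map \<pi> j)) (Cmp1 K F P A b' (ob_map \<pi> j))) \<Longrightarrow>
      (\<forall>m\<in>Arr J. Cmp (HomC K F A) (\<delta> (Cod J m)) (Cmp2 K F P A (Idn (HomC K P A) b) (ar_map \<pi> m)) =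
                  Cmp (HomC K F A) (Cmp2 K F P A (Idn (HomC K P A) b') (ar_map \<pi> m)) (\<delta> (Dom J m))) \<Longrightarrow>
      \<exists>!\<beta>. \<beta> \<in> arrows (HomC K P A) b b' \<and> (\<forall>j\<in>Obj J. Cmp2 K F P A \<beta> (Idn (HomC K F P) (ob_map \<pi> j)) = \<delta> j)"
  shows "bitensor_product K J F P"
proof -
  let ?R = "representable K F" and ?G = "representable K P"
  let ?H = "diagrams_in J ?R"
  \<comment> \<open>The comparison at \<open>A\<close>: postcomposition of the universal diagram
    with the functor that \<open>b\<close> induces on hom-categories, and whiskering of 2-cells with
    that diagram.\<close>
  define s where "s = (\<lambda>A. \<lparr>ob_map = (\<lambda>b\<in>Obj (HomC K P A). fcmp J (F1 ?R P A b) \<pi>),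
    ar_map = (\<lambda>\<beta>\<in>Arr (HomC K P A). hcomp J (HomC K F A) (F2 ?R P A \<beta>) (nid J (HomC K F P) \<pi>))\<rparr>)"
  have R: "strict_cat_functor K ?R" and G: "strict_cat_functor K ?G"
    using F P by (auto intro: representable_strict)
  have H: "strict_cat_functor K ?H" using J R by (auto intro: diagrams_strict)
  have s_ob [simp]: "b \<in> Obj (HomC K P A) \<Longrightarrow> ob_map (s A) b = fcmp J (F1 ?R P A b) \<pi>"
    and s_ar [simp]: "\<beta> \<in> Arr (HomC K P A) \<Longrightarrow> ar_map (s A) \<beta> = hcomp J (HomC K F A) (F2 ?R P A \<beta>) (nid J (HomC K F P) \<pi>)"
    for A b \<beta> by (auto simp: s_def)
  have RF: "is_functor (HomC K F A) (HomC K F B) (F1 ?R A B f)" if "A \<in> Obj0 K" "B \<in> Obj0 K" "f \<in> Obj (HomC K A B)" for A B f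
    using that F by (rule_tac rep_F1_functor)
  have RN: "is_ntrans (HomC K F A) (HomC K F B) (F2 ?R A B f)" if "A \<in> Obj0 K" "B \<in> Obj0 K" "f \<in> Arr (HomC K A B)" for A B f
    using that R by (auto simp: strict_cat_functor_def)
  have pj [simp]: "j \<in> Obj J \<Longrightarrow> ob_map \<pi> j \<in> Obj (HomC K F P)" "m \<in> Arr J \<Longrightarrow> ar_map \<pi> m \<in> Arr (HomC K F P)"
    "m \<in> Arr J \<Longrightarrow> Dom (HomC K F P) (ar_map \<pi> m) = ob_map \<pi> (Dom J m)"
    "m \<in> Arr J \<Longrightarrow> Cod (HomC K F P) (ar_map \<pi> m) = ob_map \<pi> (Cod J m)" for j m
    using \<pi> by auto
  have s_ob_functor: "is_functor J (HomC K F A) (fcmp J (F1 ?R P A b) \<pi>)" if "A \<in> Obj0 K" "b \<in> Obj (HomC K P A)" for A b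
    using that F P J \<pi> by (auto intro!: fcmp_functor[OF J \<pi>] RF)
  have s_ar_nt: "is_ntrans J (HomC K F A) (hcomp J (HomC K F A) (F2 ?R P A \<beta>) (nid J (HomC K F P) \<pi>))"
    if "A \<in> Obj0 K" "\<beta> \<in> Arr (HomC K P A)" for A \<beta>
    using that F P J \<pi> by (auto intro!: hcomp_ntrans[OF J, of "HomC K F P"] RN)
  \<comment> \<open>The second factor is what \<open>hcomp\<close> adds for the identity
    transformation of \<open>\<pi>\<close>; it is itself an identity 2-cell.\<close>
  have hc: "Cmp (HomC K F A) (Cmp2 K F P A \<beta> (Idn (HomC K F P) x)) (Cmp2 K F P A (Idn (HomC K P A) (Dom (HomC K P A) \<beta>)) (Idn (HomC K F P) x))
      = Cmp2 K F P A \<beta> (Idn (HomC K F P) x)" if "A \<in> Obj0 K" "\<beta> \<in> Arr (HomC K P A)" "x \<in> Obj (HomC K F P)" for A \<beta> x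
    using that F P by (simp add: cmp2_id)
  have s_cpt: "cpt (hcomp J (HomC K F A) (F2 ?R P A \<beta>) (nid J (HomC K F P) \<pi>)) j = Cmp2 K F P A \<beta> (Idn (HomC K F P) (ob_map \<pi> j))"
    if "A \<in> Obj0 K" "\<beta> \<in> Arr (HomC K P A)" "j \<in> Obj J" for A \<beta> j
    using that F P by (simp add: hc)
  have sF: "is_functor (HomC K P A) (fun_cat J (HomC K F A)) (s A)" if A: "A \<in> Obj0 K" for A
  proof (rule is_functorI)
    fix b assume "b \<in> Obj (HomC K P A)"
    then show "ar_map (s A) (Idn (HomC K P A) b) = Idn (fun_cat J (HomC K F A)) (ob_map (s A) b)"
      using A F P by (auto intro!: ntrans_eqI[where C=J] simp: s_cpt cmp2_id simp del: hcomp_simps(3))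
  next
    fix \<beta> \<gamma> assume "\<beta> \<in> Arr (HomC K P A)" "\<gamma> \<in> Arr (HomC K P A)" "Cod (HomC K P A) \<beta> = Dom (HomC K P A) \<gamma>"
    then show "ar_map (s A) (Cmp (HomC K P A) \<gamma> \<beta>) = Cmp (fun_cat J (HomC K F A)) (ar_map (s A) \<gamma>) (ar_map (s A) \<beta>)"
      using A F P by (auto intro!: ntrans_eqI[where C=J] simp: s_cpt whisker_right_comp simp del: hcomp_simps(3))
  qed (use A P in \<open>auto simp: s_def s_ob_functor s_ar_nt\<close>)
  \<comment> \<open>The representable 2-functor preserves composition of 1-cells, and composition of
    functors is associative. This is where strict naturality of the comparison comes from.\<close>
  have comp: "fcmp J (F1 ?R P B (Cmp1 K P A B f b)) \<pi> = fcmp J (F1 ?R A B f) (fcmp J (F1 ?R P A b) \<pi>)"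
    if "A \<in> Obj0 K" "B \<in> Obj0 K" "f \<in> Obj (HomC K A B)" "b \<in> Obj (HomC K P A)" for A B f b
  proof -
    have "F1 ?R P B (Cmp1 K P A B f b) = fcmp (HomC K F P) (F1 ?R A B f) (F1 ?R P A b)"
      using that R P by (auto simp: strict_cat_functor_def)
    then show ?thesis by (simp add: fcmp_assoc[OF \<pi>])
  qed
  have s_nat: "fcmp (HomC K P A) (s B) (F1 ?G A B f) = fcmp (HomC K P A) (F1 ?H A B f) (s A)"
    if A: "A \<in> Obj0 K" "B \<in> Obj0 K" "f \<in> Obj (HomC K A B)" for A B f
  proof (rule ftor_eqI[where C="HomC K P A"])
    fix b assume b: "b \<in> Obj (HomC K P A)"
    then show "ob_map (fcmp (HomC K P A) (s B) (F1 ?G A B f)) b = ob_map (fcmp (HomC K P A) (F1 ?H A B f) (s A)) b"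
      using A P by (simp add: s_ob_functor comp)
  next
    fix \<beta> assume b: "\<beta> \<in> Arr (HomC K P A)"
    then have "hcomp J (HomC K F B) (F2 ?R P B (Cmp2 K P A B (Idn (HomC K A B) f) \<beta>)) (nid J (HomC K F P) \<pi>)
      = hcomp J (HomC K F B) (nid (HomC K F A) (HomC K F B) (F1 ?R A B f)) (hcomp J (HomC K F A) (F2 ?R P A \<beta>) (nid J (HomC K F P) \<pi>))"
      using A P F by (intro ntrans_eqI[where C=J]) (simp_all add: cmp2_id assoc2 assoc1 comp)
    then show "ar_map (fcmp (HomC K P A) (s B) (F1 ?G A B f)) \<beta> = ar_map (fcmp (HomC K P A) (F1 ?H A B f) (s A)) \<beta>"
      using A P b by (simp add: s_ar_nt)
  qed auto
  have s_nat2: "ar_map (s B) (cpt (F2 ?G A B \<phi>) b) = cpt (F2 ?H A B \<phi>) (ob_map (s A) b)"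
    if A: "A \<in> Obj0 K" "B \<in> Obj0 K" "\<phi> \<in> Arr (HomC K A B)" "b \<in> Obj (HomC K P A)" for A B \<phi> b
  proof -
    have "hcomp J (HomC K F B) (F2 ?R P B (Cmp2 K P A B \<phi> (Idn (HomC K P A) b))) (nid J (HomC K F P) \<pi>)
      = hcomp J (HomC K F B) (F2 ?R A B \<phi>) (nid J (HomC K F A) (fcmp J (F1 ?R P A b) \<pi>))"
      using A P F by (intro ntrans_eqI[where C=J]) (simp_all add: assoc2 assoc1 comp cmp2_id)
    then show ?thesis using A P diag_F2(3)[where G="?R" and A=A and B=B and \<phi>=\<phi> and J=J, OF rep_F2(1,2)]
      by (simp add: s_ob_functor)
  qed
  \<comment> \<open>A preimage of the diagram, chosen separately for every \<open>A\<close>; the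
    hypothesis \<open>surj\<close> provides one.\<close>
  define t where "t = (\<lambda>A D. SOME b. b \<in> Obj (HomC K P A) \<and> fcmp J (F1 ?R P A b) \<pi> = D)"
  have t: "t A D \<in> Obj (HomC K P A) \<and> fcmp J (F1 ?R P A (t A D)) \<pi> = D" if A: "A \<in> Obj0 K" "is_functor J (HomC K F A) D" for A D
  proof -
    obtain b where b: "b \<in> Obj (HomC K P A)" "\<forall>j\<in>Obj J. Cmp1 K F P A b (ob_map \<pi> j) = ob_map D j"
        "\<forall>m\<in>Arr J. Cmp2 K F P A (Idn (HomC K P A) b) (ar_map \<pi> m) = ar_map D m"
      using surj[OF A] by auto
    have "fcmp J (F1 ?R P A b) \<pi> = D"
      by (rule functor_eqI[OF s_ob_functor[OF A(1) b(1)] A(2)]) (use b in auto)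
    then show ?thesis unfolding t_def using someI[of "\<lambda>b. b \<in> Obj (HomC K P A) \<and> fcmp J (F1 ?R P A b) \<pi> = D" b] b by auto
  qed
  have FF: "\<exists>!\<beta>. \<beta> \<in> arrows (HomC K P A) b b' \<and> ar_map (s A) \<beta> = \<delta>"
    if A: "A \<in> Obj0 K" "b \<in> Obj (HomC K P A)" "b' \<in> Obj (HomC K P A)" and d: "is_ntrans J (HomC K F A) \<delta>"
      "nsrc \<delta> = fcmp J (F1 ?R P A b) \<pi>" "ntgt \<delta> = fcmp J (F1 ?R P A b') \<pi>" for A b b' \<delta>
  proof -
    \<comment> \<open>Source and target agree already because \<open>\<beta>\<close> runs from
      \<open>b\<close> to \<open>b'\<close>. What remains is the family of components, to which the
      hypothesis \<open>ff\<close> applies.\<close>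
    have "ar_map (s A) \<beta> = \<delta> \<longleftrightarrow> (\<forall>j\<in>Obj J. Cmp2 K F P A \<beta> (Idn (HomC K F P) (ob_map \<pi> j)) = cpt \<delta> j)"
      if b: "\<beta> \<in> arrows (HomC K P A) b b'" for \<beta>
    proof -
      have "ar_map (s A) \<beta> = \<delta> \<longleftrightarrow> (\<forall>j\<in>Obj J. cpt (ar_map (s A) \<beta>) j = cpt \<delta> j)"
        using b d A by (auto intro!: ntrans_eqI[where C=J] nt_ext[OF d(1)] simp: arrows_iff simp del: hcomp_simps(3))
      then show ?thesis using b A by (simp add: arrows_iff s_cpt del: hcomp_simps(3))
    qed
    moreover have "\<exists>!\<beta>. \<beta> \<in> arrows (HomC K P A) b b' \<and> (\<forall>j\<in>Obj J. Cmp2 K F P A \<beta> (Idn (HomC K F P) (ob_map \<pi> j)) = cpt \<delta> j)"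
    proof (rule ff[OF A])
      show "\<forall>j\<in>Obj J. cpt \<delta> j \<in> arrows (HomC K F A) (Cmp1 K F P A b (ob_map \<pi> j)) (Cmp1 K F P A b' (ob_map \<pi> j))"
        using d A by (auto simp: arrows_iff)
      show "\<forall>m\<in>Arr J. Cmp (HomC K F A) (cpt \<delta> (Cod J m)) (Cmp2 K F P A (Idn (HomC K P A) b) (ar_map \<pi> m)) =
              Cmp (HomC K F A) (Cmp2 K F P A (Idn (HomC K P A) b') (ar_map \<pi> m)) (cpt \<delta> (Dom J m))"
        using nt_nat[OF d(1)] d A by simp
    qed
    ultimately show ?thesis by (simp cong: conj_cong)
  qed
  interpret strict_cat_functor_pair K ?G ?H s t
    by unfold_locales
      (use sF s_nat s_nat2 t FF G H in \<open>auto simp: arrows_iff[of _ "fun_cat _ _"]\<close>)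
  show ?thesis using equivalent P by (simp add: bitensor_product_def)
qed

end

section \<open>Blocks of lists and words of a theory\<close>

lemma nth_in_set: "set xs \<subseteq> S \<Longrightarrow> i < length xs \<Longrightarrow> xs ! i \<in> S"
  by (meson nth_mem subsetD)

lemma nth_index: "set f \<subseteq> {..<l} \<Longrightarrow> i < length f \<Longrightarrow> f ! i < (l :: nat)"
  by (meson lessThan_iff nth_mem subsetD)

lemma set_map_nth_subset:
  assumes "set f \<subseteq> {..<length xs}" "set xs \<subseteq> S"
  shows "set (map ((!) xs) f) \<subseteq> S"
  using assms(1) by (auto intro!: nth_in_set[OF assms(2)])

lemma length_blocks [simp]: "length (blocks ns xs) = length ns"
  by (induction ns arbitrary: xs) auto

lemma blocks_nth: "i < length ns \<Longrightarrow> blocks ns xs ! i = take (ns ! i) (drop (offset ns i) xs)"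
  by (induction ns arbitrary: xs i) (auto simp: offset_def nth_Cons drop_drop add.commute split: nat.split)

lemma offset_0 [simp]: "offset ns 0 = 0"
  by (simp add: offset_def)

lemma offset_Cons_Suc [simp]: "offset (n # ns) (Suc i) = n + offset ns i"
  by (simp add: offset_def)

lemma offset_bound: "i < length ns \<Longrightarrow> offset ns i + ns ! i \<le> sum_list ns"
proof (induction ns arbitrary: i)
  case (Cons n ns)
  then show ?case by (cases i) auto
qed simp

lemma length_blocks_nth [simp]:
  "i < length ns \<Longrightarrow> length xs = sum_list ns \<Longrightarrow> length (blocks ns xs ! i) = ns ! i"
  using offset_bound[of i ns] by (simp add: blocks_nth)

lemma set_blocks_nth: "i < length ns \<Longrightarrow> set (blocks ns xs ! i) \<subseteq> set xs"
  by (auto simp: blocks_nth dest!: in_set_takeD in_set_dropD)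

lemma blocks_map: "blocks ns (map f xs) = map (map f) (blocks ns xs)"
  by (induction ns arbitrary: xs) (auto simp: take_map drop_map)

lemma blocks_map2: "i < length ns \<Longrightarrow> map2 f (blocks ns xs ! i) (blocks ns ys ! i) = blocks ns (map2 f xs ys) ! i"
  by (simp add: blocks_nth take_map drop_map take_zip drop_zip)

lemma blocks_concat: "map length xss = ns \<Longrightarrow> blocks ns (concat xss) = xss"
  by (induction xss arbitrary: ns) auto

lemma concat_nth:
  "i < length xss \<Longrightarrow> j < length (xss ! i) \<Longrightarrow> concat xss ! (offset (map length xss) i + j) = xss ! i ! j"
proof (induction xss arbitrary: i)
  case (Cons xs xss)
  then show ?case by (cases i) (auto simp: nth_append add.assoc)
qed simp

lemma concat_nth':
  "map length xss = ns \<Longrightarrow> i < length xss \<Longrightarrow> j < ns ! i \<Longrightarrow> concat xss ! (offset ns i + j) = xss ! i ! j"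
  using concat_nth[of i xss j] by auto

lemma length_block_incl [simp]: "length (block_incl ns i) = ns ! i"
  by (simp add: block_incl_def)

lemma block_incl_index: "i < length ns \<Longrightarrow> index_map (ns ! i) (sum_list ns) (block_incl ns i)"
  using offset_bound[of i ns] by (auto simp: index_map_def block_incl_def)

lemma map_block_incl:
  "i < length ns \<Longrightarrow> length xs = sum_list ns \<Longrightarrow> map ((!) xs) (block_incl ns i) = blocks ns xs ! i"
  using offset_bound[of i ns] by (intro nth_equalityI) (auto simp: block_incl_def blocks_nth)

lemma map_concat_block:
  assumes "map length xss = ns" "i < length ns"
  shows "map ((!) (concat xss)) (block_incl ns i) = xss ! i"
  using assms map_block_incl[of i ns "concat xss"] by (auto simp: blocks_concat length_concat)

lemma length_block_map [simp]: "length (block_map ns f) = sum_list (map ((!) ns) f)"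
  by (simp add: block_map_def length_concat o_def)

lemma block_map_index:
  "set f \<subseteq> {..<length ns} \<Longrightarrow> index_map (sum_list (map ((!) ns) f)) (sum_list ns) (block_map ns f)"
  using block_incl_index[of _ ns] by (fastforce simp: index_map_def block_map_def length_concat o_def)

lemma block_sum_index:
  assumes "length ns' = length gs" "\<forall>j<length gs. index_map (ns ! j) (ns' ! j) (gs ! j)" "length ns = length gs"
  shows "index_map (sum_list ns) (sum_list ns') (block_sum ns' gs)"
proof -
  have "map (\<lambda>i. length (gs ! i)) [0..<length gs] = ns"
    using assms by (intro nth_equalityI) (auto simp: index_map_def)
  moreover have "offset ns' i + j < sum_list ns'" if "i < length gs" "j \<in> set (gs ! i)" for i j
    using offset_bound[of i ns'] that assms by (force simp: index_map_def)
  ultimately show ?thesis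
    by (auto simp: index_map_def block_sum_def length_concat o_def)
qed

lemma map2_map1 [simp]: "map2 f (map g xs) ys = map2 (\<lambda>x. f (g x)) xs ys"
  by (simp add: zip_map1 o_def split_def)

lemma map2_map2 [simp]: "map2 f xs (map g ys) = map2 (\<lambda>x y. f x (g y)) xs ys"
  by (simp add: zip_map2 o_def split_def)

lemma sum_list_concat: "sum_list (concat nss) = sum_list (map sum_list nss)" for nss :: "nat list list"
  by (induction nss) auto

text \<open>Two-level addressing: on the left the position of a small block in the flat list of
  sizes, on the right its position relative to the large block that contains it.\<close>

lemma offset_map_length_add:
  "i < length nss \<Longrightarrow> q < length (nss ! i) \<Longrightarrow>
   offset (concat nss) (offset (map length nss) i + q) = offset (map sum_list nss) i + offset (nss ! i) q"
proof (induction nss arbitrary: i)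
  case (Cons ns nss)
  show ?case
  proof (cases i)
    case (Suc j)
    then show ?thesis using Cons by (simp add: offset_def add.assoc)
  qed (use Cons in \<open>simp add: offset_def\<close>)
qed simp

text \<open>The inclusion of a small block factors through the large block around it. Associativity
  of substitution of words rests on this.\<close>

lemma block_incl_block_incl:
  assumes "i < length nss" "q < length (nss ! i)"
  shows "map ((!) (block_incl (map sum_list nss) i)) (block_incl (nss ! i) q) = block_incl (concat nss) (offset (map length nss) i + q)"
  using assms offset_bound[of q "nss ! i"]
  by (intro nth_equalityI)
    (auto simp: concat_nth[of i nss] block_incl_def offset_map_length_add)

locale alg_theory =
  fixes T :: "'t thy_data"
  assumes th: "is_theory T"
begin

abbreviation "C \<equiv> tcat T"
abbreviation "ar \<equiv> arity T"

lemma cat_C [simp]: "category C" and ObjC [simp]: "Obj C = UNIV"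
  and pr [simp]: "i < n \<Longrightarrow> pr T n i \<in> Arr C" "i < n \<Longrightarrow> Dom C (pr T n i) = n" "i < n \<Longrightarrow> Cod C (pr T n i) = 1"
  using th by (auto simp: is_theory_def arrows_iff)

section \<open>Reindexings and tuples as arrows of the theory\<close>

lemma tuple_ex1: "set hs \<subseteq> arrows C m 1 \<Longrightarrow>
  \<exists>!h. h \<in> arrows C m (length hs) \<and> (\<forall>i<length hs. Cmp C (pr T (length hs) i) h = hs ! i)"
proof -
  assume hs: "set hs \<subseteq> arrows C m 1"
  have "\<forall>m n hs. length hs = n \<and> set hs \<subseteq> arrows C m 1 \<longrightarrow>
        (\<exists>!h. h \<in> arrows C m n \<and> (\<forall>i<n. Cmp C (pr T n i) h = hs ! i))"
    using th unfolding is_theory_def by (elim conjE)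
  from this[THEN spec, THEN spec, THEN spec, of hs "length hs" m] hs show ?thesis by simp
qed

lemma tuple:
  assumes "set hs \<subseteq> arrows C m 1"
  shows "tuple T m hs \<in> Arr C" "Dom C (tuple T m hs) = m" "Cod C (tuple T m hs) = length hs"
    "i < length hs \<Longrightarrow> Cmp C (pr T (length hs) i) (tuple T m hs) = hs ! i"
  using theI'[OF tuple_ex1[OF assms]] unfolding tuple_def[symmetric] by (auto simp: arrows_iff)

text \<open>The projections are jointly monic, by the uniqueness half of the product property. The
  identities between words below are checked through it.\<close>

lemma arrow_eqI:
  assumes "h \<in> Arr C" "h' \<in> Arr C" "Dom C h = m" "Dom C h' = m" "Cod C h = n" "Cod C h' = n"
    "\<And>i. i < n \<Longrightarrow> Cmp C (pr T n i) h = Cmp C (pr T n i) h'"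
  shows "h = h'"
proof -
  let ?hs = "map (\<lambda>i. Cmp C (pr T n i) h) [0..<n]"
  have "set ?hs \<subseteq> arrows C m 1" using assms by (auto simp: arrows_iff)
  from tuple_ex1[OF this] show ?thesis using assms by (auto simp: arrows_iff)
qed

text \<open>The arrow \<open>f'\<close> from \<open>l\<close> to the length of \<open>f\<close>,
  isolated so that \<open>w\<^sub>f\<close> becomes a plain composite in the theory.\<close>

definition rmap where "rmap l f = tuple T l (map (pr T l) f)"

lemma rmap:
  assumes "set f \<subseteq> {..<l}"
  shows "rmap l f \<in> Arr C" "Dom C (rmap l f) = l" "Cod C (rmap l f) = length f"
    "i < length f \<Longrightarrow> Cmp C (pr T (length f) i) (rmap l f) = pr T l (f ! i)"
proof -
  have "set (map (pr T l) f) \<subseteq> arrows C l 1" using assms by (auto simp: arrows_iff)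
  from tuple[OF this] show "rmap l f \<in> Arr C" "Dom C (rmap l f) = l" "Cod C (rmap l f) = length f"
    "i < length f \<Longrightarrow> Cmp C (pr T (length f) i) (rmap l f) = pr T l (f ! i)"
    by (auto simp: rmap_def)
qed

lemma tsub_rmap: "tsub T w l f = Cmp C w (rmap l f)"
  by (simp add: tsub_def rmap_def)

text \<open>Contravariance of the passage from a function to its arrow: composing functions reverses
  to composing the arrows in the opposite order. Each projection of either side is
  \<open>pr T m (g ! (f ! i))\<close>.\<close>

lemma rmap_rmap:
  assumes "set f \<subseteq> {..<l}" "length g = l" "set g \<subseteq> {..<m}"
  shows "Cmp C (rmap l f) (rmap m g) = rmap m (map ((!) g) f)"
proof (rule arrow_eqI[of _ _ m "length f"])
  have s: "set (map ((!) g) f) \<subseteq> {..<m}" using assms by (intro set_map_nth_subset) auto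
  note * = rmap[OF assms(1)] rmap[OF assms(3)] rmap[OF s]
  show "Cmp C (rmap l f) (rmap m g) \<in> Arr C" "rmap m (map ((!) g) f) \<in> Arr C"
    "Dom C (Cmp C (rmap l f) (rmap m g)) = m" "Dom C (rmap m (map ((!) g) f)) = m"
    "Cod C (Cmp C (rmap l f) (rmap m g)) = length f" "Cod C (rmap m (map ((!) g) f)) = length f"
    using * assms by auto
  fix i assume i: "i < length f"
  then have fi: "f ! i < l" using assms(1) by (rule_tac nth_index)
  have "Cmp C (pr T (length f) i) (Cmp C (rmap l f) (rmap m g)) = Cmp C (Cmp C (pr T (length f) i) (rmap l f)) (rmap m g)"
    using * assms i by (subst cat_assoc) auto
  also have "\<dots> = pr T m (g ! (f ! i))"
    using *(4)[OF i] *(8)[of "f ! i"] fi assms by simp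
  finally show "Cmp C (pr T (length f) i) (Cmp C (rmap l f) (rmap m g)) = Cmp C (pr T (length f) i) (rmap m (map ((!) g) f))"
    using *(12)[of i] i by simp
qed

lemma wordI: "w \<in> Arr C \<Longrightarrow> Cod C w = 1 \<Longrightarrow> w \<in> words T"
  by (auto simp: words_def)

lemma word_simps [simp]: "w \<in> words T \<Longrightarrow> w \<in> Arr C" "w \<in> words T \<Longrightarrow> Cod C w = 1"
  by (auto simp: words_def)

lemma tsub_word [simp]:
  assumes "w \<in> words T" "index_map (ar w) l f"
  shows "tsub T w l f \<in> words T" "ar (tsub T w l f) = l"
  using assms rmap[of f l] by (auto simp: tsub_rmap index_map_def intro!: wordI)

text \<open>The arrow \<open>(w\<^sub>1, \<dots>, w\<^sub>k)\<close> out of the sum of the arities,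
  isolated so that \<open>tgamma\<close> becomes composition with it.\<close>

definition btup where "btup ws = tuple T (sum_list (map ar ws))
  (map (\<lambda>i. tsub T (ws ! i) (sum_list (map ar ws)) (block_incl (map ar ws) i)) [0..<length ws])"

lemma tgamma_btup: "tgamma T w ws = Cmp C w (btup ws)"
  by (simp add: tgamma_def btup_def Let_def)

lemma sub_incl:
  assumes "set ws \<subseteq> words T" "i < length ws"
  shows "tsub T (ws ! i) (sum_list (map ar ws)) (block_incl (map ar ws) i) \<in> words T"
    "ar (tsub T (ws ! i) (sum_list (map ar ws)) (block_incl (map ar ws) i)) = sum_list (map ar ws)"
  using block_incl_index[of i "map ar ws"] assms nth_in_set[OF assms] by auto

lemma btup:
  assumes "set ws \<subseteq> words T"
  shows "btup ws \<in> Arr C" "Dom C (btup ws) = sum_list (map ar ws)" "Cod C (btup ws) = length ws"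
    "i < length ws \<Longrightarrow> Cmp C (pr T (length ws) i) (btup ws) = tsub T (ws ! i) (sum_list (map ar ws)) (block_incl (map ar ws) i)"
proof -
  let ?hs = "map (\<lambda>i. tsub T (ws ! i) (sum_list (map ar ws)) (block_incl (map ar ws) i)) [0..<length ws]"
  have "set ?hs \<subseteq> arrows C (sum_list (map ar ws)) 1"
    using sub_incl[OF assms] by (auto simp: arrows_iff)
  from tuple[OF this] show "btup ws \<in> Arr C" "Dom C (btup ws) = sum_list (map ar ws)" "Cod C (btup ws) = length ws"
    "i < length ws \<Longrightarrow> Cmp C (pr T (length ws) i) (btup ws) = tsub T (ws ! i) (sum_list (map ar ws)) (block_incl (map ar ws) i)"
    by (auto simp: btup_def)
qed

lemma tgamma_word [simp]:
  assumes "fits T w ws"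
  shows "tgamma T w ws \<in> words T" "ar (tgamma T w ws) = sum_list (map ar ws)"
  using assms btup[of ws] by (auto simp: tgamma_btup fits_def intro!: wordI)

lemma tunit_word [simp]: "tunit T \<in> words T" "ar (tunit T) = 1"
  by (auto simp: tunit_def intro!: wordI)

lemma word_rmap_btup:
  assumes "set ws \<subseteq> words T" "i < length ws"
  shows "Cmp C (pr T (length ws) i) (btup ws) = Cmp C (ws ! i) (rmap (sum_list (map ar ws)) (block_incl (map ar ws) i))"
  using btup(4)[OF assms] by (simp add: tsub_rmap)

section \<open>Identities between words that match the sources in the coherence laws\<close>

lemma tsub_tsub:
  assumes "w \<in> words T" "index_map (ar w) l f" "index_map l m g"
  shows "tsub T (tsub T w l f) m g = tsub T w m (map ((!) g) f)"
  using assms rmap[of f l] rmap[of g m]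
  by (simp add: tsub_rmap index_map_def cat_assoc rmap_rmap)

lemma rmap_id: "rmap n [0..<n] = Idn C n"
  by (rule arrow_eqI[of _ _ n n]) (use rmap[of "[0..<n]" n] in \<open>auto simp: atLeast0LessThan\<close>)

lemma tsub_id: "w \<in> words T \<Longrightarrow> tsub T w (ar w) [0..<ar w] = w"
  by (simp add: tsub_rmap rmap_id)

lemma tgamma_unit_left: "w \<in> words T \<Longrightarrow> tgamma T (tunit T) [w] = w"
  using word_rmap_btup[of "[w]" 0] rmap_id[of "ar w"]
  by (simp add: tgamma_btup tunit_def block_incl_def)

text \<open>All blocks have one element, so the tuple of the unit words has the projections as its
  components and is the identity.\<close>

lemma tgamma_unit_right:
  assumes "w \<in> words T"
  shows "tgamma T w (replicate (ar w) (tunit T)) = w"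
proof -
  let ?u = "replicate (ar w) (tunit T)"
  have s: "set ?u \<subseteq> words T" by auto
  have "btup ?u = Idn C (ar w)"
  proof (rule arrow_eqI[of _ _ "ar w" "ar w"])
    fix i assume i: "i < ar w"
    have "offset (replicate (ar w) 1) i = i" using i by (simp add: offset_def take_replicate sum_list_replicate)
    then have b: "block_incl (replicate (ar w) 1) i = [i]" using i by (simp add: block_incl_def)
    have "Cmp C (pr T 1 0) (rmap (ar w) [i]) = pr T (ar w) i" using rmap(4)[of "[i]" "ar w" 0] i by simp
    then show "Cmp C (pr T (ar w) i) (btup ?u) = Cmp C (pr T (ar w) i) (Idn C (ar w))"
      using i word_rmap_btup[OF s, of i] b by (simp add: tunit_def[symmetric] sum_list_replicate) (simp add: tunit_def)
  qed (use btup[OF s] in \<open>auto simp: sum_list_replicate\<close>)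
  then show ?thesis using assms by (simp add: tgamma_btup)
qed

text \<open>It is enough to have a commuting square formed by the tuples of the two lists and the
  reindexings by \<open>f\<close> and by its block map. Under the \<open>i\<close>-th projection
  both ways give the word with index \<open>f ! i\<close> on its own block. The two sides of law (4)
  start at the functors of the two words equated here.\<close>

lemma tgamma_block_map:
  assumes "w \<in> words T" "set ws \<subseteq> words T" "index_map (ar w) (length ws) f"
  shows "tsub T (tgamma T w (map ((!) ws) f)) (sum_list (map ar ws)) (block_map (map ar ws) f)
    = tgamma T (tsub T w (length ws) f) ws"
proof -
  let ?N = "sum_list (map ar ws)" and ?f' = "block_map (map ar ws) f" and ?wf = "map ((!) ws) f"
  have f: "length f = ar w" "set f \<subseteq> {..<length ws}" using assms by (auto simp: index_map_def)
  have wf: "set ?wf \<subseteq> words T" using assms f by (intro set_map_nth_subset) auto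
  have arw: "map ((!) (map ar ws)) f = map ar ?wf" using f by (auto simp: subset_iff)
  have f': "length ?f' = sum_list (map ar ?wf)" "set ?f' \<subseteq> {..<?N}"
    using block_map_index[of f "map ar ws"] f(2) unfolding length_block_map arw by (auto simp: index_map_def)
  note * = btup[OF wf] btup[OF assms(2)] rmap[OF f'(2)] rmap[OF f(2)]
  have "Cmp C (btup ?wf) (rmap ?N ?f') = Cmp C (rmap (length ws) f) (btup ws)"
  proof (rule arrow_eqI[of _ _ ?N "length f"])
    fix i assume i: "i < length f"
    have fi: "f ! i < length ws" using i f(2) by (rule_tac nth_index)
    have wi: "ws ! (f ! i) \<in> words T" using fi assms(2) by (rule_tac nth_in_set)
    have bi: "set (block_incl (map ar ?wf) i) \<subseteq> {..<sum_list (map ar ?wf)}" "length (block_incl (map ar ?wf) i) = ar (ws ! (f ! i))"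
      using block_incl_index[of i "map ar ?wf"] i by (auto simp: index_map_def)
    have bi': "set (block_incl (map ar ws) (f ! i)) \<subseteq> {..<?N}" using block_incl_index[of "f ! i" "map ar ws"] fi by (auto simp: index_map_def)
    have e: "map ((!) ?f') (block_incl (map ar ?wf) i) = block_incl (map ar ws) (f ! i)"
      unfolding block_map_def using i f by (subst map_concat_block) (auto simp: subset_iff)
    have "Cmp C (pr T (length f) i) (Cmp C (btup ?wf) (rmap ?N ?f')) = Cmp C (Cmp C (pr T (length f) i) (btup ?wf)) (rmap ?N ?f')"
      using * i f f' by (subst cat_assoc) auto
    also have "\<dots> = Cmp C (ws ! (f ! i)) (Cmp C (rmap (sum_list (map ar ?wf)) (block_incl (map ar ?wf) i)) (rmap ?N ?f'))"
      using word_rmap_btup[OF wf, of i] i wi rmap[OF bi(1)] bi * f'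
      by (simp add: cat_assoc)
    also have "\<dots> = Cmp C (ws ! (f ! i)) (rmap ?N (block_incl (map ar ws) (f ! i)))"
      using rmap_rmap[OF bi(1) f'] e by simp
    also have "\<dots> = Cmp C (pr T (length ws) (f ! i)) (btup ws)"
      using word_rmap_btup[OF assms(2) fi] by simp
    also have "\<dots> = Cmp C (Cmp C (pr T (length f) i) (rmap (length ws) f)) (btup ws)"
      using *(16)[OF i] by simp
    also have "\<dots> = Cmp C (pr T (length f) i) (Cmp C (rmap (length ws) f) (btup ws))"
      using * i f by (subst cat_assoc) auto
    finally show "Cmp C (pr T (length f) i) (Cmp C (btup ?wf) (rmap ?N ?f')) = Cmp C (pr T (length f) i) (Cmp C (rmap (length ws) f) (btup ws))" .
  qed (use * f f' in auto)
  then show ?thesis using * f f' assms by (simp add: tgamma_btup tsub_rmap cat_assoc)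
qed

text \<open>Same scheme as for block maps: on the \<open>i\<close>-th block the block sum is
  \<open>gs ! i\<close> followed by the inclusion of the \<open>i\<close>-th block of sizes
  \<open>ns'\<close>. It matches the sources in law (5).\<close>

lemma tgamma_block_sum:
  assumes "fits T w ws" "length ns' = length ws" "length gs = length ws"
    "\<forall>j<length ws. index_map (ar (ws ! j)) (ns' ! j) (gs ! j)"
  shows "tsub T (tgamma T w ws) (sum_list ns') (block_sum ns' gs)
    = tgamma T w (map (\<lambda>j. tsub T (ws ! j) (ns' ! j) (gs ! j)) [0..<length ws])"
proof -
  let ?N = "sum_list ns'" and ?g = "block_sum ns' gs" and ?us = "map (\<lambda>j. tsub T (ws ! j) (ns' ! j) (gs ! j)) [0..<length ws]"
  have ws: "set ws \<subseteq> words T" "w \<in> words T" "length ws = ar w" using assms by (auto simp: fits_def)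
  have wi: "i < length ws \<Longrightarrow> ws ! i \<in> words T" for i using ws by (rule_tac nth_in_set)
  have us: "set ?us \<subseteq> words T" using assms wi by auto
  have ns': "map ar ?us = ns'" using assms wi by (intro nth_equalityI) auto
  have g: "length ?g = sum_list (map ar ws)" "set ?g \<subseteq> {..<?N}"
    using block_sum_index[of ns' gs "map ar ws"] assms by (auto simp: index_map_def)
  note * = btup[OF ws(1)] btup[OF us, unfolded ns'] rmap[OF g(2)]
  have "Cmp C (btup ws) (rmap ?N ?g) = btup ?us"
  proof (rule arrow_eqI[of _ _ ?N "length ws"])
    fix i assume i: "i < length ws"
    have gi: "length (gs ! i) = ar (ws ! i)" "set (gs ! i) \<subseteq> {..<ns' ! i}" using assms i by (auto simp: index_map_def)
    have bi: "set (block_incl (map ar ws) i) \<subseteq> {..<sum_list (map ar ws)}"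
      using block_incl_index[of i "map ar ws"] i by (auto simp: index_map_def)
    have bi': "set (block_incl ns' i) \<subseteq> {..<?N}" "length (block_incl ns' i) = ns' ! i"
      using block_incl_index[of i ns'] i assms by (auto simp: index_map_def)
    have "map ((!) ?g) (block_incl (map ar ws) i) = map (\<lambda>j. offset ns' i + j) (gs ! i)"
      unfolding block_sum_def using i assms by (subst map_concat_block) (auto intro!: nth_equalityI simp: index_map_def)
    also have "\<dots> = map ((!) (block_incl ns' i)) (gs ! i)"
      using gi by (auto simp: block_incl_def subset_iff)
    finally have e: "map ((!) ?g) (block_incl (map ar ws) i) = map ((!) (block_incl ns' i)) (gs ! i)" .
    have "Cmp C (pr T (length ws) i) (Cmp C (btup ws) (rmap ?N ?g)) = Cmp C (Cmp C (pr T (length ws) i) (btup ws)) (rmap ?N ?g)"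
      using * i g by (subst cat_assoc) auto
    also have "\<dots> = Cmp C (ws ! i) (Cmp C (rmap (sum_list (map ar ws)) (block_incl (map ar ws) i)) (rmap ?N ?g))"
      using word_rmap_btup[OF ws(1) i] i wi rmap[OF bi] * g by (simp add: cat_assoc)
    also have "\<dots> = Cmp C (ws ! i) (Cmp C (rmap (ns' ! i) (gs ! i)) (rmap ?N (block_incl ns' i)))"
      using rmap_rmap[OF bi g] rmap_rmap[OF gi(2) bi'(2,1)] e by simp
    also have "\<dots> = Cmp C (pr T (length ws) i) (btup ?us)"
      using word_rmap_btup[OF us, of i] i wi rmap[OF gi(2)] rmap[OF bi'(1)] gi bi' assms ns'
      by (simp add: cat_assoc tsub_rmap)
    finally show "Cmp C (pr T (length ws) i) (Cmp C (btup ws) (rmap ?N ?g)) = Cmp C (pr T (length ws) i) (btup ?us)" .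
  qed (use * g in auto)
  then show ?thesis using * g ws by (simp add: tgamma_btup tsub_rmap cat_assoc)
qed

text \<open>The bookkeeping shared by all arguments about two levels of substitution.\<close>

lemma fits_nested:
  assumes "fits T w ws" "list_all2 (fits T) ws wss"
  shows "length wss = length ws" "i < length ws \<Longrightarrow> fits T (ws ! i) (wss ! i)" "fits T (tgamma T w ws) (concat wss)"
    "fits T w (map2 (tgamma T) ws wss)" "map ar (map2 (tgamma T) ws wss) = map (\<lambda>us. sum_list (map ar us)) wss"
    "length (concat wss) = sum_list (map ar ws)" "map length wss = map ar ws"
proof -
  show l: "length wss = length ws" and f: "i < length ws \<Longrightarrow> fits T (ws ! i) (wss ! i)" for i
    using assms by (auto simp: list_all2_conv_all_nth)
  show m: "map length wss = map ar ws"
    using l f by (intro nth_equalityI) (auto simp: fits_def)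
  then show lc: "length (concat wss) = sum_list (map ar ws)" by (simp add: length_concat)
  have "set us \<subseteq> words T" if "us \<in> set wss" for us
    using that f l by (auto simp: in_set_conv_nth fits_def)
  then show "fits T (tgamma T w ws) (concat wss)"
    using assms lc by (auto simp: fits_def[of _ "tgamma T w ws"])
  show "fits T w (map2 (tgamma T) ws wss)" "map ar (map2 (tgamma T) ws wss) = map (\<lambda>us. sum_list (map ar us)) wss"
    using assms f l by (auto simp: fits_def[of _ w] in_set_conv_nth intro!: nth_equalityI)
qed

text \<open>Joint monicity is used twice. The outer projection selects \<open>ws ! i\<close>, the
  inner one the word \<open>wss ! i ! q\<close> on its block of the flat list, and the two
  descriptions of that block agree by \<open>block_incl_block_incl\<close>. It matches the sources
  in law (1).\<close>

lemma tgamma_assoc: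
  assumes "fits T w ws" "list_all2 (fits T) ws wss"
  shows "tgamma T (tgamma T w ws) (concat wss) = tgamma T w (map2 (tgamma T) ws wss)"
proof -
  note f = fits_nested[OF assms]
  let ?us = "map2 (tgamma T) ws wss" and ?ns = "map ar ws" and ?N = "sum_list (map ar (concat wss))"
  let ?nss = "map (map ar) wss"
  have ws: "set ws \<subseteq> words T" "w \<in> words T" "length ws = ar w" using assms by (auto simp: fits_def)
  have cw: "set (concat wss) \<subseteq> words T" and us: "set ?us \<subseteq> words T" using f(3,4) by (auto simp: fits_def)
  have wi: "i < length ws \<Longrightarrow> ws ! i \<in> words T" for i using ws by (rule_tac nth_in_set)
  have wsi: "i < length ws \<Longrightarrow> set (wss ! i) \<subseteq> words T \<and> length (wss ! i) = ar (ws ! i)" for i using f(2)[of i] by (auto simp: fits_def)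
  have nss: "map sum_list ?nss = map ar ?us" "map length ?nss = ?ns" "concat ?nss = map ar (concat wss)"
    "sum_list (map ar ?us) = ?N"
    using f(5,7) by (auto simp: o_def map_concat sum_list_concat)
  note * = btup[OF ws(1)] btup[OF us] btup[OF cw] f(1,6) nss(4)
  have "Cmp C (btup ws) (btup (concat wss)) = btup ?us"
  proof (rule arrow_eqI[of _ _ ?N "length ws"])
    fix i assume i: "i < length ws"
    have bi: "set (block_incl ?ns i) \<subseteq> {..<sum_list ?ns}" "length (block_incl ?ns i) = ar (ws ! i)"
      using block_incl_index[of i "?ns"] i by (auto simp: index_map_def)
    have bu: "set (block_incl (map ar ?us) i) \<subseteq> {..<?N}" "length (block_incl (map ar ?us) i) = sum_list (map ar (wss ! i))"
      using block_incl_index[of i "map ar ?us"] i f(1,2) nss(4) by (auto simp: index_map_def)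
    note ** = rmap[OF bi(1)] rmap[OF bu(1)] btup[of "wss ! i"] wsi[OF i] wi[OF i]
    \<comment> \<open>The flat tuple restricted to the \<open>i\<close>-th group of words is the
      tuple of \<open>wss ! i\<close>, placed on the \<open>i\<close>-th large block.\<close>
    have e: "Cmp C (rmap (sum_list ?ns) (block_incl ?ns i)) (btup (concat wss)) = Cmp C (btup (wss ! i)) (rmap ?N (block_incl (map ar ?us) i))"
    proof (rule arrow_eqI[of _ _ ?N "ar (ws ! i)"])
      fix q assume q: "q < ar (ws ! i)"
      let ?r = "offset ?ns i + q"
      have r: "?r < sum_list ?ns" "block_incl ?ns i ! q = ?r"
        using offset_bound[of i ?ns] i q by (auto simp: block_incl_def)
      have cr: "concat wss ! ?r = wss ! i ! q" using concat_nth'[OF f(7), of i q] i q f(1) by simp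
      have wq: "wss ! i ! q \<in> words T" using wsi[OF i] q by (intro nth_in_set) auto
      have bq: "set (block_incl (map ar (wss ! i)) q) \<subseteq> {..<sum_list (map ar (wss ! i))}"
         "length (block_incl (map ar (wss ! i)) q) = ar (wss ! i ! q)"
        using block_incl_index[of q "map ar (wss ! i)"] q wsi[OF i] by (auto simp: index_map_def)
      have "Cmp C (pr T (ar (ws ! i)) q) (Cmp C (rmap (sum_list ?ns) (block_incl ?ns i)) (btup (concat wss)))
        = Cmp C (Cmp C (pr T (ar (ws ! i)) q) (rmap (sum_list ?ns) (block_incl ?ns i))) (btup (concat wss))"
        using * ** i q bi by (subst cat_assoc) auto
      also have "\<dots> = Cmp C (pr T (length (concat wss)) ?r) (btup (concat wss))"
        using **(4)[of q] q bi r f(6) by simp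
      also have "\<dots> = Cmp C (wss ! i ! q) (rmap ?N (block_incl (map ar (concat wss)) ?r))"
        using word_rmap_btup[OF cw, of ?r] r f(6) cr by simp
      also have "block_incl (map ar (concat wss)) ?r = map ((!) (block_incl (map ar ?us) i)) (block_incl (map ar (wss ! i)) q)"
        using block_incl_block_incl[of i ?nss q] i q wsi[OF i] f(1) nss by simp
      also have "Cmp C (wss ! i ! q) (rmap ?N \<dots>) = Cmp C (wss ! i ! q) (Cmp C (rmap (sum_list (map ar (wss ! i))) (block_incl (map ar (wss ! i)) q)) (rmap ?N (block_incl (map ar ?us) i)))"
        using rmap_rmap[OF bq(1) bu(2,1)] by simp
      also have "\<dots> = Cmp C (Cmp C (pr T (ar (ws ! i)) q) (btup (wss ! i))) (rmap ?N (block_incl (map ar ?us) i))"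
        using word_rmap_btup[of "wss ! i" q] wsi[OF i] q rmap[OF bq(1)] bq wq ** bu by (simp add: cat_assoc)
      also have "\<dots> = Cmp C (pr T (ar (ws ! i)) q) (Cmp C (btup (wss ! i)) (rmap ?N (block_incl (map ar ?us) i)))"
        using ** q bu by (subst cat_assoc) auto
      finally show "Cmp C (pr T (ar (ws ! i)) q) (Cmp C (rmap (sum_list ?ns) (block_incl ?ns i)) (btup (concat wss)))
        = Cmp C (pr T (ar (ws ! i)) q) (Cmp C (btup (wss ! i)) (rmap ?N (block_incl (map ar ?us) i)))" .
    qed (use * ** bi bu in auto)
    have "Cmp C (pr T (length ws) i) (Cmp C (btup ws) (btup (concat wss))) = Cmp C (Cmp C (pr T (length ws) i) (btup ws)) (btup (concat wss))"
      using * i by (subst cat_assoc) auto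
    also have "\<dots> = Cmp C (ws ! i) (Cmp C (rmap (sum_list ?ns) (block_incl ?ns i)) (btup (concat wss)))"
      using word_rmap_btup[OF ws(1) i] * ** bi by (simp add: cat_assoc)
    also have "\<dots> = Cmp C (pr T (length ws) i) (btup ?us)"
      unfolding e using word_rmap_btup[OF us, of i] i * ** bu tgamma_btup[of "ws ! i" "wss ! i"] by (simp add: cat_assoc)
    finally show "Cmp C (pr T (length ws) i) (Cmp C (btup ws) (btup (concat wss))) = Cmp C (pr T (length ws) i) (btup ?us)" .
  qed (use * in auto)
  then show ?thesis using * ws by (simp add: tgamma_btup cat_assoc)
qed

end

section \<open>Powers of a category\<close>

lemma pow_simps [simp]: "xs \<in> Obj (pow n X) \<longleftrightarrow> length xs = n \<and> set xs \<subseteq> Obj X"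
  "fs \<in> Arr (pow n X) \<longleftrightarrow> length fs = n \<and> set fs \<subseteq> Arr X"
  "Dom (pow n X) = map (Dom X)" "Cod (pow n X) = map (Cod X)" "Idn (pow n X) = map (Idn X)" "Cmp (pow n X) = map2 (Cmp X)"
  by (auto simp: pow_def)

lemma map_eq_nth: "map f xs = map g ys \<Longrightarrow> i < length xs \<Longrightarrow> f (xs ! i) = g (ys ! i)"
  by (metis length_map nth_map)

lemma pow_category:
  assumes X: "category X"
  shows "category (pow n X)"
proof (rule categoryI)
  fix fs assume fs: "fs \<in> Arr (pow n X)"
  show "Dom (pow n X) fs \<in> Obj (pow n X)" "Cod (pow n X) fs \<in> Obj (pow n X)" using fs X by auto
  have "fs ! i \<in> Arr X" if "i < n" for i using fs that by (auto intro!: nth_in_set)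
  then show "Cmp (pow n X) fs (Idn (pow n X) (Dom (pow n X) fs)) = fs"
   "Cmp (pow n X) (Idn (pow n X) (Cod (pow n X) fs)) fs = fs" using fs X by (auto simp del: map_eq_conv intro!: nth_equalityI)
next
  fix xs assume "xs \<in> Obj (pow n X)"
  then show "Idn (pow n X) xs \<in> arrows (pow n X) xs xs" using X by (auto simp: arrows_iff subset_iff intro!: map_idI)
next
  fix fs gs assume fs: "fs \<in> Arr (pow n X)" and gs: "gs \<in> Arr (pow n X)" and c: "Cod (pow n X) fs = Dom (pow n X) gs"
  have i: "fs ! i \<in> Arr X" "gs ! i \<in> Arr X" "Cod X (fs ! i) = Dom X (gs ! i)" if "i < n" for i
    using fs gs c that by (auto intro!: nth_in_set map_eq_nth)
  have "set (map2 (Cmp X) gs fs) \<subseteq> Arr X"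
    using X i fs gs by (auto simp: set_zip)
  then show "Cmp (pow n X) gs fs \<in> arrows (pow n X) (Dom (pow n X) fs) (Cod (pow n X) gs)"
    using i fs gs X by (auto simp: arrows_iff intro!: nth_equalityI)
  fix hs assume hs: "hs \<in> Arr (pow n X)" and c': "Cod (pow n X) gs = Dom (pow n X) hs"
  have "hs ! i \<in> Arr X" "Cod X (gs ! i) = Dom X (hs ! i)" if "i < n" for i
    using hs gs c' that by (auto intro!: nth_in_set map_eq_nth)
  then show "Cmp (pow n X) hs (Cmp (pow n X) gs fs) = Cmp (pow n X) (Cmp (pow n X) hs gs) fs"
    using i fs gs hs X by (auto simp del: map_eq_conv intro!: nth_equalityI simp: cat_assoc)
qed

lemma pow_inv_arrow:
  assumes X: "category X" and "length fs = n" "\<And>i. i < n \<Longrightarrow> invertible_arrow X (fs ! i)"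
  shows "invertible_arrow (pow n X) fs"
  by (rule inv_arrowI[where g="map (inverse_arrow X) fs"])
    (use assms in \<open>auto simp: inverse_arrow in_set_conv_nth intro!: nth_equalityI\<close>)

lemma blocks_obj: "i < length ns \<Longrightarrow> length xs = sum_list ns \<Longrightarrow> set xs \<subseteq> S \<Longrightarrow> length (blocks ns xs ! i) = ns ! i \<and> set (blocks ns xs ! i) \<subseteq> S"
  using set_blocks_nth[of i ns xs] by auto

lemma map2_in:
  assumes "length xs = n" "length ys = n" "\<And>i. i < n \<Longrightarrow> f (xs ! i) (ys ! i) \<in> S"
  shows "(\<lambda>(x, y). f x y) ` set (zip xs ys) \<subseteq> S"
  using assms by (auto simp: set_zip)

section \<open>Products, powers and reindexings of functors\<close>

lemma fprod_simps [simp]: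
  "length xs = sum_list ns \<Longrightarrow> set xs \<subseteq> Obj X \<Longrightarrow> ob_map (fprod X ns Fs) xs = map2 ob_map Fs (blocks ns xs)"
  "length fs = sum_list ns \<Longrightarrow> set fs \<subseteq> Arr X \<Longrightarrow> ar_map (fprod X ns Fs) fs = map2 ar_map Fs (blocks ns fs)"
  by (auto simp: fprod_def)

lemma fprod_ext: "ob_map (fprod X ns Fs) \<in> extensional (Obj (pow (sum_list ns) X))" "ar_map (fprod X ns Fs) \<in> extensional (Arr (pow (sum_list ns) X))"
  by (auto simp: fprod_def)

lemma fprod_functor:
  assumes X: "category X" and l: "length Fs = length ns"
    and F: "\<And>i. i < length ns \<Longrightarrow> is_functor (pow (ns ! i) X) Y (Fs ! i)"
  shows "is_functor (pow (sum_list ns) X) (pow (length ns) Y) (fprod X ns Fs)"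
proof (rule is_functorI)
  show "ob_map (fprod X ns Fs) \<in> extensional (Obj (pow (sum_list ns) X))" "ar_map (fprod X ns Fs) \<in> extensional (Arr (pow (sum_list ns) X))"
    by (rule fprod_ext)+
next
  fix xs assume "xs \<in> Obj (pow (sum_list ns) X)"
  then have xs: "length xs = sum_list ns" "set xs \<subseteq> Obj X" by auto
  have xi: "blocks ns xs ! i \<in> Obj (pow (ns ! i) X)" if "i < length ns" for i
    using blocks_obj[OF that xs] by simp
  show "ob_map (fprod X ns Fs) xs \<in> Obj (pow (length ns) Y)"
    using xs l ftor_ob[OF F xi] by (simp add: map2_in[of _ "length ns"])
  have "blocks ns (map (Idn X) xs) ! i = Idn (pow (ns ! i) X) (blocks ns xs ! i)" if "i < length ns" for i
    using that by (simp add: blocks_map)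
  then show "ar_map (fprod X ns Fs) (Idn (pow (sum_list ns) X) xs) = Idn (pow (length ns) Y) (ob_map (fprod X ns Fs) xs)"
    using xs l ftor_id[OF F xi] X image_subset_iff[of "Idn X" "set xs" "Arr X"] by (auto simp del: map_eq_conv intro!: nth_equalityI)
next
  fix fs assume "fs \<in> Arr (pow (sum_list ns) X)"
  then have fs: "length fs = sum_list ns" "set fs \<subseteq> Arr X" "set (map (Dom X) fs) \<subseteq> Obj X" "set (map (Cod X) fs) \<subseteq> Obj X" using X by auto
  have fi: "blocks ns fs ! i \<in> Arr (pow (ns ! i) X)" if "i < length ns" for i
    using blocks_obj[OF that fs(1,2)] by simp
  show "ar_map (fprod X ns Fs) fs \<in> Arr (pow (length ns) Y)"
    using fs l ftor_ar[OF F fi] by (simp add: map2_in[of _ "length ns"])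
  show "Dom (pow (length ns) Y) (ar_map (fprod X ns Fs) fs) = ob_map (fprod X ns Fs) (Dom (pow (sum_list ns) X) fs)"
    "Cod (pow (length ns) Y) (ar_map (fprod X ns Fs) fs) = ob_map (fprod X ns Fs) (Cod (pow (sum_list ns) X) fs)"
    using fs l ftor_dom[OF F fi] ftor_cod[OF F fi] X by (auto simp del: map_eq_conv intro!: nth_equalityI simp: blocks_map)
  fix gs assume "gs \<in> Arr (pow (sum_list ns) X)" and c: "Cod (pow (sum_list ns) X) fs = Dom (pow (sum_list ns) X) gs"
  then have gs: "length gs = sum_list ns" "set gs \<subseteq> Arr X" by auto
  have gi: "blocks ns gs ! i \<in> Arr (pow (ns ! i) X)" if "i < length ns" for i
    using blocks_obj[OF that gs] by simp
  have ci: "Cod (pow (ns ! i) X) (blocks ns fs ! i) = Dom (pow (ns ! i) X) (blocks ns gs ! i)" if "i < length ns" for i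
    using arg_cong[OF c, of "\<lambda>xs. blocks ns xs ! i"] that by (simp add: blocks_map)
  have cm: "map2 (Cmp X) gs fs \<in> Arr (pow (sum_list ns) X)"
    using cat_cmp_arr[OF pow_category[OF X, of "sum_list ns"], of fs gs] fs gs c by simp
  have "ar_map (Fs ! i) (blocks ns (map2 (Cmp X) gs fs) ! i) = Cmp Y (ar_map (Fs ! i) (blocks ns gs ! i)) (ar_map (Fs ! i) (blocks ns fs ! i))"
    if "i < length ns" for i
    using ftor_cmp[OF F fi gi ci] that by (simp add: blocks_map2)
  then show "ar_map (fprod X ns Fs) (Cmp (pow (sum_list ns) X) gs fs) =
           Cmp (pow (length ns) Y) (ar_map (fprod X ns Fs) gs) (ar_map (fprod X ns Fs) fs)"
    using cm fs gs l by (auto simp del: map_eq_conv intro!: nth_equalityI)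
qed

lemma nprod_simps [simp]:
  "nsrc (nprod X ns \<alpha>s) = fprod X ns (map nsrc \<alpha>s)" "ntgt (nprod X ns \<alpha>s) = fprod X ns (map ntgt \<alpha>s)"
  "length xs = sum_list ns \<Longrightarrow> set xs \<subseteq> Obj X \<Longrightarrow> cpt (nprod X ns \<alpha>s) xs = map2 cpt \<alpha>s (blocks ns xs)"
  "cpt (nprod X ns \<alpha>s) \<in> extensional (Obj (pow (sum_list ns) X))"
  by (auto simp: nprod_def)

lemma nprod_niso:
  assumes X: "category X" and Y: "category Y" and l: "length \<alpha>s = length ns" "length Fs = length ns" "length Gs = length ns"
    and a: "\<And>i. i < length ns \<Longrightarrow> is_niso (pow (ns ! i) X) Y (Fs ! i) (Gs ! i) (\<alpha>s ! i)"
  shows "is_niso (pow (sum_list ns) X) (pow (length ns) Y) (fprod X ns Fs) (fprod X ns Gs) (nprod X ns \<alpha>s)"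
proof -
  note n = is_nisoD[OF a]
  have s: "map nsrc \<alpha>s = Fs" "map ntgt \<alpha>s = Gs" using n(2,3) l by (auto simp del: map_eq_conv intro!: nth_equalityI)
  have F: "is_functor (pow (ns ! i) X) Y (Fs ! i)" "is_functor (pow (ns ! i) X) Y (Gs ! i)" if "i < length ns" for i
    using nt_src[OF n(1)[OF that]] nt_tgt[OF n(1)[OF that]] n[OF that] by auto
  have bo: "blocks ns xs ! i \<in> Obj (pow (ns ! i) X)" if "i < length ns" "length xs = sum_list ns" "set xs \<subseteq> Obj X" for i xs
    using blocks_obj[OF that] by simp
  have nt: "is_ntrans (pow (sum_list ns) X) (pow (length ns) Y) (nprod X ns \<alpha>s)"
  proof (rule is_ntransI)
    show "is_functor (pow (sum_list ns) X) (pow (length ns) Y) (nsrc (nprod X ns \<alpha>s))"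
       "is_functor (pow (sum_list ns) X) (pow (length ns) Y) (ntgt (nprod X ns \<alpha>s))"
      using F l s by (auto intro!: fprod_functor[OF X])
  next
    fix xs assume "xs \<in> Obj (pow (sum_list ns) X)"
    then have xs: "length xs = sum_list ns" "set xs \<subseteq> Obj X" by auto
    show "cpt (nprod X ns \<alpha>s) xs \<in> Arr (pow (length ns) Y)"
      using xs l nt_arr[OF n(1) bo] by (simp add: map2_in[of _ "length ns"])
    show "Dom (pow (length ns) Y) (cpt (nprod X ns \<alpha>s) xs) = ob_map (nsrc (nprod X ns \<alpha>s)) xs"
      "Cod (pow (length ns) Y) (cpt (nprod X ns \<alpha>s) xs) = ob_map (ntgt (nprod X ns \<alpha>s)) xs"
      using xs l nt_dom[OF n(1) bo] nt_cod[OF n(1) bo] by (auto simp del: map_eq_conv intro!: nth_equalityI)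
  next
    fix fs assume "fs \<in> Arr (pow (sum_list ns) X)"
    then have fs: "length fs = sum_list ns" "set fs \<subseteq> Arr X" "set (map (Dom X) fs) \<subseteq> Obj X" "set (map (Cod X) fs) \<subseteq> Obj X" using X by auto
    have fi: "blocks ns fs ! i \<in> Arr (pow (ns ! i) X)" if "i < length ns" for i
      using blocks_obj[OF that fs(1,2)] by simp
    show "Cmp (pow (length ns) Y) (cpt (nprod X ns \<alpha>s) (Cod (pow (sum_list ns) X) fs)) (ar_map (nsrc (nprod X ns \<alpha>s)) fs) =
      Cmp (pow (length ns) Y) (ar_map (ntgt (nprod X ns \<alpha>s)) fs) (cpt (nprod X ns \<alpha>s) (Dom (pow (sum_list ns) X) fs))"
      using fs l nt_nat[OF n(1) fi] by (auto simp del: map_eq_conv intro!: nth_equalityI simp: blocks_map)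
  qed auto
  have "invertible_arrow (pow (length ns) Y) (cpt (nprod X ns \<alpha>s) xs)" if "xs \<in> Obj (pow (sum_list ns) X)" for xs
    using that l n(4)[OF _ bo] by (auto intro!: pow_inv_arrow[OF Y])
  then show ?thesis using nt s unfolding is_niso_def by simp
qed

lemma fpow_simps [simp]: "length xs = n \<Longrightarrow> set xs \<subseteq> Obj X \<Longrightarrow> ob_map (fpow X n H) xs = map (ob_map H) xs"
  "length fs = n \<Longrightarrow> set fs \<subseteq> Arr X \<Longrightarrow> ar_map (fpow X n H) fs = map (ar_map H) fs"
  by (auto simp: fpow_def)

lemma fpow_ext: "ob_map (fpow X n H) \<in> extensional (Obj (pow n X))" "ar_map (fpow X n H) \<in> extensional (Arr (pow n X))"
  by (auto simp: fpow_def)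

lemma fpow_functor:
  assumes X: "category X" and H: "is_functor X Y H"
  shows "is_functor (pow n X) (pow n Y) (fpow X n H)"
proof (rule is_functorI)
  fix fs gs assume "fs \<in> Arr (pow n X)" "gs \<in> Arr (pow n X)" and c: "Cod (pow n X) fs = Dom (pow n X) gs"
  then have fs: "length fs = n" "set fs \<subseteq> Arr X" and gs: "length gs = n" "set gs \<subseteq> Arr X" by auto
  have i: "fs ! i \<in> Arr X" "gs ! i \<in> Arr X" "Cod X (fs ! i) = Dom X (gs ! i)" if "i < n" for i
    using fs gs c that by (auto intro!: nth_in_set map_eq_nth)
  have cm: "map2 (Cmp X) gs fs \<in> Arr (pow n X)"
    using cat_cmp_arr[OF pow_category[OF X, of n], of fs gs] fs gs c by simp
  show "ar_map (fpow X n H) (Cmp (pow n X) gs fs) = Cmp (pow n Y) (ar_map (fpow X n H) gs) (ar_map (fpow X n H) fs)"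
    using cm fs gs i by (auto simp del: map_eq_conv intro!: nth_equalityI simp: ftor_cmp[OF H])
next
  fix f assume f: "f \<in> Arr (pow n X)"
  have s: "set (map (Dom X) f) \<subseteq> Obj X" "set (map (Cod X) f) \<subseteq> Obj X" using X f by auto
  show "Dom (pow n Y) (ar_map (fpow X n H) f) = ob_map (fpow X n H) (Dom (pow n X) f)"
    "Cod (pow n Y) (ar_map (fpow X n H) f) = ob_map (fpow X n H) (Cod (pow n X) f)"
    using f s by (auto simp: ftor_dom[OF H] ftor_cod[OF H] subset_iff)
next
  fix xs assume xs: "xs \<in> Obj (pow n X)"
  then have "set (map (Idn X) xs) \<subseteq> Arr X" using X by auto
  then show "ar_map (fpow X n H) (Idn (pow n X) xs) = Idn (pow n Y) (ob_map (fpow X n H) xs)"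
    using xs by (auto simp: ftor_id[OF H] subset_iff)
qed (use assms in \<open>auto simp: fpow_ext[unfolded pow_def, simplified] fpow_ext simp del: pow_simps(1,2), auto simp: subset_iff\<close>)

lemma fpow_comp:
  assumes X: "category X" and G: "is_functor X Y G"
  shows "fcmp (pow n X) (fpow Y n H) (fpow X n G) = fpow X n (fcmp X H G)"
proof (rule ftor_eqI[where C="pow n X"])
  fix xs assume "xs \<in> Obj (pow n X)"
  moreover from this have "set (map (ob_map G) xs) \<subseteq> Obj Y" using G by auto
  ultimately show "ob_map (fcmp (pow n X) (fpow Y n H) (fpow X n G)) xs = ob_map (fpow X n (fcmp X H G)) xs"
    by (auto simp: subset_iff)
next
  fix xs assume "xs \<in> Arr (pow n X)"
  moreover from this have "set (map (ar_map G) xs) \<subseteq> Arr Y" using G by auto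
  ultimately show "ar_map (fcmp (pow n X) (fpow Y n H) (fpow X n G)) xs = ar_map (fpow X n (fcmp X H G)) xs"
    by (auto simp: subset_iff)
qed (auto simp: fpow_ext simp del: pow_simps)

lemma fpow_fid:
  assumes X: "category X"
  shows "fpow X n (fid X) = fid (pow n X)"
proof (rule functor_eqI[of "pow n X" "pow n X" _ "pow n X"])
  show "is_functor (pow n X) (pow n X) (fpow X n (fid X))" by (rule fpow_functor[OF X]) (simp add: X)
  show "is_functor (pow n X) (pow n X) (fid (pow n X))" by (simp add: pow_category[OF X])
  fix xs assume xs: "xs \<in> Obj (pow n X)"
  then have "map (ob_map (fid X)) xs = xs" by (auto intro!: map_idI)
  then show "ob_map (fpow X n (fid X)) xs = ob_map (fid (pow n X)) xs" using xs by simp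
next
  fix xs assume xs: "xs \<in> Arr (pow n X)"
  then have "map (ar_map (fid X)) xs = xs" by (auto intro!: map_idI)
  then show "ar_map (fpow X n (fid X)) xs = ar_map (fid (pow n X)) xs" using xs by simp
qed

lemma npow_simps [simp]: "nsrc (npow X n \<alpha>) = fpow X n (nsrc \<alpha>)" "ntgt (npow X n \<alpha>) = fpow X n (ntgt \<alpha>)"
  "length xs = n \<Longrightarrow> set xs \<subseteq> Obj X \<Longrightarrow> cpt (npow X n \<alpha>) xs = map (cpt \<alpha>) xs"
  "cpt (npow X n \<alpha>) \<in> extensional (Obj (pow n X))"
  by (auto simp: npow_def)

lemma reindex_simps [simp]: "length xs = l \<Longrightarrow> set xs \<subseteq> Obj X \<Longrightarrow> ob_map (reindex X l f) xs = map ((!) xs) f"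
  "length fs = l \<Longrightarrow> set fs \<subseteq> Arr X \<Longrightarrow> ar_map (reindex X l f) fs = map ((!) fs) f"
  by (auto simp: reindex_def)

lemma reindex_functor:
  assumes X: "category X" and f: "set f \<subseteq> {..<l}"
  shows "is_functor (pow l X) (pow (length f) X) (reindex X l f)"
proof (rule is_functorI)
  have a1: "length xs = l \<Longrightarrow> set xs \<subseteq> S \<Longrightarrow> set (map ((!) xs) f) \<subseteq> S" for xs and S :: "'b set"
    using set_map_nth_subset[of f xs] f by auto
  have a2: "length xs = l \<Longrightarrow> set xs \<subseteq> S \<Longrightarrow> set (map ((!) xs) f) \<subseteq> S" for xs and S :: "'a set"
    using set_map_nth_subset[of f xs] f by auto
  have fi: "i \<in> set f \<Longrightarrow> i < l" for i using f by auto
  show "ob_map (reindex X l f) \<in> extensional (Obj (pow l X))" "ar_map (reindex X l f) \<in> extensional (Arr (pow l X))"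
    by (auto simp: reindex_def)
  show "xs \<in> Obj (pow l X) \<Longrightarrow> ob_map (reindex X l f) xs \<in> Obj (pow (length f) X)" for xs
    using a2[of xs "Obj X"] by auto
  show "xs \<in> Obj (pow l X) \<Longrightarrow> ar_map (reindex X l f) (Idn (pow l X) xs) = Idn (pow (length f) X) (ob_map (reindex X l f) xs)" for xs
    using X fi image_subset_iff[of "Idn X" "set xs" "Arr X"] by (auto simp: subset_iff)
  fix fs assume fs: "fs \<in> Arr (pow l X)"
  then show "ar_map (reindex X l f) fs \<in> Arr (pow (length f) X)"
    using a1[of fs "Arr X"] by auto
  have "set (map (Dom X) fs) \<subseteq> Obj X" "set (map (Cod X) fs) \<subseteq> Obj X" using X fs by auto
  then show "Dom (pow (length f) X) (ar_map (reindex X l f) fs) = ob_map (reindex X l f) (Dom (pow l X) fs)"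
    "Cod (pow (length f) X) (ar_map (reindex X l f) fs) = ob_map (reindex X l f) (Cod (pow l X) fs)"
    using fs fi by simp_all
  fix gs assume gs: "gs \<in> Arr (pow l X)" and c: "Cod (pow l X) fs = Dom (pow l X) gs"
  have cm: "map2 (Cmp X) gs fs \<in> Arr (pow l X)"
    using cat_cmp_arr[OF pow_category[OF X, of l], of fs gs] fs gs c by simp
  then show "ar_map (reindex X l f) (Cmp (pow l X) gs fs) = Cmp (pow (length f) X) (ar_map (reindex X l f) gs) (ar_map (reindex X l f) fs)"
    using fs gs fi by (auto simp del: map_eq_conv intro!: nth_equalityI)
qed

lemma niso_eq_iff:
  assumes "category C" "category D" "is_niso C D F G \<alpha>" "is_niso C D F H \<beta>"
  shows "\<alpha> = \<beta> \<longleftrightarrow> (\<forall>x\<in>Obj C. cpt \<alpha> x = cpt \<beta> x)"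
  using niso_eqI[OF assms] by auto

section \<open>Substitution of transformations and its components\<close>

lemma egammaN_niso:
  assumes X: "category X" and a: "is_niso (pow (length ns) X) X F G \<alpha>"
    and l: "length \<alpha>s = length ns" "length Fs = length ns" "length Gs = length ns"
    and as: "\<And>i. i < length ns \<Longrightarrow> is_niso (pow (ns ! i) X) X (Fs ! i) (Gs ! i) (\<alpha>s ! i)"
  shows "is_niso (pow (sum_list ns) X) X (egamma X ns F Fs) (egamma X ns G Gs) (egammaN X ns \<alpha> \<alpha>s)"
  unfolding egamma_def egammaN_def
  using X a nprod_niso[OF X X l as] by (auto intro!: hcomp_niso[where D="pow (length ns) X"] pow_category)

text \<open>The identity transformations contribute a list of identities, which the source functor
  of \<open>\<alpha>\<close> sends to an identity. Only \<open>\<alpha>\<close> at the list of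
  values survives.\<close>

lemma cpt_egammaN_whisker_right:
  assumes X: "category X" and a: "is_ntrans (pow (length us) X) X \<alpha>"
    and \<Phi>: "\<And>u. u \<in> set us \<Longrightarrow> is_functor (pow (ar u) X) X (\<Phi> u)"
    and xs: "length xs = sum_list (map ar us)" "set xs \<subseteq> Obj X"
  shows "cpt (egammaN X (map ar us) \<alpha> (map (\<lambda>u. nid (pow (ar u) X) X (\<Phi> u)) us)) xs
      = cpt \<alpha> (map2 (\<lambda>u. ob_map (\<Phi> u)) us (blocks (map ar us) xs))"
proof -
  let ?ys = "map2 (\<lambda>u. ob_map (\<Phi> u)) us (blocks (map ar us) xs)"
  have b: "length (blocks (map ar us) xs ! i) = ar (us ! i)" "set (blocks (map ar us) xs ! i) \<subseteq> Obj X" if "i < length us" for i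
    using blocks_obj[of i "map ar us" xs "Obj X"] xs that by auto
  have ys: "?ys \<in> Obj (pow (length us) X)"
    using ftor_ob[OF \<Phi>] b by (simp add: map2_in[of _ "length us"])
  have e: "map2 (\<lambda>u. cpt (nid (pow (ar u) X) X (\<Phi> u))) us (blocks (map ar us) xs) = map (Idn X) ?ys"
    using b by (intro nth_equalityI) auto
  have i: "ar_map (nsrc \<alpha>) (map (Idn X) ?ys) = Idn X (ob_map (nsrc \<alpha>) ?ys)"
    using nsrc_id[OF a ys] by simp
  have "cpt (egammaN X (map ar us) \<alpha> (map (\<lambda>u. nid (pow (ar u) X) X (\<Phi> u)) us)) xs
     = Cmp X (cpt \<alpha> ?ys) (ar_map (nsrc \<alpha>) (map2 (\<lambda>u. cpt (nid (pow (ar u) X) X (\<Phi> u))) us (blocks (map ar us) xs)))"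
    using xs by (simp add: egammaN_def o_def)
  also have "\<dots> = cpt \<alpha> ?ys"
    unfolding e i by (rule cat_id_right[OF X nt_arr[OF a ys] nt_dom[OF a ys]])
  finally show ?thesis .
qed

lemma cpt_hcomp_nid_left:
  assumes "category E" "is_functor D E F" "is_ntrans C D \<alpha>" "x \<in> Obj C"
  shows "cpt (hcomp C E (nid D E F) \<alpha>) x = ar_map F (cpt \<alpha> x)"
  using assms by simp

lemma cpt_hcomp_nid_right:
  assumes "category E" "is_ntrans D E \<beta>" "is_functor C D F" "x \<in> Obj C"
  shows "cpt (hcomp C E \<beta> (nid C D F)) x = cpt \<beta> (ob_map F x)"
  using assms by simp

lemma cpt_egammaN_whisker_left:
  assumes X: "category X" and F: "is_functor (pow (length ns) X) X F"
    and l: "length \<alpha>s = length ns" "length Fs = length ns" "length Gs = length ns"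
    and as: "\<And>i. i < length ns \<Longrightarrow> is_niso (pow (ns ! i) X) X (Fs ! i) (Gs ! i) (\<alpha>s ! i)"
    and xs: "length xs = sum_list ns" "set xs \<subseteq> Obj X"
  shows "cpt (egammaN X ns (nid (pow (length ns) X) X F) \<alpha>s) xs = ar_map F (map2 cpt \<alpha>s (blocks ns xs))"
  unfolding egammaN_def
  using xs by (subst cpt_hcomp_nid_left[OF X F is_nisoD(1)[OF nprod_niso[OF X X l as]]]) auto

section \<open>Pseudo algebras in components\<close>

text \<open>The typing half of \<open>pseudo_algebra\<close>, without the seven laws. The
  translation of a law into components rests on this half alone, so it serves both for reading the
  laws off a given algebra and for proving them for the algebra under construction.\<close>

locale typed_palg = alg_theory T for T :: "'t thy_data" +
  fixes A :: "('t, 'o, 'a) palg"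
  assumes cat [simp]: "category (acat A)"
    and op: "w \<in> words T \<Longrightarrow> is_functor (pow (arity T w) (acat A)) (acat A) (aop A w)"
    and acmp: "fits T w ws \<Longrightarrow> is_niso (pow (sum_list (map (arity T) ws)) (acat A)) (acat A) (aop A (tgamma T w ws))
         (egamma (acat A) (map (arity T) ws) (aop A w) (map (aop A) ws)) (acmp A w ws)"
    and auni: "is_niso (pow 1 (acat A)) (acat A) (aop A (tunit T)) (eunit (acat A)) (auni A)"
    and asub: "w \<in> words T \<Longrightarrow> index_map (arity T w) l f \<Longrightarrow>
         is_niso (pow l (acat A)) (acat A) (aop A (tsub T w l f)) (esub (acat A) (aop A w) l f) (asub A w l f)"
begin

lemma pow_cat [simp]: "category (pow n (acat A))"
  by (rule pow_category) simp

section \<open>Typing and naturality of the structure in components\<close>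

lemma op_simps [simp]:
  assumes "w \<in> words T"
  shows "length xs = ar w \<Longrightarrow> set xs \<subseteq> Obj (acat A) \<Longrightarrow> ob_map (aop A w) xs \<in> Obj (acat A)"
    "length fs = ar w \<Longrightarrow> set fs \<subseteq> Arr (acat A) \<Longrightarrow> ar_map (aop A w) fs \<in> Arr (acat A)"
    "length fs = ar w \<Longrightarrow> set fs \<subseteq> Arr (acat A) \<Longrightarrow> Dom (acat A) (ar_map (aop A w) fs) = ob_map (aop A w) (map (Dom (acat A)) fs)"
    "length fs = ar w \<Longrightarrow> set fs \<subseteq> Arr (acat A) \<Longrightarrow> Cod (acat A) (ar_map (aop A w) fs) = ob_map (aop A w) (map (Cod (acat A)) fs)"
    "length xs = ar w \<Longrightarrow> set xs \<subseteq> Obj (acat A) \<Longrightarrow> ar_map (aop A w) (map (Idn (acat A)) xs) = Idn (acat A) (ob_map (aop A w) xs)"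
  using ftor_ob[OF op[OF assms], of xs] ftor_ar[OF op[OF assms], of fs] ftor_dom[OF op[OF assms], of fs]
    ftor_cod[OF op[OF assms], of fs] ftor_id[OF op[OF assms], of xs] by auto

lemma op_cmp:
  assumes "w \<in> words T" "length fs = ar w" "length gs = ar w" "set fs \<subseteq> Arr (acat A)" "set gs \<subseteq> Arr (acat A)"
    "map (Cod (acat A)) fs = map (Dom (acat A)) gs"
  shows "ar_map (aop A w) (map2 (Cmp (acat A)) gs fs) = Cmp (acat A) (ar_map (aop A w) gs) (ar_map (aop A w) fs)"
  using ftor_cmp[OF op[OF assms(1)], of fs gs] assms by auto

text \<open>The object part of \<open>\<Phi>(w\<^sub>1) \<times> \<dots> \<times>
  \<Phi>(w\<^sub>k)\<close>, that is, the argument at which the outer operation is taken in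
  \<open>egamma\<close>.\<close>

definition opb :: "'t list \<Rightarrow> 'o list \<Rightarrow> 'o list" where
  "opb ws xs = map2 (\<lambda>u. ob_map (aop A u)) ws (blocks (map ar ws) xs)"

lemma length_opb [simp]: "length (opb ws xs) = length ws"
  by (simp add: opb_def)

lemma opb_nth [simp]: "i < length ws \<Longrightarrow> opb ws xs ! i = ob_map (aop A (ws ! i)) (blocks (map ar ws) xs ! i)"
  by (simp add: opb_def)

lemma opb_obj [simp]:
  assumes "set ws \<subseteq> words T" "length xs = sum_list (map ar ws)" "set xs \<subseteq> Obj (acat A)"
  shows "set (opb ws xs) \<subseteq> Obj (acat A)"
proof -
  have "ob_map (aop A (ws ! i)) (blocks (map ar ws) xs ! i) \<in> Obj (acat A)" if "i < length ws" for i
    using blocks_obj[of i "map ar ws" xs "Obj (acat A)"] that assms nth_in_set[OF assms(1), of i] by simp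
  then show ?thesis by (auto simp: in_set_conv_nth)
qed

lemma acmp_simps:
  assumes f: "fits T w ws" and xs: "length xs = sum_list (map ar ws)" "set xs \<subseteq> Obj (acat A)"
  shows "cpt (acmp A w ws) xs \<in> Arr (acat A)" "invertible_arrow (acat A) (cpt (acmp A w ws) xs)"
    "Dom (acat A) (cpt (acmp A w ws) xs) = ob_map (aop A (tgamma T w ws)) xs"
    "Cod (acat A) (cpt (acmp A w ws) xs) = ob_map (aop A w) (opb ws xs)"
  using nt_arr[OF is_nisoD(1)[OF acmp[OF f]], of xs] nt_dom[OF is_nisoD(1)[OF acmp[OF f]], of xs]
    nt_cod[OF is_nisoD(1)[OF acmp[OF f]], of xs] is_nisoD(2,3)[OF acmp[OF f]] is_nisoD(4)[OF acmp[OF f], of xs] xs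
  by (auto simp: egamma_def opb_def)

lemma acmp_nat:
  assumes f: "fits T w ws" and fs: "length fs = sum_list (map ar ws)" "set fs \<subseteq> Arr (acat A)"
  shows "Cmp (acat A) (cpt (acmp A w ws) (map (Cod (acat A)) fs)) (ar_map (aop A (tgamma T w ws)) fs)
     = Cmp (acat A) (ar_map (aop A w) (map2 (\<lambda>u. ar_map (aop A u)) ws (blocks (map ar ws) fs))) (cpt (acmp A w ws) (map (Dom (acat A)) fs))"
  using nt_nat[OF is_nisoD(1)[OF acmp[OF f]], of fs] is_nisoD[OF acmp[OF f]] fs by (auto simp: egamma_def)

lemma auni_simps:
  assumes "x \<in> Obj (acat A)"
  shows "cpt (auni A) [x] \<in> Arr (acat A)" "invertible_arrow (acat A) (cpt (auni A) [x])"
    "Dom (acat A) (cpt (auni A) [x]) = ob_map (aop A (tunit T)) [x]"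
    "Cod (acat A) (cpt (auni A) [x]) = x"
  using nt_arr[OF is_nisoD(1)[OF auni], of "[x]"] nt_dom[OF is_nisoD(1)[OF auni], of "[x]"]
    nt_cod[OF is_nisoD(1)[OF auni], of "[x]"] is_nisoD(2,3)[OF auni] is_nisoD(4)[OF auni, of "[x]"] assms
  by (auto simp: eunit_def)

lemma auni_nat:
  assumes "f \<in> Arr (acat A)"
  shows "Cmp (acat A) (cpt (auni A) [Cod (acat A) f]) (ar_map (aop A (tunit T)) [f])
     = Cmp (acat A) f (cpt (auni A) [Dom (acat A) f])"
  using nt_nat[OF is_nisoD(1)[OF auni], of "[f]"] is_nisoD[OF auni] assms by (auto simp: eunit_def)

lemma asub_simps:
  assumes w: "w \<in> words T" "index_map (ar w) l f" and xs: "length xs = l" "set xs \<subseteq> Obj (acat A)"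
  shows "cpt (asub A w l f) xs \<in> Arr (acat A)" "invertible_arrow (acat A) (cpt (asub A w l f) xs)"
    "Dom (acat A) (cpt (asub A w l f) xs) = ob_map (aop A (tsub T w l f)) xs"
    "Cod (acat A) (cpt (asub A w l f) xs) = ob_map (aop A w) (map ((!) xs) f)"
  using nt_arr[OF is_nisoD(1)[OF asub[OF w]], of xs] nt_dom[OF is_nisoD(1)[OF asub[OF w]], of xs]
    nt_cod[OF is_nisoD(1)[OF asub[OF w]], of xs] is_nisoD(2,3)[OF asub[OF w]] is_nisoD(4)[OF asub[OF w], of xs] xs
  by (auto simp: esub_def)

lemma asub_nat:
  assumes w: "w \<in> words T" "index_map (ar w) l f" and fs: "length fs = l" "set fs \<subseteq> Arr (acat A)"
  shows "Cmp (acat A) (cpt (asub A w l f) (map (Cod (acat A)) fs)) (ar_map (aop A (tsub T w l f)) fs)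
     = Cmp (acat A) (ar_map (aop A w) (map ((!) fs) f)) (cpt (asub A w l f) (map (Dom (acat A)) fs))"
  using nt_nat[OF is_nisoD(1)[OF asub[OF w]], of fs] is_nisoD[OF asub[OF w]] fs by (auto simp: esub_def)

section \<open>The coherence laws as equations between components\<close>

lemma iw_niso:
  "w \<in> words T \<Longrightarrow> is_niso (pow (ar w) (acat A)) (acat A) (aop A w) (aop A w) (nid (pow (ar w) (acat A)) (acat A) (aop A w))"
  by (simp add: nid_niso op)

text \<open>Both sides are invertible transformations, and \<open>tgamma_assoc\<close> identifies
  their sources, so they agree as soon as their components do; agreement of the targets then comes
  for free. Whiskered factors are evaluated by \<open>cpt_egammaN_whisker_right\<close> and
  \<open>cpt_egammaN_whisker_left\<close>. The other laws follow this pattern, each with its own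
  identity between words.\<close>

lemma coherence1:
  assumes f: "fits T w ws" "list_all2 (fits T) ws wss"
  shows "vcomp (pow (sum_list (concat (map (map ar) wss))) (acat A)) (acat A)
      (egammaN (acat A) (concat (map (map ar) wss)) (acmp A w ws) (map (\<lambda>w. nid (pow (ar w) (acat A)) (acat A) (aop A w)) (concat wss)))
      (acmp A (tgamma T w ws) (concat wss))
    = vcomp (pow (sum_list (concat (map (map ar) wss))) (acat A)) (acat A)
      (egammaN (acat A) (map sum_list (map (map ar) wss)) (nid (pow (ar w) (acat A)) (acat A) (aop A w)) (map2 (acmp A) ws wss))
      (acmp A w (map2 (tgamma T) ws wss)) \<longleftrightarrow>
   (\<forall>xs. length xs = sum_list (map ar (concat wss)) \<longrightarrow> set xs \<subseteq> Obj (acat A) \<longrightarrow>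
     Cmp (acat A) (cpt (acmp A w ws) (opb (concat wss) xs)) (cpt (acmp A (tgamma T w ws) (concat wss)) xs)
     = Cmp (acat A) (ar_map (aop A w) (map2 cpt (map2 (acmp A) ws wss) (blocks (map ar (map2 (tgamma T) ws wss)) xs)))
         (cpt (acmp A w (map2 (tgamma T) ws wss)) xs))"
proof -
  let ?X = "acat A"
  note fn = fits_nested[OF f]
  define us where "us = map2 (tgamma T) ws wss"
  define cs where "cs = concat wss"
  define ds where "ds = map2 (acmp A) ws wss"
  have nsc: "concat (map (map ar) wss) = map ar cs" by (simp add: cs_def map_concat)
  have nsu: "map sum_list (map (map ar) wss) = map ar us" using fn(5) by (simp add: us_def o_def)
  have sum: "sum_list (map ar us) = sum_list (map ar cs)" unfolding nsu[symmetric] nsc[symmetric] by (rule sum_list_concat[symmetric])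
  have w: "w \<in> words T" "length ws = ar w" using f by (auto simp: fits_def)
  have fu: "fits T w us" and fc: "fits T (tgamma T w ws) cs" using fn by (auto simp: us_def cs_def)
  have lc: "length cs = sum_list (map ar ws)" using fn by (simp add: cs_def)
  have lu: "length us = ar w" "length ds = length us" using w fn by (auto simp: us_def ds_def)
  have cW: "set cs \<subseteq> words T" using fc by (simp add: fits_def)
  have L: "is_niso (pow (sum_list (map ar cs)) ?X) ?X (aop A (tgamma T (tgamma T w ws) cs))
     (egamma ?X (map ar cs) (egamma ?X (map ar ws) (aop A w) (map (aop A) ws)) (map (aop A) cs))
     (vcomp (pow (sum_list (map ar cs)) ?X) ?X (egammaN ?X (map ar cs) (acmp A w ws) (map (\<lambda>w. nid (pow (ar w) ?X) ?X (aop A w)) cs))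
      (acmp A (tgamma T w ws) cs))"
    by (rule vcomp_niso[OF pow_cat cat acmp[OF fc] egammaN_niso])
      (use acmp[OF f(1)] lc cW in \<open>auto intro!: iw_niso nth_in_set\<close>)
  have dsi: "is_niso (pow (map ar us ! i) ?X) ?X (map (aop A) us ! i)
      (map2 (\<lambda>w ws. egamma ?X (map ar ws) (aop A w) (map (aop A) ws)) ws wss ! i) (ds ! i)" if "i < length us" for i
    using acmp[OF fn(2)[of i]] that fn(1,2) by (simp add: us_def ds_def)
  have R: "is_niso (pow (sum_list (map ar us)) ?X) ?X (aop A (tgamma T w us))
     (egamma ?X (map ar us) (aop A w) (map2 (\<lambda>w ws. egamma ?X (map ar ws) (aop A w) (map (aop A) ws)) ws wss))
     (vcomp (pow (sum_list (map ar us)) ?X) ?X (egammaN ?X (map ar us) (nid (pow (ar w) ?X) ?X (aop A w)) ds) (acmp A w us))"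
    by (rule vcomp_niso[OF pow_cat cat acmp[OF fu] egammaN_niso])
      (use iw_niso[OF w(1)] lu fn(1) w(2) dsi in auto)
  have src: "tgamma T w us = tgamma T (tgamma T w ws) cs"
    unfolding us_def cs_def by (rule tgamma_assoc[OF f, symmetric])
  have c1: "cpt (egammaN ?X (map ar cs) (acmp A w ws) (map (\<lambda>w. nid (pow (ar w) ?X) ?X (aop A w)) cs)) xs = cpt (acmp A w ws) (opb cs xs)"
    if "length xs = sum_list (map ar cs)" "set xs \<subseteq> Obj ?X" for xs
    unfolding opb_def
    by (rule cpt_egammaN_whisker_right) (use that lc is_nisoD(1)[OF acmp[OF f(1)]] cW op in auto)
  have c2: "cpt (egammaN ?X (map ar us) (nid (pow (ar w) ?X) ?X (aop A w)) ds) xs = ar_map (aop A w) (map2 cpt ds (blocks (map ar us) xs))"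
    if "length xs = sum_list (map ar us)" "set xs \<subseteq> Obj ?X" for xs
    using cpt_egammaN_whisker_left[of ?X "map ar us" "aop A w" ds "map (aop A) us" "map2 (\<lambda>w ws. egamma ?X (map ar ws) (aop A w) (map (aop A) ws)) ws wss", OF cat _ _ _ _ dsi that]
      lu op[OF w(1)] fn(1) w(2) by simp
  show ?thesis
    unfolding nsc nsu us_def[symmetric] cs_def[symmetric] ds_def[symmetric]
    using niso_eq_iff[OF pow_cat cat L R[unfolded src sum]] c1 c2[unfolded sum] by (auto simp: sum)
qed

lemma unit_block: "i < length xs \<Longrightarrow> blocks (replicate (length xs) (Suc 0)) xs ! i = [xs ! i]"
proof (induction xs arbitrary: i)
  case (Cons x xs)
  then show ?case by (cases i) auto
qed simp

lemma coherence2: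
  assumes w: "w \<in> words T"
  shows "vcomp (pow (ar w) (acat A)) (acat A)
      (egammaN (acat A) (replicate (ar w) 1) (nid (pow (ar w) (acat A)) (acat A) (aop A w)) (replicate (ar w) (auni A)))
      (acmp A w (replicate (ar w) (tunit T)))
    = nid (pow (ar w) (acat A)) (acat A) (aop A w) \<longleftrightarrow>
   (\<forall>xs. length xs = ar w \<longrightarrow> set xs \<subseteq> Obj (acat A) \<longrightarrow>
     Cmp (acat A) (ar_map (aop A w) (map (\<lambda>x. cpt (auni A) [x]) xs)) (cpt (acmp A w (replicate (ar w) (tunit T))) xs)
     = Idn (acat A) (ob_map (aop A w) xs))"
proof -
  let ?X = "acat A" and ?n = "ar w"
  have f: "fits T w (replicate ?n (tunit T))" using w by (auto simp: fits_def)
  have s: "sum_list (map ar (replicate ?n (tunit T))) = ?n" "sum_list (replicate ?n 1) = ?n"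
    "map ar (replicate ?n (tunit T)) = replicate ?n 1" by (auto simp: sum_list_replicate)
  have L: "is_niso (pow ?n ?X) ?X (aop A (tgamma T w (replicate ?n (tunit T))))
     (egamma ?X (replicate ?n 1) (aop A w) (replicate ?n (eunit ?X)))
     (vcomp (pow ?n ?X) ?X (egammaN ?X (replicate ?n 1) (nid (pow ?n ?X) ?X (aop A w)) (replicate ?n (auni A)))
      (acmp A w (replicate ?n (tunit T))))"
    using acmp[OF f, unfolded s] egammaN_niso[OF cat, of "replicate ?n 1" "aop A w" "aop A w" "nid (pow ?n ?X) ?X (aop A w)" "replicate ?n (auni A)"
        "map (aop A) (replicate ?n (tunit T))" "replicate ?n (eunit ?X)"] iw_niso[OF w] auni
    by (auto simp: sum_list_replicate intro: vcomp_niso[OF pow_cat cat])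
  have c: "cpt (egammaN ?X (replicate ?n 1) (nid (pow ?n ?X) ?X (aop A w)) (replicate ?n (auni A))) xs =
      ar_map (aop A w) (map (\<lambda>x. cpt (auni A) [x]) xs)" if "length xs = ?n" "set xs \<subseteq> Obj ?X" for xs
  proof -
    have "cpt (egammaN ?X (replicate ?n 1) (nid (pow ?n ?X) ?X (aop A w)) (replicate ?n (auni A))) xs =
      ar_map (aop A w) (map2 cpt (replicate ?n (auni A)) (blocks (replicate ?n 1) xs))"
      using cpt_egammaN_whisker_left[OF cat, of "replicate ?n 1" "aop A w" "replicate ?n (auni A)" "replicate ?n (aop A (tunit T))" "replicate ?n (eunit ?X)" xs]
         that op[OF w] auni by (simp add: sum_list_replicate)
    moreover have "map2 cpt (replicate ?n (auni A)) (blocks (replicate ?n 1) xs) = map (\<lambda>x. cpt (auni A) [x]) xs"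
      using that unit_block[of _ xs] by (intro nth_equalityI) auto
    ultimately show ?thesis by simp
  qed
  show ?thesis
    using c niso_eq_iff[OF pow_cat cat L[unfolded tgamma_unit_right[OF w]] iw_niso[OF w]] by auto
qed

lemma coherence3:
  assumes w: "w \<in> words T"
  shows "vcomp (pow (ar w) (acat A)) (acat A)
      (egammaN (acat A) [ar w] (auni A) [nid (pow (ar w) (acat A)) (acat A) (aop A w)])
      (acmp A (tunit T) [w])
    = nid (pow (ar w) (acat A)) (acat A) (aop A w) \<longleftrightarrow>
   (\<forall>xs. length xs = ar w \<longrightarrow> set xs \<subseteq> Obj (acat A) \<longrightarrow>
     Cmp (acat A) (cpt (auni A) [ob_map (aop A w) xs]) (cpt (acmp A (tunit T) [w]) xs)
     = Idn (acat A) (ob_map (aop A w) xs))"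
proof -
  let ?X = "acat A" and ?n = "ar w"
  have f: "fits T (tunit T) [w]" using w by (auto simp: fits_def)
  have L: "is_niso (pow ?n ?X) ?X (aop A w) (egamma ?X [?n] (eunit ?X) [aop A w])
     (vcomp (pow ?n ?X) ?X (egammaN ?X [?n] (auni A) [nid (pow ?n ?X) ?X (aop A w)])
      (acmp A (tunit T) [w]))"
    using acmp[OF f] egammaN_niso[OF cat, of "[?n]" "aop A (tunit T)" "eunit ?X" "auni A" "[nid (pow ?n ?X) ?X (aop A w)]"
        "[aop A w]" "[aop A w]"] iw_niso[OF w] auni
    by (auto simp: tgamma_unit_left[OF w] intro: vcomp_niso[OF pow_cat cat])
  have c: "cpt (egammaN ?X [?n] (auni A) [nid (pow ?n ?X) ?X (aop A w)]) xs =
      cpt (auni A) [ob_map (aop A w) xs]" if "length xs = ?n" "set xs \<subseteq> Obj ?X" for xs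
    using cpt_egammaN_whisker_right[OF cat, where us="[w]" and \<alpha>="auni A" and \<Phi>="aop A" and ar=ar and xs=xs] that op[OF w] is_nisoD(1)[OF auni] by simp
  show ?thesis
    using niso_eq_iff[OF pow_cat cat L iw_niso[OF w]] c by auto
qed

lemma esubN_niso:
  assumes a: "is_niso (pow (length f) (acat A)) (acat A) F G \<alpha>" and f: "set f \<subseteq> {..<l}"
  shows "is_niso (pow l (acat A)) (acat A) (esub (acat A) F l f) (esub (acat A) G l f) (esubN (acat A) (acat A) \<alpha> l f)"
  unfolding esub_def esubN_def
  by (rule hcomp_niso[OF pow_cat pow_cat cat nid_niso[OF pow_cat pow_cat reindex_functor[OF cat f]] a])

lemma cpt_esubN:
  assumes a: "is_ntrans (pow (length f) (acat A)) (acat A) \<alpha>" and f: "set f \<subseteq> {..<l}" and xs: "length xs = l" "set xs \<subseteq> Obj (acat A)"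
  shows "cpt (esubN (acat A) (acat A) \<alpha> l f) xs = cpt \<alpha> (map ((!) xs) f)"
  unfolding esubN_def using xs by (subst cpt_hcomp_nid_right[OF cat a reindex_functor[OF cat f]]) auto

text \<open>The sources are matched by \<open>tgamma_block_map\<close>. Substitution along an index
  map only rearranges the argument list, so \<open>c\<close> on the left is taken at the reindexed
  list.\<close>

lemma coherence4:
  assumes w: "w \<in> words T" and ws: "set ws \<subseteq> words T" "index_map (ar w) (length ws) f"
  shows "vcomp (pow (sum_list (map ar ws)) (acat A)) (acat A)
      (esubN (acat A) (acat A) (acmp A w (map ((!) ws) f)) (sum_list (map ar ws)) (block_map (map ar ws) f))
      (asub A (tgamma T w (map ((!) ws) f)) (sum_list (map ar ws)) (block_map (map ar ws) f))
    = vcomp (pow (sum_list (map ar ws)) (acat A)) (acat A)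
      (egammaN (acat A) (map ar ws) (asub A w (length ws) f) (map (\<lambda>w. nid (pow (ar w) (acat A)) (acat A) (aop A w)) ws))
      (acmp A (tsub T w (length ws) f) ws) \<longleftrightarrow>
   (\<forall>xs. length xs = sum_list (map ar ws) \<longrightarrow> set xs \<subseteq> Obj (acat A) \<longrightarrow>
     Cmp (acat A) (cpt (acmp A w (map ((!) ws) f)) (map ((!) xs) (block_map (map ar ws) f)))
        (cpt (asub A (tgamma T w (map ((!) ws) f)) (sum_list (map ar ws)) (block_map (map ar ws) f)) xs)
     = Cmp (acat A) (cpt (asub A w (length ws) f) (opb ws xs)) (cpt (acmp A (tsub T w (length ws) f) ws) xs))"
proof -
  let ?X = "acat A" and ?N = "sum_list (map ar ws)" and ?wf = "map ((!) ws) f" and ?g = "block_map (map ar ws) f"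
  have f: "length f = ar w" "set f \<subseteq> {..<length ws}" using ws by (auto simp: index_map_def)
  have fw: "fits T w ?wf" using w f set_map_nth_subset[OF f(2) ws(1)] by (auto simp: fits_def)
  have arw: "map ((!) (map ar ws)) f = map ar ?wf" using f by (auto simp: subset_iff)
  have g: "index_map (sum_list (map ar ?wf)) ?N ?g"
    using block_map_index[of f "map ar ws"] f(2) unfolding arw by auto
  then have g': "length ?g = sum_list (map ar ?wf)" "set ?g \<subseteq> {..<?N}" by (auto simp: index_map_def)
  have fs: "fits T (tsub T w (length ws) f) ws" using w ws by (simp add: fits_def)
  have gi: "index_map (ar (tgamma T w ?wf)) ?N ?g" using g fw by simp
  have L: "is_niso (pow ?N ?X) ?X (aop A (tsub T (tgamma T w ?wf) ?N ?g)) (esub ?X (egamma ?X (map ar ?wf) (aop A w) (map (aop A) ?wf)) ?N ?g)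
      (vcomp (pow ?N ?X) ?X (esubN ?X ?X (acmp A w ?wf) ?N ?g) (asub A (tgamma T w ?wf) ?N ?g))"
    by (rule vcomp_niso[OF pow_cat cat asub esubN_niso])
      (use gi fw g' acmp[OF fw] in simp_all)
  have R: "is_niso (pow ?N ?X) ?X (aop A (tgamma T (tsub T w (length ws) f) ws)) (egamma ?X (map ar ws) (esub ?X (aop A w) (length ws) f) (map (aop A) ws))
      (vcomp (pow ?N ?X) ?X (egammaN ?X (map ar ws) (asub A w (length ws) f) (map (\<lambda>w. nid (pow (ar w) ?X) ?X (aop A w)) ws))
         (acmp A (tsub T w (length ws) f) ws))"
    by (rule vcomp_niso[OF pow_cat cat acmp[OF fs] egammaN_niso])
      (use asub[OF w ws(2)] ws(1) in \<open>auto intro!: iw_niso nth_in_set\<close>)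
  have c1: "cpt (esubN ?X ?X (acmp A w ?wf) ?N ?g) xs = cpt (acmp A w ?wf) (map ((!) xs) ?g)" if "length xs = ?N" "set xs \<subseteq> Obj ?X" for xs
    by (rule cpt_esubN) (use that g' is_nisoD(1)[OF acmp[OF fw]] in auto)
  have c2: "cpt (egammaN ?X (map ar ws) (asub A w (length ws) f) (map (\<lambda>w. nid (pow (ar w) ?X) ?X (aop A w)) ws)) xs
      = cpt (asub A w (length ws) f) (opb ws xs)" if "length xs = ?N" "set xs \<subseteq> Obj ?X" for xs
    unfolding opb_def
    by (rule cpt_egammaN_whisker_right) (use that is_nisoD(1)[OF asub[OF w ws(2)]] ws(1) op in auto)
  show ?thesis
    using niso_eq_iff[OF pow_cat cat L R[folded tgamma_block_map[OF w ws]]] c1 c2 by auto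
qed

text \<open>The sources are matched by \<open>tgamma_block_sum\<close>. On the right the inner
  \<open>s\<close> cells act block by block, on blocks of sizes \<open>ns'\<close>, under the outer
  operation.\<close>

lemma coherence5:
  assumes f: "fits T w ws" and l: "length ns' = length ws" "length gs = length ws"
    and g: "\<forall>j<length ws. index_map (ar (ws ! j)) (ns' ! j) (gs ! j)"
  shows "vcomp (pow (sum_list ns') (acat A)) (acat A)
      (esubN (acat A) (acat A) (acmp A w ws) (sum_list ns') (block_sum ns' gs))
      (asub A (tgamma T w ws) (sum_list ns') (block_sum ns' gs))
    = vcomp (pow (sum_list ns') (acat A)) (acat A)
      (egammaN (acat A) ns' (nid (pow (ar w) (acat A)) (acat A) (aop A w)) (map (\<lambda>j. asub A (ws ! j) (ns' ! j) (gs ! j)) [0..<length ws]))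
      (acmp A w (map (\<lambda>j. tsub T (ws ! j) (ns' ! j) (gs ! j)) [0..<length ws])) \<longleftrightarrow>
   (\<forall>xs. length xs = sum_list ns' \<longrightarrow> set xs \<subseteq> Obj (acat A) \<longrightarrow>
     Cmp (acat A) (cpt (acmp A w ws) (map ((!) xs) (block_sum ns' gs)))
        (cpt (asub A (tgamma T w ws) (sum_list ns') (block_sum ns' gs)) xs)
     = Cmp (acat A) (ar_map (aop A w) (map2 cpt (map (\<lambda>j. asub A (ws ! j) (ns' ! j) (gs ! j)) [0..<length ws]) (blocks ns' xs)))
        (cpt (acmp A w (map (\<lambda>j. tsub T (ws ! j) (ns' ! j) (gs ! j)) [0..<length ws])) xs))"
proof -
  let ?X = "acat A" and ?N = "sum_list ns'" and ?g = "block_sum ns' gs"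
  define us where "us = map (\<lambda>j. tsub T (ws ! j) (ns' ! j) (gs ! j)) [0..<length ws]"
  define ss where "ss = map (\<lambda>j. asub A (ws ! j) (ns' ! j) (gs ! j)) [0..<length ws]"
  have w: "w \<in> words T" "length ws = ar w" "set ws \<subseteq> words T" using f by (auto simp: fits_def)
  have wi: "i < length ws \<Longrightarrow> ws ! i \<in> words T" for i using w by (rule_tac nth_in_set)
  have lu: "length us = length ws" "length ss = length ws" by (auto simp: us_def ss_def)
  have ui: "us ! i \<in> words T" "ar (us ! i) = ns' ! i" if "i < length ws" for i
    using wi that g by (auto simp: us_def)
  have fu: "fits T w us" using w lu ui by (auto simp: fits_def in_set_conv_nth)
  have nu: "map ar us = ns'" using ui lu l by (auto intro!: nth_equalityI)
  have gi: "index_map (ar (tgamma T w ws)) ?N ?g"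
    using block_sum_index[of ns' gs "map ar ws"] f l g by simp
  then have g': "length ?g = sum_list (map ar ws)" "set ?g \<subseteq> {..<?N}" using f by (auto simp: index_map_def)
  have ssi: "is_niso (pow (ns' ! i) ?X) ?X (map (aop A) us ! i) (map (\<lambda>j. esub ?X (aop A (ws ! j)) (ns' ! j) (gs ! j)) [0..<length ws] ! i) (ss ! i)"
    if "i < length ns'" for i
    using asub[of "ws ! i" "ns' ! i" "gs ! i"] that wi g l lu by (simp add: ss_def us_def)
  have L: "is_niso (pow ?N ?X) ?X (aop A (tsub T (tgamma T w ws) ?N ?g)) (esub ?X (egamma ?X (map ar ws) (aop A w) (map (aop A) ws)) ?N ?g)
      (vcomp (pow ?N ?X) ?X (esubN ?X ?X (acmp A w ws) ?N ?g) (asub A (tgamma T w ws) ?N ?g))"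
    by (rule vcomp_niso[OF pow_cat cat asub esubN_niso])
      (use gi f g' acmp[OF f] in simp_all)
  have R: "is_niso (pow ?N ?X) ?X (aop A (tgamma T w us)) (egamma ?X ns' (aop A w) (map (\<lambda>j. esub ?X (aop A (ws ! j)) (ns' ! j) (gs ! j)) [0..<length ws]))
      (vcomp (pow ?N ?X) ?X (egammaN ?X ns' (nid (pow (ar w) ?X) ?X (aop A w)) ss) (acmp A w us))"
    by (rule vcomp_niso[OF pow_cat cat acmp[OF fu, unfolded nu] egammaN_niso])
      (use iw_niso[OF w(1)] w l lu ssi in auto)
  have c1: "cpt (esubN ?X ?X (acmp A w ws) ?N ?g) xs = cpt (acmp A w ws) (map ((!) xs) ?g)" if "length xs = ?N" "set xs \<subseteq> Obj ?X" for xs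
    by (rule cpt_esubN) (use that g' is_nisoD(1)[OF acmp[OF f]] in auto)
  have c2: "cpt (egammaN ?X ns' (nid (pow (ar w) ?X) ?X (aop A w)) ss) xs = ar_map (aop A w) (map2 cpt ss (blocks ns' xs))"
    if "length xs = ?N" "set xs \<subseteq> Obj ?X" for xs
    using cpt_egammaN_whisker_left[OF cat _ _ _ _ ssi that, of "aop A w"] l lu op[OF w(1)] w by simp
  show ?thesis
    unfolding us_def[symmetric] ss_def[symmetric]
    using niso_eq_iff[OF pow_cat cat L R[unfolded us_def, folded tgamma_block_sum[OF f l g], folded us_def]] c1 c2 by auto
qed

lemma coherence6:
  assumes w: "w \<in> words T" and f: "index_map (ar w) l f" and g: "index_map l m g"
  shows "vcomp (pow m (acat A)) (acat A) (esubN (acat A) (acat A) (asub A w l f) m g) (asub A (tsub T w l f) m g)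
      = asub A w m (map ((!) g) f) \<longleftrightarrow>
   (\<forall>xs. length xs = m \<longrightarrow> set xs \<subseteq> Obj (acat A) \<longrightarrow>
     Cmp (acat A) (cpt (asub A w l f) (map ((!) xs) g)) (cpt (asub A (tsub T w l f) m g) xs)
     = cpt (asub A w m (map ((!) g) f)) xs)"
proof -
  let ?X = "acat A"
  have g': "length g = l" "set g \<subseteq> {..<m}" and f': "length f = ar w" "set f \<subseteq> {..<l}" using f g by (auto simp: index_map_def)
  have gf: "index_map (ar w) m (map ((!) g) f)" using set_map_nth_subset[of f g "{..<m}"] f' g' by (auto simp: index_map_def)
  have L: "is_niso (pow m ?X) ?X (aop A (tsub T (tsub T w l f) m g)) (esub ?X (esub ?X (aop A w) l f) m g)
     (vcomp (pow m ?X) ?X (esubN ?X ?X (asub A w l f) m g) (asub A (tsub T w l f) m g))"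
    by (rule vcomp_niso[OF pow_cat cat asub esubN_niso])
      (use w f g g' asub[OF w f] in simp_all)
  have c: "cpt (esubN ?X ?X (asub A w l f) m g) xs = cpt (asub A w l f) (map ((!) xs) g)" if "length xs = m" "set xs \<subseteq> Obj ?X" for xs
    by (rule cpt_esubN) (use that g' is_nisoD(1)[OF asub[OF w f]] in auto)
  show ?thesis
    using niso_eq_iff[OF pow_cat cat L asub[OF w gf, folded tsub_tsub[OF w f g]]] c by auto
qed

lemma coherence7:
  assumes w: "w \<in> words T"
  shows "asub A w (ar w) [0..<ar w] = nid (pow (ar w) (acat A)) (acat A) (aop A w) \<longleftrightarrow>
   (\<forall>xs. length xs = ar w \<longrightarrow> set xs \<subseteq> Obj (acat A) \<longrightarrow> cpt (asub A w (ar w) [0..<ar w]) xs = Idn (acat A) (ob_map (aop A w) xs))"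
proof -
  have i: "index_map (ar w) (ar w) [0..<ar w]" by (auto simp: index_map_def)
  show ?thesis
    using niso_eq_iff[OF pow_cat cat asub[OF w i, unfolded tsub_id[OF w]] iw_niso[OF w]] by auto
qed

end

section \<open>Pseudo algebras and their laws in components\<close>

locale palg = typed_palg T A for T :: "'t thy_data" and A :: "('t, 'o, 'a) palg" +
  assumes pa: "pseudo_algebra T A"

lemma palgI:
  assumes "is_theory T" "pseudo_algebra T A"
  shows "palg T A"
proof -
  interpret alg_theory T by unfold_locales fact
  note p = assms(2)[unfolded pseudo_algebra_def Let_def]
  show ?thesis
  proof unfold_locales
    show "pseudo_algebra T A" by fact
    show "category (acat A)" by (rule p[THEN conjunct1])
    show "is_niso (pow 1 (acat A)) (acat A) (aop A (tunit T)) (eunit (acat A)) (auni A)"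
      by (rule p[THEN conjunct2, THEN conjunct2, THEN conjunct2, THEN conjunct1])
    fix w
    show "w \<in> words T \<Longrightarrow> is_functor (pow (ar w) (acat A)) (acat A) (aop A w)"
      by (rule p[THEN conjunct2, THEN conjunct1, rule_format])
    show "fits T w ws \<Longrightarrow> is_niso (pow (sum_list (map ar ws)) (acat A)) (acat A) (aop A (tgamma T w ws))
         (egamma (acat A) (map ar ws) (aop A w) (map (aop A) ws)) (acmp A w ws)" for ws
      by (rule p[THEN conjunct2, THEN conjunct2, THEN conjunct1, rule_format])
    show "w \<in> words T \<Longrightarrow> index_map (ar w) l f \<Longrightarrow>
         is_niso (pow l (acat A)) (acat A) (aop A (tsub T w l f)) (esub (acat A) (aop A w) l f) (asub A w l f)" for l f
      by (rule p[THEN conjunct2, THEN conjunct2, THEN conjunct2, THEN conjunct2, THEN conjunct1, rule_format])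
  qed
qed

lemma (in palg) coh:
  shows "fits T w ws \<Longrightarrow> list_all2 (fits T) ws wss \<Longrightarrow> length xs = sum_list (map ar (concat wss)) \<Longrightarrow> set xs \<subseteq> Obj (acat A) \<Longrightarrow>
     Cmp (acat A) (cpt (acmp A w ws) (opb (concat wss) xs)) (cpt (acmp A (tgamma T w ws) (concat wss)) xs)
     = Cmp (acat A) (ar_map (aop A w) (map2 cpt (map2 (acmp A) ws wss) (blocks (map ar (map2 (tgamma T) ws wss)) xs)))
         (cpt (acmp A w (map2 (tgamma T) ws wss)) xs)"
   and "w \<in> words T \<Longrightarrow> length xs = ar w \<Longrightarrow> set xs \<subseteq> Obj (acat A) \<Longrightarrow>
     Cmp (acat A) (ar_map (aop A w) (map (\<lambda>x. cpt (auni A) [x]) xs)) (cpt (acmp A w (replicate (ar w) (tunit T))) xs)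
     = Idn (acat A) (ob_map (aop A w) xs)"
   and "w \<in> words T \<Longrightarrow> length xs = ar w \<Longrightarrow> set xs \<subseteq> Obj (acat A) \<Longrightarrow>
     Cmp (acat A) (cpt (auni A) [ob_map (aop A w) xs]) (cpt (acmp A (tunit T) [w]) xs)
     = Idn (acat A) (ob_map (aop A w) xs)"
   and "w \<in> words T \<Longrightarrow> set ws \<subseteq> words T \<Longrightarrow> index_map (ar w) (length ws) f \<Longrightarrow> length xs = sum_list (map ar ws) \<Longrightarrow> set xs \<subseteq> Obj (acat A) \<Longrightarrow>
     Cmp (acat A) (cpt (acmp A w (map ((!) ws) f)) (map ((!) xs) (block_map (map ar ws) f)))
        (cpt (asub A (tgamma T w (map ((!) ws) f)) (sum_list (map ar ws)) (block_map (map ar ws) f)) xs)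
     = Cmp (acat A) (cpt (asub A w (length ws) f) (opb ws xs)) (cpt (acmp A (tsub T w (length ws) f) ws) xs)"
   and "fits T w ws \<Longrightarrow> length ns' = length ws \<Longrightarrow> length gs = length ws \<Longrightarrow>
      \<forall>j<length ws. index_map (ar (ws ! j)) (ns' ! j) (gs ! j) \<Longrightarrow> length xs = sum_list ns' \<Longrightarrow> set xs \<subseteq> Obj (acat A) \<Longrightarrow>
     Cmp (acat A) (cpt (acmp A w ws) (map ((!) xs) (block_sum ns' gs)))
        (cpt (asub A (tgamma T w ws) (sum_list ns') (block_sum ns' gs)) xs)
     = Cmp (acat A) (ar_map (aop A w) (map2 cpt (map (\<lambda>j. asub A (ws ! j) (ns' ! j) (gs ! j)) [0..<length ws]) (blocks ns' xs)))
        (cpt (acmp A w (map (\<lambda>j. tsub T (ws ! j) (ns' ! j) (gs ! j)) [0..<length ws])) xs)"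
   and "w \<in> words T \<Longrightarrow> index_map (ar w) l f \<Longrightarrow> index_map l m g \<Longrightarrow> length xs = m \<Longrightarrow> set xs \<subseteq> Obj (acat A) \<Longrightarrow>
     Cmp (acat A) (cpt (asub A w l f) (map ((!) xs) g)) (cpt (asub A (tsub T w l f) m g) xs)
     = cpt (asub A w m (map ((!) g) f)) xs"
   and "w \<in> words T \<Longrightarrow> length xs = ar w \<Longrightarrow> set xs \<subseteq> Obj (acat A) \<Longrightarrow>
     cpt (asub A w (ar w) [0..<ar w]) xs = Idn (acat A) (ob_map (aop A w) xs)"
proof -
  note p = pa[unfolded pseudo_algebra_def Let_def]
  note q1 = p[THEN conjunct2, THEN conjunct2, THEN conjunct2, THEN conjunct2, THEN conjunct2]
  note c1 = q1[THEN conjunct1, rule_format] and q2 = q1[THEN conjunct2]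
  note c2 = q2[THEN conjunct1, rule_format] and q3 = q2[THEN conjunct2]
  note c3 = q3[THEN conjunct1, rule_format] and q4 = q3[THEN conjunct2]
  note c4 = q4[THEN conjunct1, rule_format] and q5 = q4[THEN conjunct2]
  note c5 = q5[THEN conjunct1, rule_format] and q6 = q5[THEN conjunct2]
  note c6 = q6[THEN conjunct1, rule_format] and q7 = q6[THEN conjunct2]
  note c7 = q7[rule_format]
  show "fits T w ws \<Longrightarrow> list_all2 (fits T) ws wss \<Longrightarrow> length xs = sum_list (map ar (concat wss)) \<Longrightarrow> set xs \<subseteq> Obj (acat A) \<Longrightarrow>
     Cmp (acat A) (cpt (acmp A w ws) (opb (concat wss) xs)) (cpt (acmp A (tgamma T w ws) (concat wss)) xs)
     = Cmp (acat A) (ar_map (aop A w) (map2 cpt (map2 (acmp A) ws wss) (blocks (map ar (map2 (tgamma T) ws wss)) xs)))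
         (cpt (acmp A w (map2 (tgamma T) ws wss)) xs)"
    by (rule coherence1[THEN iffD1, rule_format, OF _ _ c1[OF conjI]])
  show "w \<in> words T \<Longrightarrow> length xs = ar w \<Longrightarrow> set xs \<subseteq> Obj (acat A) \<Longrightarrow>
     Cmp (acat A) (ar_map (aop A w) (map (\<lambda>x. cpt (auni A) [x]) xs)) (cpt (acmp A w (replicate (ar w) (tunit T))) xs)
     = Idn (acat A) (ob_map (aop A w) xs)"
    by (rule coherence2[THEN iffD1, rule_format, OF _ c2])
  show "w \<in> words T \<Longrightarrow> length xs = ar w \<Longrightarrow> set xs \<subseteq> Obj (acat A) \<Longrightarrow>
     Cmp (acat A) (cpt (auni A) [ob_map (aop A w) xs]) (cpt (acmp A (tunit T) [w]) xs)
     = Idn (acat A) (ob_map (aop A w) xs)"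
    by (rule coherence3[THEN iffD1, rule_format, OF _ c3])
  show "w \<in> words T \<Longrightarrow> set ws \<subseteq> words T \<Longrightarrow> index_map (ar w) (length ws) f \<Longrightarrow> length xs = sum_list (map ar ws) \<Longrightarrow> set xs \<subseteq> Obj (acat A) \<Longrightarrow>
     Cmp (acat A) (cpt (acmp A w (map ((!) ws) f)) (map ((!) xs) (block_map (map ar ws) f)))
        (cpt (asub A (tgamma T w (map ((!) ws) f)) (sum_list (map ar ws)) (block_map (map ar ws) f)) xs)
     = Cmp (acat A) (cpt (asub A w (length ws) f) (opb ws xs)) (cpt (acmp A (tsub T w (length ws) f) ws) xs)"
    by (rule coherence4[THEN iffD1, rule_format, OF _ _ _ c4[OF _ conjI]])
  show "fits T w ws \<Longrightarrow> length ns' = length ws \<Longrightarrow> length gs = length ws \<Longrightarrow>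
      \<forall>j<length ws. index_map (ar (ws ! j)) (ns' ! j) (gs ! j) \<Longrightarrow> length xs = sum_list ns' \<Longrightarrow> set xs \<subseteq> Obj (acat A) \<Longrightarrow>
     Cmp (acat A) (cpt (acmp A w ws) (map ((!) xs) (block_sum ns' gs)))
        (cpt (asub A (tgamma T w ws) (sum_list ns') (block_sum ns' gs)) xs)
     = Cmp (acat A) (ar_map (aop A w) (map2 cpt (map (\<lambda>j. asub A (ws ! j) (ns' ! j) (gs ! j)) [0..<length ws]) (blocks ns' xs)))
        (cpt (acmp A w (map (\<lambda>j. tsub T (ws ! j) (ns' ! j) (gs ! j)) [0..<length ws])) xs)"
    by (rule coherence5[THEN iffD1, rule_format, OF _ _ _ _ c5[OF conjI[OF _ conjI[OF _ conjI]]]]; blast)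
  show "w \<in> words T \<Longrightarrow> index_map (ar w) l f \<Longrightarrow> index_map l m g \<Longrightarrow> length xs = m \<Longrightarrow> set xs \<subseteq> Obj (acat A) \<Longrightarrow>
     Cmp (acat A) (cpt (asub A w l f) (map ((!) xs) g)) (cpt (asub A (tsub T w l f) m g) xs)
     = cpt (asub A w m (map ((!) g) f)) xs"
    by (rule coherence6[THEN iffD1, rule_format, OF _ _ _ c6[OF _ conjI]])
  show "w \<in> words T \<Longrightarrow> length xs = ar w \<Longrightarrow> set xs \<subseteq> Obj (acat A) \<Longrightarrow>
     cpt (asub A w (ar w) [0..<ar w]) xs = Idn (acat A) (ob_map (aop A w) xs)"
    by (rule coherence7[THEN iffD1, rule_format, OF _ c7])
qed

section \<open>Morphisms in components\<close>

lemma functor_arrows: "is_functor C D F \<Longrightarrow> f \<in> arrows C x y \<Longrightarrow> ar_map F f \<in> arrows D (ob_map F x) (ob_map F y)"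
  by (auto simp: arrows_iff)

context typed_palg
begin

lemma op_arr:
  assumes w: "w \<in> words T" and l: "length fs = ar w" "length xs = ar w" "length ys = ar w"
    and f: "\<And>i. i < ar w \<Longrightarrow> fs ! i \<in> arrows (acat A) (xs ! i) (ys ! i)"
  shows "ar_map (aop A w) fs \<in> arrows (acat A) (ob_map (aop A w) xs) (ob_map (aop A w) ys)"
proof -
  have s: "set fs \<subseteq> Arr (acat A)" using f l by (auto simp: in_set_conv_nth arrows_iff)
  have d: "map (Dom (acat A)) fs = xs" "map (Cod (acat A)) fs = ys"
    using f l by (auto intro!: nth_equalityI simp: arrows_iff)
  show ?thesis using w l s d by (simp add: arrows_iff)
qed

text \<open>Functoriality of an operation with the composite list \<open>hs\<close> described by its
  entries. In the applications \<open>hs\<close> is rarely written as a \<open>map2\<close> of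
  composition, and one list may be such a composite in two ways.\<close>

lemma op_comp:
  assumes w: "w \<in> words T" and l: "length fs = ar w" "length gs = ar w" "length hs = ar w"
    and f: "\<And>i. i < ar w \<Longrightarrow> fs ! i \<in> Arr (acat A)" "\<And>i. i < ar w \<Longrightarrow> gs ! i \<in> Arr (acat A)"
      "\<And>i. i < ar w \<Longrightarrow> Cod (acat A) (fs ! i) = Dom (acat A) (gs ! i)"
      "\<And>i. i < ar w \<Longrightarrow> hs ! i = Cmp (acat A) (gs ! i) (fs ! i)"
  shows "ar_map (aop A w) hs = Cmp (acat A) (ar_map (aop A w) gs) (ar_map (aop A w) fs)"
proof -
  have "hs = map2 (Cmp (acat A)) gs fs" using l f(4) by (intro nth_equalityI) auto
  moreover have "map (Cod (acat A)) fs = map (Dom (acat A)) gs" using l f(3) by (intro nth_equalityI) auto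
  moreover have "set fs \<subseteq> Arr (acat A)" "set gs \<subseteq> Arr (acat A)" using f(1,2) l by (auto simp: in_set_conv_nth)
  ultimately show ?thesis using op_cmp[OF w l(1,2)] by simp
qed

lemma op_id:
  assumes w: "w \<in> words T" and l: "length xs = ar w" "length fs = ar w" and xs: "set xs \<subseteq> Obj (acat A)"
    and f: "\<And>i. i < ar w \<Longrightarrow> fs ! i = Idn (acat A) (xs ! i)"
  shows "ar_map (aop A w) fs = Idn (acat A) (ob_map (aop A w) xs)"
proof -
  have "fs = map (Idn (acat A)) xs" using l f by (intro nth_equalityI) auto
  then show ?thesis using w l xs by simp
qed

lemma op_invertible:
  assumes w: "w \<in> words T" and l: "length fs = ar w" and f: "\<And>i. i < ar w \<Longrightarrow> invertible_arrow (acat A) (fs ! i)"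
  shows "invertible_arrow (acat A) (ar_map (aop A w) fs)"
  by (rule invertible_arrow_functor[OF op[OF w] pow_cat cat pow_inv_arrow[OF cat l f]])

end

text \<open>The typing half of \<open>pseudo_morphism\<close>, split off for the same reason as for
  algebras: it serves given morphisms and morphisms under construction alike.\<close>

locale typed_mor = A: typed_palg T A + B: typed_palg T B
  for T :: "'t thy_data" and A :: "('t, 'o, 'a) palg" and B :: "('t, 'o, 'a) palg" +
  fixes h :: "('t, 'o, 'a) pmor"
  assumes H [simp]: "is_functor (acat A) (acat B) (mfun h)"
    and rho_ext: "mrho h \<in> extensional (words T)"
    and rho: "w \<in> words T \<Longrightarrow> is_niso (pow (arity T w) (acat A)) (acat B)
         (fcmp (pow (arity T w) (acat A)) (mfun h) (aop A w))
         (fcmp (pow (arity T w) (acat A)) (aop B w) (fpow (acat A) (arity T w) (mfun h))) (mrho h w)"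
begin

lemma H_simps [simp]:
  "x \<in> Obj (acat A) \<Longrightarrow> ob_map (mfun h) x \<in> Obj (acat B)"
  "f \<in> Arr (acat A) \<Longrightarrow> ar_map (mfun h) f \<in> Arr (acat B)"
  "f \<in> Arr (acat A) \<Longrightarrow> Dom (acat B) (ar_map (mfun h) f) = ob_map (mfun h) (Dom (acat A) f)"
  "f \<in> Arr (acat A) \<Longrightarrow> Cod (acat B) (ar_map (mfun h) f) = ob_map (mfun h) (Cod (acat A) f)"
  "x \<in> Obj (acat A) \<Longrightarrow> ar_map (mfun h) (Idn (acat A) x) = Idn (acat B) (ob_map (mfun h) x)"
  using ftor_ob[OF H] ftor_ar[OF H] ftor_dom[OF H] ftor_cod[OF H] ftor_id[OF H] by auto

lemma H_cmp: "f \<in> Arr (acat A) \<Longrightarrow> g \<in> Arr (acat A) \<Longrightarrow> Cod (acat A) f = Dom (acat A) g \<Longrightarrow>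
  ar_map (mfun h) (Cmp (acat A) g f) = Cmp (acat B) (ar_map (mfun h) g) (ar_map (mfun h) f)"
  by (rule ftor_cmp[OF H])

lemma H_image [simp]: "set xs \<subseteq> Obj (acat A) \<Longrightarrow> ob_map (mfun h) ` set xs \<subseteq> Obj (acat B)"
  by auto

lemma rho_arr:
  assumes w: "w \<in> words T" and xs: "length xs = A.ar w" "set xs \<subseteq> Obj (acat A)"
  shows "cpt (mrho h w) xs \<in> arrows (acat B) (ob_map (mfun h) (ob_map (aop A w) xs)) (ob_map (aop B w) (map (ob_map (mfun h)) xs))"
    "invertible_arrow (acat B) (cpt (mrho h w) xs)"
  using nt_arr[OF is_nisoD(1)[OF rho[OF w]], of xs] nt_dom[OF is_nisoD(1)[OF rho[OF w]], of xs]
    nt_cod[OF is_nisoD(1)[OF rho[OF w]], of xs] is_nisoD(2,3)[OF rho[OF w]] is_nisoD(4)[OF rho[OF w], of xs] xs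
  by (auto simp: arrows_iff)

lemma rho_simps [simp]:
  assumes w: "w \<in> words T" and xs: "length xs = A.ar w" "set xs \<subseteq> Obj (acat A)"
  shows "cpt (mrho h w) xs \<in> Arr (acat B)"
    "Dom (acat B) (cpt (mrho h w) xs) = ob_map (mfun h) (ob_map (aop A w) xs)"
    "Cod (acat B) (cpt (mrho h w) xs) = ob_map (aop B w) (map (ob_map (mfun h)) xs)"
  using rho_arr[OF assms] by (auto simp: arrows_iff)

lemma rho_nat:
  assumes w: "w \<in> words T" and fs: "length fs = A.ar w" "set fs \<subseteq> Arr (acat A)"
  shows "Cmp (acat B) (cpt (mrho h w) (map (Cod (acat A)) fs)) (ar_map (mfun h) (ar_map (aop A w) fs))
     = Cmp (acat B) (ar_map (aop B w) (map (ar_map (mfun h)) fs)) (cpt (mrho h w) (map (Dom (acat A)) fs))"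
  using nt_nat[OF is_nisoD(1)[OF rho[OF w]], of fs] is_nisoD(2,3)[OF rho[OF w]] fs by auto

lemma rho_nat':
  assumes w: "w \<in> words T" and l: "length fs = A.ar w" "length xs = A.ar w" "length ys = A.ar w" "length gs = A.ar w"
    and f: "\<And>i. i < A.ar w \<Longrightarrow> fs ! i \<in> arrows (acat A) (xs ! i) (ys ! i)" "\<And>i. i < A.ar w \<Longrightarrow> gs ! i = ar_map (mfun h) (fs ! i)"
  shows "Cmp (acat B) (cpt (mrho h w) ys) (ar_map (mfun h) (ar_map (aop A w) fs))
     = Cmp (acat B) (ar_map (aop B w) gs) (cpt (mrho h w) xs)"
proof -
  have "map (Dom (acat A)) fs = xs" "map (Cod (acat A)) fs = ys" "map (ar_map (mfun h)) fs = gs"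
    using f l by (auto intro!: nth_equalityI simp: arrows_iff)
  moreover have "set fs \<subseteq> Arr (acat A)" using f l by (auto simp: in_set_conv_nth arrows_iff)
  ultimately show ?thesis using rho_nat[OF w l(1)] by simp
qed

lemma fpow_H: "is_functor (pow n (acat A)) (pow n (acat B)) (fpow (acat A) n (mfun h))"
  by (rule fpow_functor) auto

lemma fprod_op:
  assumes ws: "set ws \<subseteq> words T"
  shows "is_functor (pow (sum_list (map A.ar ws)) (acat A)) (pow (length ws) (acat A)) (fprod (acat A) (map A.ar ws) (map (aop A) ws))"
  using fprod_functor[of "acat A" "map (aop A) ws" "map A.ar ws" "acat A"] A.op nth_in_set[OF ws] by simp

text \<open>In the law for \<open>c\<close> the target of the cell \<open>\<rho>\<close> at
  \<open>w\<close> has to be the source of the product of the inner \<open>\<rho>\<close>,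
  literally, for the cells to be composed by \<open>vcomp_niso\<close>.\<close>

lemma fpow_fprod:
  assumes ws: "set ws \<subseteq> words T"
  shows "fcmp (pow (sum_list (map A.ar ws)) (acat A)) (fpow (acat A) (length ws) (mfun h)) (fprod (acat A) (map A.ar ws) (map (aop A) ws))
   = fprod (acat A) (map A.ar ws) (map (\<lambda>u. fcmp (pow (A.ar u) (acat A)) (mfun h) (aop A u)) ws)"
    (is "?L = ?R")
proof -
  have u: "i < length ws \<Longrightarrow> ws ! i \<in> words T" for i using nth_in_set[OF ws] .
  have L: "is_functor (pow (sum_list (map A.ar ws)) (acat A)) (pow (length ws) (acat B)) ?L"
    by (rule fcmp_functor[OF A.pow_cat fprod_op[OF ws] fpow_H])
  have R: "is_functor (pow (sum_list (map A.ar ws)) (acat A)) (pow (length (map A.ar ws)) (acat B)) ?R"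
    by (rule fprod_functor) (auto intro!: fcmp_functor[OF A.pow_cat A.op H] u)
  show ?thesis
  proof (rule functor_eqI[OF L R])
    fix xs assume xs0: "xs \<in> Obj (pow (sum_list (map A.ar ws)) (acat A))"
    then have xs: "length xs = sum_list (map A.ar ws)" "set xs \<subseteq> Obj (acat A)" by auto
    have b: "length (blocks (map A.ar ws) xs ! i) = A.ar (ws ! i)" "set (blocks (map A.ar ws) xs ! i) \<subseteq> Obj (acat A)" if "i < length ws" for i
      using blocks_obj[of i "map A.ar ws" xs "Obj (acat A)"] xs that by auto
    show "ob_map ?L xs = ob_map ?R xs"
      using xs ftor_ob[OF fprod_op[OF ws] xs0] b by (auto intro!: nth_equalityI simp del: map_eq_conv)
  next
    fix xs assume xs0: "xs \<in> Arr (pow (sum_list (map A.ar ws)) (acat A))"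
    then have xs: "length xs = sum_list (map A.ar ws)" "set xs \<subseteq> Arr (acat A)" by auto
    have b: "length (blocks (map A.ar ws) xs ! i) = A.ar (ws ! i)" "set (blocks (map A.ar ws) xs ! i) \<subseteq> Arr (acat A)" if "i < length ws" for i
      using blocks_obj[of i "map A.ar ws" xs "Arr (acat A)"] xs that by auto
    show "ar_map ?L xs = ar_map ?R xs"
      using xs ftor_ar[OF fprod_op[OF ws] xs0] b by (auto intro!: nth_equalityI simp del: map_eq_conv)
  qed
qed

text \<open>The component at \<open>xs\<close> of the product of the \<open>\<rho>\<close> of the
  words \<open>ws\<close>: one arrow for each block.\<close>

definition rhob where "rhob ws xs = map2 (\<lambda>u. cpt (mrho h u)) ws (blocks (map A.ar ws) xs)"

lemma rhob:
  assumes ws: "set ws \<subseteq> words T" and xs: "length xs = sum_list (map A.ar ws)" "set xs \<subseteq> Obj (acat A)"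
  shows "length (rhob ws xs) = length ws"
    "i < length ws \<Longrightarrow> rhob ws xs ! i = cpt (mrho h (ws ! i)) (blocks (map A.ar ws) xs ! i)"
    "i < length ws \<Longrightarrow> rhob ws xs ! i \<in> arrows (acat B) (map (ob_map (mfun h)) (A.opb ws xs) ! i) (B.opb ws (map (ob_map (mfun h)) xs) ! i)"
    "i < length ws \<Longrightarrow> invertible_arrow (acat B) (rhob ws xs ! i)"
proof -
  have b: "length (blocks (map A.ar ws) xs ! i) = A.ar (ws ! i)" "set (blocks (map A.ar ws) xs ! i) \<subseteq> Obj (acat A)" if "i < length ws" for i
    using blocks_obj[of i "map A.ar ws" xs "Obj (acat A)"] xs that by auto
  show "length (rhob ws xs) = length ws" by (simp add: rhob_def)
  show r: "i < length ws \<Longrightarrow> rhob ws xs ! i = cpt (mrho h (ws ! i)) (blocks (map A.ar ws) xs ! i)" for i by (simp add: rhob_def)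
  show "i < length ws \<Longrightarrow> rhob ws xs ! i \<in> arrows (acat B) (map (ob_map (mfun h)) (A.opb ws xs) ! i) (B.opb ws (map (ob_map (mfun h)) xs) ! i)"
    "i < length ws \<Longrightarrow> invertible_arrow (acat B) (rhob ws xs ! i)"
    using rho_arr[OF nth_in_set[OF ws] b] r by (simp_all add: blocks_map)
qed

text \<open>Both sides are invertible and start at \<open>H\<close> after the operation of
  \<open>tgamma T w ws\<close>, so components decide. On the right three cells are pasted: the image
  of \<open>c\<close>, then \<open>\<rho>\<close> at \<open>w\<close>, then the
  \<open>\<rho>\<close> of the inner words.\<close>

lemma mor_coherence1:
  assumes f: "fits T w ws"
  shows "vcomp (pow (sum_list (map A.ar ws)) (acat A)) (acat B)
      (hcomp (pow (sum_list (map A.ar ws)) (acat A)) (acat B) (acmp B w ws)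
         (nid (pow (sum_list (map A.ar ws)) (acat A)) (pow (sum_list (map A.ar ws)) (acat B)) (fpow (acat A) (sum_list (map A.ar ws)) (mfun h))))
      (mrho h (tgamma T w ws))
    = vcomp (pow (sum_list (map A.ar ws)) (acat A)) (acat B)
       (hcomp (pow (sum_list (map A.ar ws)) (acat A)) (acat B) (nid (pow (A.ar w) (acat B)) (acat B) (aop B w)) (nprod (acat A) (map A.ar ws) (map (mrho h) ws)))
       (vcomp (pow (sum_list (map A.ar ws)) (acat A)) (acat B)
         (hcomp (pow (sum_list (map A.ar ws)) (acat A)) (acat B) (mrho h w)
           (nid (pow (sum_list (map A.ar ws)) (acat A)) (pow (A.ar w) (acat A)) (fprod (acat A) (map A.ar ws) (map (aop A) ws))))
         (hcomp (pow (sum_list (map A.ar ws)) (acat A)) (acat B) (nid (acat A) (acat B) (mfun h)) (acmp A w ws))) \<longleftrightarrow>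
    (\<forall>xs. length xs = sum_list (map A.ar ws) \<longrightarrow> set xs \<subseteq> Obj (acat A) \<longrightarrow>
     Cmp (acat B) (cpt (acmp B w ws) (map (ob_map (mfun h)) xs)) (cpt (mrho h (tgamma T w ws)) xs)
     = Cmp (acat B) (ar_map (aop B w) (rhob ws xs))
         (Cmp (acat B) (cpt (mrho h w) (A.opb ws xs)) (ar_map (mfun h) (cpt (acmp A w ws) xs))))"
proof -
  let ?X = "acat A" and ?Y = "acat B" and ?H = "mfun h" and ?N = "sum_list (map A.ar ws)" and ?k = "A.ar w"
  let ?P = "fprod ?X (map A.ar ws) (map (aop A) ws)"
  have w: "w \<in> words T" "length ws = ?k" "set ws \<subseteq> words T" using f by (auto simp: fits_def)
  note P = fprod_op[OF w(3), unfolded w(2)]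
  have G: "tgamma T w ws \<in> words T" "A.ar (tgamma T w ws) = ?N" using f by auto
  have L2: "is_niso (pow ?N ?X) ?Y (fcmp (pow ?N ?X) (aop B (tgamma T w ws)) (fpow ?X ?N ?H)) (fcmp (pow ?N ?X) (egamma ?Y (map A.ar ws) (aop B w) (map (aop B) ws)) (fpow ?X ?N ?H))
      (hcomp (pow ?N ?X) ?Y (acmp B w ws) (nid (pow ?N ?X) (pow ?N ?Y) (fpow ?X ?N ?H)))"
    by (rule hcomp_niso[OF A.pow_cat B.pow_cat B.cat nid_niso[OF A.pow_cat B.pow_cat fpow_H] B.acmp[OF f]])
  note L = vcomp_niso[OF A.pow_cat B.cat rho[OF G(1), unfolded G(2)] L2]
  have R1: "is_niso (pow ?N ?X) ?Y (fcmp (pow ?N ?X) ?H (aop A (tgamma T w ws))) (fcmp (pow ?N ?X) ?H (egamma ?X (map A.ar ws) (aop A w) (map (aop A) ws)))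
      (hcomp (pow ?N ?X) ?Y (nid ?X ?Y ?H) (acmp A w ws))"
    by (rule hcomp_niso[OF A.pow_cat A.cat B.cat A.acmp[OF f] nid_niso[OF A.cat B.cat H]])
  have R2: "is_niso (pow ?N ?X) ?Y (fcmp (pow ?N ?X) ?H (egamma ?X (map A.ar ws) (aop A w) (map (aop A) ws)))
      (fcmp (pow ?N ?X) (aop B w) (fcmp (pow ?N ?X) (fpow ?X ?k ?H) ?P))
      (hcomp (pow ?N ?X) ?Y (mrho h w) (nid (pow ?N ?X) (pow ?k ?X) ?P))"
    using hcomp_niso[OF A.pow_cat A.pow_cat B.cat nid_niso[OF A.pow_cat A.pow_cat P] rho[OF w(1)]]
    by (simp add: egamma_def fcmp_assoc[OF P])
  have R3: "is_niso (pow ?N ?X) ?Y (fcmp (pow ?N ?X) (aop B w) (fcmp (pow ?N ?X) (fpow ?X ?k ?H) ?P))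
      (fcmp (pow ?N ?X) (aop B w) (fprod ?X (map A.ar ws) (map (\<lambda>u. fcmp (pow (A.ar u) ?X) (aop B u) (fpow ?X (A.ar u) ?H)) ws)))
      (hcomp (pow ?N ?X) ?Y (nid (pow ?k ?Y) ?Y (aop B w)) (nprod ?X (map A.ar ws) (map (mrho h) ws)))"
    unfolding fpow_fprod[OF w(3), unfolded w(2)]
    by (rule hcomp_niso[OF A.pow_cat B.pow_cat B.cat _ B.iw_niso[OF w(1)]])
      (use nprod_niso[OF A.cat B.cat, of "map (mrho h) ws" "map A.ar ws" "map (\<lambda>u. fcmp (pow (A.ar u) ?X) ?H (aop A u)) ws"
        "map (\<lambda>u. fcmp (pow (A.ar u) ?X) (aop B u) (fpow ?X (A.ar u) ?H)) ws"] rho nth_in_set[OF w(3)] w(2) in auto)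
  note R = vcomp_niso[OF A.pow_cat B.cat vcomp_niso[OF A.pow_cat B.cat R1 R2] R3]
  have c1: "cpt (hcomp (pow ?N ?X) ?Y (acmp B w ws) (nid (pow ?N ?X) (pow ?N ?Y) (fpow ?X ?N ?H))) xs = cpt (acmp B w ws) (map (ob_map ?H) xs)"
    if "length xs = ?N" "set xs \<subseteq> Obj ?X" for xs
    using that by (subst cpt_hcomp_nid_right[OF B.cat is_nisoD(1)[OF B.acmp[OF f]] fpow_H]) auto
  have c2: "cpt (hcomp (pow ?N ?X) ?Y (nid ?X ?Y ?H) (acmp A w ws)) xs = ar_map ?H (cpt (acmp A w ws) xs)"
    if "length xs = ?N" "set xs \<subseteq> Obj ?X" for xs
    using that by (subst cpt_hcomp_nid_left[OF B.cat H is_nisoD(1)[OF A.acmp[OF f]]]) auto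
  have c3: "cpt (hcomp (pow ?N ?X) ?Y (mrho h w) (nid (pow ?N ?X) (pow ?k ?X) ?P)) xs = cpt (mrho h w) (A.opb ws xs)"
    if "length xs = ?N" "set xs \<subseteq> Obj ?X" for xs
    using that by (subst cpt_hcomp_nid_right[OF B.cat is_nisoD(1)[OF rho[OF w(1)]] P]) (auto simp: A.opb_def)
  have c4: "cpt (hcomp (pow ?N ?X) ?Y (nid (pow ?k ?Y) ?Y (aop B w)) (nprod ?X (map A.ar ws) (map (mrho h) ws))) xs = ar_map (aop B w) (rhob ws xs)"
    if "length xs = ?N" "set xs \<subseteq> Obj ?X" for xs
  proof -
    have "is_ntrans (pow ?N ?X) (pow ?k ?Y) (nprod ?X (map A.ar ws) (map (mrho h) ws))"
      using is_nisoD(1)[OF nprod_niso[OF A.cat B.cat, of "map (mrho h) ws" "map A.ar ws" "map (\<lambda>u. fcmp (pow (A.ar u) ?X) ?H (aop A u)) ws"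
        "map (\<lambda>u. fcmp (pow (A.ar u) ?X) (aop B u) (fpow ?X (A.ar u) ?H)) ws"]] rho nth_in_set[OF w(3)] w(2) by auto
    from cpt_hcomp_nid_left[OF B.cat B.op[OF w(1)] this] that show ?thesis by (simp add: rhob_def)
  qed
  show ?thesis
    using niso_eq_iff[OF A.pow_cat B.cat L R] c1 c2 c3 c4 by auto
qed

lemma mor_coherence2:
  "vcomp (pow 1 (acat A)) (acat B) (hcomp (pow 1 (acat A)) (acat B) (auni B)
      (nid (pow 1 (acat A)) (pow 1 (acat B)) (fpow (acat A) 1 (mfun h)))) (mrho h (tunit T))
    = hcomp (pow 1 (acat A)) (acat B) (nid (acat A) (acat B) (mfun h)) (auni A) \<longleftrightarrow>
   (\<forall>x\<in>Obj (acat A). Cmp (acat B) (cpt (auni B) [ob_map (mfun h) x]) (cpt (mrho h (tunit T)) [x]) = ar_map (mfun h) (cpt (auni A) [x]))"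
proof -
  let ?X = "acat A" and ?Y = "acat B" and ?H = "mfun h"
  note L = vcomp_niso[OF A.pow_cat B.cat rho[OF A.tunit_word(1), unfolded A.tunit_word(2)]
     hcomp_niso[OF A.pow_cat B.pow_cat B.cat nid_niso[OF A.pow_cat B.pow_cat fpow_H] B.auni]]
  note R = hcomp_niso[OF A.pow_cat A.cat B.cat A.auni nid_niso[OF A.cat B.cat H]]
  have "(\<forall>xs\<in>Obj (pow 1 ?X). Q xs) \<longleftrightarrow> (\<forall>x\<in>Obj ?X. Q [x])" for Q by (auto simp: length_Suc_conv)
  moreover have "cpt (hcomp (pow 1 ?X) ?Y (auni B) (nid (pow 1 ?X) (pow 1 ?Y) (fpow ?X 1 ?H))) [x] = cpt (auni B) [ob_map ?H x]"
    if "x \<in> Obj ?X" for x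
    using that by (subst cpt_hcomp_nid_right[OF B.cat is_nisoD(1)[OF B.auni] fpow_H]) auto
  moreover have "cpt (hcomp (pow 1 ?X) ?Y (nid ?X ?Y ?H) (auni A)) [x] = ar_map ?H (cpt (auni A) [x])"
    if "x \<in> Obj ?X" for x
    using that by (subst cpt_hcomp_nid_left[OF B.cat H is_nisoD(1)[OF A.auni]]) auto
  ultimately show ?thesis
    using niso_eq_iff[OF A.pow_cat B.cat L R] by simp
qed

lemma mor_coherence3:
  assumes w: "w \<in> words T" "index_map (A.ar w) l f"
  shows "vcomp (pow l (acat A)) (acat B) (hcomp (pow l (acat A)) (acat B) (asub B w l f)
      (nid (pow l (acat A)) (pow l (acat B)) (fpow (acat A) l (mfun h)))) (mrho h (tsub T w l f))
    = vcomp (pow l (acat A)) (acat B) (esubN (acat A) (acat B) (mrho h w) l f)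
      (hcomp (pow l (acat A)) (acat B) (nid (acat A) (acat B) (mfun h)) (asub A w l f)) \<longleftrightarrow>
   (\<forall>xs. length xs = l \<longrightarrow> set xs \<subseteq> Obj (acat A) \<longrightarrow>
     Cmp (acat B) (cpt (asub B w l f) (map (ob_map (mfun h)) xs)) (cpt (mrho h (tsub T w l f)) xs)
     = Cmp (acat B) (cpt (mrho h w) (map ((!) xs) f)) (ar_map (mfun h) (cpt (asub A w l f) xs)))"
proof -
  let ?X = "acat A" and ?Y = "acat B" and ?H = "mfun h"
  have f: "length f = A.ar w" "set f \<subseteq> {..<l}" using w by (auto simp: index_map_def)
  note r = reindex_functor[OF A.cat f(2), unfolded f(1)]
  have G: "tsub T w l f \<in> words T" "A.ar (tsub T w l f) = l" using w by auto
  note L = vcomp_niso[OF A.pow_cat B.cat rho[OF G(1), unfolded G(2)]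
     hcomp_niso[OF A.pow_cat B.pow_cat B.cat nid_niso[OF A.pow_cat B.pow_cat fpow_H] B.asub[OF w]]]
  note R1 = hcomp_niso[OF A.pow_cat A.cat B.cat A.asub[OF w] nid_niso[OF A.cat B.cat H]]
  note R2 = hcomp_niso[OF A.pow_cat A.pow_cat B.cat nid_niso[OF A.pow_cat A.pow_cat r] rho[OF w(1)], unfolded fcmp_assoc[OF r]]
  note R = vcomp_niso[OF A.pow_cat B.cat R1[unfolded esub_def] R2]
  have c1: "cpt (hcomp (pow l ?X) ?Y (asub B w l f) (nid (pow l ?X) (pow l ?Y) (fpow ?X l ?H))) xs = cpt (asub B w l f) (map (ob_map ?H) xs)"
    if "length xs = l" "set xs \<subseteq> Obj ?X" for xs
    using that by (subst cpt_hcomp_nid_right[OF B.cat is_nisoD(1)[OF B.asub[OF w]] fpow_H]) auto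
  have c2: "cpt (hcomp (pow l ?X) ?Y (nid ?X ?Y ?H) (asub A w l f)) xs = ar_map ?H (cpt (asub A w l f) xs)"
    if "length xs = l" "set xs \<subseteq> Obj ?X" for xs
    using that by (subst cpt_hcomp_nid_left[OF B.cat H is_nisoD(1)[OF A.asub[OF w]]]) auto
  have c3: "cpt (hcomp (pow l ?X) ?Y (mrho h w) (nid (pow l ?X) (pow (A.ar w) ?X) (reindex ?X l f))) xs = cpt (mrho h w) (map ((!) xs) f)"
    if "length xs = l" "set xs \<subseteq> Obj ?X" for xs
    using that by (subst cpt_hcomp_nid_right[OF B.cat is_nisoD(1)[OF rho[OF w(1)]] r]) auto
  show ?thesis
    unfolding esubN_def f(1)
    using niso_eq_iff[OF A.pow_cat B.cat L R] c1 c2 c3 by auto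
qed

end

locale mor = typed_mor T A B h + A: palg T A + B: palg T B
  for T :: "'t thy_data" and A :: "('t, 'o, 'a) palg" and B :: "('t, 'o, 'a) palg" and h :: "('t, 'o, 'a) pmor" +
  assumes pm: "pseudo_morphism T A B h"
begin

lemmas coherence_laws = pm[unfolded pseudo_morphism_def Let_def, THEN conjunct2, THEN conjunct2, THEN conjunct2]

lemma mor_coh1: "fits T w ws \<Longrightarrow> length xs = sum_list (map A.ar ws) \<Longrightarrow> set xs \<subseteq> Obj (acat A) \<Longrightarrow>
     Cmp (acat B) (cpt (acmp B w ws) (map (ob_map (mfun h)) xs)) (cpt (mrho h (tgamma T w ws)) xs)
     = Cmp (acat B) (ar_map (aop B w) (rhob ws xs))
         (Cmp (acat B) (cpt (mrho h w) (A.opb ws xs)) (ar_map (mfun h) (cpt (acmp A w ws) xs)))"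
  using mor_coherence1[THEN iffD1, rule_format] coherence_laws[THEN conjunct1, rule_format]
  by blast

lemma mor_coh2: "x \<in> Obj (acat A) \<Longrightarrow>
   Cmp (acat B) (cpt (auni B) [ob_map (mfun h) x]) (cpt (mrho h (tunit T)) [x]) = ar_map (mfun h) (cpt (auni A) [x])"
  by (rule mor_coherence2[THEN iffD1, rule_format,
     OF coherence_laws[THEN conjunct2, THEN conjunct1]])

lemma mor_coh3: "w \<in> words T \<Longrightarrow> index_map (A.ar w) l f \<Longrightarrow> length xs = l \<Longrightarrow> set xs \<subseteq> Obj (acat A) \<Longrightarrow>
     Cmp (acat B) (cpt (asub B w l f) (map (ob_map (mfun h)) xs)) (cpt (mrho h (tsub T w l f)) xs)
     = Cmp (acat B) (cpt (mrho h w) (map ((!) xs) f)) (ar_map (mfun h) (cpt (asub A w l f) xs))"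
  by (rule mor_coherence3[THEN iffD1, rule_format, OF _ _
     coherence_laws[THEN conjunct2, THEN conjunct2, rule_format]])

end

lemma morI:
  assumes "palg T A" "palg T B" "pseudo_morphism T A B h"
  shows "mor T A B h"
proof -
  interpret A: palg T A by fact
  interpret B: palg T B by fact
  note p = assms(3)[unfolded pseudo_morphism_def Let_def]
  show ?thesis
  proof unfold_locales
    show "pseudo_morphism T A B h" by fact
    show "is_functor (acat A) (acat B) (mfun h)" by (rule p[THEN conjunct1])
    show "mrho h \<in> extensional (words T)" by (rule p[THEN conjunct2, THEN conjunct1])
    show "w \<in> words T \<Longrightarrow> is_niso (pow (A.ar w) (acat A)) (acat B)
         (fcmp (pow (A.ar w) (acat A)) (mfun h) (aop A w))
         (fcmp (pow (A.ar w) (acat A)) (aop B w) (fpow (acat A) (A.ar w) (mfun h))) (mrho h w)" for w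
      by (rule p[THEN conjunct2, THEN conjunct2, THEN conjunct1, rule_format])
  qed
qed

lemma (in typed_mor) pseudo_morphismI:
  assumes "\<And>w ws xs. fits T w ws \<Longrightarrow> length xs = sum_list (map A.ar ws) \<Longrightarrow> set xs \<subseteq> Obj (acat A) \<Longrightarrow>
     Cmp (acat B) (cpt (acmp B w ws) (map (ob_map (mfun h)) xs)) (cpt (mrho h (tgamma T w ws)) xs)
     = Cmp (acat B) (ar_map (aop B w) (rhob ws xs))
         (Cmp (acat B) (cpt (mrho h w) (A.opb ws xs)) (ar_map (mfun h) (cpt (acmp A w ws) xs)))"
   and "\<And>x. x \<in> Obj (acat A) \<Longrightarrow>
   Cmp (acat B) (cpt (auni B) [ob_map (mfun h) x]) (cpt (mrho h (tunit T)) [x]) = ar_map (mfun h) (cpt (auni A) [x])"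
   and "\<And>w l f xs. w \<in> words T \<Longrightarrow> index_map (A.ar w) l f \<Longrightarrow> length xs = l \<Longrightarrow> set xs \<subseteq> Obj (acat A) \<Longrightarrow>
     Cmp (acat B) (cpt (asub B w l f) (map (ob_map (mfun h)) xs)) (cpt (mrho h (tsub T w l f)) xs)
     = Cmp (acat B) (cpt (mrho h w) (map ((!) xs) f)) (ar_map (mfun h) (cpt (asub A w l f) xs))"
  shows "pseudo_morphism T A B h"
  unfolding pseudo_morphism_def Let_def
  apply (intro conjI H rho_ext ballI rho)
     apply assumption
    apply (intro allI impI)
    apply (rule mor_coherence1[THEN iffD2])
     apply assumption
    apply (intro allI impI assms(1))
      apply assumption+
   apply (rule mor_coherence2[THEN iffD2])
   apply (intro ballI assms(2), assumption)
  apply (intro allI impI)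
  apply (rule mor_coherence3[THEN iffD2])
    apply assumption+
  apply (intro allI impI assms(3))
     apply assumption+
  done

section \<open>The 2-category of pseudo algebras\<close>

lemma hcomp_nid_nid:
  assumes "category E" "is_functor C D F" "is_functor D E G"
  shows "hcomp C E (nid D E G) (nid C D F) = nid C E (fcmp C G F)"
  using assms by (intro ntrans_eqI[where C=C]) auto

lemma hcomp_fid_left:
  assumes "category D" "is_ntrans C D \<alpha>"
  shows "hcomp C D (nid D D (fid D)) \<alpha> = \<alpha>"
  using assms nt_ext[OF assms(2)] fcmp_fid_left[OF nt_src[OF assms(2)]] fcmp_fid_left[OF nt_tgt[OF assms(2)]]
  by (intro ntrans_eqI[where C=C]) auto

lemma hcomp_assoc:
  assumes "category D" "category E" "category E'" "is_ntrans C D \<alpha>" "is_ntrans D E \<beta>" "is_ntrans E E' \<gamma>"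
  shows "hcomp C E' (hcomp D E' \<gamma> \<beta>) \<alpha> = hcomp C E' \<gamma> (hcomp C E \<beta> \<alpha>)"
proof (rule ntrans_eqI[where C=C])
  fix x assume x: "x \<in> Obj C"
  show "cpt (hcomp C E' (hcomp D E' \<gamma> \<beta>) \<alpha>) x = cpt (hcomp C E' \<gamma> (hcomp C E \<beta> \<alpha>)) x"
    using assms x by (simp add: ftor_cmp[OF nt_src[OF assms(6)]] cat_assoc)
qed (auto simp: fcmp_assoc[OF nt_src[OF assms(4)]] fcmp_assoc[OF nt_tgt[OF assms(4)]])

lemma hcomp_interchange:
  assumes "category D" "category E" "is_ntrans C D \<alpha>" "is_ntrans C D \<alpha>'" "ntgt \<alpha> = nsrc \<alpha>'"
    "is_ntrans D E \<beta>" "is_ntrans D E \<beta>'" "ntgt \<beta> = nsrc \<beta>'"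
  shows "hcomp C E (vcomp D E \<beta>' \<beta>) (vcomp C D \<alpha>' \<alpha>) = vcomp C E (hcomp C E \<beta>' \<alpha>') (hcomp C E \<beta> \<alpha>)"
proof (rule ntrans_eqI[where C=C])
  fix x assume x: "x \<in> Obj C"
  let ?B = "cpt \<beta> (ob_map (ntgt \<alpha>') x)" and ?B' = "cpt \<beta>' (ob_map (ntgt \<alpha>') x)"
    and ?a = "ar_map (nsrc \<beta>) (cpt \<alpha> x)" and ?a' = "ar_map (nsrc \<beta>) (cpt \<alpha>' x)"
  \<comment> \<open>The two middle factors are exchanged by naturality of \<open>\<beta>\<close> at
    the component of \<open>\<alpha>'\<close>.\<close>
  have n: "Cmp E ?B ?a' = Cmp E (ar_map (nsrc \<beta>') (cpt \<alpha>' x)) (cpt \<beta> (ob_map (ntgt \<alpha>) x))"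
    using nt_nat[OF assms(6), of "cpt \<alpha>' x"] assms x by simp
  have e: "?a' \<in> Arr E" "Cod E ?a' = Dom E ?B" "Dom E ?a' = Cod E ?a" "?a \<in> Arr E" "?B \<in> Arr E" "?B' \<in> Arr E" "Cod E ?B = Dom E ?B'"
    using assms x by auto
  have "Cmp E (Cmp E ?B' ?B) (ar_map (nsrc \<beta>) (Cmp D (cpt \<alpha>' x) (cpt \<alpha> x))) = Cmp E ?B' (Cmp E (Cmp E ?B ?a') ?a)"
    using assms x e by (simp add: ftor_cmp[OF nt_src[OF assms(6)]] cat_assoc)
  also have "\<dots> = Cmp E (Cmp E ?B' (ar_map (nsrc \<beta>') (cpt \<alpha>' x))) (Cmp E (cpt \<beta> (ob_map (ntgt \<alpha>) x)) ?a)"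
    unfolding n using assms x by (simp add: cat_assoc)
  finally show "cpt (hcomp C E (vcomp D E \<beta>' \<beta>) (vcomp C D \<alpha>' \<alpha>)) x = cpt (vcomp C E (hcomp C E \<beta>' \<alpha>') (hcomp C E \<beta> \<alpha>)) x"
    using x assms by simp
qed auto

section \<open>2-cells and equality of morphisms in components\<close>

lemma npow_ntrans:
  assumes X: "category X" and Y: "category Y" and a: "is_ntrans X Y \<alpha>"
  shows "is_ntrans (pow n X) (pow n Y) (npow X n \<alpha>)"
proof (rule is_ntransI)
  fix fs assume fs: "fs \<in> Arr (pow n X)"
  then have s: "set (map (Dom X) fs) \<subseteq> Obj X" "set (map (Cod X) fs) \<subseteq> Obj X" using X by auto
  have i: "fs ! i \<in> Arr X" if "i < n" for i using fs that by (auto intro!: nth_in_set)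
  show "Cmp (pow n Y) (cpt (npow X n \<alpha>) (Cod (pow n X) fs)) (ar_map (nsrc (npow X n \<alpha>)) fs) =
         Cmp (pow n Y) (ar_map (ntgt (npow X n \<alpha>)) fs) (cpt (npow X n \<alpha>) (Dom (pow n X) fs))"
    using fs s i nt_nat[OF a] by (auto intro!: nth_equalityI simp del: map_eq_conv)
next
  fix xs assume xs: "xs \<in> Obj (pow n X)"
  show "cpt (npow X n \<alpha>) xs \<in> Arr (pow n Y)" using xs nt_arr[OF a] by auto
  show "Dom (pow n Y) (cpt (npow X n \<alpha>) xs) = ob_map (nsrc (npow X n \<alpha>)) xs"
     "Cod (pow n Y) (cpt (npow X n \<alpha>) xs) = ob_map (ntgt (npow X n \<alpha>)) xs"
    using xs nt_dom[OF a] nt_cod[OF a] by (auto simp: subset_iff)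
qed (use fpow_functor[OF X nt_src[OF a]] fpow_functor[OF X nt_tgt[OF a]] in auto)

text \<open>A 2-cell may fail to be invertible, so \<open>niso_eq_iff\<close> does not apply. Here
  sources and targets of both sides are matched directly, from those of \<open>\<alpha>\<close> and
  of the two \<open>\<rho>\<close>.\<close>

lemma cell_coherence:
  assumes A: "palg T A" and B: "palg T B" and g: "pseudo_morphism T A B g" and h: "pseudo_morphism T A B h"
    and a: "is_ntrans (acat A) (acat B) \<alpha>" "nsrc \<alpha> = mfun g" "ntgt \<alpha> = mfun h" and w: "w \<in> words T"
  shows "vcomp (pow (arity T w) (acat A)) (acat B) (mrho h w) (hcomp (pow (arity T w) (acat A)) (acat B) \<alpha> (nid (pow (arity T w) (acat A)) (acat A) (aop A w)))
     = vcomp (pow (arity T w) (acat A)) (acat B)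
        (hcomp (pow (arity T w) (acat A)) (acat B) (nid (pow (arity T w) (acat B)) (acat B) (aop B w)) (npow (acat A) (arity T w) \<alpha>)) (mrho g w)
   \<longleftrightarrow> (\<forall>xs. length xs = arity T w \<longrightarrow> set xs \<subseteq> Obj (acat A) \<longrightarrow>
     Cmp (acat B) (cpt (mrho h w) xs) (cpt \<alpha> (ob_map (aop A w) xs)) = Cmp (acat B) (ar_map (aop B w) (map (cpt \<alpha>) xs)) (cpt (mrho g w) xs))"
    (is "?L = ?R \<longleftrightarrow> _")
proof -
  interpret g: mor T A B g by (rule morI) fact+
  interpret h: mor T A B h by (rule morI) fact+
  let ?Xn = "pow (arity T w) (acat A)"
  note gr = is_nisoD[OF g.rho[OF w]] and hr = is_nisoD[OF h.rho[OF w]]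
  have c1: "cpt (hcomp ?Xn (acat B) \<alpha> (nid ?Xn (acat A) (aop A w))) xs = cpt \<alpha> (ob_map (aop A w) xs)"
    if "xs \<in> Obj ?Xn" for xs
    using that by (rule cpt_hcomp_nid_right[OF g.B.cat a(1) g.A.op[OF w]])
  have c2: "cpt (hcomp ?Xn (acat B) (nid (pow (arity T w) (acat B)) (acat B) (aop B w)) (npow (acat A) (arity T w) \<alpha>)) xs
    = ar_map (aop B w) (map (cpt \<alpha>) xs)" if "xs \<in> Obj ?Xn" for xs
    using cpt_hcomp_nid_left[OF g.B.cat g.B.op[OF w] npow_ntrans[OF g.A.cat g.B.cat a(1)] that] that by simp
  have "?L = ?R \<longleftrightarrow> (\<forall>xs\<in>Obj ?Xn. cpt ?L xs = cpt ?R xs)"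
  proof
    assume *: "\<forall>xs\<in>Obj ?Xn. cpt ?L xs = cpt ?R xs"
    show "?L = ?R"
      by (rule ntrans_eqI[where C="?Xn"]) (use * gr hr a in \<open>auto simp del: hcomp_simps(3) vcomp_simps(3)\<close>)
  qed simp
  then show ?thesis using c1 c2 by auto
qed

lemma pseudo_cellI:
  assumes A: "palg T A" and B: "palg T B" and g: "pseudo_morphism T A B (csrc \<alpha>)" and h: "pseudo_morphism T A B (ctgt \<alpha>)"
    and a: "is_ntrans (acat A) (acat B) (cnat \<alpha>)" "nsrc (cnat \<alpha>) = mfun (csrc \<alpha>)" "ntgt (cnat \<alpha>) = mfun (ctgt \<alpha>)"
    and c: "\<And>w xs. w \<in> words T \<Longrightarrow> length xs = arity T w \<Longrightarrow> set xs \<subseteq> Obj (acat A) \<Longrightarrow>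
     Cmp (acat B) (cpt (mrho (ctgt \<alpha>) w) xs) (cpt (cnat \<alpha>) (ob_map (aop A w) xs))
       = Cmp (acat B) (ar_map (aop B w) (map (cpt (cnat \<alpha>)) xs)) (cpt (mrho (csrc \<alpha>) w) xs)"
  shows "pseudo_cell T A B \<alpha>"
  unfolding pseudo_cell_def Let_def
  using g h a c cell_coherence[OF A B g h a] by blast

lemma pseudo_cellD:
  assumes A: "palg T A" and B: "palg T B" and c: "pseudo_cell T A B \<alpha>"
  shows "pseudo_morphism T A B (csrc \<alpha>)" "pseudo_morphism T A B (ctgt \<alpha>)"
    "is_ntrans (acat A) (acat B) (cnat \<alpha>)" "nsrc (cnat \<alpha>) = mfun (csrc \<alpha>)" "ntgt (cnat \<alpha>) = mfun (ctgt \<alpha>)"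
    "w \<in> words T \<Longrightarrow> length xs = arity T w \<Longrightarrow> set xs \<subseteq> Obj (acat A) \<Longrightarrow>
     Cmp (acat B) (cpt (mrho (ctgt \<alpha>) w) xs) (cpt (cnat \<alpha>) (ob_map (aop A w) xs))
       = Cmp (acat B) (ar_map (aop B w) (map (cpt (cnat \<alpha>)) xs)) (cpt (mrho (csrc \<alpha>) w) xs)"
proof -
  note p = c[unfolded pseudo_cell_def Let_def]
  show g: "pseudo_morphism T A B (csrc \<alpha>)" and h: "pseudo_morphism T A B (ctgt \<alpha>)"
    and a: "is_ntrans (acat A) (acat B) (cnat \<alpha>)" "nsrc (cnat \<alpha>) = mfun (csrc \<alpha>)" "ntgt (cnat \<alpha>) = mfun (ctgt \<alpha>)"
    using p by auto
  show "w \<in> words T \<Longrightarrow> length xs = arity T w \<Longrightarrow> set xs \<subseteq> Obj (acat A) \<Longrightarrow>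
     Cmp (acat B) (cpt (mrho (ctgt \<alpha>) w) xs) (cpt (cnat \<alpha>) (ob_map (aop A w) xs))
       = Cmp (acat B) (ar_map (aop B w) (map (cpt (cnat \<alpha>)) xs)) (cpt (mrho (csrc \<alpha>) w) xs)"
    using p cell_coherence[OF A B g h a] by blast
qed

lemma cell_simps:
  assumes A: "palg T A" and B: "palg T B" and c: "pseudo_cell T A B \<alpha>"
  shows "x \<in> Obj (acat A) \<Longrightarrow> cpt (cnat \<alpha>) x \<in> arrows (acat B) (ob_map (mfun (csrc \<alpha>)) x) (ob_map (mfun (ctgt \<alpha>)) x)"
  using pseudo_cellD(3-5)[OF assms] nt_arr[OF pseudo_cellD(3)[OF assms]] nt_dom[OF pseudo_cellD(3)[OF assms]] nt_cod[OF pseudo_cellD(3)[OF assms]]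
  by (auto simp: arrows_iff)

text \<open>\<open>\<rho>\<close> is invertible and \<open>mfun\<close> fixes its source, so its
  components determine it, target included.\<close>

lemma pmor_eqI:
  assumes A: "palg T A" and B: "palg T B" and g: "pseudo_morphism T A B g" and h: "pseudo_morphism T A B h"
    and m: "mfun g = mfun h" and r: "\<And>w xs. w \<in> words T \<Longrightarrow> length xs = arity T w \<Longrightarrow> set xs \<subseteq> Obj (acat A) \<Longrightarrow> cpt (mrho g w) xs = cpt (mrho h w) xs"
  shows "g = h"
proof (rule pmor.equality)
  interpret g: mor T A B g by (rule morI) fact+
  interpret h: mor T A B h by (rule morI) fact+
  show "mrho g = mrho h"
  proof (rule extensionalityI[OF g.rho_ext h.rho_ext])
    fix w assume w: "w \<in> words T"
    show "mrho g w = mrho h w"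
      by (rule niso_eqI[OF g.A.pow_cat g.B.cat g.rho[OF w] h.rho[OF w, folded m]]) (use r w in auto)
  qed
qed (use m in auto)

lemma pcell_eqI:
  assumes "csrc \<alpha> = csrc \<beta>" "ctgt \<alpha> = ctgt \<beta>" "cnat \<alpha> = cnat \<beta>"
  shows "\<alpha> = (\<beta> :: ('t, 'o, 'a) pcell)"
  using assms by (intro pcell.equality) auto

section \<open>Identity morphisms and composition of morphisms\<close>

lemma mor_id_morphism:
  assumes A: "palg T A"
  shows "pseudo_morphism T A A (mor_id T A)"
proof -
  interpret A: palg T A by fact
  let ?X = "acat A"
  interpret m: typed_mor T A A "mor_id T A"
  proof
    fix w assume w: "w \<in> words T"
    show "is_niso (pow (A.ar w) ?X) ?X (fcmp (pow (A.ar w) ?X) (mfun (mor_id T A)) (aop A w))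
     (fcmp (pow (A.ar w) ?X) (aop A w) (fpow ?X (A.ar w) (mfun (mor_id T A)))) (mrho (mor_id T A) w)"
      using w A.op[OF w] by (simp add: mor_id_def fcmp_fid_left fpow_fid fcmp_fid_right nid_niso)
  qed (auto simp: mor_id_def)
  have r: "cpt (mrho (mor_id T A) w) xs = Idn ?X (ob_map (aop A w) xs)" if "w \<in> words T" "length xs = A.ar w" "set xs \<subseteq> Obj ?X" for w xs
    using that by (simp add: mor_id_def)
  have f: "mfun (mor_id T A) = fid ?X" by (simp add: mor_id_def)
  have l: "map (ob_map (fid ?X)) xs = xs" if "set xs \<subseteq> Obj ?X" for xs
    using that by (auto intro!: map_idI)
  show ?thesis
  proof (rule m.pseudo_morphismI)
    fix w ws xs assume fw: "fits T w ws" and xs: "length xs = sum_list (map A.ar ws)" "set xs \<subseteq> Obj ?X"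
    have w: "w \<in> words T" "set ws \<subseteq> words T" "length ws = A.ar w" using fw by (auto simp: fits_def)
    have o: "length (A.opb ws xs) = A.ar w" "set (A.opb ws xs) \<subseteq> Obj ?X" using w xs by auto
    have b: "length (blocks (map A.ar ws) xs ! i) = A.ar (ws ! i)" "set (blocks (map A.ar ws) xs ! i) \<subseteq> Obj ?X" if "i < length ws" for i
      using blocks_obj[of i "map A.ar ws" xs "Obj ?X"] xs that by auto
    have "ar_map (aop A w) (m.rhob ws xs) = Idn ?X (ob_map (aop A w) (A.opb ws xs))"
      using m.rhob[OF w(2) xs] r b w o nth_in_set[OF w(2)] by (intro A.op_id) auto
    then show "Cmp ?X (cpt (acmp A w ws) (map (ob_map (mfun (mor_id T A))) xs)) (cpt (mrho (mor_id T A) (tgamma T w ws)) xs) =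
       Cmp ?X (ar_map (aop A w) (m.rhob ws xs)) (Cmp ?X (cpt (mrho (mor_id T A) w) (A.opb ws xs)) (ar_map (mfun (mor_id T A)) (cpt (acmp A w ws) xs)))"
      using xs w o A.acmp_simps[OF fw xs] fw by (simp add: f l r)
  next
    fix x assume "x \<in> Obj ?X"
    then show "Cmp ?X (cpt (auni A) [ob_map (mfun (mor_id T A)) x]) (cpt (mrho (mor_id T A) (tunit T)) [x]) = ar_map (mfun (mor_id T A)) (cpt (auni A) [x])"
      using A.auni_simps[of x] by (simp add: f r)
  next
    fix w l f xs assume w: "w \<in> words T" "index_map (A.ar w) l f" and xs: "length xs = l" "set xs \<subseteq> Obj ?X"
    have f': "length f = A.ar w" "set f \<subseteq> {..<l}" using w by (auto simp: index_map_def)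
    have "set (map ((!) xs) f) \<subseteq> Obj ?X" using set_map_nth_subset[of f xs] f' xs by auto
    then show "Cmp ?X (cpt (asub A w l f) (map (ob_map (mfun (mor_id T A))) xs)) (cpt (mrho (mor_id T A) (tsub T w l f)) xs) =
       Cmp ?X (cpt (mrho (mor_id T A) w) (map ((!) xs) f)) (ar_map (mfun (mor_id T A)) (cpt (asub A w l f) xs))"
      using xs w f' A.asub_simps[OF w xs] by (simp add: f l r)
  qed
qed

lemma mor_comp_fun [simp]: "mfun (mor_comp T A B C h g) = fcmp (acat A) (mfun h) (mfun g)"
  by (simp add: mor_comp_def)

lemma mor_comp_rho:
  assumes "palg T A" "palg T B" "palg T C" "pseudo_morphism T A B g" "pseudo_morphism T B C h"
    "w \<in> words T" "length xs = arity T w" "set xs \<subseteq> Obj (acat A)"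
  shows "cpt (mrho (mor_comp T A B C h g) w) xs
    = Cmp (acat C) (cpt (mrho h w) (map (ob_map (mfun g)) xs)) (ar_map (mfun h) (cpt (mrho g w) xs))"
proof -
  interpret g: mor T A B g by (rule morI) fact+
  interpret h: mor T B C h by (rule morI) fact+
  have xs: "xs \<in> Obj (pow (arity T w) (acat A))" using assms by simp
  have "ob_map (fpow (acat A) (arity T w) (mfun g)) xs = map (ob_map (mfun g)) xs" using assms by simp
  then show ?thesis
    using cpt_hcomp_nid_right[OF h.B.cat is_nisoD(1)[OF h.rho[OF assms(6)]] g.fpow_H xs]
      cpt_hcomp_nid_left[OF h.B.cat h.H is_nisoD(1)[OF g.rho[OF assms(6)]] xs] assms(6-8)
    by (simp add: mor_comp_def Let_def del: hcomp_simps(3))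
qed

text \<open>The law for \<open>h\<close> is pasted with the image under \<open>h\<close> of the law
  for \<open>g\<close>. For \<open>c\<close> the two are joined by naturality of the
  \<open>\<rho>\<close> of \<open>h\<close> at the list of \<open>\<rho>\<close> components of
  \<open>g\<close> (\<open>e3\<close>).\<close>

lemma mor_comp_morphism:
  assumes "palg T A" "palg T B" "palg T C" "pseudo_morphism T A B g" "pseudo_morphism T B C h"
  shows "pseudo_morphism T A C (mor_comp T A B C h g)"
proof -
  interpret g: mor T A B g by (rule morI) fact+
  interpret h: mor T B C h by (rule morI) fact+
  let ?X = "acat A" and ?Y = "acat B" and ?Z = "acat C" and ?G = "ob_map (mfun g)" and ?H = "ob_map (mfun h)"
    and ?k = "mor_comp T A B C h g"
  interpret m: typed_mor T A C "mor_comp T A B C h g"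
  proof
    fix w assume w: "w \<in> words T"
    let ?n = "arity T w"
    have "is_niso (pow ?n ?X) ?Z (fcmp (pow ?n ?X) (mfun h) (fcmp (pow ?n ?X) (mfun g) (aop A w)))
      (fcmp (pow ?n ?X) (mfun h) (fcmp (pow ?n ?X) (aop B w) (fpow ?X ?n (mfun g))))
      (hcomp (pow ?n ?X) ?Z (nid ?Y ?Z (mfun h)) (mrho g w))"
      by (rule hcomp_niso[OF g.A.pow_cat g.B.cat h.B.cat g.rho[OF w] nid_niso[OF g.B.cat h.B.cat h.H]])
    moreover have "is_niso (pow ?n ?X) ?Z (fcmp (pow ?n ?X) (fcmp (pow ?n ?Y) (mfun h) (aop B w)) (fpow ?X ?n (mfun g)))
      (fcmp (pow ?n ?X) (fcmp (pow ?n ?Y) (aop C w) (fpow ?Y ?n (mfun h))) (fpow ?X ?n (mfun g)))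
      (hcomp (pow ?n ?X) ?Z (mrho h w) (nid (pow ?n ?X) (pow ?n ?Y) (fpow ?X ?n (mfun g))))"
      by (rule hcomp_niso[OF g.A.pow_cat g.B.pow_cat h.B.cat nid_niso[OF g.A.pow_cat g.B.pow_cat g.fpow_H] h.rho[OF w]])
    ultimately show "is_niso (pow ?n ?X) ?Z (fcmp (pow ?n ?X) (mfun ?k) (aop A w))
     (fcmp (pow ?n ?X) (aop C w) (fpow ?X ?n (mfun ?k))) (mrho ?k w)"
      using w by (simp add: mor_comp_def Let_def fcmp_assoc[OF g.A.op[OF w]] fcmp_assoc[OF g.fpow_H] fpow_comp[OF g.A.cat g.H] vcomp_niso)
  qed (auto simp: mor_comp_def intro!: fcmp_functor[OF g.A.cat g.H h.H])
  have r: "cpt (mrho ?k w) xs = Cmp ?Z (cpt (mrho h w) (map ?G xs)) (ar_map (mfun h) (cpt (mrho g w) xs))"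
    if "w \<in> words T" "length xs = arity T w" "set xs \<subseteq> Obj ?X" for w xs by (rule mor_comp_rho[OF assms that])
  have k_ob: "map (ob_map (mfun ?k)) xs = map ?H (map ?G xs)" if "set xs \<subseteq> Obj ?X" for xs using that by auto
  show ?thesis
  proof (rule m.pseudo_morphismI)
    fix w ws xs assume fw: "fits T w ws" and xs: "length xs = sum_list (map g.A.ar ws)" "set xs \<subseteq> Obj ?X"
    have w: "w \<in> words T" "set ws \<subseteq> words T" "length ws = arity T w" using fw by (auto simp: fits_def)
    define ys where "ys = map ?G xs"
    have ys: "length ys = sum_list (map g.A.ar ws)" "set ys \<subseteq> Obj ?Y" using xs by (auto simp: ys_def)
    have zs: "length (map ?H ys) = sum_list (map g.A.ar ws)" "set (map ?H ys) \<subseteq> Obj ?Z" using ys by auto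
    have o: "length (g.A.opb ws xs) = arity T w" "set (g.A.opb ws xs) \<subseteq> Obj ?X" using w xs by auto
    have o': "length (g.B.opb ws ys) = arity T w" "set (g.B.opb ws ys) \<subseteq> Obj ?Y" using w ys by auto
    have go: "length (map ?G (g.A.opb ws xs)) = arity T w" "set (map ?G (g.A.opb ws xs)) \<subseteq> Obj ?Y" using o by auto
    have G: "tgamma T w ws \<in> words T" "arity T (tgamma T w ws) = sum_list (map g.A.ar ws)" using fw by auto
    have bl: "length (blocks (map g.A.ar ws) xs ! i) = g.A.ar (ws ! i)" "set (blocks (map g.A.ar ws) xs ! i) \<subseteq> Obj ?X" if "i < length ws" for i
      using blocks_obj[of i "map g.A.ar ws" xs "Obj ?X"] xs that by auto
    note gb = g.rhob[OF w(2) xs] and hb = h.rhob[OF w(2) ys] and kb = m.rhob[OF w(2) xs]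
    let ?a = "cpt (acmp C w ws) (map ?H ys)" and ?b = "cpt (mrho h (tgamma T w ws)) ys"
      and ?c = "ar_map (mfun h) (cpt (mrho g (tgamma T w ws)) xs)" and ?d = "ar_map (aop C w) (h.rhob ws ys)"
      and ?e = "cpt (mrho h w) (g.B.opb ws ys)" and ?f = "ar_map (mfun h) (cpt (acmp B w ws) ys)"
      and ?k' = "ar_map (mfun h) (ar_map (aop B w) (g.rhob ws xs))" and ?l = "ar_map (mfun h) (cpt (mrho g w) (g.A.opb ws xs))"
      and ?m = "ar_map (mfun h) (ar_map (mfun g) (cpt (acmp A w ws) xs))"
      and ?n = "ar_map (aop C w) (map (ar_map (mfun h)) (g.rhob ws xs))" and ?p = "cpt (mrho h w) (map ?G (g.A.opb ws xs))"
    have gra: "ar_map (aop B w) (g.rhob ws xs) \<in> arrows ?Y (ob_map (aop B w) (map ?G (g.A.opb ws xs))) (ob_map (aop B w) (g.B.opb ws ys))"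
      by (rule g.B.op_arr) (use w gb in \<open>auto simp: ys_def simp del: nth_map\<close>)
    have rA: "cpt (mrho g w) (g.A.opb ws xs) \<in> arrows ?Y (?G (ob_map (aop A w) (g.A.opb ws xs))) (ob_map (aop B w) (map ?G (g.A.opb ws xs)))"
      using g.rho_arr[OF w(1) o] by simp
    have gG: "cpt (mrho g (tgamma T w ws)) xs \<in> arrows ?Y (?G (ob_map (aop A (tgamma T w ws)) xs)) (ob_map (aop B (tgamma T w ws)) ys)"
      using g.rho_arr[OF G(1), of xs] G xs by (simp add: ys_def)
    have cA: "cpt (acmp A w ws) xs \<in> arrows ?X (ob_map (aop A (tgamma T w ws)) xs) (ob_map (aop A w) (g.A.opb ws xs))"
      using g.A.acmp_simps[OF fw xs] by (simp add: arrows_iff)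
    have cB: "cpt (acmp B w ws) ys \<in> arrows ?Y (ob_map (aop B (tgamma T w ws)) ys) (ob_map (aop B w) (g.B.opb ws ys))"
      using g.B.acmp_simps[OF fw ys] by (simp add: arrows_iff)
    have ty: "?a \<in> arrows ?Z (ob_map (aop C (tgamma T w ws)) (map ?H ys)) (ob_map (aop C w) (h.B.opb ws (map ?H ys)))"
      "?b \<in> arrows ?Z (?H (ob_map (aop B (tgamma T w ws)) ys)) (ob_map (aop C (tgamma T w ws)) (map ?H ys))"
      "?c \<in> arrows ?Z (?H (?G (ob_map (aop A (tgamma T w ws)) xs))) (?H (ob_map (aop B (tgamma T w ws)) ys))"
      "?d \<in> arrows ?Z (ob_map (aop C w) (map ?H (g.B.opb ws ys))) (ob_map (aop C w) (h.B.opb ws (map ?H ys)))"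
      "?e \<in> arrows ?Z (?H (ob_map (aop B w) (g.B.opb ws ys))) (ob_map (aop C w) (map ?H (g.B.opb ws ys)))"
      "?f \<in> arrows ?Z (?H (ob_map (aop B (tgamma T w ws)) ys)) (?H (ob_map (aop B w) (g.B.opb ws ys)))"
      "?k' \<in> arrows ?Z (?H (ob_map (aop B w) (map ?G (g.A.opb ws xs)))) (?H (ob_map (aop B w) (g.B.opb ws ys)))"
      "?l \<in> arrows ?Z (?H (?G (ob_map (aop A w) (g.A.opb ws xs)))) (?H (ob_map (aop B w) (map ?G (g.A.opb ws xs))))"
      "?m \<in> arrows ?Z (?H (?G (ob_map (aop A (tgamma T w ws)) xs))) (?H (?G (ob_map (aop A w) (g.A.opb ws xs))))"
      "?n \<in> arrows ?Z (ob_map (aop C w) (map ?H (map ?G (g.A.opb ws xs)))) (ob_map (aop C w) (map ?H (g.B.opb ws ys)))"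
      "?p \<in> arrows ?Z (?H (ob_map (aop B w) (map ?G (g.A.opb ws xs)))) (ob_map (aop C w) (map ?H (map ?G (g.A.opb ws xs))))"
      subgoal using h.B.acmp_simps[OF fw zs] by (simp add: arrows_iff)
      subgoal using h.rho_arr[OF G(1), of ys] G ys by simp
      subgoal by (rule functor_arrows[OF h.H gG])
      subgoal by (rule h.B.op_arr) (use w hb in \<open>auto simp del: nth_map\<close>)
      subgoal by (rule h.rho_arr[OF w(1) o'])
      subgoal by (rule functor_arrows[OF h.H cB])
      subgoal by (rule functor_arrows[OF h.H gra])
      subgoal by (rule functor_arrows[OF h.H rA])
      subgoal by (rule functor_arrows[OF h.H functor_arrows[OF g.H cA]])
      subgoal by (rule h.B.op_arr) (use w gb functor_arrows[OF h.H gb(3)] in \<open>auto simp: ys_def\<close>)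
      subgoal by (rule h.rho_arr[OF w(1) go])
      done
    have e1: "Cmp ?Z ?a ?b = Cmp ?Z ?d (Cmp ?Z ?e ?f)" by (rule h.mor_coh1[OF fw ys])
    have e2: "Cmp ?Z ?f ?c = Cmp ?Z ?k' (Cmp ?Z ?l ?m)"
      using arg_cong[OF g.mor_coh1[OF fw xs, folded ys_def], of "ar_map (mfun h)"] gra rA gG cA cB functor_arrows[OF g.H cA]
      by (simp add: h.H_cmp arrows_iff)
    have e3: "Cmp ?Z ?e ?k' = Cmp ?Z ?n ?p"
      by (rule h.rho_nat') (use w gb in \<open>auto simp: ys_def simp del: nth_map\<close>, simp)
    \<comment> \<open>On each block the \<open>\<rho>\<close> of the composite is a composite of two
      arrows, and the operation \<open>aop C w\<close> preserves composition.\<close>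
    have e4: "ar_map (aop C w) (m.rhob ws xs) = Cmp ?Z ?d ?n"
    proof (rule h.B.op_comp)
      fix i assume "i < g.A.ar w"
      then have i: "i < length ws" using w by simp
      show "h.rhob ws ys ! i \<in> Arr ?Z" "map (ar_map (mfun h)) (g.rhob ws xs) ! i \<in> Arr ?Z"
        "Cod ?Z (map (ar_map (mfun h)) (g.rhob ws xs) ! i) = Dom ?Z (h.rhob ws ys ! i)"
        using i gb(1) gb(3)[OF i] hb(3)[OF i] by (auto simp: arrows_iff ys_def)
      show "m.rhob ws xs ! i = Cmp ?Z (h.rhob ws ys ! i) (map (ar_map (mfun h)) (g.rhob ws xs) ! i)"
        using kb(2)[OF i] hb(2)[OF i] gb(1,2) i r[OF nth_in_set[OF w(2) i] bl[OF i]] by (simp add: ys_def blocks_map)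
    qed (use w gb hb kb in auto)
    have "Cmp ?Z ?a (Cmp ?Z ?b ?c) = Cmp ?Z (Cmp ?Z ?a ?b) ?c" using ty by (simp add: cat_assoc arrows_iff)
    also have "\<dots> = Cmp ?Z ?d (Cmp ?Z ?e (Cmp ?Z ?f ?c))" unfolding e1 using ty by (simp add: cat_assoc arrows_iff)
    also have "\<dots> = Cmp ?Z ?d (Cmp ?Z (Cmp ?Z ?e ?k') (Cmp ?Z ?l ?m))" unfolding e2 using ty by (simp add: cat_assoc arrows_iff)
    also have "\<dots> = Cmp ?Z (Cmp ?Z ?d ?n) (Cmp ?Z (Cmp ?Z ?p ?l) ?m)" unfolding e3 using ty by (simp add: cat_assoc arrows_iff)
    finally show "Cmp ?Z (cpt (acmp C w ws) (map (ob_map (mfun ?k)) xs)) (cpt (mrho ?k (tgamma T w ws)) xs) =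
       Cmp ?Z (ar_map (aop C w) (m.rhob ws xs)) (Cmp ?Z (cpt (mrho ?k w) (g.A.opb ws xs)) (ar_map (mfun ?k) (cpt (acmp A w ws) xs)))"
      unfolding e4 k_ob[OF xs(2)] using r[OF G(1), of xs] G xs r[OF w(1) o] cA by (simp add: ys_def arrows_iff)
  next
    fix x assume x: "x \<in> Obj ?X"
    note A = g.A.auni_simps[OF x] and B = g.B.auni_simps[of "?G x"] and C = h.B.auni_simps[of "?H (?G x)"]
    note gx = g.rho_simps[OF g.A.tunit_word(1), of "[x]"] and hx = h.rho_simps[OF g.A.tunit_word(1), of "[?G x]"]
    have "Cmp ?Z (cpt (auni C) [?H (?G x)]) (Cmp ?Z (cpt (mrho h (tunit T)) [?G x]) (ar_map (mfun h) (cpt (mrho g (tunit T)) [x])))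
       = Cmp ?Z (Cmp ?Z (cpt (auni C) [?H (?G x)]) (cpt (mrho h (tunit T)) [?G x])) (ar_map (mfun h) (cpt (mrho g (tunit T)) [x]))"
      using A B C gx hx x by (simp add: cat_assoc)
    also have "\<dots> = ar_map (mfun h) (Cmp ?Y (cpt (auni B) [?G x]) (cpt (mrho g (tunit T)) [x]))"
      using B gx x h.mor_coh2[of "?G x"] by (simp add: h.H_cmp)
    finally show "Cmp ?Z (cpt (auni C) [ob_map (mfun ?k) x]) (cpt (mrho ?k (tunit T)) [x]) = ar_map (mfun ?k) (cpt (auni A) [x])"
      using x A g.mor_coh2[OF x] r[OF g.A.tunit_word(1), of "[x]"] by simp
  next
    fix w l f xs assume w: "w \<in> words T" "index_map (g.A.ar w) l f" and xs: "length xs = l" "set xs \<subseteq> Obj ?X"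
    have f: "length f = g.A.ar w" "set f \<subseteq> {..<l}" using w by (auto simp: index_map_def)
    define ys where "ys = map ?G xs"
    have ys: "length ys = l" "set ys \<subseteq> Obj ?Y" using xs by (auto simp: ys_def)
    have zs: "length (map ?H ys) = l" "set (map ?H ys) \<subseteq> Obj ?Z" using ys by auto
    have xf: "length (map ((!) xs) f) = g.A.ar w" "set (map ((!) xs) f) \<subseteq> Obj ?X" using set_map_nth_subset[of f xs] f xs by auto
    have yf: "map ((!) ys) f = map ?G (map ((!) xs) f)" using f xs by (auto simp: ys_def subset_iff)
    have yf': "length (map ((!) ys) f) = g.A.ar w" "set (map ((!) ys) f) \<subseteq> Obj ?Y" unfolding yf using xf by auto
    have G: "tsub T w l f \<in> words T" "arity T (tsub T w l f) = l" using w by auto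
    note A = g.A.asub_simps[OF w xs] and B = g.B.asub_simps[OF w ys] and C = h.B.asub_simps[OF w zs]
    note gx = g.rho_simps[OF G(1), of xs, unfolded G(2), OF xs] and hx = h.rho_simps[OF G(1), of ys, unfolded G(2), OF ys]
    note gx' = g.rho_simps[OF w(1) xf] and hx' = h.rho_simps[OF w(1) yf']
    let ?a = "cpt (asub C w l f) (map ?H ys)" and ?b = "cpt (mrho h (tsub T w l f)) ys" and ?c = "ar_map (mfun h) (cpt (mrho g (tsub T w l f)) xs)"
      and ?d = "cpt (mrho h w) (map ((!) ys) f)" and ?e = "ar_map (mfun h) (cpt (asub B w l f) ys)"
      and ?l = "ar_map (mfun h) (cpt (mrho g w) (map ((!) xs) f))" and ?m = "ar_map (mfun h) (ar_map (mfun g) (cpt (asub A w l f) xs))"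
    have "Cmp ?Z ?a (Cmp ?Z ?b ?c) = Cmp ?Z (Cmp ?Z ?a ?b) ?c" using A B C gx hx by (simp add: cat_assoc ys_def)
    also have "\<dots> = Cmp ?Z ?d (Cmp ?Z ?e ?c)" unfolding h.mor_coh3[OF w ys]
      using A B C gx hx hx' by (subst cat_assoc) (simp_all add: ys_def)
    also have "Cmp ?Z ?e ?c = ar_map (mfun h) (Cmp ?Y (cpt (asub B w l f) ys) (cpt (mrho g (tsub T w l f)) xs))"
      using B gx by (simp add: h.H_cmp ys_def)
    also have "\<dots> = Cmp ?Z ?l ?m"
      unfolding g.mor_coh3[OF w xs, folded ys_def] using A gx' by (simp add: h.H_cmp)
    also have "Cmp ?Z ?d (Cmp ?Z ?l ?m) = Cmp ?Z (Cmp ?Z ?d ?l) ?m"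
      using A gx' hx' unfolding yf by (subst cat_assoc) simp_all
    finally show "Cmp ?Z (cpt (asub C w l f) (map (ob_map (mfun ?k)) xs)) (cpt (mrho ?k (tsub T w l f)) xs) =
       Cmp ?Z (cpt (mrho ?k w) (map ((!) xs) f)) (ar_map (mfun ?k) (cpt (asub A w l f) xs))"
      unfolding k_ob[OF xs(2)] using r[OF G(1), of xs] G xs r[OF w(1) xf] A yf by (simp add: ys_def del: map_eq_conv)
  qed
qed

section \<open>Identity 2-cells and the two compositions of 2-cells\<close>

lemma cell_id:
  assumes A: "palg T A" and B: "palg T B" and h: "pseudo_morphism T A B h"
  shows "pseudo_cell T A B \<lparr>csrc = h, ctgt = h, cnat = nid (acat A) (acat B) (mfun h)\<rparr>"
proof -
  interpret h: mor T A B h by (rule morI) fact+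
  show ?thesis
  proof (rule pseudo_cellI[OF A B]; (simp only: pcell.simps)?)
    fix w xs assume w: "w \<in> words T" and xs: "length xs = arity T w" "set xs \<subseteq> Obj (acat A)"
    have "ar_map (aop B w) (map (cpt (nid (acat A) (acat B) (mfun h))) xs) = Idn (acat B) (ob_map (aop B w) (map (ob_map (mfun h)) xs))"
      using w xs by (intro h.B.op_id) (auto dest!: nth_in_set)
    then show "Cmp (acat B) (cpt (mrho h w) xs) (cpt (nid (acat A) (acat B) (mfun h)) (ob_map (aop A w) xs)) =
       Cmp (acat B) (ar_map (aop B w) (map (cpt (nid (acat A) (acat B) (mfun h))) xs)) (cpt (mrho h w) xs)"
      using w xs by simp
  qed (use h h.H in auto)
qed

lemma cell_vcomp:
  assumes A: "palg T A" and B: "palg T B" and a: "pseudo_cell T A B \<alpha>" and b: "pseudo_cell T A B \<beta>" and e: "ctgt \<alpha> = csrc \<beta>"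
  shows "pseudo_cell T A B \<lparr>csrc = csrc \<alpha>, ctgt = ctgt \<beta>, cnat = vcomp (acat A) (acat B) (cnat \<beta>) (cnat \<alpha>)\<rparr>"
proof -
  note ad = pseudo_cellD[OF A B a] and bd = pseudo_cellD[OF A B b]
  interpret g: mor T A B "csrc \<alpha>" by (rule morI[OF A B ad(1)])
  interpret h: mor T A B "csrc \<beta>" by (rule morI[OF A B bd(1)])
  interpret k: mor T A B "ctgt \<beta>" by (rule morI[OF A B bd(2)])
  note as = cell_simps[OF A B a] and bs = cell_simps[OF A B b]
  show ?thesis
  proof (rule pseudo_cellI[OF A B]; (simp only: pcell.simps)?)
    show "is_ntrans (acat A) (acat B) (vcomp (acat A) (acat B) (cnat \<beta>) (cnat \<alpha>))"
      using ad bd e by (intro vcomp_ntrans) auto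
    fix w xs assume w: "w \<in> words T" and xs: "length xs = arity T w" "set xs \<subseteq> Obj (acat A)"
    have xi: "xs ! i \<in> Obj (acat A)" if "i < arity T w" for i using xs that by (auto intro!: nth_in_set)
    have ox: "ob_map (aop A w) xs \<in> Obj (acat A)" using w xs by simp
    let ?a = "cpt (cnat \<alpha>) (ob_map (aop A w) xs)" and ?b = "cpt (cnat \<beta>) (ob_map (aop A w) xs)"
      and ?A = "ar_map (aop B w) (map (cpt (cnat \<alpha>)) xs)" and ?B = "ar_map (aop B w) (map (cpt (cnat \<beta>)) xs)"
    have ty: "?A \<in> arrows (acat B) (ob_map (aop B w) (map (ob_map (mfun (csrc \<alpha>))) xs)) (ob_map (aop B w) (map (ob_map (mfun (ctgt \<alpha>))) xs))"
       "?B \<in> arrows (acat B) (ob_map (aop B w) (map (ob_map (mfun (csrc \<beta>))) xs)) (ob_map (aop B w) (map (ob_map (mfun (ctgt \<beta>))) xs))"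
      by (rule g.B.op_arr; use w xs xi as bs in simp)+
    note t = ty as[OF ox] bs[OF ox] g.rho_arr(1)[OF w xs] h.rho_arr(1)[OF w xs] k.rho_arr(1)[OF w xs]
    have comp: "ar_map (aop B w) (map (cpt (vcomp (acat A) (acat B) (cnat \<beta>) (cnat \<alpha>))) xs) = Cmp (acat B) ?B ?A"
      by (rule g.B.op_comp) (use w xs xi as bs e in \<open>auto simp: arrows_iff\<close>)
    have "Cmp (acat B) (cpt (mrho (ctgt \<beta>) w) xs) (Cmp (acat B) ?b ?a) = Cmp (acat B) (Cmp (acat B) (cpt (mrho (ctgt \<beta>) w) xs) ?b) ?a"
      using t e by (simp add: arrows_iff cat_assoc)
    also have "\<dots> = Cmp (acat B) ?B (Cmp (acat B) (cpt (mrho (ctgt \<alpha>) w) xs) ?a)"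
      unfolding bd(6)[OF w xs] using t e by (simp add: arrows_iff cat_assoc)
    also have "\<dots> = Cmp (acat B) (Cmp (acat B) ?B ?A) (cpt (mrho (csrc \<alpha>) w) xs)"
      unfolding ad(6)[OF w xs] using t e by (simp add: arrows_iff cat_assoc)
    finally show "Cmp (acat B) (cpt (mrho (ctgt \<beta>) w) xs) (cpt (vcomp (acat A) (acat B) (cnat \<beta>) (cnat \<alpha>)) (ob_map (aop A w) xs)) =
       Cmp (acat B) (ar_map (aop B w) (map (cpt (vcomp (acat A) (acat B) (cnat \<beta>) (cnat \<alpha>))) xs)) (cpt (mrho (csrc \<alpha>) w) xs)"
      unfolding comp using ox by simp
  qed (use ad bd in auto)
qed

text \<open>Five equations are pasted: naturality of \<open>\<beta>\<close> at a component of
  \<open>\<rho>\<close> (\<open>e1\<close>), the 2-cell law for \<open>\<beta>\<close>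
  (\<open>e2\<close>), the image of the 2-cell law for \<open>\<alpha>\<close> (\<open>e3\<close>),
  naturality of the \<open>\<rho>\<close> of the source of \<open>\<beta>\<close>
  (\<open>e4\<close>), and functoriality of the operation of \<open>C\<close>
  (\<open>e5\<close>).\<close>

lemma cell_hcomp:
  assumes A: "palg T A" and B: "palg T B" and C: "palg T C" and a: "pseudo_cell T A B \<alpha>" and b: "pseudo_cell T B C \<beta>"
  shows "pseudo_cell T A C \<lparr>csrc = mor_comp T A B C (csrc \<beta>) (csrc \<alpha>), ctgt = mor_comp T A B C (ctgt \<beta>) (ctgt \<alpha>),
    cnat = hcomp (acat A) (acat C) (cnat \<beta>) (cnat \<alpha>)\<rparr>"
proof -
  note ad = pseudo_cellD[OF A B a] and bd = pseudo_cellD[OF B C b]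
  interpret g: mor T A B "csrc \<alpha>" by (rule morI[OF A B ad(1)])
  interpret g': mor T A B "ctgt \<alpha>" by (rule morI[OF A B ad(2)])
  interpret h: mor T B C "csrc \<beta>" by (rule morI[OF B C bd(1)])
  interpret h': mor T B C "ctgt \<beta>" by (rule morI[OF B C bd(2)])
  note as = cell_simps[OF A B a] and bs = cell_simps[OF B C b]
  let ?Z = "acat C"
  show ?thesis
  proof (rule pseudo_cellI[OF A C]; (simp only: pcell.simps)?)
    show "pseudo_morphism T A C (mor_comp T A B C (csrc \<beta>) (csrc \<alpha>))" "pseudo_morphism T A C (mor_comp T A B C (ctgt \<beta>) (ctgt \<alpha>))"
      using mor_comp_morphism[OF A B C] ad bd by auto
    show "is_ntrans (acat A) ?Z (hcomp (acat A) ?Z (cnat \<beta>) (cnat \<alpha>))"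
      using ad bd by (intro hcomp_ntrans[of _ "acat B"]) auto
    fix w xs assume w: "w \<in> words T" and xs: "length xs = arity T w" "set xs \<subseteq> Obj (acat A)"
    have xi: "xs ! i \<in> Obj (acat A)" if "i < arity T w" for i using xs that by (auto intro!: nth_in_set)
    have ox: "ob_map (aop A w) xs \<in> Obj (acat A)" using w xs by simp
    let ?G = "ob_map (mfun (csrc \<alpha>))" and ?G' = "ob_map (mfun (ctgt \<alpha>))"
    have gx: "length (map ?G xs) = arity T w" "set (map ?G xs) \<subseteq> Obj (acat B)" and gx': "length (map ?G' xs) = arity T w" "set (map ?G' xs) \<subseteq> Obj (acat B)"
      using xs by auto
    let ?aF = "cpt (cnat \<alpha>) (ob_map (aop A w) xs)"
    let ?b = "cpt (cnat \<beta>) (?G' (ob_map (aop A w) xs))" and ?ha = "ar_map (mfun (csrc \<beta>)) ?aF"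
      and ?r' = "cpt (mrho (ctgt \<beta>) w) (map ?G' xs)" and ?s' = "ar_map (mfun (ctgt \<beta>)) (cpt (mrho (ctgt \<alpha>) w) xs)"
      and ?s = "ar_map (mfun (csrc \<beta>)) (cpt (mrho (ctgt \<alpha>) w) xs)" and ?bb = "cpt (cnat \<beta>) (ob_map (aop B w) (map ?G' xs))"
      and ?r = "cpt (mrho (csrc \<beta>) w) (map ?G' xs)" and ?B = "ar_map (aop C w) (map (cpt (cnat \<beta>)) (map ?G' xs))"
      and ?q = "ar_map (mfun (csrc \<beta>)) (ar_map (aop B w) (map (cpt (cnat \<alpha>)) xs))"
      and ?p = "ar_map (mfun (csrc \<beta>)) (cpt (mrho (csrc \<alpha>) w) xs)"
      and ?Q = "ar_map (aop C w) (map (\<lambda>x. ar_map (mfun (csrc \<beta>)) (cpt (cnat \<alpha>) x)) xs)"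
      and ?rr = "cpt (mrho (csrc \<beta>) w) (map ?G xs)"
    have q: "ar_map (aop B w) (map (cpt (cnat \<alpha>)) xs) \<in> arrows (acat B) (ob_map (aop B w) (map ?G xs)) (ob_map (aop B w) (map ?G' xs))"
      by (rule g.B.op_arr) (use w xs xi as in auto)
    have gG: "?G' (ob_map (aop A w) xs) \<in> Obj (acat B)" "ob_map (aop B w) (map ?G' xs) \<in> Obj (acat B)"
      using ox gx' w by auto
    have ty: "?b \<in> arrows ?Z (ob_map (mfun (csrc \<beta>)) (?G' (ob_map (aop A w) xs))) (ob_map (mfun (ctgt \<beta>)) (?G' (ob_map (aop A w) xs)))"
      "?ha \<in> arrows ?Z (ob_map (mfun (csrc \<beta>)) (?G (ob_map (aop A w) xs))) (ob_map (mfun (csrc \<beta>)) (?G' (ob_map (aop A w) xs)))"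
      "?r' \<in> arrows ?Z (ob_map (mfun (ctgt \<beta>)) (ob_map (aop B w) (map ?G' xs))) (ob_map (aop C w) (map (ob_map (mfun (ctgt \<beta>))) (map ?G' xs)))"
      "?s' \<in> arrows ?Z (ob_map (mfun (ctgt \<beta>)) (?G' (ob_map (aop A w) xs))) (ob_map (mfun (ctgt \<beta>)) (ob_map (aop B w) (map ?G' xs)))"
      "?s \<in> arrows ?Z (ob_map (mfun (csrc \<beta>)) (?G' (ob_map (aop A w) xs))) (ob_map (mfun (csrc \<beta>)) (ob_map (aop B w) (map ?G' xs)))"
      "?bb \<in> arrows ?Z (ob_map (mfun (csrc \<beta>)) (ob_map (aop B w) (map ?G' xs))) (ob_map (mfun (ctgt \<beta>)) (ob_map (aop B w) (map ?G' xs)))"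
      "?r \<in> arrows ?Z (ob_map (mfun (csrc \<beta>)) (ob_map (aop B w) (map ?G' xs))) (ob_map (aop C w) (map (ob_map (mfun (csrc \<beta>))) (map ?G' xs)))"
      "?B \<in> arrows ?Z (ob_map (aop C w) (map (ob_map (mfun (csrc \<beta>))) (map ?G' xs))) (ob_map (aop C w) (map (ob_map (mfun (ctgt \<beta>))) (map ?G' xs)))"
      "?q \<in> arrows ?Z (ob_map (mfun (csrc \<beta>)) (ob_map (aop B w) (map ?G xs))) (ob_map (mfun (csrc \<beta>)) (ob_map (aop B w) (map ?G' xs)))"
      "?p \<in> arrows ?Z (ob_map (mfun (csrc \<beta>)) (?G (ob_map (aop A w) xs))) (ob_map (mfun (csrc \<beta>)) (ob_map (aop B w) (map ?G xs)))"
      "?Q \<in> arrows ?Z (ob_map (aop C w) (map (ob_map (mfun (csrc \<beta>))) (map ?G xs))) (ob_map (aop C w) (map (ob_map (mfun (csrc \<beta>))) (map ?G' xs)))"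
      "?rr \<in> arrows ?Z (ob_map (mfun (csrc \<beta>)) (ob_map (aop B w) (map ?G xs))) (ob_map (aop C w) (map (ob_map (mfun (csrc \<beta>))) (map ?G xs)))"
      subgoal by (rule bs[OF gG(1)])
      subgoal by (rule functor_arrows[OF h.H as[OF ox]])
      subgoal by (rule h'.rho_arr(1)[OF w gx'])
      subgoal by (rule functor_arrows[OF h'.H g'.rho_arr(1)[OF w xs]])
      subgoal by (rule functor_arrows[OF h.H g'.rho_arr(1)[OF w xs]])
      subgoal by (rule bs[OF gG(2)])
      subgoal by (rule h.rho_arr(1)[OF w gx'])
      subgoal by (rule h.B.op_arr) (use w xs xi bs g'.H_simps in auto)
      subgoal by (rule functor_arrows[OF h.H q])
      subgoal by (rule functor_arrows[OF h.H g.rho_arr(1)[OF w xs]])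
      subgoal by (rule h.B.op_arr) (use w xs xi functor_arrows[OF h.H as] in auto)
      subgoal by (rule h.rho_arr(1)[OF w gx])
      done
    have e1: "Cmp ?Z ?s' ?b = Cmp ?Z ?bb ?s"
      using nt_nat[OF bd(3), of "cpt (mrho (ctgt \<alpha>) w) xs"] g'.rho_simps[OF w xs] bd by simp
    have e2: "Cmp ?Z ?r' ?bb = Cmp ?Z ?B ?r" by (rule bd(6)[OF w gx'])
    have e3: "Cmp ?Z ?s ?ha = Cmp ?Z ?q ?p"
      using arg_cong[OF ad(6)[OF w xs], of "ar_map (mfun (csrc \<beta>))"] g'.rho_simps[OF w xs] g.rho_simps[OF w xs] as[OF ox] q
      by (simp add: h.H_cmp arrows_iff)
    have e4: "Cmp ?Z ?r ?q = Cmp ?Z ?Q ?rr"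
      by (rule h.rho_nat') (use w xs xi as in auto)
    have e5: "ar_map (aop C w) (map (cpt (hcomp (acat A) ?Z (cnat \<beta>) (cnat \<alpha>))) xs) = Cmp ?Z ?B ?Q"
    proof (rule h.B.op_comp)
      fix i assume i: "i < g.A.ar w"
      note x = xi[OF i]
      show "map (\<lambda>x. ar_map (mfun (csrc \<beta>)) (cpt (cnat \<alpha>) x)) xs ! i \<in> Arr ?Z" "map (cpt (cnat \<beta>)) (map ?G' xs) ! i \<in> Arr ?Z"
        "Cod ?Z (map (\<lambda>x. ar_map (mfun (csrc \<beta>)) (cpt (cnat \<alpha>) x)) xs ! i) = Dom ?Z (map (cpt (cnat \<beta>)) (map ?G' xs) ! i)"
        using i x xs functor_arrows[OF h.H as[OF x]] bs[OF g'.H_simps(1)[OF x]] by (auto simp: arrows_iff)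
      show "map (cpt (hcomp (acat A) ?Z (cnat \<beta>) (cnat \<alpha>))) xs ! i =
         Cmp ?Z (map (cpt (cnat \<beta>)) (map ?G' xs) ! i) (map (\<lambda>x. ar_map (mfun (csrc \<beta>)) (cpt (cnat \<alpha>) x)) xs ! i)"
        using i x xs ad bd by simp
    qed (use w xs in auto)
    have "Cmp ?Z (Cmp ?Z ?r' ?s') (Cmp ?Z ?b ?ha) = Cmp ?Z ?r' (Cmp ?Z (Cmp ?Z ?s' ?b) ?ha)" using ty by (simp add: arrows_iff cat_assoc)
    also have "\<dots> = Cmp ?Z (Cmp ?Z ?r' ?bb) (Cmp ?Z ?s ?ha)" unfolding e1 using ty by (simp add: arrows_iff cat_assoc)
    also have "\<dots> = Cmp ?Z ?B (Cmp ?Z (Cmp ?Z ?r ?q) ?p)" unfolding e2 e3 using ty by (simp add: arrows_iff cat_assoc)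
    also have "\<dots> = Cmp ?Z (Cmp ?Z ?B ?Q) (Cmp ?Z ?rr ?p)" unfolding e4 using ty by (simp add: arrows_iff cat_assoc)
    finally show "Cmp ?Z (cpt (mrho (mor_comp T A B C (ctgt \<beta>) (ctgt \<alpha>)) w) xs) (cpt (hcomp (acat A) ?Z (cnat \<beta>) (cnat \<alpha>)) (ob_map (aop A w) xs)) =
       Cmp ?Z (ar_map (aop C w) (map (cpt (hcomp (acat A) ?Z (cnat \<beta>) (cnat \<alpha>))) xs)) (cpt (mrho (mor_comp T A B C (csrc \<beta>) (csrc \<alpha>)) w) xs)"
      unfolding e5 using mor_comp_rho[OF A B C ad(1) bd(1) w xs] mor_comp_rho[OF A B C ad(2) bd(2) w xs] ox ad bd by simp
  qed (use ad bd in auto)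
qed

section \<open>Strict associativity and unit law\<close>

lemma mor_comp_assoc:
  assumes A: "palg T A" and B: "palg T B" and C: "palg T C" and D: "palg T D"
    and f: "pseudo_morphism T A B f" and g: "pseudo_morphism T B C g" and h: "pseudo_morphism T C D h"
  shows "mor_comp T A B D (mor_comp T B C D h g) f = mor_comp T A C D h (mor_comp T A B C g f)"
proof -
  interpret f: mor T A B f by (rule morI) fact+
  interpret g: mor T B C g by (rule morI) fact+
  interpret h: mor T C D h by (rule morI) fact+
  note m = mor_comp_morphism[OF B C D g h] mor_comp_morphism[OF A B C f g]
  show ?thesis
  proof (rule pmor_eqI[OF A D mor_comp_morphism[OF A B D f m(1)] mor_comp_morphism[OF A C D m(2) h]])
    show "mfun (mor_comp T A B D (mor_comp T B C D h g) f) = mfun (mor_comp T A C D h (mor_comp T A B C g f))"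
      by (simp add: fcmp_assoc[OF f.H])
    fix w xs assume w: "w \<in> words T" and xs: "length xs = arity T w" "set xs \<subseteq> Obj (acat A)"
    let ?ys = "map (ob_map (mfun f)) xs"
    let ?zs = "map (ob_map (mfun g)) ?ys"
    have ys: "length ?ys = arity T w" "set ?ys \<subseteq> Obj (acat B)" using xs by auto
    have zs: "length ?zs = arity T w" "set ?zs \<subseteq> Obj (acat C)" using ys by auto
    have l: "map (ob_map (fcmp (acat A) (mfun g) (mfun f))) xs = ?zs" using xs by auto
    show "cpt (mrho (mor_comp T A B D (mor_comp T B C D h g) f) w) xs = cpt (mrho (mor_comp T A C D h (mor_comp T A B C g f)) w) xs"
      unfolding mor_comp_rho[OF A B D f m(1) w xs] mor_comp_rho[OF A C D m(2) h w xs] mor_comp_rho[OF B C D g h w ys] mor_comp_rho[OF A B C f g w xs]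
      using f.rho_simps[OF w xs] g.rho_simps[OF w ys] h.rho_simps[OF w zs] l w xs
      by (simp add: h.H_cmp cat_assoc del: map_eq_conv)
  qed
qed

lemma mor_comp_id_left:
  assumes A: "palg T A" and B: "palg T B" and f: "pseudo_morphism T A B f"
  shows "mor_comp T A B B (mor_id T B) f = f"
proof -
  interpret f: mor T A B f by (rule morI) fact+
  show ?thesis
  proof (rule pmor_eqI[OF A B mor_comp_morphism[OF A B B f mor_id_morphism[OF B]] f])
    show "mfun (mor_comp T A B B (mor_id T B) f) = mfun f"
      by (simp add: fcmp_fid_left[OF f.H] mor_id_def)
    fix w xs assume w: "w \<in> words T" and xs: "length xs = arity T w" "set xs \<subseteq> Obj (acat A)"
    then show "cpt (mrho (mor_comp T A B B (mor_id T B) f) w) xs = cpt (mrho f w) xs"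
      using f.rho_simps[OF w xs] by (simp add: mor_comp_rho[OF A B B f mor_id_morphism[OF B] w xs], simp add: mor_id_def)
  qed
qed

section \<open>The strict 2-category of pseudo algebras\<close>

lemma hom_simps [simp]: "Obj (hom_PsAlg T A B) = {h. pseudo_morphism T A B h}" "Arr (hom_PsAlg T A B) = {\<alpha>. pseudo_cell T A B \<alpha>}"
  "Dom (hom_PsAlg T A B) = csrc" "Cod (hom_PsAlg T A B) = ctgt"
  "Idn (hom_PsAlg T A B) h = \<lparr>csrc = h, ctgt = h, cnat = nid (acat A) (acat B) (mfun h)\<rparr>"
  "Cmp (hom_PsAlg T A B) \<beta> \<alpha> = \<lparr>csrc = csrc \<alpha>, ctgt = ctgt \<beta>, cnat = vcomp (acat A) (acat B) (cnat \<beta>) (cnat \<alpha>)\<rparr>"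
  by (auto simp: hom_PsAlg_def)

lemma hom_category:
  assumes A: "palg T A" and B: "palg T B"
  shows "category (hom_PsAlg T A B)"
proof -
  interpret A: palg T A by fact
  interpret B: palg T B by fact
  have F: "category (fun_cat (acat A) (acat B))" by (rule fun_cat_category) auto
  note d = pseudo_cellD[OF A B]
  show ?thesis
  proof (rule categoryI)
    fix \<alpha> assume "\<alpha> \<in> Arr (hom_PsAlg T A B)"
    then have a: "pseudo_cell T A B \<alpha>" by simp
    show "Cmp (hom_PsAlg T A B) \<alpha> (Idn (hom_PsAlg T A B) (Dom (hom_PsAlg T A B) \<alpha>)) = \<alpha>"
      using d[OF a] cat_id_right[OF F, of "cnat \<alpha>" "mfun (csrc \<alpha>)"] by (intro pcell_eqI) simp_all
    show "Cmp (hom_PsAlg T A B) (Idn (hom_PsAlg T A B) (Cod (hom_PsAlg T A B) \<alpha>)) \<alpha> = \<alpha>"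
      using d[OF a] cat_id_left[OF F, of "cnat \<alpha>" "mfun (ctgt \<alpha>)"] by (intro pcell_eqI) simp_all
  next
    fix \<alpha> \<beta> \<gamma> assume "\<alpha> \<in> Arr (hom_PsAlg T A B)" "\<beta> \<in> Arr (hom_PsAlg T A B)" "\<gamma> \<in> Arr (hom_PsAlg T A B)"
      and e: "Cod (hom_PsAlg T A B) \<alpha> = Dom (hom_PsAlg T A B) \<beta>" "Cod (hom_PsAlg T A B) \<beta> = Dom (hom_PsAlg T A B) \<gamma>"
    then have a: "pseudo_cell T A B \<alpha>" "pseudo_cell T A B \<beta>" "pseudo_cell T A B \<gamma>" by auto
    show "Cmp (hom_PsAlg T A B) \<gamma> (Cmp (hom_PsAlg T A B) \<beta> \<alpha>) = Cmp (hom_PsAlg T A B) (Cmp (hom_PsAlg T A B) \<gamma> \<beta>) \<alpha>"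
      using d[OF a(1)] d[OF a(2)] d[OF a(3)] e cat_assoc[OF F, of "cnat \<alpha>" "cnat \<beta>" "cnat \<gamma>"] by (intro pcell_eqI) simp_all
  qed (use d cell_id[OF A B] cell_vcomp[OF A B] in \<open>auto simp: arrows_iff\<close>)
qed

lemma PsAlg_simps [simp]: "Obj0 (PsAlg T) = {A. pseudo_algebra T A \<and> small_category (acat A)}" "HomC (PsAlg T) = hom_PsAlg T"
  "Idn1 (PsAlg T) = mor_id T" "Cmp1 (PsAlg T) = mor_comp T"
  "Cmp2 (PsAlg T) A B C \<beta> \<alpha> = \<lparr>csrc = mor_comp T A B C (csrc \<beta>) (csrc \<alpha>), ctgt = mor_comp T A B C (ctgt \<beta>) (ctgt \<alpha>),
       cnat = hcomp (acat A) (acat C) (cnat \<beta>) (cnat \<alpha>)\<rparr>"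
  by (auto simp: PsAlg_def)

lemma PsAlg_strict_twocat:
  assumes T: "is_theory (T :: 't thy_data)"
  shows "strict_twocat (PsAlg T :: (('t, 'u, 'u) palg, ('t, 'u, 'u) pmor, ('t, 'u, 'u) pcell) twocat)"
proof -
  have p: "A \<in> Obj0 (PsAlg T) \<Longrightarrow> palg T A" for A :: "('t, 'u, 'u) palg" using T by (auto intro: palgI)
  have c: "A \<in> Obj0 (PsAlg T) \<Longrightarrow> category (acat A)" for A :: "('t, 'u, 'u) palg" by (auto simp: small_category_def)
  show ?thesis
  \<comment> \<open>The cases follow the assumptions of \<open>strict_twocat\<close>:
    hom-categories, identity 1-cells, composites of 1-cells, typing of horizontal composition, its
    identities, interchange, associativity for 1-cells and for 2-cells, unit law for 1-cells and for
    2-cells.\<close>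
  proof (unfold_locales, goal_cases)
    case (1 A B) then show ?case using hom_category[OF p[OF 1(1)] p[OF 1(2)]] by simp
  next
    case (2 A) then show ?case using mor_id_morphism[OF p[OF 2(1)]] by simp
  next
    case (3 A B C f g) then show ?case using mor_comp_morphism[OF p[OF 3(1)] p[OF 3(2)] p[OF 3(3)]] by simp
  next
    case (4 A B C \<alpha> \<beta>) then show ?case using cell_hcomp[OF p[OF 4(1)] p[OF 4(2)] p[OF 4(3)]] by (simp add: arrows_iff)
  next
    case (5 A B C f g)
    interpret f: mor T A B f by (rule morI) (use 5 p in auto)
    interpret g: mor T B C g by (rule morI) (use 5 p in auto)
    show ?case by (simp add: hcomp_nid_nid[OF g.B.cat f.H g.H])
  next
    case (6 A B C \<alpha> \<alpha>' \<beta> \<beta>')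
    note d = pseudo_cellD[OF p[OF 6(1)] p[OF 6(2)]] pseudo_cellD[OF p[OF 6(2)] p[OF 6(3)]]
    show ?case
      using 6 hcomp_interchange[OF c[OF 6(2)] c[OF 6(3)], of "acat A" "cnat \<alpha>" "cnat \<alpha>'" "cnat \<beta>" "cnat \<beta>'"] d by simp
  next
    case (7 A B C D f g h) then show ?case using mor_comp_assoc[OF p[OF 7(1)] p[OF 7(2)] p[OF 7(3)] p[OF 7(4)]] by simp
  next
    case (8 A B C D \<alpha> \<beta> \<gamma>)
    note d = pseudo_cellD[OF p[OF 8(1)] p[OF 8(2)]] pseudo_cellD[OF p[OF 8(2)] p[OF 8(3)]] pseudo_cellD[OF p[OF 8(3)] p[OF 8(4)]]
    show ?case
      using 8 hcomp_assoc[OF c[OF 8(2)] c[OF 8(3)] c[OF 8(4)], of "acat A" "cnat \<alpha>" "cnat \<beta>" "cnat \<gamma>"] d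
        mor_comp_assoc[OF p[OF 8(1)] p[OF 8(2)] p[OF 8(3)] p[OF 8(4)]] by simp
  next
    case (9 A B f) then show ?case using mor_comp_id_left[OF p[OF 9(1)] p[OF 9(2)]] by simp
  next
    case (10 A B \<alpha>)
    note d = pseudo_cellD[OF p[OF 10(1)] p[OF 10(2)]]
    show ?case
      using 10 d hcomp_fid_left[OF c[OF 10(2)], of "acat A" "cnat \<alpha>"] mor_comp_id_left[OF p[OF 10(1)] p[OF 10(2)]]
      by (intro pcell_eqI) (simp_all add: mor_id_def[of T B])
  qed
qed

section \<open>Small sets of terms\<close>

lemma infinite_times_lepoll: "infinite B \<Longrightarrow> B \<times> B \<lesssim> B"
  by (simp add: eqpoll_iff_card_of_ordIso eqpoll_imp_lepoll card_of_Times_same_infinite)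

lemma lepoll_total: "A \<lesssim> B \<or> B \<lesssim> A"
  using ordLeq_total[OF card_of_Well_order card_of_Well_order, of A B]
  by (auto simp: lepoll_def simp flip: card_of_ordLeq)

lemma UN_nat_lepoll:
  fixes S :: "nat \<Rightarrow> 'a set"
  assumes B: "infinite B" and S: "\<And>n. S n \<lesssim> B"
  shows "(\<Union>n. S n) \<lesssim> B"
proof -
  have "(\<Union>n. S n) \<lesssim> (UNIV :: nat set) \<times> B"
  proof -
    obtain g where g: "\<And>n. inj_on (g n) (S n)" "\<And>n. g n ` S n \<subseteq> B" using S unfolding lepoll_def by metis
    \<comment> \<open>The injection depends on the index of the set, so an element needs one
      definite index; with the least one, index and code together determine the element.\<close>
    define k where "k x = (LEAST n. x \<in> S n)" for x
    have k: "x \<in> S (k x)" if "x \<in> S n" for x n unfolding k_def by (rule LeastI) fact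
    have "inj_on (\<lambda>x. (k x, g (k x) x)) (\<Union>n. S n)"
    proof (rule inj_onI)
      fix x y assume xy: "x \<in> (\<Union>n. S n)" "y \<in> (\<Union>n. S n)" and e: "(k x, g (k x) x) = (k y, g (k y) y)"
      have "k x = k y" using e by simp
      moreover have "x \<in> S (k x)" "y \<in> S (k y)" using xy k by blast+
      ultimately have "x \<in> S (k x)" "y \<in> S (k x)" by simp_all
      then show "x = y" using e by (intro inj_onD[OF g(1)[of "k x"]]) auto
    qed
    moreover have "(\<lambda>x. (k x, g (k x) x)) ` (\<Union>n. S n) \<subseteq> UNIV \<times> B"
    proof
      fix p assume "p \<in> (\<lambda>x. (k x, g (k x) x)) ` (\<Union>n. S n)"
      then obtain x n where p: "p = (k x, g (k x) x)" "x \<in> S n" by blast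
      have "g (k x) x \<in> B" using g(2)[of "k x"] k[OF p(2)] by blast
      then show "p \<in> UNIV \<times> B" using p by simp
    qed
    ultimately show ?thesis unfolding lepoll_def by blast
  qed
  also have "\<dots> \<lesssim> B \<times> B" using B by (intro times_lepoll_mono) (auto simp: infinite_le_lepoll)
  also have "\<dots> \<lesssim> B" by (rule infinite_times_lepoll[OF B])
  finally show ?thesis .
qed

lemma lists_lepoll:
  assumes B: "infinite B"
  shows "lists B \<lesssim> B"
proof -
  have n: "{xs \<in> lists B. length xs = n} \<lesssim> B" for n
  proof (induction n)
    case 0
    have e: "{xs \<in> lists B. length xs = 0} = {[]}" by auto
    show ?case unfolding e by (rule finite_lepoll_infinite[OF B]) simp
  next
    case (Suc n)
    have "{xs \<in> lists B. length xs = Suc n} \<subseteq> (\<lambda>(x, xs). x # xs) ` (B \<times> {xs \<in> lists B. length xs = n})"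
    proof
      fix xs assume xs: "xs \<in> {xs \<in> lists B. length xs = Suc n}"
      then obtain y ys where "xs = y # ys" by (cases xs) auto
      then show "xs \<in> (\<lambda>(x, xs). x # xs) ` (B \<times> {xs \<in> lists B. length xs = n})"
        using xs by (intro image_eqI[of _ _ "(y, ys)"]) auto
    qed
    then have "{xs \<in> lists B. length xs = Suc n} \<lesssim> B \<times> {xs \<in> lists B. length xs = n}"
      by (rule subset_image_lepoll)
    also have "\<dots> \<lesssim> B \<times> B" by (rule times_lepoll_mono[OF lepoll_refl Suc])
    also have "\<dots> \<lesssim> B" by (rule infinite_times_lepoll[OF B])
    finally show ?case .
  qed
  have "lists B \<subseteq> (\<Union>n. {xs \<in> lists B. length xs = n})" by blast
  then show ?thesis by (rule lepoll_trans[OF subset_imp_lepoll UN_nat_lepoll[OF B n]])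
qed

text \<open>A common frame for terms and for arrows: \<open>f l\<close> is the operation with label
  \<open>l\<close>, applied to lists of any length. Elements from lists of the wrong length do no
  harm, as only an upper bound is sought.\<close>

inductive_set generated :: "'l set \<Rightarrow> ('l \<Rightarrow> 'a list \<Rightarrow> 'a) \<Rightarrow> 'a set" for L f where
  "l \<in> L \<Longrightarrow> xs \<in> lists (generated L f) \<Longrightarrow> f l xs \<in> generated L f"
monos lists_mono

text \<open>Each stage of the generation is bounded by \<open>B\<close> because lists over
  \<open>B\<close> and pairs from \<open>B\<close> are, and countably many stages exhaust the
  generated set.\<close>

lemma generated_lepoll:
  assumes B: "infinite B" and L: "L \<lesssim> B"
  shows "generated L f \<lesssim> B"
proof -
  \<comment> \<open>\<open>S n\<close> collects the elements obtained in at most \<open>n\<close>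
    nested steps.\<close>
  define S where "S = rec_nat {} (\<lambda>n S. (\<lambda>(l, xs). f l xs) ` (L \<times> lists S))"
  have S: "S 0 = {}" "S (Suc n) = (\<lambda>(l, xs). f l xs) ` (L \<times> lists (S n))" for n by (auto simp: S_def)
  have "S n \<lesssim> B" for n
  proof (induction n)
    case (Suc n)
    have "S (Suc n) \<lesssim> L \<times> lists (S n)" unfolding S by (rule image_lepoll)
    also have "\<dots> \<lesssim> B \<times> lists B" by (rule times_lepoll_mono[OF L lists_lepoll_mono[OF Suc]])
    also have "\<dots> \<lesssim> B \<times> B" by (rule times_lepoll_mono[OF lepoll_refl lists_lepoll[OF B]])
    also have "\<dots> \<lesssim> B" by (rule infinite_times_lepoll[OF B])
    finally show ?case .
  qed (simp add: S)
  then have U: "(\<Union>n. S n) \<lesssim> B" by (rule UN_nat_lepoll[OF B])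
  have "generated L f \<subseteq> (\<Union>n. S n)"
  proof
    have "S n \<subseteq> S (Suc n)" for n
    proof (induction n)
      case (Suc n)
      then show ?case using lists_mono[OF Suc] unfolding S(2) by blast
    qed (simp add: S)
    then have mono: "m \<le> n \<Longrightarrow> S m \<subseteq> S n" for m n by (rule lift_Suc_mono_le[of S])
    \<comment> \<open>Finitariness enters here: the finitely many entries of a list all occur at one
      common stage.\<close>
    have ls: "\<exists>n. set xs \<subseteq> S n" if "set xs \<subseteq> (\<Union>n. S n)" for xs
      using that
    proof (induction xs)
      case (Cons x xs)
      then obtain n m where nm: "set xs \<subseteq> S n" "x \<in> S m" by auto
      then have "set (x # xs) \<subseteq> S (max n m)" using mono[of n "max n m"] mono[of m "max n m"] by auto
      then show ?case ..
    qed simp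
    fix x assume "x \<in> generated L f"
    then show "x \<in> (\<Union>n. S n)"
    proof induction
      case (1 l xs)
      have "set xs \<subseteq> (\<Union>n. S n)" using 1(2) by (auto simp: in_lists_conv_set)
      then obtain n where "set xs \<subseteq> S n" using ls by blast
      then have "f l xs \<in> S (Suc n)" using 1(1) unfolding S by (intro image_eqI[of _ _ "(l, xs)"]) auto
      then show ?case by blast
    qed
  qed
  then show ?thesis by (rule lepoll_trans[OF subset_imp_lepoll U])
qed

text \<open>For finite \<open>S\<close> an infinite set strictly below \<open>'u\<close> is
  required; a countably infinite subset is one precisely because \<open>'u\<close> is uncountable.
  For infinite \<open>S\<close> its image inside \<open>'u\<close> serves.\<close>

lemma small_infinite_bound:
  assumes U: "uncountable (UNIV :: 'u set)" and S: "small TYPE('u) S"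
  shows "\<exists>B :: 'u set. infinite B \<and> S \<lesssim> B \<and> B \<prec> (UNIV :: 'u set)"
proof (cases "finite S")
  case True
  have "infinite (UNIV :: 'u set)" using U countable_finite by blast
  then obtain N :: "'u set" where N: "infinite N" "countable N" using infinite_countable_subset' by blast
  have "N \<lesssim> (UNIV :: 'u set)" by (simp add: subset_imp_lepoll)
  moreover have "\<not> N \<approx> (UNIV :: 'u set)" using N U countable_eqpoll eqpoll_sym by blast
  ultimately have "N \<prec> (UNIV :: 'u set)" by (simp add: lesspoll_def)
  then show ?thesis using N finite_lepoll_infinite[OF N(1) True] by blast
next
  case False
  have "S \<lesssim> (UNIV :: 'u set)" using S by (simp add: small_def lesspoll_def)
  then obtain f :: "_ \<Rightarrow> 'u" where f: "inj_on f S" unfolding lepoll_def by blast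
  have e: "S \<approx> f ` S" using inj_on_image_eqpoll_self[OF f] eqpoll_sym by blast
  then have "f ` S \<prec> (UNIV :: 'u set)" using S eq_lesspoll_trans[OF eqpoll_sym[OF e]] by (auto simp: small_def)
  then show ?thesis using e False f finite_imageD by (blast intro: eqpoll_imp_lepoll)
qed

section \<open>Closure properties of small sets\<close>

lemma small_lepoll: "small u S \<Longrightarrow> S' \<lesssim> S \<Longrightarrow> small u S'"
  unfolding small_def by (rule lesspoll_trans1)

lemma small_subset: "small u S \<Longrightarrow> S' \<subseteq> S \<Longrightarrow> small u S'"
  by (rule small_lepoll[OF _ subset_imp_lepoll])

lemma small_image: "small u S \<Longrightarrow> small u (f ` S)"
  by (rule small_lepoll[OF _ image_lepoll])

lemma small_injection:
  assumes "small TYPE('u) S"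
  shows "\<exists>f :: _ \<Rightarrow> 'u. inj_on f S"
  using assms unfolding small_def lesspoll_def lepoll_def by blast

lemma small_common_bound:
  assumes unc: "uncountable (UNIV :: 'u set)" and "small TYPE('u) A" "small TYPE('u) C"
  shows "\<exists>B :: 'u set. infinite B \<and> A \<lesssim> B \<and> C \<lesssim> B \<and> B \<prec> (UNIV :: 'u set)"
proof -
  obtain B1 B2 :: "'u set" where B: "infinite B1" "A \<lesssim> B1" "B1 \<prec> (UNIV :: 'u set)" "infinite B2" "C \<lesssim> B2" "B2 \<prec> (UNIV :: 'u set)"
    using small_infinite_bound[OF assms(1,2)] small_infinite_bound[OF assms(1,3)] by blast
  from lepoll_total[of B1 B2] show ?thesis
  proof
    assume "B1 \<lesssim> B2"
    then show ?thesis using B lepoll_trans[OF B(2)] by (intro exI[of _ B2]) simp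
  next
    assume "B2 \<lesssim> B1"
    then show ?thesis using B lepoll_trans[OF B(5)] by (intro exI[of _ B1]) simp
  qed
qed

lemma small_by_bound: "B \<prec> (UNIV :: 'u set) \<Longrightarrow> S \<lesssim> B \<Longrightarrow> small TYPE('u) S"
  unfolding small_def by (rule lesspoll_trans1)

lemma small_times:
  assumes unc: "uncountable (UNIV :: 'u set)"
  shows "small TYPE('u) A \<Longrightarrow> small TYPE('u) C \<Longrightarrow> small TYPE('u) (A \<times> C)"
proof -
  assume "small TYPE('u) A" "small TYPE('u) C"
  then obtain B :: "'u set" where B: "infinite B" "A \<lesssim> B" "C \<lesssim> B" "B \<prec> (UNIV :: 'u set)" using small_common_bound[OF unc] by blast
  have "A \<times> C \<lesssim> B" by (rule lepoll_trans[OF times_lepoll_mono[OF B(2,3)] infinite_times_lepoll[OF B(1)]])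
  then show ?thesis by (rule small_by_bound[OF B(4)])
qed

lemma small_lists:
  assumes unc: "uncountable (UNIV :: 'u set)"
  shows "small TYPE('u) A \<Longrightarrow> small TYPE('u) (lists A)"
proof -
  assume "small TYPE('u) A"
  then obtain B :: "'u set" where B: "infinite B" "A \<lesssim> B" "B \<prec> (UNIV :: 'u set)" using small_common_bound[OF unc] by blast
  have "lists A \<lesssim> B" by (rule lepoll_trans[OF lists_lepoll_mono[OF B(2)] lists_lepoll[OF B(1)]])
  then show ?thesis by (rule small_by_bound[OF B(3)])
qed

lemma small_generated:
  assumes unc: "uncountable (UNIV :: 'u set)"
  shows "small TYPE('u) L \<Longrightarrow> small TYPE('u) (generated L f)"
proof -
  assume "small TYPE('u) L"
  then obtain B :: "'u set" where B: "infinite B" "L \<lesssim> B" "B \<prec> (UNIV :: 'u set)" using small_common_bound[OF unc] by blast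
  from B(3) generated_lepoll[OF B(1,2)] show ?thesis by (rule small_by_bound)
qed

lemma small_Un:
  assumes unc: "uncountable (UNIV :: 'u set)"
  shows "small TYPE('u) A \<Longrightarrow> small TYPE('u) C \<Longrightarrow> small TYPE('u) (A \<union> C)"
proof -
  assume "small TYPE('u) A" "small TYPE('u) C"
  then obtain B :: "'u set" where B: "infinite B" "A \<lesssim> B" "C \<lesssim> B" "B \<prec> (UNIV :: 'u set)" using small_common_bound[OF unc] by blast
  \<comment> \<open>The binary union is treated as a countable one, with \<open>A\<close> at index 0
    and \<open>C\<close> at all other indices.\<close>
  have U: "(\<Union>n::nat. if n = 0 then A else C) \<lesssim> B" by (rule UN_nat_lepoll[OF B(1)]) (simp add: B)
  have "A \<union> C \<subseteq> (\<Union>n::nat. if n = 0 then A else C)"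
  proof (rule subsetI, elim UnE)
    fix x assume "x \<in> A"
    then show "x \<in> (\<Union>n::nat. if n = 0 then A else C)" by (intro UN_I[of 0]) simp_all
  next
    fix x assume "x \<in> C"
    then show "x \<in> (\<Union>n::nat. if n = 0 then A else C)" by (intro UN_I[of 1]) simp_all
  qed
  then show ?thesis by (rule small_by_bound[OF B(4) lepoll_trans[OF subset_imp_lepoll U]])
qed

lemma small_nat:
  assumes unc: "uncountable (UNIV :: 'u set)"
  shows "small TYPE('u) (UNIV :: nat set)"
proof -
  \<comment> \<open>A common bound of small sets is infinite and so bounds the naturals. The empty
    set, small because \<open>'u\<close> is inhabited, is the one to which the bound is
    applied.\<close>
  have "\<not> ({} :: nat set) \<approx> (UNIV :: 'u set)"
  proof
    assume "({} :: nat set) \<approx> (UNIV :: 'u set)"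
    then have "(UNIV :: 'u set) \<approx> ({} :: nat set)" by (rule eqpoll_sym)
    then show False by simp
  qed
  then have "small TYPE('u) ({} :: nat set)" by (simp add: small_def lesspoll_def)
  from small_common_bound[OF unc this this] obtain B :: "'u set" where B: "infinite B" "B \<prec> (UNIV :: 'u set)" by blast
  then show ?thesis using small_by_bound[OF B(2)] by (simp add: infinite_le_lepoll)
qed

section \<open>Formal terms and their encoding in \<open>'u\<close>\<close>

datatype ('t, 'u) tm = Gen 'u 'u | App 't "('t, 'u) tm list"

text \<open>Primitive recursion and not a plain fold: \<open>h\<close> receives the encoded subterms
  along with the results on them. The extension of a 2-cell depends on the subterms themselves,
  through the components of \<open>\<rho>\<close>.\<close>

primrec tm_fold :: "(('t, 'u) tm \<Rightarrow> 'u) \<Rightarrow> ('u \<Rightarrow> 'u \<Rightarrow> 'r) \<Rightarrow> ('t \<Rightarrow> 'u list \<Rightarrow> 'r list \<Rightarrow> 'r) \<Rightarrow> ('t, 'u) tm \<Rightarrow> 'r" where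
  "tm_fold e g h (Gen j x) = g j x"
| "tm_fold e g h (App w ts) = h w (map e ts) (map (tm_fold e g h) ts)"

inductive_set wf_tm :: "'u set \<Rightarrow> 'u set \<Rightarrow> 't set \<Rightarrow> ('t \<Rightarrow> nat) \<Rightarrow> ('t, 'u) tm set" for I S W n where
  Gen: "j \<in> I \<Longrightarrow> x \<in> S \<Longrightarrow> Gen j x \<in> wf_tm I S W n"
| App: "w \<in> W \<Longrightarrow> length ts = n w \<Longrightarrow> ts \<in> lists (wf_tm I S W n) \<Longrightarrow> App w ts \<in> wf_tm I S W n"
monos lists_mono

text \<open>The labels are pairs for the generators and words for the applications; the operation of
  a pair ignores its argument list.\<close>

lemma small_wf_tm:
  fixes I S :: "'v set" and W :: "'t set"
  assumes unc: "uncountable (UNIV :: 'u set)" and "small TYPE('u) I" "small TYPE('u) S" "small TYPE('u) W"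
  shows "small TYPE('u) (wf_tm I S W n)"
proof -
  define f where "f l ts = (case l of Inl p \<Rightarrow> Gen (fst p) (snd p) | Inr w \<Rightarrow> App w ts)" for l and ts :: "('t, 'v) tm list"
  have f: "f (Inl p) ts = Gen (fst p) (snd p)" "f (Inr w) ts = App w ts" for p w ts by (simp_all add: f_def)
  let ?L = "Inl ` (I \<times> S) \<union> Inr ` W"
  have "t \<in> generated ?L f" if "t \<in> wf_tm I S W n" for t
    using that
  proof induction
    case (Gen j x)
    have "f (Inl (j, x)) [] \<in> generated ?L f" by (rule generated.intros) (use Gen in auto)
    then show ?case by (simp add: f)
  next
    case (App w ts)
    have "f (Inr w) ts \<in> generated ?L f" by (rule generated.intros) (use App in \<open>auto simp: in_lists_conv_set\<close>)
    then show ?case by (simp add: f)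
  qed
  moreover have "small TYPE('u) (generated ?L f)"
    by (intro small_generated[OF unc] small_Un[OF unc] small_image small_times[OF unc] assms)
  ultimately show ?thesis using small_subset by blast
qed

text \<open>The interface of the term algebra inside \<open>'u\<close>: smallness, closure,
  induction and primitive recursion. Recursion with values in \<open>'u\<close> covers both the
  values of terms and the components of 2-cells, since objects and arrows of every small algebra
  have type \<open>'u\<close>.\<close>

lemma free_terms_exist:
  fixes I S :: "'u set" and W :: "'t set" and n :: "'t \<Rightarrow> nat"
  assumes unc: "uncountable (UNIV :: 'u set)" and "small TYPE('u) I" "small TYPE('u) S" "small TYPE('u) W"
  shows "\<exists>(gen :: 'u \<Rightarrow> 'u \<Rightarrow> 'u) (app :: 't \<Rightarrow> 'u list \<Rightarrow> 'u) P. small TYPE('u) P \<and>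
    (\<forall>j\<in>I. \<forall>x\<in>S. gen j x \<in> P) \<and> (\<forall>w\<in>W. \<forall>xs. length xs = n w \<longrightarrow> set xs \<subseteq> P \<longrightarrow> app w xs \<in> P) \<and>
    (\<forall>Q. (\<forall>j\<in>I. \<forall>x\<in>S. Q (gen j x)) \<longrightarrow> (\<forall>w\<in>W. \<forall>xs. length xs = n w \<longrightarrow> set xs \<subseteq> P \<longrightarrow> (\<forall>x\<in>set xs. Q x) \<longrightarrow> Q (app w xs)) \<longrightarrow> (\<forall>x\<in>P. Q x)) \<and>
    (\<forall>(g :: 'u \<Rightarrow> 'u \<Rightarrow> 'u) (h :: 't \<Rightarrow> 'u list \<Rightarrow> 'u list \<Rightarrow> 'u). \<exists>r. (\<forall>j\<in>I. \<forall>x\<in>S. r (gen j x) = g j x) \<and>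
       (\<forall>w\<in>W. \<forall>xs. length xs = n w \<longrightarrow> set xs \<subseteq> P \<longrightarrow> r (app w xs) = h w xs (map r xs)))"
proof -
  let ?wf = "wf_tm I S W n"
  have sm: "small TYPE('u) ?wf" by (rule small_wf_tm[OF assms])
  \<comment> \<open>Smallness of the set of well-formed terms is what provides codes for them in
    \<open>'u\<close>.\<close>
  then obtain e :: "('t, 'u) tm \<Rightarrow> 'u" where e: "inj_on e ?wf" using small_injection by blast
  define d where "d = inv_into ?wf e"
  have de: "t \<in> ?wf \<Longrightarrow> d (e t) = t" for t unfolding d_def using e by (rule inv_into_f_f)
  define gen where "gen = (\<lambda>j x. e (Gen j x))"
  define app where "app = (\<lambda>w xs. e (App w (map d xs)))"
  define P where "P = e ` ?wf"
  have ed: "x \<in> P \<Longrightarrow> e (d x) = x" and dP: "x \<in> P \<Longrightarrow> d x \<in> ?wf" for x using de by (auto simp: P_def)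
  have dl: "set xs \<subseteq> P \<Longrightarrow> map d xs \<in> lists ?wf" for xs using dP by (auto simp: subset_iff)
  have el: "set xs \<subseteq> P \<Longrightarrow> map e (map d xs) = xs" for xs using ed by (auto intro!: map_idI simp: subset_iff)
  have 1: "small TYPE('u) P" unfolding P_def by (rule small_image[OF sm])
  have 2: "\<forall>j\<in>I. \<forall>x\<in>S. gen j x \<in> P" by (auto simp: gen_def P_def intro: wf_tm.Gen)
  have 3: "\<forall>w\<in>W. \<forall>xs. length xs = n w \<longrightarrow> set xs \<subseteq> P \<longrightarrow> app w xs \<in> P"
  proof (intro ballI allI impI)
    fix w xs assume "w \<in> W" "length xs = n w" "set xs \<subseteq> P"
    then have "App w (map d xs) \<in> ?wf" by (intro wf_tm.App dl) simp_all
    then show "app w xs \<in> P" by (simp add: app_def P_def)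
  qed
  have 4: "\<forall>x\<in>P. Q x" if g: "\<forall>j\<in>I. \<forall>x\<in>S. Q (gen j x)"
    and a: "\<forall>w\<in>W. \<forall>xs. length xs = n w \<longrightarrow> set xs \<subseteq> P \<longrightarrow> (\<forall>x\<in>set xs. Q x) \<longrightarrow> Q (app w xs)" for Q
  proof -
    have "Q (e t)" if "t \<in> ?wf" for t
      using that
    proof induction
      case (Gen j x) then show ?case using g by (simp add: gen_def)
    next
      case (App w ts)
      have "map d (map e ts) = ts" using App(3) de by (auto simp: in_lists_conv_set intro!: map_idI)
      moreover have "Q (app w (map e ts))"
        by (rule a[rule_format]) (use App in \<open>auto simp: P_def in_lists_conv_set\<close>)
      ultimately show ?case by (simp add: app_def)
    qed
    then show ?thesis by (auto simp: P_def)
  qed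
  have 5: "\<exists>r. (\<forall>j\<in>I. \<forall>x\<in>S. r (gen j x) = g j x) \<and>
       (\<forall>w\<in>W. \<forall>xs. length xs = n w \<longrightarrow> set xs \<subseteq> P \<longrightarrow> r (app w xs) = h w xs (map r xs))"
    for g :: "'u \<Rightarrow> 'u \<Rightarrow> 'u" and h :: "'t \<Rightarrow> 'u list \<Rightarrow> 'u list \<Rightarrow> 'u"
  proof (intro exI[of _ "\<lambda>x. tm_fold e g h (d x)"] conjI ballI allI impI)
    fix j x assume "j \<in> I" "x \<in> S"
    then show "tm_fold e g h (d (gen j x)) = g j x" by (simp add: gen_def de wf_tm.Gen)
  next
    fix w xs assume w: "w \<in> W" "length xs = n w" "set xs \<subseteq> P"
    have "App w (map d xs) \<in> ?wf" by (rule wf_tm.App) (use w dl in auto)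
    then show "tm_fold e g h (d (app w xs)) = h w xs (map (\<lambda>x. tm_fold e g h (d x)) xs)"
      using el[OF w(3)] by (simp add: app_def de o_def)
  qed
  show ?thesis
    by (rule exI[of _ gen], rule exI[of _ app], rule exI[of _ P], intro conjI 1 2 3 allI impI 4 5)
qed

section \<open>The category of terms and evaluated arrows\<close>

lemma blocks_append: "blocks (ms @ ns) xs = blocks ms (take (sum_list ms) xs) @ blocks ns (drop (sum_list ms) xs)"
  by (induction ms arbitrary: xs) (auto simp: drop_drop take_drop min_def add.commute)

context typed_palg
begin

lemma opb_concat:
  "length xs = sum_list (map ar (concat wss)) \<Longrightarrow> opb (concat wss) xs = concat (map2 opb wss (blocks (map (\<lambda>us. sum_list (map ar us)) wss) xs))"
proof (induction wss arbitrary: xs)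
  case (Cons us wss)
  have "opb (us @ concat wss) xs = opb us (take (sum_list (map ar us)) xs) @ opb (concat wss) (drop (sum_list (map ar us)) xs)"
    by (simp add: opb_def blocks_append)
  then show ?case using Cons by simp
qed (simp add: opb_def)

text \<open>Equality in the free algebra will be tested by \<open>faithful\<close>, which asks for
  equal codomains. This identity matches the codomains of the two sides of law (1); the next two
  lemmas do so for laws (4) and (5).\<close>

lemma opb_opb:
  assumes f: "fits T w ws" "list_all2 (fits T) ws wss" and xs: "length xs = sum_list (map ar (concat wss))"
  shows "opb ws (opb (concat wss) xs) =
    map (\<lambda>i. ob_map (aop A (ws ! i)) (opb (wss ! i) (blocks (map ar (map2 (tgamma T) ws wss)) xs ! i))) [0..<length ws]"
proof -
  note fn = fits_nested[OF f]
  have "map length (map2 opb wss (blocks (map (\<lambda>us. sum_list (map ar us)) wss) xs)) = map ar ws"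
    using fn(7)[symmetric] by (auto intro!: nth_equalityI simp del: map_eq_conv)
  then show ?thesis
    unfolding opb_concat[OF xs] fn(5)
    using fn(1) by (intro nth_equalityI) (simp_all add: blocks_concat)
qed

lemma opb_block_map:
  assumes ws: "set ws \<subseteq> words T" and f: "set f \<subseteq> {..<length ws}" and xs: "length xs = sum_list (map ar ws)"
  shows "opb (map ((!) ws) f) (map ((!) xs) (block_map (map ar ws) f)) = map ((!) (opb ws xs)) f"
proof -
  have fi: "f ! i < length ws" if "i < length f" for i using nth_index[OF f that] .
  have "map ((!) xs) (block_map (map ar ws) f) = concat (map (\<lambda>i. blocks (map ar ws) xs ! i) f)"
    using f xs by (auto simp: block_map_def map_concat map_block_incl subset_iff intro!: arg_cong[where f=concat])
  moreover have "blocks (map ar (map ((!) ws) f)) (concat (map (\<lambda>i. blocks (map ar ws) xs ! i) f)) = map (\<lambda>i. blocks (map ar ws) xs ! i) f"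
    using f xs by (intro blocks_concat) (auto simp: subset_iff)
  ultimately show ?thesis using fi by (intro nth_equalityI) simp_all
qed

lemma opb_block_sum:
  assumes l: "length ns' = length ws" "length gs = length ws"
    and g: "\<forall>j<length ws. index_map (ar (ws ! j)) (ns' ! j) (gs ! j)" and xs: "length xs = sum_list ns'"
  shows "opb ws (map ((!) xs) (block_sum ns' gs)) = map (\<lambda>i. ob_map (aop A (ws ! i)) (map ((!) (blocks ns' xs ! i)) (gs ! i))) [0..<length ws]"
proof -
  have b: "xs ! (offset ns' i + j) = blocks ns' xs ! i ! j" if "i < length ws" "j \<in> set (gs ! i)" for i j
  proof -
    have j: "j < ns' ! i" using g that by (auto simp: index_map_def)
    show ?thesis using j that offset_bound[of i ns'] l xs by (simp add: blocks_nth)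
  qed
  have "map ((!) xs) (block_sum ns' gs) = concat (map (\<lambda>i. map ((!) (blocks ns' xs ! i)) (gs ! i)) [0..<length ws])"
    using b l by (auto simp: block_sum_def map_concat intro!: arg_cong[where f=concat])
  moreover have "blocks (map ar ws) (concat (map (\<lambda>i. map ((!) (blocks ns' xs ! i)) (gs ! i)) [0..<length ws])) = map (\<lambda>i. map ((!) (blocks ns' xs ! i)) (gs ! i)) [0..<length ws]"
    using g by (intro blocks_concat nth_equalityI) (auto simp: index_map_def)
  ultimately show ?thesis by (intro nth_equalityI) simp_all
qed

end

lemma eunit_functor:
  assumes X: "category X"
  shows "is_functor (pow 1 X) X (eunit X)"
  by (rule is_functorI) (use X in \<open>auto simp: eunit_def length_Suc_conv\<close>)

lemma nisoI:
  assumes "is_functor C D (nsrc \<alpha>)" "is_functor C D (ntgt \<alpha>)" "cpt \<alpha> \<in> extensional (Obj C)"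
    "\<And>x. x \<in> Obj C \<Longrightarrow> cpt \<alpha> x \<in> arrows D (ob_map (nsrc \<alpha>) x) (ob_map (ntgt \<alpha>) x)"
    "\<And>x. x \<in> Obj C \<Longrightarrow> invertible_arrow D (cpt \<alpha> x)"
    "\<And>f. f \<in> Arr C \<Longrightarrow> Cmp D (cpt \<alpha> (Cod C f)) (ar_map (nsrc \<alpha>) f) = Cmp D (ar_map (ntgt \<alpha>) f) (cpt \<alpha> (Dom C f))"
  shows "is_niso C D (nsrc \<alpha>) (ntgt \<alpha>) \<alpha>"
  unfolding is_niso_def using assms by (auto intro!: is_ntransI simp: arrows_iff)

text \<open>Labels for the generating arrows: identities, the structure isomorphisms \<open>c\<close>, \<open>I\<close> and \<open>s\<close>, the
  images under \<open>\<pi> j\<close> of the arrows of \<open>F\<close>, the coherence isomorphisms \<open>\<rho>\<close> of \<open>\<pi> j\<close>, and the components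
  of the images under \<open>\<pi>\<close> of the arrows of \<open>J\<close>.\<close>

datatype ('t, 'u) glab = GId 'u | GC 't "'t list" "'u list" | GI 'u | GS 't nat "nat list" "'u list"
  | GF 'u 'u | GR 'u 't "'u list" | GJ 'u 'u

text \<open>One label for each way of forming an arrow, through which the set of arrows falls under
  \<open>generated\<close>.\<close>

datatype ('t, 'u) alab = LGen "('t, 'u) glab" | LOp 't | LCmp | LInv

type_synonym ('t, 'u) model = "('t, 'u, 'u) palg \<times> ('u, 'u, ('t, 'u, 'u) pmor, ('t, 'u, 'u) pcell) ftor"

text \<open>The terms enter through the interface of \<open>free_terms_exist\<close>, so that their
  encoding stays hidden: \<open>gen j x\<close> are the generators, \<open>app w xs\<close> the
  formal applications, \<open>Ob\<close> is the set of all terms.\<close>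

locale free_palg = alg_theory T for T :: "'t thy_data" +
  fixes J :: "('u, 'u) cat" and F :: "('t, 'u, 'u) palg"
    and gen :: "'u \<Rightarrow> 'u \<Rightarrow> 'u" and app :: "'t \<Rightarrow> 'u list \<Rightarrow> 'u" and Ob :: "'u set"
  assumes unc: "uncountable (UNIV :: 'u set)"
    and small_words: "small TYPE('u) (words T)"
    and J: "small_category J"
    and F: "F \<in> Obj0 (PsAlg T)"
    and small_Ob: "small TYPE('u) Ob"
    and gen_Ob [simp]: "j \<in> Obj J \<Longrightarrow> x \<in> Obj (acat F) \<Longrightarrow> gen j x \<in> Ob"
    and app_Ob [simp]: "w \<in> words T \<Longrightarrow> length xs = arity T w \<Longrightarrow> set xs \<subseteq> Ob \<Longrightarrow> app w xs \<in> Ob"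
    and Ob_induct: "(\<And>j x. j \<in> Obj J \<Longrightarrow> x \<in> Obj (acat F) \<Longrightarrow> Q (gen j x)) \<Longrightarrow>
      (\<And>w xs. w \<in> words T \<Longrightarrow> length xs = arity T w \<Longrightarrow> set xs \<subseteq> Ob \<Longrightarrow> (\<And>x. x \<in> set xs \<Longrightarrow> Q x) \<Longrightarrow> Q (app w xs)) \<Longrightarrow>
      x \<in> Ob \<Longrightarrow> Q x"
    and Ob_rec: "\<exists>r :: 'u \<Rightarrow> 'u. (\<forall>j\<in>Obj J. \<forall>x\<in>Obj (acat F). r (gen j x) = g j x) \<and>
       (\<forall>w\<in>words T. \<forall>xs. length xs = arity T w \<longrightarrow> set xs \<subseteq> Ob \<longrightarrow> r (app w xs) = h w xs (map r xs))"
begin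

section \<open>Models and the values of terms\<close>

lemma J_cat [simp]: "category J" and J_small: "small TYPE('u) (Obj J)" "small TYPE('u) (Arr J)"
  using J by (auto simp: small_category_def)

lemma F_palg: "palg T F" and F_small: "small TYPE('u) (Obj (acat F))" "small TYPE('u) (Arr (acat F))"
  using F th by (auto intro: palgI simp: small_category_def)

sublocale F: palg T F by (rule F_palg)

definition Mod :: "('t, 'u) model set" where
  "Mod = {(A, D). A \<in> Obj0 (PsAlg T) \<and> is_functor J (hom_PsAlg T F A) D}"

lemma mod_palg: "M \<in> Mod \<Longrightarrow> palg T (fst M)"
  using th by (auto simp: Mod_def intro: palgI)

lemma mod_functor: "M \<in> Mod \<Longrightarrow> is_functor J (hom_PsAlg T F (fst M)) (snd M)"
  by (auto simp: Mod_def)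

lemma mod_cat [simp]: "M \<in> Mod \<Longrightarrow> category (acat (fst M))"
  by (auto simp: Mod_def small_category_def)

lemma mod_mor: "M \<in> Mod \<Longrightarrow> j \<in> Obj J \<Longrightarrow> mor T F (fst M) (ob_map (snd M) j)"
  using ftor_ob[OF mod_functor, of M j] by (intro morI F_palg mod_palg) simp_all

lemma mod_cell:
  assumes "M \<in> Mod" "m \<in> Arr J"
  shows "pseudo_cell T F (fst M) (ar_map (snd M) m)"
    "csrc (ar_map (snd M) m) = ob_map (snd M) (Dom J m)" "ctgt (ar_map (snd M) m) = ob_map (snd M) (Cod J m)"
  using ftor_ar[OF mod_functor[OF assms(1)] assms(2)] ftor_dom[OF mod_functor[OF assms(1)] assms(2)]
    ftor_cod[OF mod_functor[OF assms(1)] assms(2)] by auto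

text \<open>The value of a term in the model \<open>M\<close>. The recursion principle gives
  existence only and fixes nothing off \<open>Ob\<close>, hence the choice.\<close>

definition io :: "('t, 'u) model \<Rightarrow> 'u \<Rightarrow> 'u" where
  "io M = (SOME r. (\<forall>j\<in>Obj J. \<forall>x\<in>Obj (acat F). r (gen j x) = ob_map (mfun (ob_map (snd M) j)) x) \<and>
       (\<forall>w\<in>words T. \<forall>xs. length xs = arity T w \<longrightarrow> set xs \<subseteq> Ob \<longrightarrow> r (app w xs) = ob_map (aop (fst M) w) (map r xs)))"

lemma io [simp]:
  shows "j \<in> Obj J \<Longrightarrow> x \<in> Obj (acat F) \<Longrightarrow> io M (gen j x) = ob_map (mfun (ob_map (snd M) j)) x"
    "w \<in> words T \<Longrightarrow> length xs = arity T w \<Longrightarrow> set xs \<subseteq> Ob \<Longrightarrow> io M (app w xs) = ob_map (aop (fst M) w) (map (io M) xs)"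
  using someI_ex[OF Ob_rec[of "\<lambda>j x. ob_map (mfun (ob_map (snd M) j)) x" "\<lambda>w xs rs. ob_map (aop (fst M) w) rs"]]
  unfolding io_def[symmetric] by blast+

lemma io_obj [simp]:
  assumes M: "M \<in> Mod" and x: "x \<in> Ob"
  shows "io M x \<in> Obj (acat (fst M))"
  using x
proof (rule Ob_induct[rotated 2])
  fix j x assume j: "j \<in> Obj J" "x \<in> Obj (acat F)"
  interpret D: mor T F "fst M" "ob_map (snd M) j" by (rule mod_mor[OF M j(1)])
  show "io M (gen j x) \<in> Obj (acat (fst M))" using j by simp
next
  fix w xs assume w: "w \<in> words T" "length xs = ar w" "set xs \<subseteq> Ob" and IH: "\<And>x. x \<in> set xs \<Longrightarrow> io M x \<in> Obj (acat (fst M))"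
  interpret A: palg T "fst M" by (rule mod_palg[OF M])
  have "set (map (io M) xs) \<subseteq> Obj (acat (fst M))" using IH by auto
  then show "io M (app w xs) \<in> Obj (acat (fst M))" using w by simp
qed

lemma io_set: "M \<in> Mod \<Longrightarrow> set xs \<subseteq> Ob \<Longrightarrow> set (map (io M) xs) \<subseteq> Obj (acat (fst M))"
  by (auto simp: subset_iff)

text \<open>This will turn out to be \<open>opb\<close> of the free algebra; it is written down
  before that algebra exists because the target of the generator \<open>GC\<close> refers to
  it.\<close>

definition pob where "pob ws xs = map2 app ws (blocks (map ar ws) xs)"

lemma pob:
  assumes "set ws \<subseteq> words T" "length xs = sum_list (map ar ws)" "set xs \<subseteq> Ob"
  shows "length (pob ws xs) = length ws" "set (pob ws xs) \<subseteq> Ob"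
    "i < length ws \<Longrightarrow> pob ws xs ! i = app (ws ! i) (blocks (map ar ws) xs ! i)"
proof -
  have b: "length (blocks (map ar ws) xs ! i) = ar (ws ! i) \<and> set (blocks (map ar ws) xs ! i) \<subseteq> Ob" if "i < length ws" for i
    using blocks_obj[of i "map ar ws" xs Ob] that assms by simp
  then have "app (ws ! i) (blocks (map ar ws) xs ! i) \<in> Ob" if "i < length ws" for i
    using that nth_in_set[OF assms(1)] by simp
  then show "set (pob ws xs) \<subseteq> Ob" by (auto simp: pob_def in_set_conv_nth)
qed (auto simp: pob_def)

lemma io_pob:
  assumes M: "M \<in> Mod" and ws: "set ws \<subseteq> words T" "length xs = sum_list (map ar ws)" "set xs \<subseteq> Ob"
  shows "map (io M) (pob ws xs) = typed_palg.opb T (fst M) ws (map (io M) xs)"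
proof -
  interpret A: palg T "fst M" by (rule mod_palg[OF M])
  have b: "length (blocks (map ar ws) xs ! i) = ar (ws ! i) \<and> set (blocks (map ar ws) xs ! i) \<subseteq> Ob" if "i < length ws" for i
    using blocks_obj[of i "map ar ws" xs Ob] that ws by simp
  then show ?thesis using pob[OF ws] nth_in_set[OF ws(1)] by (auto intro!: nth_equalityI simp: blocks_map)
qed

section \<open>Generating arrows: source, target, value in a model, typing\<close>

fun gsrc :: "('t, 'u) glab \<Rightarrow> 'u" where
  "gsrc (GId x) = x"
| "gsrc (GC w ws xs) = app (tgamma T w ws) xs"
| "gsrc (GI x) = app (tunit T) [x]"
| "gsrc (GS w l f xs) = app (tsub T w l f) xs"
| "gsrc (GF j a) = gen j (Dom (acat F) a)"
| "gsrc (GR j w xs) = gen j (ob_map (aop F w) xs)"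
| "gsrc (GJ m x) = gen (Dom J m) x"

fun gtgt :: "('t, 'u) glab \<Rightarrow> 'u" where
  "gtgt (GId x) = x"
| "gtgt (GC w ws xs) = app w (pob ws xs)"
| "gtgt (GI x) = x"
| "gtgt (GS w l f xs) = app w (map ((!) xs) f)"
| "gtgt (GF j a) = gen j (Cod (acat F) a)"
| "gtgt (GR j w xs) = app w (map (gen j) xs)"
| "gtgt (GJ m x) = gen (Cod J m) x"

fun gval :: "('t, 'u) model \<Rightarrow> ('t, 'u) glab \<Rightarrow> 'u" where
  "gval M (GId x) = Idn (acat (fst M)) (io M x)"
| "gval M (GC w ws xs) = cpt (acmp (fst M) w ws) (map (io M) xs)"
| "gval M (GI x) = cpt (auni (fst M)) [io M x]"
| "gval M (GS w l f xs) = cpt (asub (fst M) w l f) (map (io M) xs)"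
| "gval M (GF j a) = ar_map (mfun (ob_map (snd M) j)) a"
| "gval M (GR j w xs) = cpt (mrho (ob_map (snd M) j) w) xs"
| "gval M (GJ m x) = cpt (cnat (ar_map (snd M) m)) x"

fun gok :: "('t, 'u) glab \<Rightarrow> bool" where
  "gok (GId x) = (x \<in> Ob)"
| "gok (GC w ws xs) = (fits T w ws \<and> length xs = sum_list (map ar ws) \<and> set xs \<subseteq> Ob)"
| "gok (GI x) = (x \<in> Ob)"
| "gok (GS w l f xs) = (w \<in> words T \<and> index_map (ar w) l f \<and> length xs = l \<and> set xs \<subseteq> Ob)"
| "gok (GF j a) = (j \<in> Obj J \<and> a \<in> Arr (acat F))"
| "gok (GR j w xs) = (j \<in> Obj J \<and> w \<in> words T \<and> length xs = ar w \<and> set xs \<subseteq> Obj (acat F))"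
| "gok (GJ m x) = (m \<in> Arr J \<and> x \<in> Obj (acat F))"

text \<open>False exactly for the labels whose values are images of arbitrary arrows of
  \<open>F\<close> or components at arbitrary arrows of \<open>J\<close>; these may fail to be
  invertible. All other labels have invertible values in every model.\<close>

fun ginv :: "('t, 'u) glab \<Rightarrow> bool" where
  "ginv (GF j a) = False"
| "ginv (GJ m x) = False"
| "ginv g = True"

lemma gsrc_Ob: "gok g \<Longrightarrow> gsrc g \<in> Ob"
  by (cases g) auto

lemma index_set: "index_map k l f \<Longrightarrow> length xs = l \<Longrightarrow> set xs \<subseteq> S \<Longrightarrow> length (map ((!) xs) f) = k \<and> set (map ((!) xs) f) \<subseteq> S"
  using set_map_nth_subset[of f xs S] by (auto simp: index_map_def)

lemma gtgt_Ob: "gok g \<Longrightarrow> gtgt g \<in> Ob"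
proof (cases g)
  case (GC w ws xs)
  assume "gok g"
  then show ?thesis using GC pob[of ws xs] by (auto simp: fits_def)
next
  case (GS w l f xs)
  assume "gok g"
  then show ?thesis using GS index_set[of _ l f xs Ob] by (auto simp del: set_map)
next
  case (GR j w xs)
  assume "gok g"
  then have "set (map (gen j) xs) \<subseteq> Ob" using GR by (auto simp: subset_iff)
  then show ?thesis using GR \<open>gok g\<close> by auto
qed auto

lemma gval:
  assumes M: "M \<in> Mod" and g: "gok g"
  shows "gval M g \<in> arrows (acat (fst M)) (io M (gsrc g)) (io M (gtgt g)) \<and> (ginv g \<longrightarrow> invertible_arrow (acat (fst M)) (gval M g))"
proof -
  interpret A: palg T "fst M" by (rule mod_palg[OF M])
  show ?thesis
  proof (cases g)
    case (GId x)
    then show ?thesis using g M by (simp add: arrows_iff)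
  next
    case (GC w ws xs)
    then have f: "fits T w ws" and xs: "length xs = sum_list (map ar ws)" "set xs \<subseteq> Ob" using g by auto
    have w: "w \<in> words T" "set ws \<subseteq> words T" "length ws = ar w" using f by (auto simp: fits_def)
    show ?thesis using GC A.acmp_simps[OF f, of "map (io M) xs"] io_set[OF M xs(2)] xs f pob[OF w(2) xs] io_pob[OF M w(2) xs] w
      by (simp add: arrows_iff)
  next
    case (GI x)
    then show ?thesis using g M A.auni_simps[of "io M x"] by (simp add: arrows_iff)
  next
    case (GS w l f xs)
    then have w: "w \<in> words T" "index_map (ar w) l f" and xs: "length xs = l" "set xs \<subseteq> Ob" using g by auto
    have f: "set f \<subseteq> {..<l}" using w by (auto simp: index_map_def)
    have e: "map ((!) (map (io M) xs)) f = map (io M) (map ((!) xs) f)" using f xs by (auto simp: subset_iff)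
    show ?thesis using GS A.asub_simps[OF w, of "map (io M) xs"] io_set[OF M xs(2)] xs index_set[OF w(2) xs] w
      unfolding e by (simp add: arrows_iff)
  next
    case (GF j a)
    then have j: "j \<in> Obj J" "a \<in> Arr (acat F)" using g by auto
    interpret D: mor T F "fst M" "ob_map (snd M) j" by (rule mod_mor[OF M j(1)])
    show ?thesis using GF j by (simp add: arrows_iff)
  next
    case (GR j w xs)
    then have j: "j \<in> Obj J" and w: "w \<in> words T" and xs: "length xs = ar w" "set xs \<subseteq> Obj (acat F)" using g by auto
    interpret D: mor T F "fst M" "ob_map (snd M) j" by (rule mod_mor[OF M j(1)])
    have "set (map (gen j) xs) \<subseteq> Ob" using xs j by (auto simp: subset_iff)
    moreover have "map (io M) (map (gen j) xs) = map (ob_map (mfun (ob_map (snd M) j))) xs" using j xs by (auto simp: subset_iff)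
    ultimately show ?thesis using GR j w xs D.rho_arr[OF w xs] by (simp add: arrows_iff del: map_map map_eq_conv)
  next
    case (GJ m x)
    then have m: "m \<in> Arr J" "x \<in> Obj (acat F)" using g by auto
    show ?thesis using GJ m cell_simps[OF F_palg mod_palg[OF M] mod_cell(1)[OF M m(1)] m(2)] mod_cell[OF M m(1)]
      by (simp add: arrows_iff)
  qed
qed

text \<open>An arrow is a triple of source term, target term and family of values. Families are
  restricted to \<open>Mod\<close>, so that triples with the same ends are equal once they agree in
  all models. The three definitions after this one are composition, the operations and pointwise
  inversion of triples.\<close>

definition gtrip where "gtrip g = (gsrc g, gtgt g, \<lambda>M\<in>Mod. gval M g)"
definition ctrip where "ctrip b a = (fst a, fst (snd b), \<lambda>M\<in>Mod. Cmp (acat (fst M)) (snd (snd b) M) (snd (snd a) M))"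
definition otrip where "otrip w as = (app w (map fst as), app w (map (\<lambda>a. fst (snd a)) as),
   \<lambda>M\<in>Mod. ar_map (aop (fst M) w) (map (\<lambda>a. snd (snd a) M) as))"
definition itrip where "itrip a = (fst (snd a), fst a, \<lambda>M\<in>Mod. inverse_arrow (acat (fst M)) (snd (snd a) M))"

text \<open>The rule \<open>inv\<close> adjoins the pointwise inverse of every family that is
  invertible in each model, not just of the structure cells. Hence invertibility in the category of
  terms can be tested in the models.\<close>

inductive_set AA :: "('u \<times> 'u \<times> (('t, 'u) model \<Rightarrow> 'u)) set" where
  gen: "gok g \<Longrightarrow> gtrip g \<in> AA"
| cmp: "a \<in> AA \<Longrightarrow> b \<in> AA \<Longrightarrow> fst (snd a) = fst b \<Longrightarrow> ctrip b a \<in> AA"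
| op: "w \<in> words T \<Longrightarrow> length as = arity T w \<Longrightarrow> as \<in> lists AA \<Longrightarrow> otrip w as \<in> AA"
| inv: "a \<in> AA \<Longrightarrow> \<forall>M\<in>Mod. invertible_arrow (acat (fst M)) (snd (snd a) M) \<Longrightarrow> itrip a \<in> AA"
monos lists_mono

definition typed_triple where "typed_triple a \<longleftrightarrow> fst a \<in> Ob \<and> fst (snd a) \<in> Ob \<and> snd (snd a) \<in> extensional Mod \<and>
  (\<forall>M\<in>Mod. snd (snd a) M \<in> arrows (acat (fst M)) (io M (fst a)) (io M (fst (snd a))))"

lemma AA_typed: "a \<in> AA \<Longrightarrow> typed_triple a"
proof (induction rule: AA.induct)
  case (gen g)
  then show ?case using gsrc_Ob[OF gen] gtgt_Ob[OF gen] gval[OF _ gen] by (simp add: typed_triple_def gtrip_def)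
next
  case (cmp a b)
  then show ?case by (auto simp: typed_triple_def ctrip_def arrows_iff)
next
  case (op w as)
  have as: "typed_triple a" if "a \<in> set as" for a using op(3) that by (auto simp: in_lists_conv_set)
  have s: "set (map fst as) \<subseteq> Ob" "set (map (\<lambda>a. fst (snd a)) as) \<subseteq> Ob" using as by (auto simp: typed_triple_def)
  have "ar_map (aop (fst M) w) (map (\<lambda>a. snd (snd a) M) as) \<in> arrows (acat (fst M))
     (ob_map (aop (fst M) w) (map (io M) (map fst as))) (ob_map (aop (fst M) w) (map (io M) (map (\<lambda>a. fst (snd a)) as)))" if M: "M \<in> Mod" for M
  proof -
    interpret A: palg T "fst M" by (rule mod_palg[OF M])
    show ?thesis by (rule A.op_arr) (use op as M nth_mem[of _ as] in \<open>auto simp: typed_triple_def\<close>)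
  qed
  then show ?case using op s by (simp add: typed_triple_def otrip_def del: map_map set_map)
next
  case (inv a)
  have "inverse_arrow (acat (fst M)) (snd (snd a) M) \<in> arrows (acat (fst M)) (io M (fst (snd a))) (io M (fst a))" if M: "M \<in> Mod" for M
    using inverse_arrow[of "acat (fst M)" "snd (snd a) M"] inv M by (simp add: typed_triple_def arrows_iff)
  then show ?case using inv by (simp add: typed_triple_def itrip_def)
qed

text \<open>The labels of generators are built from small sets by products and lists, and all
  triples arise from them by finitary operations. The bound depends on the labels alone; the large
  index set \<open>Mod\<close> of the families never enters the count.\<close>

lemma small_AA: "small TYPE('u) AA"
proof -
  let ?W = "words T" and ?JO = "Obj J" and ?FO = "Obj (acat F)"
  let ?G = "GId ` Ob \<union> (\<lambda>(w, ws, xs). GC w ws xs) ` (?W \<times> lists ?W \<times> lists Ob) \<union> GI ` Ob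
     \<union> (\<lambda>(w, l, f, xs). GS w l f xs) ` (?W \<times> (UNIV :: nat set) \<times> lists (UNIV :: nat set) \<times> lists Ob)
     \<union> (\<lambda>(j, a). GF j a) ` (?JO \<times> Arr (acat F)) \<union> (\<lambda>(j, w, xs). GR j w xs) ` (?JO \<times> ?W \<times> lists ?FO)
     \<union> (\<lambda>(m, x). GJ m x) ` (Arr J \<times> ?FO)"
  have "{g. gok g} \<subseteq> ?G"
  proof (rule subsetI)
    fix g assume "g \<in> {g. gok g}"
    then show "g \<in> ?G" by (cases g) (force simp: fits_def in_lists_conv_set image_iff)+
  qed
  moreover have "small TYPE('u) ?G"
    by (intro small_Un[OF unc] small_image small_times[OF unc] small_lists[OF unc] small_nat[OF unc]
       small_Ob small_words J_small F_small)
  ultimately have g: "small TYPE('u) {g. gok g}" by (rule small_subset[rotated])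
  \<comment> \<open>The last set is \<open>{LCmp, LInv}\<close>, written as an image of the naturals
    to make its smallness immediate.\<close>
  let ?L = "LGen ` {g. gok g} \<union> LOp ` ?W \<union> (\<lambda>n. if n = 0 then LCmp else LInv) ` (UNIV :: nat set)"
  have L: "small TYPE('u) ?L"
    by (intro small_Un[OF unc] small_image g small_words small_nat[OF unc])
  have Li: "LCmp \<in> ?L" "LInv \<in> ?L" by (auto intro: image_eqI[of _ _ "0::nat"] image_eqI[of _ _ "1::nat"])
  \<comment> \<open>Arguments are read by position, with the arrow to be applied first at position
    0. Other lists give junk values, which merely enlarge the bounding set.\<close>
  define f where "f = (\<lambda>l as. case l of LGen g \<Rightarrow> gtrip g | LOp w \<Rightarrow> otrip w as | LCmp \<Rightarrow> ctrip (as ! 1) (as ! 0) | LInv \<Rightarrow> itrip (as ! 0))"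
  have fs: "f (LGen g) as = gtrip g" "f (LOp w) as = otrip w as" "f LCmp as = ctrip (as ! 1) (as ! 0)" "f LInv as = itrip (as ! 0)" for g w as
    by (simp_all add: f_def)
  have "a \<in> generated ?L f" if "a \<in> AA" for a
    using that
  proof induction
    case (gen g)
    have "f (LGen g) [] \<in> generated ?L f" by (rule generated.intros) (use gen in auto)
    then show ?case by (simp add: fs)
  next
    case (cmp a b)
    have "f LCmp [a, b] \<in> generated ?L f" by (rule generated.intros[OF Li(1)]) (use cmp in auto)
    then show ?case by (simp add: fs)
  next
    case (op w as)
    have "f (LOp w) as \<in> generated ?L f" by (rule generated.intros) (use op in \<open>auto simp: in_lists_conv_set\<close>)
    then show ?case by (simp add: fs)
  next
    case (inv a)
    have "f LInv [a] \<in> generated ?L f" by (rule generated.intros[OF Li(2)]) (use inv in auto)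
    then show ?case by (simp add: fs)
  qed
  then have "AA \<subseteq> generated ?L f" by blast
  then show ?thesis by (rule small_subset[OF small_generated[OF unc L]])
qed

text \<open>As \<open>AA\<close> is small, its elements, which are not of type \<open>'u\<close>, can be encoded in \<open>'u\<close>.\<close>

definition ea :: "_ \<Rightarrow> 'u" where "ea = (SOME e. inj_on e AA)"

lemma ea_inj: "inj_on ea AA"
  unfolding ea_def by (rule someI_ex[OF small_injection[OF small_AA]])

definition da where "da = inv_into AA ea"

lemma da_ea [simp]: "a \<in> AA \<Longrightarrow> da (ea a) = a"
  unfolding da_def using ea_inj by (rule inv_into_f_f)

section \<open>The category of terms\<close>

definition ev :: "('t, 'u) model \<Rightarrow> 'u \<Rightarrow> 'u" where "ev M a = snd (snd (da a)) M"
definition garr where "garr g = ea (gtrip g)"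
definition appa where "appa w fs = ea (otrip w (map da fs))"

definition XP :: "('u, 'u) cat" where
  "XP = \<lparr>Obj = Ob, Arr = ea ` AA, Dom = (\<lambda>a. fst (da a)), Cod = (\<lambda>a. fst (snd (da a))), Idn = (\<lambda>x. garr (GId x)),
     Cmp = (\<lambda>b a. ea (ctrip (da b) (da a)))\<rparr>"

lemma XP_obj [simp]: "Obj XP = Ob"
  by (simp add: XP_def)

lemma XP_arr: "a \<in> Arr XP \<Longrightarrow> da a \<in> AA \<and> ea (da a) = a"
  by (auto simp: XP_def)

lemma XP_ea: "a \<in> AA \<Longrightarrow> ea a \<in> Arr XP"
  by (auto simp: XP_def)

lemma XP_dom: "Dom XP a = fst (da a)" and XP_cod: "Cod XP a = fst (snd (da a))"
  by (auto simp: XP_def)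

lemma XP_typed:
  assumes "a \<in> Arr XP"
  shows "Dom XP a \<in> Ob" "Cod XP a \<in> Ob" "M \<in> Mod \<Longrightarrow> ev M a \<in> arrows (acat (fst M)) (io M (Dom XP a)) (io M (Cod XP a))"
  using AA_typed[of "da a"] XP_arr[OF assms] by (auto simp: typed_triple_def XP_dom XP_cod ev_def)

lemma ev_simps [simp]:
  assumes "a \<in> Arr XP" "M \<in> Mod"
  shows "ev M a \<in> Arr (acat (fst M))" "Dom (acat (fst M)) (ev M a) = io M (Dom XP a)" "Cod (acat (fst M)) (ev M a) = io M (Cod XP a)"
  using XP_typed(3)[OF assms] by (auto simp: arrows_iff)

text \<open>The encoding is injective on \<open>AA\<close> and the families are extensional on
  \<open>Mod\<close>, so the two ends and the values determine an arrow. Equations between arrows of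
  the free algebra are carried over from the models through this lemma.\<close>

lemma faithful:
  assumes "a \<in> Arr XP" "b \<in> Arr XP" "Dom XP a = Dom XP b" "Cod XP a = Cod XP b" "\<And>M. M \<in> Mod \<Longrightarrow> ev M a = ev M b"
  shows "a = b"
proof -
  have e: "snd (snd (da a)) \<in> extensional Mod" "snd (snd (da b)) \<in> extensional Mod"
    using AA_typed XP_arr assms by (auto simp: typed_triple_def)
  have "snd (snd (da a)) = snd (snd (da b))"
    by (rule extensionalityI[OF e]) (use assms(5) in \<open>auto simp: ev_def\<close>)
  then have "da a = da b" using assms by (simp add: prod_eq_iff XP_dom XP_cod)
  then show ?thesis using XP_arr assms by metis
qed

lemma garr:
  assumes "gok g"
  shows "garr g \<in> Arr XP" "Dom XP (garr g) = gsrc g" "Cod XP (garr g) = gtgt g" "M \<in> Mod \<Longrightarrow> ev M (garr g) = gval M g"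
  using AA.gen[OF assms] by (auto simp: garr_def XP_ea XP_dom XP_cod ev_def) (auto simp: gtrip_def)

lemma XP_Idn: "Idn XP x = garr (GId x)"
  by (simp add: XP_def)

lemma XP_Cmp:
  assumes "a \<in> Arr XP" "b \<in> Arr XP" "Cod XP a = Dom XP b"
  shows "Cmp XP b a \<in> Arr XP" "Dom XP (Cmp XP b a) = Dom XP a" "Cod XP (Cmp XP b a) = Cod XP b"
    "M \<in> Mod \<Longrightarrow> ev M (Cmp XP b a) = Cmp (acat (fst M)) (ev M b) (ev M a)"
proof -
  have c: "ctrip (da b) (da a) \<in> AA"
    by (rule AA.cmp) (use XP_arr assms in \<open>auto simp: XP_dom XP_cod\<close>)
  have d: "Cmp XP b a = ea (ctrip (da b) (da a))" by (simp add: XP_def)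
  show "Cmp XP b a \<in> Arr XP" "Dom XP (Cmp XP b a) = Dom XP a" "Cod XP (Cmp XP b a) = Cod XP b"
    "M \<in> Mod \<Longrightarrow> ev M (Cmp XP b a) = Cmp (acat (fst M)) (ev M b) (ev M a)"
    unfolding d using c by (auto simp: XP_ea XP_dom XP_cod ev_def) (auto simp: ctrip_def)
qed

lemma ev_Idn: "x \<in> Ob \<Longrightarrow> M \<in> Mod \<Longrightarrow> ev M (Idn XP x) = Idn (acat (fst M)) (io M x)"
  using garr(4)[of "GId x"] by (simp add: XP_Idn)

lemma XP_category [simp]: "category XP"
proof (rule categoryI)
  fix f assume f: "f \<in> Arr XP"
  show "Dom XP f \<in> Obj XP" "Cod XP f \<in> Obj XP" using XP_typed[OF f] by auto
  have i: "garr (GId x) \<in> Arr XP" "Dom XP (garr (GId x)) = x" "Cod XP (garr (GId x)) = x" if "x \<in> Ob" for x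
    using garr[of "GId x"] that by auto
  show "Cmp XP f (Idn XP (Dom XP f)) = f" "Cmp XP (Idn XP (Cod XP f)) f = f"
    by (rule faithful; use f i[of "Dom XP f"] i[of "Cod XP f"] XP_typed[OF f] ev_Idn[unfolded XP_Idn] in \<open>simp add: XP_Cmp XP_Idn\<close>)+
  fix g assume g: "g \<in> Arr XP" "Cod XP f = Dom XP g"
  show "Cmp XP g f \<in> arrows XP (Dom XP f) (Cod XP g)" using XP_Cmp f g by (auto simp: arrows_iff)
  fix h assume h: "h \<in> Arr XP" "Cod XP g = Dom XP h"
  show "Cmp XP h (Cmp XP g f) = Cmp XP (Cmp XP h g) f"
    by (rule faithful) (use f g h in \<open>simp_all add: XP_Cmp cat_assoc\<close>)
next
  fix x assume "x \<in> Obj XP"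
  then show "Idn XP x \<in> arrows XP x x" using garr[of "GId x"] by (auto simp: arrows_iff XP_Idn)
qed

lemma appa:
  assumes w: "w \<in> words T" and fs: "length fs = ar w" "set fs \<subseteq> Arr XP"
  shows "appa w fs \<in> Arr XP" "Dom XP (appa w fs) = app w (map (Dom XP) fs)" "Cod XP (appa w fs) = app w (map (Cod XP) fs)"
    "M \<in> Mod \<Longrightarrow> ev M (appa w fs) = ar_map (aop (fst M) w) (map (ev M) fs)"
proof -
  have c: "otrip w (map da fs) \<in> AA"
  proof (rule AA.op)
    have "\<forall>f\<in>set fs. da f \<in> AA" using fs(2) XP_arr by blast
    then show "map da fs \<in> lists AA" by (simp add: in_lists_conv_set)
  qed (use w fs in auto)
  have m: "map (Dom XP) fs = map (\<lambda>a. fst (da a)) fs" "map (Cod XP) fs = map (\<lambda>a. fst (snd (da a))) fs"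
    "map (ev M) fs = map (\<lambda>a. snd (snd (da a)) M) fs" for M
    by (simp_all add: XP_dom XP_cod ev_def)
  have d: "da (appa w fs) = otrip w (map da fs)" using c by (simp add: appa_def)
  show "appa w fs \<in> Arr XP" using c by (simp add: appa_def XP_ea)
  show "Dom XP (appa w fs) = app w (map (Dom XP) fs)" "Cod XP (appa w fs) = app w (map (Cod XP) fs)"
    unfolding m XP_dom[of "appa w fs"] XP_cod[of "appa w fs"] d by (simp_all add: otrip_def o_def)
  show "M \<in> Mod \<Longrightarrow> ev M (appa w fs) = ar_map (aop (fst M) w) (map (ev M) fs)"
    unfolding m ev_def[of M "appa w fs"] d by (simp add: otrip_def o_def)
qed

text \<open>The pointwise inverse is an arrow by the rule \<open>inv\<close> of \<open>AA\<close>,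
  and the two equations hold in every model.\<close>

lemma XP_invertible:
  assumes a: "a \<in> Arr XP" and i: "\<And>M. M \<in> Mod \<Longrightarrow> invertible_arrow (acat (fst M)) (ev M a)"
  shows "ea (itrip (da a)) \<in> Arr XP" "Dom XP (ea (itrip (da a))) = Cod XP a" "Cod XP (ea (itrip (da a))) = Dom XP a"
    "Cmp XP (ea (itrip (da a))) a = Idn XP (Dom XP a)" "Cmp XP a (ea (itrip (da a))) = Idn XP (Cod XP a)"
proof -
  have c: "itrip (da a) \<in> AA"
    by (rule AA.inv) (use XP_arr a i in \<open>auto simp: ev_def\<close>)
  show d: "ea (itrip (da a)) \<in> Arr XP" "Dom XP (ea (itrip (da a))) = Cod XP a" "Cod XP (ea (itrip (da a))) = Dom XP a"
    using c by (simp_all add: XP_ea XP_dom XP_cod) (simp_all add: itrip_def)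
  have e: "ev M (ea (itrip (da a))) = inverse_arrow (acat (fst M)) (ev M a)" if "M \<in> Mod" for M
    using c that by (simp add: ev_def) (simp add: itrip_def ev_def)
  show "Cmp XP (ea (itrip (da a))) a = Idn XP (Dom XP a)" "Cmp XP a (ea (itrip (da a))) = Idn XP (Cod XP a)"
    by (rule faithful; simp add: XP_Cmp d e a inverse_arrow[OF i] XP_typed(1,2)[OF a] ev_Idn)+
qed

lemma XP_invertible_arrow:
  assumes a: "a \<in> Arr XP" and i: "\<And>M. M \<in> Mod \<Longrightarrow> invertible_arrow (acat (fst M)) (ev M a)"
  shows "invertible_arrow XP a"
  by (rule inv_arrowI[where g="ea (itrip (da a))"]) (use a XP_invertible[OF a i] in auto)

lemma garr_invertible: "gok g \<Longrightarrow> ginv g \<Longrightarrow> invertible_arrow XP (garr g)"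
  using garr gval by (auto intro!: XP_invertible_arrow)

lemma garr_arrows: "gok g \<Longrightarrow> garr g \<in> arrows XP (gsrc g) (gtgt g)"
  using garr by (auto simp: arrows_iff)

text \<open>Induction over \<open>AA\<close> restated inside the category. In the case of inverses
  the pointwise inverse appears as a two-sided inverse \<open>b\<close> of \<open>a\<close>, so that
  no triples are visible to the user.\<close>

lemma arr_induct [consumes 1, case_names gen cmp op inv]:
  assumes a: "a \<in> Arr XP"
    and "\<And>g. gok g \<Longrightarrow> Q (garr g)"
    and "\<And>a b. a \<in> Arr XP \<Longrightarrow> b \<in> Arr XP \<Longrightarrow> Cod XP a = Dom XP b \<Longrightarrow> Q a \<Longrightarrow> Q b \<Longrightarrow> Q (Cmp XP b a)"
    and "\<And>w fs. w \<in> words T \<Longrightarrow> length fs = ar w \<Longrightarrow> set fs \<subseteq> Arr XP \<Longrightarrow> (\<And>f. f \<in> set fs \<Longrightarrow> Q f) \<Longrightarrow> Q (appa w fs)"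
    and "\<And>a b. a \<in> Arr XP \<Longrightarrow> b \<in> Arr XP \<Longrightarrow> Dom XP b = Cod XP a \<Longrightarrow> Cod XP b = Dom XP a \<Longrightarrow>
       Cmp XP b a = Idn XP (Dom XP a) \<Longrightarrow> Cmp XP a b = Idn XP (Cod XP a) \<Longrightarrow> Q a \<Longrightarrow> Q b"
  shows "Q a"
proof -
  have "Q (ea t)" if "t \<in> AA" for t
    using that
  proof induction
    case (gen g)
    then show ?case using assms(2)[of g] by (simp add: garr_def)
  next
    case (cmp a b)
    then have "Q (Cmp XP (ea b) (ea a))" by (intro assms(3)) (auto simp: XP_ea XP_dom XP_cod)
    then show ?case using cmp by (simp add: XP_def)
  next
    case (op w as)
    have "Q (appa w (map ea as))" by (rule assms(4)) (use op in \<open>auto simp: XP_ea in_lists_conv_set\<close>)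
    moreover have "map da (map ea as) = as" using op by (auto simp: in_lists_conv_set intro!: map_idI)
    ultimately show ?case by (simp add: appa_def)
  next
    case (inv a)
    have a: "ea a \<in> Arr XP" using inv by (auto simp: XP_ea)
    have "invertible_arrow (acat (fst M)) (ev M (ea a))" if "M \<in> Mod" for M using inv that by (simp add: ev_def)
    note i = XP_invertible[OF a this]
    have "Q (ea (itrip (da (ea a))))"
      by (rule assms(5)[OF a i inv(3)])
    then show ?case using inv by simp
  qed
  then show ?thesis using XP_arr[OF a] by metis
qed

end

section \<open>The free pseudo algebra\<close>

context free_palg
begin

section \<open>Operations and structure cells of the free algebra\<close>

definition opP where "opP w = \<lparr>ob_map = (\<lambda>xs\<in>Obj (pow (ar w) XP). app w xs), ar_map = (\<lambda>fs\<in>Arr (pow (ar w) XP). appa w fs)\<rparr>"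

definition P :: "('t, 'u, 'u) palg" where
  "P = \<lparr>acat = XP, aop = opP,
     acmp = (\<lambda>w ws. \<lparr>nsrc = opP (tgamma T w ws), ntgt = egamma XP (map ar ws) (opP w) (map opP ws),
        cpt = (\<lambda>xs\<in>Obj (pow (sum_list (map ar ws)) XP). garr (GC w ws xs))\<rparr>),
     auni = \<lparr>nsrc = opP (tunit T), ntgt = eunit XP, cpt = (\<lambda>xs\<in>Obj (pow 1 XP). garr (GI (hd xs)))\<rparr>,
     asub = (\<lambda>w l f. \<lparr>nsrc = opP (tsub T w l f), ntgt = esub XP (opP w) l f,
        cpt = (\<lambda>xs\<in>Obj (pow l XP). garr (GS w l f xs))\<rparr>)\<rparr>"

lemma P_cat [simp]: "acat P = XP" and P_op: "aop P = opP"
  by (simp_all add: P_def)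

lemma opP_simps [simp]:
  "length xs = ar w \<Longrightarrow> set xs \<subseteq> Ob \<Longrightarrow> ob_map (opP w) xs = app w xs"
  "length fs = ar w \<Longrightarrow> set fs \<subseteq> Arr XP \<Longrightarrow> ar_map (opP w) fs = appa w fs"
  by (auto simp: opP_def)

lemma XP_Obs:
  "set fs \<subseteq> Arr XP \<Longrightarrow> set (map (Dom XP) fs) \<subseteq> Ob" "set fs \<subseteq> Arr XP \<Longrightarrow> set (map (Cod XP) fs) \<subseteq> Ob"
  using XP_typed by auto

lemma XP_id_set: "set xs \<subseteq> Ob \<Longrightarrow> set (map (Idn XP) xs) \<subseteq> Arr XP"
  by auto

lemma pow_arrow_obj: "fs \<in> Arr (pow n XP) \<Longrightarrow> M \<in> Mod \<Longrightarrow> map (Dom (acat (fst M))) (map (ev M) fs) = map (io M) (map (Dom XP) fs)"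
  "fs \<in> Arr (pow n XP) \<Longrightarrow> M \<in> Mod \<Longrightarrow> map (Cod (acat (fst M))) (map (ev M) fs) = map (io M) (map (Cod XP) fs)"
  by (auto simp: subset_iff)

lemma ev_set: "set fs \<subseteq> Arr XP \<Longrightarrow> M \<in> Mod \<Longrightarrow> set (map (ev M) fs) \<subseteq> Arr (acat (fst M))"
  by (auto simp: subset_iff)

text \<open>Preservation of identities and of composites is tested in the models, whose operations
  are functors.\<close>

lemma opP_functor:
  assumes w: "w \<in> words T"
  shows "is_functor (pow (ar w) XP) XP (opP w)"
proof (rule is_functorI)
  show "ob_map (opP w) \<in> extensional (Obj (pow (ar w) XP))" "ar_map (opP w) \<in> extensional (Arr (pow (ar w) XP))"
    by (auto simp: opP_def)
next
  fix xs assume xs: "xs \<in> Obj (pow (ar w) XP)"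
  then have s: "length xs = ar w" "set xs \<subseteq> Ob" by auto
  show "ob_map (opP w) xs \<in> Obj XP" using s w by simp
  have i: "length (map (Idn XP) xs) = ar w" "set (map (Idn XP) xs) \<subseteq> Arr XP" using XP_id_set[OF s(2)] s by auto
  have d: "map (Dom XP) (map (Idn XP) xs) = xs" "map (Cod XP) (map (Idn XP) xs) = xs" using s by (auto intro!: map_idI simp: subset_iff)
  have "appa w (map (Idn XP) xs) = Idn XP (app w xs)"
  proof (rule faithful)
    fix M assume M: "M \<in> Mod"
    interpret A: palg T "fst M" by (rule mod_palg[OF M])
    have "map (ev M) (map (Idn XP) xs) = map (Idn (acat (fst M))) (map (io M) xs)" using s M by (auto simp: ev_Idn subset_iff)
    then show "ev M (appa w (map (Idn XP) xs)) = ev M (Idn XP (app w xs))"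
      using appa(4)[OF w i M] w s M io_set[OF M s(2)] by (simp add: ev_Idn del: map_map)
  qed (use appa(1-3)[OF w i] d w s in simp_all)
  then show "ar_map (opP w) (Idn (pow (ar w) XP) xs) = Idn XP (ob_map (opP w) xs)"
    using i s by simp
next
  fix fs assume fs: "fs \<in> Arr (pow (ar w) XP)"
  then have f: "length fs = ar w" "set fs \<subseteq> Arr XP" by auto
  show "ar_map (opP w) fs \<in> Arr XP" "Dom XP (ar_map (opP w) fs) = ob_map (opP w) (Dom (pow (ar w) XP) fs)"
    "Cod XP (ar_map (opP w) fs) = ob_map (opP w) (Cod (pow (ar w) XP) fs)"
    using f appa[OF w f] XP_Obs[OF f(2)] by simp_all
  fix gs assume gs: "gs \<in> Arr (pow (ar w) XP)" and c: "Cod (pow (ar w) XP) fs = Dom (pow (ar w) XP) gs"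
  then have g: "length gs = ar w" "set gs \<subseteq> Arr XP" by auto
  have i: "fs ! i \<in> Arr XP" "gs ! i \<in> Arr XP" "Cod XP (fs ! i) = Dom XP (gs ! i)" if "i < ar w" for i
    using f g c that by (auto intro!: nth_in_set map_eq_nth)
  have cm: "Cmp (pow (ar w) XP) gs fs \<in> Arr (pow (ar w) XP)"
    using cat_cmp_arr[OF pow_category[OF XP_category] fs gs c] .
  then have m: "length (map2 (Cmp XP) gs fs) = ar w" "set (map2 (Cmp XP) gs fs) \<subseteq> Arr XP" by auto
  have d: "map (Dom XP) (map2 (Cmp XP) gs fs) = map (Dom XP) fs" "map (Cod XP) (map2 (Cmp XP) gs fs) = map (Cod XP) gs"
    using i f g by (auto intro!: nth_equalityI simp del: map_eq_conv)
  have "appa w (map2 (Cmp XP) gs fs) = Cmp XP (appa w gs) (appa w fs)"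
  proof (rule faithful)
    fix M assume M: "M \<in> Mod"
    interpret A: palg T "fst M" by (rule mod_palg[OF M])
    have "ar_map (aop (fst M) w) (map (ev M) (map2 (Cmp XP) gs fs)) = Cmp (acat (fst M)) (ar_map (aop (fst M) w) (map (ev M) gs)) (ar_map (aop (fst M) w) (map (ev M) fs))"
      by (rule A.op_comp[OF w]) (use f g i M in \<open>auto simp: XP_Cmp(4)\<close>)
    then show "ev M (appa w (map2 (Cmp XP) gs fs)) = ev M (Cmp XP (appa w gs) (appa w fs))"
      using appa[OF w m] appa[OF w f] appa[OF w g] M c by (simp add: XP_Cmp(4) del: map_map)
  qed (use appa(1-3)[OF w m] appa(1-3)[OF w f] appa(1-3)[OF w g] c d in simp_all)
  then show "ar_map (opP w) (Cmp (pow (ar w) XP) gs fs) = Cmp XP (ar_map (opP w) gs) (ar_map (opP w) fs)"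
    using f g m by simp
qed

lemma egammaP_functor:
  assumes f: "fits T w ws"
  shows "is_functor (pow (sum_list (map ar ws)) XP) XP (egamma XP (map ar ws) (opP w) (map opP ws))"
proof -
  have w: "w \<in> words T" "set ws \<subseteq> words T" "length ws = ar w" using f by (auto simp: fits_def)
  have "is_functor (pow (sum_list (map ar ws)) XP) (pow (length (map ar ws)) XP) (fprod XP (map ar ws) (map opP ws))"
    by (rule fprod_functor) (use opP_functor nth_in_set[OF w(2)] in auto)
  then show ?thesis unfolding egamma_def
    using w by (auto intro!: fcmp_functor[of _ "pow (ar w) XP"] pow_category opP_functor)
qed

lemma esubP_functor:
  assumes w: "w \<in> words T" "index_map (ar w) l f"
  shows "is_functor (pow l XP) XP (esub XP (opP w) l f)"
  using reindex_functor[OF XP_category, of f l] w unfolding esub_def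
  by (auto intro!: fcmp_functor[of _ "pow (ar w) XP"] pow_category opP_functor simp: index_map_def)

text \<open>Naturality of each structure cell is its naturality in every model, carried over by
  \<open>faithful\<close>; invertibility comes from \<open>garr_invertible\<close>, hence from the
  inverses adjoined to \<open>AA\<close>.\<close>

sublocale P: typed_palg T P
proof unfold_locales
  show "category (acat P)" by simp
  show "w \<in> words T \<Longrightarrow> is_functor (pow (ar w) (acat P)) (acat P) (aop P w)" for w
    by (simp add: opP_functor P_op)
next
  fix w ws assume f: "fits T w ws"
  let ?N = "sum_list (map ar ws)"
  have w: "w \<in> words T" "set ws \<subseteq> words T" "length ws = ar w" using f by (auto simp: fits_def)
  have G: "tgamma T w ws \<in> words T" "ar (tgamma T w ws) = ?N" using f by auto
  have wi: "i < length ws \<Longrightarrow> ws ! i \<in> words T" for i using nth_in_set[OF w(2)] .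
  have ob: "ob_map (egamma XP (map ar ws) (opP w) (map opP ws)) xs = app w (pob ws xs)" if "length xs = ?N" "set xs \<subseteq> Ob" for xs
  proof -
    have "map2 (\<lambda>u. ob_map (opP u)) ws (blocks (map ar ws) xs) = pob ws xs"
      using blocks_obj[of _ "map ar ws" xs Ob] that by (auto simp: pob_def intro!: nth_equalityI simp del: map_eq_conv)
    then show ?thesis using pob[OF w(2) that] that w by (simp add: egamma_def)
  qed
  have "is_niso (pow ?N XP) XP (nsrc (acmp P w ws)) (ntgt (acmp P w ws)) (acmp P w ws)"
  proof (rule nisoI)
    show "is_functor (pow ?N XP) XP (nsrc (acmp P w ws))" "is_functor (pow ?N XP) XP (ntgt (acmp P w ws))"
      using opP_functor[OF G(1)] egammaP_functor[OF f] G by (simp_all add: P_def)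
    show "cpt (acmp P w ws) \<in> extensional (Obj (pow ?N XP))" by (simp add: P_def)
  next
    fix xs assume "xs \<in> Obj (pow ?N XP)"
    then have xs: "length xs = ?N" "set xs \<subseteq> Ob" by auto
    have g: "gok (GC w ws xs)" using f xs by simp
    show "cpt (acmp P w ws) xs \<in> arrows XP (ob_map (nsrc (acmp P w ws)) xs) (ob_map (ntgt (acmp P w ws)) xs)"
      using garr_arrows[OF g] xs ob[OF xs] G by (simp add: P_def)
    show "invertible_arrow XP (cpt (acmp P w ws) xs)"
      using garr_invertible[OF g] xs by (simp add: P_def)
  next
    fix fs assume fs0: "fs \<in> Arr (pow ?N XP)"
    then have fs: "length fs = ?N" "set fs \<subseteq> Arr XP" by auto
    let ?ds = "map (Dom XP) fs" and ?cs = "map (Cod XP) fs"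
    have ds: "length ?ds = ?N" "set ?ds \<subseteq> Ob" and cs: "length ?cs = ?N" "set ?cs \<subseteq> Ob" using fs XP_Obs by auto
    have gd: "gok (GC w ws ?ds)" and gc: "gok (GC w ws ?cs)" using f ds cs by simp_all
    have fG: "length fs = ar (tgamma T w ws)" using fs G by simp
    \<comment> \<open>The arrow part of the product of the inner operations at \<open>fs\<close>,
      block by block. Its ends are the lists \<open>pob\<close> of the ends of
      \<open>fs\<close>.\<close>
    define l where "l = map2 appa ws (blocks (map ar ws) fs)"
    have b: "length (blocks (map ar ws) fs ! i) = ar (ws ! i)" "set (blocks (map ar ws) fs ! i) \<subseteq> Arr XP" if "i < length ws" for i
      using blocks_obj[of i "map ar ws" fs "Arr XP"] that fs by auto
    have li: "l ! i = appa (ws ! i) (blocks (map ar ws) fs ! i)" if "i < length ws" for i using that by (simp add: l_def)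
    have ll: "length l = ar w" by (simp add: l_def w)
    have lA: "set l \<subseteq> Arr XP" using appa(1)[OF wi b] li ll w by (auto simp: in_set_conv_nth)
    have ld: "map (Dom XP) l = pob ws ?ds" "map (Cod XP) l = pob ws ?cs"
      using appa(2,3)[OF wi b] li ll w pob[OF w(2) ds] pob[OF w(2) cs] by (auto intro!: nth_equalityI simp: blocks_map simp del: map_eq_conv)
    have eg: "ar_map (egamma XP (map ar ws) (opP w) (map opP ws)) fs = appa w l"
    proof -
      have "map2 (\<lambda>u. ar_map (opP u)) ws (blocks (map ar ws) fs) = l"
        using b by (auto simp: l_def intro!: nth_equalityI simp del: map_eq_conv)
      then show ?thesis using fs lA ll by (simp add: egamma_def)
    qed
    have "Cmp XP (garr (GC w ws ?cs)) (appa (tgamma T w ws) fs) = Cmp XP (appa w l) (garr (GC w ws ?ds))"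
    proof (rule faithful)
      fix M assume M: "M \<in> Mod"
      interpret A: palg T "fst M" by (rule mod_palg[OF M])
      have "map (ev M) l = map2 (\<lambda>u. ar_map (aop (fst M) u)) ws (blocks (map ar ws) (map (ev M) fs))"
        using ll w li appa(4)[OF wi b M] by (auto intro!: nth_equalityI simp: blocks_map simp del: map_eq_conv)
      then show "ev M (Cmp XP (garr (GC w ws ?cs)) (appa (tgamma T w ws) fs)) = ev M (Cmp XP (appa w l) (garr (GC w ws ?ds)))"
        using A.acmp_nat[OF f, of "map (ev M) fs"] ev_set[OF fs(2) M] fs pow_arrow_obj[OF fs0 M] M
          garr[OF gd] garr[OF gc] appa[OF G(1) fG fs(2)] appa[OF w(1) ll lA] ld
        by (simp add: XP_Cmp(4) del: map_map)
    qed (use garr[OF gd] garr[OF gc] appa(1-3)[OF G(1) fG fs(2)] appa(1-3)[OF w(1) ll lA] ld in \<open>simp_all add: XP_Cmp\<close>)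
    then show "Cmp XP (cpt (acmp P w ws) (Cod (pow ?N XP) fs)) (ar_map (nsrc (acmp P w ws)) fs) =
       Cmp XP (ar_map (ntgt (acmp P w ws)) fs) (cpt (acmp P w ws) (Dom (pow ?N XP) fs))"
      using ds cs fs fG eg by (simp add: P_def)
  qed
  then show "is_niso (pow ?N (acat P)) (acat P) (aop P (tgamma T w ws)) (egamma (acat P) (map ar ws) (aop P w) (map (aop P) ws)) (acmp P w ws)"
    by (simp add: P_def)
next
  have "is_niso (pow 1 XP) XP (nsrc (auni P)) (ntgt (auni P)) (auni P)"
  proof (rule nisoI)
    show "is_functor (pow 1 XP) XP (nsrc (auni P))" "is_functor (pow 1 XP) XP (ntgt (auni P))"
      using opP_functor[OF tunit_word(1)] eunit_functor[OF XP_category] by (simp_all add: P_def)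
    show "cpt (auni P) \<in> extensional (Obj (pow 1 XP))" by (simp add: P_def)
  next
    fix xs assume "xs \<in> Obj (pow 1 XP)"
    then obtain x where x: "xs = [x]" "x \<in> Ob" by (auto simp: length_Suc_conv)
    then have g: "gok (GI x)" by simp
    show "cpt (auni P) xs \<in> arrows XP (ob_map (nsrc (auni P)) xs) (ob_map (ntgt (auni P)) xs)"
      using garr_arrows[OF g] x by (simp add: P_def eunit_def)
    show "invertible_arrow XP (cpt (auni P) xs)"
      using garr_invertible[OF g] x by (simp add: P_def)
  next
    fix fs assume "fs \<in> Arr (pow 1 XP)"
    then obtain a where a: "fs = [a]" "a \<in> Arr XP" by (auto simp: length_Suc_conv)
    have d: "gok (GI (Dom XP a))" "gok (GI (Cod XP a))" using XP_typed[OF a(2)] by auto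
    have as: "length [a] = ar (tunit T)" "set [a] \<subseteq> Arr XP" using a by auto
    have "Cmp XP (garr (GI (Cod XP a))) (appa (tunit T) [a]) = Cmp XP a (garr (GI (Dom XP a)))"
    proof (rule faithful)
      fix M assume M: "M \<in> Mod"
      interpret A: palg T "fst M" by (rule mod_palg[OF M])
      show "ev M (Cmp XP (garr (GI (Cod XP a))) (appa (tunit T) [a])) = ev M (Cmp XP a (garr (GI (Dom XP a))))"
        using A.auni_nat[of "ev M a"] a M garr[OF d(1)] garr[OF d(2)] appa[OF tunit_word(1) as] by (simp add: XP_Cmp(4))
    qed (use a garr[OF d(1)] garr[OF d(2)] appa(1-3)[OF tunit_word(1) as] in \<open>simp_all add: XP_Cmp\<close>)
    then show "Cmp XP (cpt (auni P) (Cod (pow 1 XP) fs)) (ar_map (nsrc (auni P)) fs) =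
       Cmp XP (ar_map (ntgt (auni P)) fs) (cpt (auni P) (Dom (pow 1 XP) fs))"
      using a as XP_typed[OF a(2)] by (simp add: P_def eunit_def)
  qed
  then show "is_niso (pow 1 (acat P)) (acat P) (aop P (tunit T)) (eunit (acat P)) (auni P)"
    by (simp add: P_def)
next
  fix w l f assume w: "w \<in> words T" "index_map (ar w) l f"
  have G: "tsub T w l f \<in> words T" "ar (tsub T w l f) = l" using w by auto
  have "is_niso (pow l XP) XP (nsrc (asub P w l f)) (ntgt (asub P w l f)) (asub P w l f)"
  proof (rule nisoI)
    show "is_functor (pow l XP) XP (nsrc (asub P w l f))" "is_functor (pow l XP) XP (ntgt (asub P w l f))"
      using opP_functor[OF G(1)] esubP_functor[OF w] G by (simp_all add: P_def)
    show "cpt (asub P w l f) \<in> extensional (Obj (pow l XP))" by (simp add: P_def)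
  next
    fix xs assume "xs \<in> Obj (pow l XP)"
    then have xs: "length xs = l" "set xs \<subseteq> Ob" by auto
    have g: "gok (GS w l f xs)" using w xs by simp
    show "cpt (asub P w l f) xs \<in> arrows XP (ob_map (nsrc (asub P w l f)) xs) (ob_map (ntgt (asub P w l f)) xs)"
      using garr_arrows[OF g] xs G index_set[OF w(2) xs] by (simp add: P_def esub_def)
    show "invertible_arrow XP (cpt (asub P w l f) xs)"
      using garr_invertible[OF g] xs by (simp add: P_def)
  next
    fix fs assume fs0: "fs \<in> Arr (pow l XP)"
    then have fs: "length fs = l" "set fs \<subseteq> Arr XP" by auto
    let ?ds = "map (Dom XP) fs" and ?cs = "map (Cod XP) fs"
    have ds: "length ?ds = l" "set ?ds \<subseteq> Ob" and cs: "length ?cs = l" "set ?cs \<subseteq> Ob" using fs XP_Obs by auto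
    have gd: "gok (GS w l f ?ds)" and gc: "gok (GS w l f ?cs)" using w ds cs by simp_all
    have fG: "length fs = ar (tsub T w l f)" using fs G by simp
    have ff: "length (map ((!) fs) f) = ar w" "set (map ((!) fs) f) \<subseteq> Arr XP" using index_set[OF w(2) fs] by auto
    have fi: "i \<in> set f \<Longrightarrow> i < length fs" for i using w fs by (auto simp: index_map_def)
    have dd: "map (Dom XP) (map ((!) fs) f) = map ((!) ?ds) f" "map (Cod XP) (map ((!) fs) f) = map ((!) ?cs) f" using fi by auto
    have "Cmp XP (garr (GS w l f ?cs)) (appa (tsub T w l f) fs) = Cmp XP (appa w (map ((!) fs) f)) (garr (GS w l f ?ds))"
    proof (rule faithful)
      fix M assume M: "M \<in> Mod"
      interpret A: palg T "fst M" by (rule mod_palg[OF M])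
      have e: "map (ev M) (map ((!) fs) f) = map ((!) (map (ev M) fs)) f" using fi by auto
      show "ev M (Cmp XP (garr (GS w l f ?cs)) (appa (tsub T w l f) fs)) = ev M (Cmp XP (appa w (map ((!) fs) f)) (garr (GS w l f ?ds)))"
        using A.asub_nat[OF w, of "map (ev M) fs"] ev_set[OF fs(2) M] fs pow_arrow_obj[OF fs0 M] M
          garr[OF gd] garr[OF gc] appa[OF G(1) fG fs(2)] appa[OF w(1) ff] dd e
        by (simp add: XP_Cmp(4) del: map_map map_eq_conv)
    qed (use garr[OF gd] garr[OF gc] appa(1-3)[OF G(1) fG fs(2)] appa(1-3)[OF w(1) ff] dd in \<open>simp_all add: XP_Cmp del: map_map map_eq_conv\<close>)
    then show "Cmp XP (cpt (asub P w l f) (Cod (pow l XP) fs)) (ar_map (nsrc (asub P w l f)) fs) =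
       Cmp XP (ar_map (ntgt (asub P w l f)) fs) (cpt (asub P w l f) (Dom (pow l XP) fs))"
      using ds cs fs fG ff by (simp add: P_def esub_def)
  qed
  then show "is_niso (pow l (acat P)) (acat P) (aop P (tsub T w l f)) (esub (acat P) (aop P w) l f) (asub P w l f)"
    by (simp add: P_def)
qed

section \<open>Evaluation of the structure of the free algebra\<close>

lemma P_simps:
  "w \<in> words T \<Longrightarrow> length xs = ar w \<Longrightarrow> set xs \<subseteq> Ob \<Longrightarrow> ob_map (aop P w) xs = app w xs"
  "w \<in> words T \<Longrightarrow> length fs = ar w \<Longrightarrow> set fs \<subseteq> Arr XP \<Longrightarrow> ar_map (aop P w) fs = appa w fs"
  "length xs = sum_list (map ar ws) \<Longrightarrow> set xs \<subseteq> Ob \<Longrightarrow> cpt (acmp P w ws) xs = garr (GC w ws xs)"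
  "x \<in> Ob \<Longrightarrow> cpt (auni P) [x] = garr (GI x)"
  "length xs = l \<Longrightarrow> set xs \<subseteq> Ob \<Longrightarrow> cpt (asub P w l f) xs = garr (GS w l f xs)"
  by (auto simp: P_def)

lemma P_opb:
  assumes "set ws \<subseteq> words T" "length xs = sum_list (map ar ws)" "set xs \<subseteq> Ob"
  shows "P.opb ws xs = pob ws xs"
  using blocks_obj[of _ "map ar ws" xs Ob] assms pob[OF assms] nth_in_set[OF assms(1)]
  by (auto simp: P_simps intro!: nth_equalityI simp del: map_eq_conv)

lemma ev_op:
  assumes "M \<in> Mod" "w \<in> words T" "length fs = ar w" "set fs \<subseteq> Arr XP"
  shows "ev M (ar_map (aop P w) fs) = ar_map (aop (fst M) w) (map (ev M) fs)"
  using assms by (simp add: P_simps appa(4))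

lemma io_op:
  assumes "M \<in> Mod" "w \<in> words T" "length xs = ar w" "set xs \<subseteq> Ob"
  shows "io M (ob_map (aop P w) xs) = ob_map (aop (fst M) w) (map (io M) xs)"
  using assms by (simp add: P_simps)

text \<open>Evaluation carries the structure cells to those of the model with no comparison cells in
  between. For this reason a law of the model is literally the value of the corresponding law in the
  free algebra.\<close>

lemma ev_structure:
  assumes M: "M \<in> Mod"
  shows "fits T w ws \<Longrightarrow> length xs = sum_list (map ar ws) \<Longrightarrow> set xs \<subseteq> Ob \<Longrightarrow> ev M (cpt (acmp P w ws) xs) = cpt (acmp (fst M) w ws) (map (io M) xs)"
   "x \<in> Ob \<Longrightarrow> ev M (cpt (auni P) [x]) = cpt (auni (fst M)) [io M x]"
   "w \<in> words T \<Longrightarrow> index_map (ar w) l f \<Longrightarrow> length xs = l \<Longrightarrow> set xs \<subseteq> Ob \<Longrightarrow> ev M (cpt (asub P w l f) xs) = cpt (asub (fst M) w l f) (map (io M) xs)"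
  using M by (simp_all add: P_simps garr)

lemma io_opb:
  assumes M: "M \<in> Mod" and ws: "set ws \<subseteq> words T" "length xs = sum_list (map ar ws)" "set xs \<subseteq> Ob"
  shows "map (io M) (P.opb ws xs) = typed_palg.opb T (fst M) ws (map (io M) xs)"
  using io_pob[OF assms] P_opb[OF ws] by simp

text \<open>The values of the two sides in a model are the two sides of the model's own law. The
  domains agree by \<open>tgamma_assoc\<close>, the codomains by \<open>opb_opb\<close>, so
  \<open>faithful\<close> applies. The remaining laws are proved by the same scheme.\<close>

lemma P_coherence1:
  assumes f: "fits T w ws" "list_all2 (fits T) ws wss" and xs: "length xs = sum_list (map ar (concat wss))" "set xs \<subseteq> Ob"
  shows "Cmp XP (cpt (acmp P w ws) (P.opb (concat wss) xs)) (cpt (acmp P (tgamma T w ws) (concat wss)) xs)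
     = Cmp XP (ar_map (aop P w) (map2 cpt (map2 (acmp P) ws wss) (blocks (map ar (map2 (tgamma T) ws wss)) xs)))
         (cpt (acmp P w (map2 (tgamma T) ws wss)) xs)"
proof -
  note fn = fits_nested[OF f]
  define us where "us = map2 (tgamma T) ws wss"
  define cs where "cs = concat wss"
  have w: "w \<in> words T" "set ws \<subseteq> words T" "length ws = ar w" using f by (auto simp: fits_def)
  have fu: "fits T w us" and fc: "fits T (tgamma T w ws) cs" using fn by (auto simp: us_def cs_def)
  have uW: "set us \<subseteq> words T" and cW: "set cs \<subseteq> words T" using fu fc by (auto simp: fits_def)
  have lu: "length us = ar w" using w fn by (simp add: us_def)
  have xc: "length xs = sum_list (map ar cs)" using xs by (simp add: cs_def)
  have xu: "length xs = sum_list (map ar us)"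
    using xs fn(5) by (simp add: us_def map_concat sum_list_concat o_def)
  have oc: "length (P.opb cs xs) = sum_list (map ar ws)" "set (P.opb cs xs) \<subseteq> Ob"
    using fn(6) P.opb_obj[OF cW] xc xs by (auto simp: cs_def)
  define l where "l = map2 cpt (map2 (acmp P) ws wss) (blocks (map ar us) xs)"
  have ll: "length l = ar w" using fn w lu by (simp add: l_def)
  have b: "length (blocks (map ar us) xs ! i) = sum_list (map ar (wss ! i))" "set (blocks (map ar us) xs ! i) \<subseteq> Ob" if "i < ar w" for i
    using blocks_obj[of i "map ar us" xs Ob] that xu xs lu fn(5) w fn(1) by (auto simp: us_def)
  have fi: "fits T (ws ! i) (wss ! i)" if "i < ar w" for i using fn(2) that w by simp
  have li: "l ! i = cpt (acmp P (ws ! i) (wss ! i)) (blocks (map ar us) xs ! i)" if "i < ar w" for i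
    using that fn(1) w lu by (simp add: l_def)
  have lt: "l ! i \<in> arrows XP (P.opb us xs ! i) (ob_map (aop P (ws ! i)) (P.opb (wss ! i) (blocks (map ar us) xs ! i)))" if i: "i < ar w" for i
    using P.acmp_simps[OF fi[OF i], of "blocks (map ar us) xs ! i"] b[OF i] li[OF i] lu i w fn(1) by (simp add: arrows_iff us_def)
  have d: "ar_map (aop P w) l \<in> arrows XP (ob_map (aop P w) (P.opb us xs)) (ob_map (aop P w) (P.opb ws (P.opb cs xs)))"
    unfolding cs_def P.opb_opb[OF f xs(1)] using P.op_arr[OF w(1) ll, of "P.opb us xs"] lt lu w by (simp add: us_def)
  have lA: "set l \<subseteq> Arr XP" using lt ll by (auto simp: in_set_conv_nth arrows_iff)
  have a: "cpt (acmp P (tgamma T w ws) cs) xs \<in> arrows XP (ob_map (aop P (tgamma T (tgamma T w ws) cs)) xs) (ob_map (aop P (tgamma T w ws)) (P.opb cs xs))"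
    using P.acmp_simps[OF fc xc] xs by (simp add: arrows_iff)
  have b': "cpt (acmp P w ws) (P.opb cs xs) \<in> arrows XP (ob_map (aop P (tgamma T w ws)) (P.opb cs xs)) (ob_map (aop P w) (P.opb ws (P.opb cs xs)))"
    using P.acmp_simps[OF f(1) oc(1)] oc by (simp add: arrows_iff)
  have c: "cpt (acmp P w us) xs \<in> arrows XP (ob_map (aop P (tgamma T w us)) xs) (ob_map (aop P w) (P.opb us xs))"
    using P.acmp_simps[OF fu xu] xs by (simp add: arrows_iff)
  show ?thesis
    unfolding us_def[symmetric] cs_def[symmetric] l_def[symmetric]
  proof (rule faithful)
    fix M assume M: "M \<in> Mod"
    interpret A: palg T "fst M" by (rule mod_palg[OF M])
    have "map (ev M) l = map2 cpt (map2 (acmp (fst M)) ws wss) (blocks (map ar us) (map (io M) xs))"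
      using ll li b fi w lu fn(1) by (auto intro!: nth_equalityI simp: ev_structure[OF M] blocks_map simp del: map_eq_conv)
    then show "ev M (Cmp XP (cpt (acmp P w ws) (P.opb cs xs)) (cpt (acmp P (tgamma T w ws) cs) xs)) =
         ev M (Cmp XP (ar_map (aop P w) l) (cpt (acmp P w us) xs))"
      using A.coh(1)[OF f, of "map (io M) xs"] io_set[OF M xs(2)] xs a b' c d M w ll lA oc xc xu f fc fu io_opb[OF M cW xc xs(2)]
      by (simp add: XP_Cmp(4) arrows_iff ev_structure[OF M] ev_op us_def[symmetric] cs_def[symmetric] del: map_map)
  qed (use a b' c d tgamma_assoc[OF f] in \<open>simp_all add: XP_Cmp arrows_iff us_def cs_def\<close>)
qed

lemma P_coherence2:
  assumes w: "w \<in> words T" and xs: "length xs = ar w" "set xs \<subseteq> Ob"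
  shows "Cmp XP (ar_map (aop P w) (map (\<lambda>x. cpt (auni P) [x]) xs)) (cpt (acmp P w (replicate (ar w) (tunit T))) xs) = Idn XP (ob_map (aop P w) xs)"
proof -
  let ?u = "replicate (ar w) (tunit T)" and ?l = "map (\<lambda>x. cpt (auni P) [x]) xs"
  have f: "fits T w ?u" using w by (auto simp: fits_def)
  have xu: "length xs = sum_list (map ar ?u)" using xs by (simp add: sum_list_replicate)
  have uW: "set ?u \<subseteq> words T" by auto
  have xi: "xs ! i \<in> Ob" if "i < ar w" for i using xs that by (auto intro!: nth_in_set)
  have "i < ar w \<Longrightarrow> P.opb ?u xs ! i = ob_map (aop P (tunit T)) [xs ! i]" for i
    using P.unit_block[of i xs] xs by simp
  then have lt: "?l ! i \<in> arrows XP (P.opb ?u xs ! i) (xs ! i)" if "i < ar w" for i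
    using P.auni_simps[of "xs ! i"] xi[OF that] that xs by (simp add: arrows_iff)
  have l: "ar_map (aop P w) ?l \<in> arrows XP (ob_map (aop P w) (P.opb ?u xs)) (ob_map (aop P w) xs)"
    using P.op_arr[OF w, of ?l "P.opb ?u xs" xs] lt xs by simp
  have lA: "set ?l \<subseteq> Arr XP" using lt xs by (auto simp: in_set_conv_nth arrows_iff)
  have a: "cpt (acmp P w ?u) xs \<in> arrows XP (ob_map (aop P w) xs) (ob_map (aop P w) (P.opb ?u xs))"
    using P.acmp_simps[OF f xu] xs tgamma_unit_right[OF w] by (simp add: arrows_iff)
  show ?thesis
  proof (rule faithful)
    fix M assume M: "M \<in> Mod"
    interpret A: palg T "fst M" by (rule mod_palg[OF M])
    have "map (ev M) ?l = map (\<lambda>x. cpt (auni (fst M)) [x]) (map (io M) xs)"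
      using xs M by (auto simp: ev_structure subset_iff)
    then show "ev M (Cmp XP (ar_map (aop P w) ?l) (cpt (acmp P w ?u) xs)) = ev M (Idn XP (ob_map (aop P w) xs))"
      using A.coh(2)[OF w, of "map (io M) xs"] io_set[OF M xs(2)] xs a l M w lA f xu
      by (simp add: XP_Cmp(4) arrows_iff ev_structure(1)[OF M f xu xs(2)] ev_op ev_Idn P_simps(1) del: map_map)
  qed (use a l w xs in \<open>simp_all add: XP_Cmp arrows_iff P_simps(1)\<close>)
qed

lemma P_coherence3:
  assumes w: "w \<in> words T" and xs: "length xs = ar w" "set xs \<subseteq> Ob"
  shows "Cmp XP (cpt (auni P) [ob_map (aop P w) xs]) (cpt (acmp P (tunit T) [w]) xs) = Idn XP (ob_map (aop P w) xs)"
proof -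
  have f: "fits T (tunit T) [w]" using w by (auto simp: fits_def)
  have xu: "length xs = sum_list (map ar [w])" using xs by simp
  have o: "ob_map (aop P w) xs \<in> Ob" using w xs by (simp add: P_simps)
  have opb: "P.opb [w] xs = [ob_map (aop P w) xs]" using xs by (simp add: P.opb_def)
  have a: "cpt (acmp P (tunit T) [w]) xs \<in> arrows XP (ob_map (aop P w) xs) (ob_map (aop P (tunit T)) [ob_map (aop P w) xs])"
    using P.acmp_simps[OF f xu] xs tgamma_unit_left[OF w] opb by (simp add: arrows_iff)
  have b: "cpt (auni P) [ob_map (aop P w) xs] \<in> arrows XP (ob_map (aop P (tunit T)) [ob_map (aop P w) xs]) (ob_map (aop P w) xs)"
    using P.auni_simps[of "ob_map (aop P w) xs"] o by (simp add: arrows_iff)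
  show ?thesis
  proof (rule faithful)
    fix M assume M: "M \<in> Mod"
    interpret A: palg T "fst M" by (rule mod_palg[OF M])
    show "ev M (Cmp XP (cpt (auni P) [ob_map (aop P w) xs]) (cpt (acmp P (tunit T) [w]) xs)) = ev M (Idn XP (ob_map (aop P w) xs))"
      using A.coh(3)[OF w, of "map (io M) xs"] io_set[OF M xs(2)] xs a b o M w f xu
      by (simp add: XP_Cmp(4) arrows_iff ev_structure[OF M] ev_Idn io_op del: map_map)
  qed (use a b o in \<open>simp_all add: XP_Cmp arrows_iff\<close>)
qed

lemma map_index_io: "set f \<subseteq> {..<length xs} \<Longrightarrow> map g (map ((!) xs) f) = map ((!) (map g xs)) f"
  by (auto simp: subset_iff)

lemma P_coherence4:
  assumes w: "w \<in> words T" and ws: "set ws \<subseteq> words T" "index_map (ar w) (length ws) f"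
    and xs: "length xs = sum_list (map ar ws)" "set xs \<subseteq> Ob"
  shows "Cmp XP (cpt (acmp P w (map ((!) ws) f)) (map ((!) xs) (block_map (map ar ws) f)))
        (cpt (asub P (tgamma T w (map ((!) ws) f)) (sum_list (map ar ws)) (block_map (map ar ws) f)) xs)
     = Cmp XP (cpt (asub P w (length ws) f) (P.opb ws xs)) (cpt (acmp P (tsub T w (length ws) f) ws) xs)"
proof -
  let ?wf = "map ((!) ws) f" and ?N = "sum_list (map ar ws)" and ?g = "block_map (map ar ws) f"
  have f: "length f = ar w" "set f \<subseteq> {..<length ws}" using ws by (auto simp: index_map_def)
  have wf: "set ?wf \<subseteq> words T" using set_map_nth_subset[OF f(2) ws(1)] .
  have fw: "fits T w ?wf" using w f wf by (auto simp: fits_def)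
  have arw: "map ((!) (map ar ws)) f = map ar ?wf" using f by (auto simp: subset_iff)
  have g: "index_map (ar (tgamma T w ?wf)) ?N ?g"
    using block_map_index[of f "map ar ws"] f(2) fw unfolding arw by auto
  then have gs: "set ?g \<subseteq> {..<length xs}" using xs by (auto simp: index_map_def)
  have G: "tgamma T w ?wf \<in> words T" using fw by simp
  have fs: "fits T (tsub T w (length ws) f) ws" using w ws by (simp add: fits_def)
  have yl: "length (map ((!) xs) ?g) = sum_list (map ar ?wf)" "set (map ((!) xs) ?g) \<subseteq> Ob" using index_set[OF g xs] fw by auto
  have o: "length (P.opb ws xs) = length ws" "set (P.opb ws xs) \<subseteq> Ob" using P.opb_obj[OF ws(1) xs(1)] xs by auto
  have a: "cpt (asub P (tgamma T w ?wf) ?N ?g) xs \<in> arrows XP (ob_map (aop P (tsub T (tgamma T w ?wf) ?N ?g)) xs) (ob_map (aop P (tgamma T w ?wf)) (map ((!) xs) ?g))"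
    using P.asub_simps[OF G g xs(1)] xs by (simp add: arrows_iff)
  have b: "cpt (acmp P w ?wf) (map ((!) xs) ?g) \<in> arrows XP (ob_map (aop P (tgamma T w ?wf)) (map ((!) xs) ?g)) (ob_map (aop P w) (map ((!) (P.opb ws xs)) f))"
    using P.acmp_simps[OF fw yl(1)] yl P.opb_block_map[OF ws(1) f(2) xs(1)] by (simp add: arrows_iff)
  have c: "cpt (acmp P (tsub T w (length ws) f) ws) xs \<in> arrows XP (ob_map (aop P (tgamma T (tsub T w (length ws) f) ws)) xs) (ob_map (aop P (tsub T w (length ws) f)) (P.opb ws xs))"
    using P.acmp_simps[OF fs xs(1)] xs by (simp add: arrows_iff)
  have d: "cpt (asub P w (length ws) f) (P.opb ws xs) \<in> arrows XP (ob_map (aop P (tsub T w (length ws) f)) (P.opb ws xs)) (ob_map (aop P w) (map ((!) (P.opb ws xs)) f))"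
    using P.asub_simps[OF w ws(2) o(1)] o by (simp add: arrows_iff)
  show ?thesis
  proof (rule faithful)
    fix M assume M: "M \<in> Mod"
    interpret A: palg T "fst M" by (rule mod_palg[OF M])
    have "ev M (Cmp XP (cpt (acmp P w ?wf) (map ((!) xs) ?g)) (cpt (asub P (tgamma T w ?wf) ?N ?g) xs))
      = Cmp (acat (fst M)) (cpt (acmp (fst M) w ?wf) (map ((!) (map (io M) xs)) ?g)) (cpt (asub (fst M) (tgamma T w ?wf) ?N ?g) (map (io M) xs))"
      unfolding map_index_io[OF gs, symmetric]
      using a b M by (simp add: XP_Cmp(4) arrows_iff ev_structure(1)[OF M fw yl] ev_structure(3)[OF M G g xs] del: map_map)
    moreover have "ev M (Cmp XP (cpt (asub P w (length ws) f) (P.opb ws xs)) (cpt (acmp P (tsub T w (length ws) f) ws) xs))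
      = Cmp (acat (fst M)) (cpt (asub (fst M) w (length ws) f) (A.opb ws (map (io M) xs))) (cpt (acmp (fst M) (tsub T w (length ws) f) ws) (map (io M) xs))"
      using c d M by (simp add: XP_Cmp(4) arrows_iff ev_structure(1)[OF M fs xs] ev_structure(3)[OF M w ws(2) o] io_opb[OF M ws(1) xs] del: map_map)
    ultimately show "ev M (Cmp XP (cpt (acmp P w ?wf) (map ((!) xs) ?g)) (cpt (asub P (tgamma T w ?wf) ?N ?g) xs)) =
         ev M (Cmp XP (cpt (asub P w (length ws) f) (P.opb ws xs)) (cpt (acmp P (tsub T w (length ws) f) ws) xs))"
      using A.coh(4)[OF w ws, of "map (io M) xs"] io_set[OF M xs(2)] xs by simp
  qed (use a b c d tgamma_block_map[OF w ws] in \<open>simp_all add: XP_Cmp arrows_iff\<close>)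
qed

lemma P_coherence5:
  assumes f: "fits T w ws" and l: "length ns' = length ws" "length gs = length ws"
    and g: "\<forall>j<length ws. index_map (ar (ws ! j)) (ns' ! j) (gs ! j)" and xs: "length xs = sum_list ns'" "set xs \<subseteq> Ob"
  shows "Cmp XP (cpt (acmp P w ws) (map ((!) xs) (block_sum ns' gs)))
        (cpt (asub P (tgamma T w ws) (sum_list ns') (block_sum ns' gs)) xs)
     = Cmp XP (ar_map (aop P w) (map2 cpt (map (\<lambda>j. asub P (ws ! j) (ns' ! j) (gs ! j)) [0..<length ws]) (blocks ns' xs)))
        (cpt (acmp P w (map (\<lambda>j. tsub T (ws ! j) (ns' ! j) (gs ! j)) [0..<length ws])) xs)"
proof -
  let ?N = "sum_list ns'" and ?g = "block_sum ns' gs"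
  define us where "us = map (\<lambda>j. tsub T (ws ! j) (ns' ! j) (gs ! j)) [0..<length ws]"
  define ss where "ss = map2 cpt (map (\<lambda>j. asub P (ws ! j) (ns' ! j) (gs ! j)) [0..<length ws]) (blocks ns' xs)"
  have w: "w \<in> words T" "length ws = ar w" "set ws \<subseteq> words T" using f by (auto simp: fits_def)
  have wi: "i < length ws \<Longrightarrow> ws ! i \<in> words T" for i using w by (rule_tac nth_in_set)
  have lu: "length us = ar w" "length ss = ar w" using w l by (auto simp: us_def ss_def)
  have ui: "us ! i \<in> words T" "ar (us ! i) = ns' ! i" if "i < length ws" for i
    using wi that g by (auto simp: us_def)
  have fu: "fits T w us" using w lu ui by (auto simp: fits_def in_set_conv_nth)
  have nu: "map ar us = ns'" using ui lu l w by (auto intro!: nth_equalityI)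
  have G: "tgamma T w ws \<in> words T" using f by simp
  have gi: "index_map (ar (tgamma T w ws)) ?N ?g"
    using block_sum_index[of ns' gs "map ar ws"] f l g by simp
  then have gs: "set ?g \<subseteq> {..<length xs}" using xs by (auto simp: index_map_def)
  have xu: "length xs = sum_list (map ar us)" using xs nu by simp
  have yl: "length (map ((!) xs) ?g) = sum_list (map ar ws)" "set (map ((!) xs) ?g) \<subseteq> Ob" using index_set[OF gi xs] f by auto
  have b: "length (blocks ns' xs ! i) = ns' ! i" "set (blocks ns' xs ! i) \<subseteq> Ob" if "i < length ws" for i
    using blocks_obj[of i ns' xs Ob] that l xs by auto
  have si: "ss ! i = cpt (asub P (ws ! i) (ns' ! i) (gs ! i)) (blocks ns' xs ! i)" if "i < length ws" for i
    using that l by (simp add: ss_def)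
  have st: "ss ! i \<in> arrows XP (P.opb us xs ! i) (map (\<lambda>i. ob_map (aop P (ws ! i)) (map ((!) (blocks ns' xs ! i)) (gs ! i))) [0..<length ws] ! i)" if i: "i < ar w" for i
  proof -
    have i': "i < length ws" using i w by simp
    show ?thesis
      using P.asub_simps[OF wi[OF i'] g[rule_format, OF i'] b(1)[OF i']] b[OF i'] si[OF i'] i' lu w nu by (simp add: arrows_iff us_def)
  qed
  have sA: "set ss \<subseteq> Arr XP" using st lu by (auto simp: in_set_conv_nth arrows_iff)
  have d: "ar_map (aop P w) ss \<in> arrows XP (ob_map (aop P w) (P.opb us xs)) (ob_map (aop P w) (P.opb ws (map ((!) xs) ?g)))"
    unfolding P.opb_block_sum[OF l g xs(1)] using P.op_arr[OF w(1) lu(2), of "P.opb us xs"] st lu w by simp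
  have a: "cpt (asub P (tgamma T w ws) ?N ?g) xs \<in> arrows XP (ob_map (aop P (tsub T (tgamma T w ws) ?N ?g)) xs) (ob_map (aop P (tgamma T w ws)) (map ((!) xs) ?g))"
    using P.asub_simps[OF G gi xs(1)] xs by (simp add: arrows_iff)
  have b': "cpt (acmp P w ws) (map ((!) xs) ?g) \<in> arrows XP (ob_map (aop P (tgamma T w ws)) (map ((!) xs) ?g)) (ob_map (aop P w) (P.opb ws (map ((!) xs) ?g)))"
    using P.acmp_simps[OF f yl(1)] yl by (simp add: arrows_iff)
  have c: "cpt (acmp P w us) xs \<in> arrows XP (ob_map (aop P (tgamma T w us)) xs) (ob_map (aop P w) (P.opb us xs))"
    using P.acmp_simps[OF fu xu] xs by (simp add: arrows_iff)
  show ?thesis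
    unfolding us_def[symmetric] ss_def[symmetric]
  proof (rule faithful)
    fix M assume M: "M \<in> Mod"
    interpret A: palg T "fst M" by (rule mod_palg[OF M])
    have s: "map (ev M) ss = map2 cpt (map (\<lambda>j. asub (fst M) (ws ! j) (ns' ! j) (gs ! j)) [0..<length ws]) (blocks ns' (map (io M) xs))"
    proof (rule nth_equalityI)
      fix i assume "i < length (map (ev M) ss)"
      then have i: "i < length ws" using lu w by simp
      show "map (ev M) ss ! i = map2 cpt (map (\<lambda>j. asub (fst M) (ws ! j) (ns' ! j) (gs ! j)) [0..<length ws]) (blocks ns' (map (io M) xs)) ! i"
        using i lu w l si[OF i] ev_structure(3)[OF M wi[OF i] g[rule_format, OF i] b[OF i]] by (simp add: blocks_map)
    qed (use lu w l in simp)
    have "ev M (Cmp XP (cpt (acmp P w ws) (map ((!) xs) ?g)) (cpt (asub P (tgamma T w ws) ?N ?g) xs))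
      = Cmp (acat (fst M)) (cpt (acmp (fst M) w ws) (map ((!) (map (io M) xs)) ?g)) (cpt (asub (fst M) (tgamma T w ws) ?N ?g) (map (io M) xs))"
      unfolding map_index_io[OF gs, symmetric]
      using a b' M by (simp add: XP_Cmp(4) arrows_iff ev_structure(1)[OF M f yl] ev_structure(3)[OF M G gi xs] del: map_map)
    moreover have "ev M (Cmp XP (ar_map (aop P w) ss) (cpt (acmp P w us) xs))
      = Cmp (acat (fst M)) (ar_map (aop (fst M) w) (map (ev M) ss)) (cpt (acmp (fst M) w us) (map (io M) xs))"
      using c d M by (simp add: XP_Cmp(4) arrows_iff ev_structure(1)[OF M fu xu xs(2)] ev_op[OF M w(1) lu(2) sA])
    ultimately show "ev M (Cmp XP (cpt (acmp P w ws) (map ((!) xs) ?g)) (cpt (asub P (tgamma T w ws) ?N ?g) xs)) =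
         ev M (Cmp XP (ar_map (aop P w) ss) (cpt (acmp P w us) xs))"
      using A.coh(5)[OF f l g, of "map (io M) xs"] io_set[OF M xs(2)] xs unfolding s us_def by simp
  qed (use a b' c d tgamma_block_sum[OF f l g] in \<open>simp_all add: XP_Cmp arrows_iff us_def\<close>)
qed

lemma P_coherence6:
  assumes w: "w \<in> words T" and f: "index_map (ar w) l f" and g: "index_map l m g" and xs: "length xs = m" "set xs \<subseteq> Ob"
  shows "Cmp XP (cpt (asub P w l f) (map ((!) xs) g)) (cpt (asub P (tsub T w l f) m g) xs) = cpt (asub P w m (map ((!) g) f)) xs"
proof -
  have G: "tsub T w l f \<in> words T" "index_map (ar (tsub T w l f)) m g" using w f g by auto
  have g': "length g = l" "set g \<subseteq> {..<m}" and f': "length f = ar w" "set f \<subseteq> {..<l}" using f g by (auto simp: index_map_def)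
  have gf: "index_map (ar w) m (map ((!) g) f)" using set_map_nth_subset[of f g "{..<m}"] f' g' by (auto simp: index_map_def)
  have yl: "length (map ((!) xs) g) = l" "set (map ((!) xs) g) \<subseteq> Ob" using index_set[OF g xs] by auto
  have e: "map ((!) (map ((!) xs) g)) f = map ((!) xs) (map ((!) g) f)" using f' g' by (auto simp: subset_iff)
  note a = P.asub_simps[OF G xs(1)] and b = P.asub_simps[OF w f yl(1)] and c = P.asub_simps[OF w gf xs(1)]
  have gs: "set g \<subseteq> {..<length xs}" using g' xs by simp
  show ?thesis
  proof (rule faithful)
    fix M assume M: "M \<in> Mod"
    interpret A: palg T "fst M" by (rule mod_palg[OF M])
    have "ev M (Cmp XP (cpt (asub P w l f) (map ((!) xs) g)) (cpt (asub P (tsub T w l f) m g) xs))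
      = Cmp (acat (fst M)) (cpt (asub (fst M) w l f) (map ((!) (map (io M) xs)) g)) (cpt (asub (fst M) (tsub T w l f) m g) (map (io M) xs))"
      unfolding map_index_io[OF gs, symmetric]
      using a b M xs yl by (simp add: XP_Cmp(4) ev_structure(3)[OF M G xs] ev_structure(3)[OF M w f yl] del: map_map)
    then show "ev M (Cmp XP (cpt (asub P w l f) (map ((!) xs) g)) (cpt (asub P (tsub T w l f) m g) xs)) = ev M (cpt (asub P w m (map ((!) g) f)) xs)"
      using A.coh(6)[OF w f g, of "map (io M) xs"] io_set[OF M xs(2)] xs by (simp add: ev_structure(3)[OF M w gf xs])
  qed (use a b c xs yl tsub_tsub[OF w f g] e in \<open>simp_all add: XP_Cmp del: map_map\<close>)
qed

lemma P_coherence7: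
  assumes w: "w \<in> words T" and xs: "length xs = ar w" "set xs \<subseteq> Ob"
  shows "cpt (asub P w (ar w) [0..<ar w]) xs = Idn XP (ob_map (aop P w) xs)"
proof -
  have i: "index_map (ar w) (ar w) [0..<ar w]" by (auto simp: index_map_def)
  have e: "map ((!) xs) [0..<ar w] = xs" using xs by (auto intro!: nth_equalityI)
  note a = P.asub_simps[OF w i xs(1)]
  have o: "ob_map (aop P w) xs \<in> Ob" using w xs by (simp add: P_simps)
  show ?thesis
  proof (rule faithful)
    fix M assume M: "M \<in> Mod"
    interpret A: palg T "fst M" by (rule mod_palg[OF M])
    show "ev M (cpt (asub P w (ar w) [0..<ar w]) xs) = ev M (Idn XP (ob_map (aop P w) xs))"
      using A.coh(7)[OF w, of "map (io M) xs"] io_set[OF M xs(2)] xs M w o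
      by (simp add: ev_structure(3)[OF M w i xs] ev_Idn io_op)
  qed (use a xs tsub_id[OF w] e o in simp_all)
qed

lemma pseudo_algebra_P: "pseudo_algebra T P"
  unfolding pseudo_algebra_def Let_def
  apply (intro conjI ballI allI impI P.cat P.op P.acmp P.auni P.asub)
        apply (assumption | elim conjE)+
  subgoal
    apply (rule P.coherence1[THEN iffD2])
      apply assumption+
    unfolding P_cat XP_obj
    apply (intro allI impI)
    apply (rule P_coherence1)
       apply assumption+
    done
  subgoal by (rule P.coherence2[THEN iffD2]) (auto intro: P_coherence2)
  subgoal by (rule P.coherence3[THEN iffD2]) (auto intro: P_coherence3)
  subgoal by (elim conjE, rule P.coherence4[THEN iffD2]) (auto intro: P_coherence4)
  subgoal
    apply (elim conjE)
    apply (rule P.coherence5[THEN iffD2])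
        apply assumption+
    unfolding P_cat XP_obj
    apply (intro allI impI)
    apply (rule P_coherence5)
         apply assumption+
    done
  subgoal by (elim conjE, rule P.coherence6[THEN iffD2]) (auto intro: P_coherence6)
  subgoal by (rule P.coherence7[THEN iffD2]) (auto intro: P_coherence7)
  done

lemma P_Obj0: "P \<in> Obj0 (PsAlg T)"
proof -
  have "small TYPE('u) (Arr XP)" unfolding XP_def by (simp add: small_image[OF small_AA])
  then show ?thesis using pseudo_algebra_P small_Ob by (simp add: small_category_def)
qed

end

section \<open>Evaluation at a model\<close>

context free_palg
begin

sublocale P: palg T P
  by unfold_locales (rule pseudo_algebra_P)

lemma P_palg: "palg T P" ..

section \<open>The universal functor \<open>pi\<close>, with \<open>pim\<close> on objects and
  \<open>pic\<close> on arrows of \<open>J\<close>\<close>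

definition pim :: "'u \<Rightarrow> ('t, 'u, 'u) pmor" where
  "pim j = (let h = \<lparr>ob_map = (\<lambda>x\<in>Obj (acat F). gen j x), ar_map = (\<lambda>a\<in>Arr (acat F). garr (GF j a))\<rparr> in
    \<lparr>mfun = h, mrho = (\<lambda>w\<in>words T. \<lparr>nsrc = fcmp (pow (ar w) (acat F)) h (aop F w),
       ntgt = fcmp (pow (ar w) (acat F)) (aop P w) (fpow (acat F) (ar w) h),
       cpt = (\<lambda>xs\<in>Obj (pow (ar w) (acat F)). garr (GR j w xs))\<rparr>)\<rparr>)"

definition pic :: "'u \<Rightarrow> ('t, 'u, 'u) pcell" where
  "pic m = \<lparr>csrc = pim (Dom J m), ctgt = pim (Cod J m),
     cnat = \<lparr>nsrc = mfun (pim (Dom J m)), ntgt = mfun (pim (Cod J m)), cpt = (\<lambda>x\<in>Obj (acat F). garr (GJ m x))\<rparr>\<rparr>"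

definition pi :: "('u, 'u, ('t, 'u, 'u) pmor, ('t, 'u, 'u) pcell) ftor" where
  "pi = \<lparr>ob_map = (\<lambda>j\<in>Obj J. pim j), ar_map = (\<lambda>m\<in>Arr J. pic m)\<rparr>"

lemma pim_simps:
  "x \<in> Obj (acat F) \<Longrightarrow> ob_map (mfun (pim j)) x = gen j x"
  "a \<in> Arr (acat F) \<Longrightarrow> ar_map (mfun (pim j)) a = garr (GF j a)"
  "w \<in> words T \<Longrightarrow> length xs = ar w \<Longrightarrow> set xs \<subseteq> Obj (acat F) \<Longrightarrow> cpt (mrho (pim j) w) xs = garr (GR j w xs)"
  "w \<in> words T \<Longrightarrow> nsrc (mrho (pim j) w) = fcmp (pow (ar w) (acat F)) (mfun (pim j)) (aop F w)"
  "w \<in> words T \<Longrightarrow> ntgt (mrho (pim j) w) = fcmp (pow (ar w) (acat F)) (aop P w) (fpow (acat F) (ar w) (mfun (pim j)))"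
  "w \<in> words T \<Longrightarrow> cpt (mrho (pim j) w) \<in> extensional (Obj (pow (ar w) (acat F)))"
  by (simp_all add: pim_def Let_def)

text \<open>In a model the generator \<open>GF j a\<close> has as value the image of
  \<open>a\<close> under the functor underlying the diagram at \<open>j\<close>. Functoriality holds
  there and hence for the families.\<close>

lemma pim_functor:
  assumes j: "j \<in> Obj J"
  shows "is_functor (acat F) XP (mfun (pim j))"
proof (rule is_functorI)
  show "ob_map (mfun (pim j)) \<in> extensional (Obj (acat F))" "ar_map (mfun (pim j)) \<in> extensional (Arr (acat F))"
    by (simp_all add: pim_def Let_def)
  have g: "gok (GF j a)" if "a \<in> Arr (acat F)" for a using j that by simp
  show "x \<in> Obj (acat F) \<Longrightarrow> ob_map (mfun (pim j)) x \<in> Obj XP" for x using j by (simp add: pim_simps)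
  show "a \<in> Arr (acat F) \<Longrightarrow> ar_map (mfun (pim j)) a \<in> Arr XP"
    "a \<in> Arr (acat F) \<Longrightarrow> Dom XP (ar_map (mfun (pim j)) a) = ob_map (mfun (pim j)) (Dom (acat F) a)"
    "a \<in> Arr (acat F) \<Longrightarrow> Cod XP (ar_map (mfun (pim j)) a) = ob_map (mfun (pim j)) (Cod (acat F) a)" for a
    using garr[OF g, of a] by (simp_all add: pim_simps)
  show "ar_map (mfun (pim j)) (Idn (acat F) x) = Idn XP (ob_map (mfun (pim j)) x)" if x: "x \<in> Obj (acat F)" for x
  proof (rule faithful)
    fix M assume M: "M \<in> Mod"
    interpret D: mor T F "fst M" "ob_map (snd M) j" by (rule mod_mor[OF M j])
    show "ev M (ar_map (mfun (pim j)) (Idn (acat F) x)) = ev M (Idn XP (ob_map (mfun (pim j)) x))"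
      using x j M garr(4)[OF g, of "Idn (acat F) x" M] by (simp add: pim_simps ev_Idn)
  qed (use x j garr(1-3)[OF g, of "Idn (acat F) x"] in \<open>simp_all add: pim_simps\<close>)
  fix a b assume ab: "a \<in> Arr (acat F)" "b \<in> Arr (acat F)" "Cod (acat F) a = Dom (acat F) b"
  show "ar_map (mfun (pim j)) (Cmp (acat F) b a) = Cmp XP (ar_map (mfun (pim j)) b) (ar_map (mfun (pim j)) a)"
  proof (rule faithful)
    fix M assume M: "M \<in> Mod"
    interpret D: mor T F "fst M" "ob_map (snd M) j" by (rule mod_mor[OF M j])
    show "ev M (ar_map (mfun (pim j)) (Cmp (acat F) b a)) = ev M (Cmp XP (ar_map (mfun (pim j)) b) (ar_map (mfun (pim j)) a))"
      using ab M garr[OF g, of "Cmp (acat F) b a"] garr[OF g[OF ab(1)]] garr[OF g[OF ab(2)]]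
      by (simp add: pim_simps XP_Cmp(4) D.H_cmp)
  qed (use ab garr(1-3)[OF g, of "Cmp (acat F) b a"] garr(1-3)[OF g[OF ab(1)]] garr(1-3)[OF g[OF ab(2)]] in \<open>simp_all add: pim_simps XP_Cmp\<close>)
qed

lemma gen_set: "j \<in> Obj J \<Longrightarrow> set xs \<subseteq> Obj (acat F) \<Longrightarrow> set (map (gen j) xs) \<subseteq> Ob"
  by (auto simp: subset_iff)

lemma io_gen_map: "j \<in> Obj J \<Longrightarrow> set xs \<subseteq> Obj (acat F) \<Longrightarrow> map (io M) (map (gen j) xs) = map (ob_map (mfun (ob_map (snd M) j))) xs"
  by (auto simp: subset_iff)

lemma map_pim: "set xs \<subseteq> Obj (acat F) \<Longrightarrow> map (ob_map (mfun (pim j))) xs = map (gen j) xs"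
  by (auto simp: subset_iff pim_simps)

lemma typed_mor_pim:
  assumes j: "j \<in> Obj J"
  shows "typed_mor T F P (pim j)"
proof unfold_locales
  show "is_functor (acat F) (acat P) (mfun (pim j))" using pim_functor[OF j] by simp
  show "mrho (pim j) \<in> extensional (words T)" by (simp add: pim_def Let_def)
  fix w assume w: "w \<in> words T"
  have "is_niso (pow (ar w) (acat F)) XP (nsrc (mrho (pim j) w)) (ntgt (mrho (pim j) w)) (mrho (pim j) w)"
  proof (rule nisoI)
    show "is_functor (pow (ar w) (acat F)) XP (nsrc (mrho (pim j) w))"
      using w by (simp add: pim_simps) (rule fcmp_functor[OF F.pow_cat F.op[OF w] pim_functor[OF j]])
    show "is_functor (pow (ar w) (acat F)) XP (ntgt (mrho (pim j) w))"
      using w P.op[OF w] by (simp add: pim_simps) (rule fcmp_functor[OF F.pow_cat fpow_functor[OF F.cat pim_functor[OF j]]], simp)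
    show "cpt (mrho (pim j) w) \<in> extensional (Obj (pow (ar w) (acat F)))" by (rule pim_simps(6)[OF w])
  next
    fix xs assume "xs \<in> Obj (pow (ar w) (acat F))"
    then have xs: "length xs = ar w" "set xs \<subseteq> Obj (acat F)" by auto
    have g: "gok (GR j w xs)" using j w xs by simp
    show "cpt (mrho (pim j) w) xs \<in> arrows XP (ob_map (nsrc (mrho (pim j) w)) xs) (ob_map (ntgt (mrho (pim j) w)) xs)"
      using garr_arrows[OF g] w xs gen_set[OF j xs(2)] map_pim[OF xs(2), of j] by (simp add: pim_simps P_simps del: set_map map_eq_conv)
    show "invertible_arrow XP (cpt (mrho (pim j) w) xs)"
      using garr_invertible[OF g] w xs by (simp add: pim_simps)
  next
    fix fs assume "fs \<in> Arr (pow (ar w) (acat F))"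
    then have fs: "length fs = ar w" "set fs \<subseteq> Arr (acat F)" by auto
    let ?ds = "map (Dom (acat F)) fs" and ?cs = "map (Cod (acat F)) fs" and ?gs = "map (\<lambda>a. garr (GF j a)) fs"
    have ds: "length ?ds = ar w" "set ?ds \<subseteq> Obj (acat F)" and cs: "length ?cs = ar w" "set ?cs \<subseteq> Obj (acat F)" using fs by auto
    have gd: "gok (GR j w ?ds)" and gc: "gok (GR j w ?cs)" using j w ds cs by simp_all
    have gi: "gok (GF j a)" if "a \<in> set fs" for a using j fs that by auto
    have ga: "gok (GF j (ar_map (aop F w) fs))" using j w fs by simp
    have gs: "length ?gs = ar w" "set ?gs \<subseteq> Arr XP" using fs garr(1)[OF gi] by auto
    have gdc: "map (Dom XP) ?gs = map (gen j) ?ds" "map (Cod XP) ?gs = map (gen j) ?cs" using garr(2,3)[OF gi] by auto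
    have "Cmp XP (garr (GR j w ?cs)) (garr (GF j (ar_map (aop F w) fs))) = Cmp XP (appa w ?gs) (garr (GR j w ?ds))"
    proof (rule faithful)
      fix M assume M: "M \<in> Mod"
      interpret D: mor T F "fst M" "ob_map (snd M) j" by (rule mod_mor[OF M j])
      have "map (ev M) ?gs = map (ar_map (mfun (ob_map (snd M) j))) fs" using garr(4)[OF gi M] by auto
      then show "ev M (Cmp XP (garr (GR j w ?cs)) (garr (GF j (ar_map (aop F w) fs)))) = ev M (Cmp XP (appa w ?gs) (garr (GR j w ?ds)))"
        using D.rho_nat[OF w fs] garr[OF gd] garr[OF gc] garr[OF ga] appa[OF w gs] gdc M w fs
        by (simp add: XP_Cmp(4) del: map_map map_eq_conv)
    qed (use garr(1-3)[OF gd] garr(1-3)[OF gc] garr(1-3)[OF ga] appa(1-3)[OF w gs] gdc w fs in \<open>simp_all add: XP_Cmp del: map_map map_eq_conv\<close>)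
    moreover have "map (ar_map (mfun (pim j))) fs = ?gs" using fs by (auto simp: pim_simps)
    ultimately show "Cmp XP (cpt (mrho (pim j) w) (Cod (pow (ar w) (acat F)) fs)) (ar_map (nsrc (mrho (pim j) w)) fs) =
       Cmp XP (ar_map (ntgt (mrho (pim j) w)) fs) (cpt (mrho (pim j) w) (Dom (pow (ar w) (acat F)) fs))"
      using fs ds cs w gs by (simp add: pim_simps P_simps del: map_map map_eq_conv)
  qed
  then show "is_niso (pow (ar w) (acat F)) (acat P) (fcmp (pow (ar w) (acat F)) (mfun (pim j)) (aop F w))
     (fcmp (pow (ar w) (acat F)) (aop P w) (fpow (acat F) (ar w) (mfun (pim j)))) (mrho (pim j) w)"
    using w by (simp add: pim_simps)
qed

text \<open>In a model with diagram \<open>D\<close> the generators \<open>GF\<close> and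
  \<open>GR\<close> evaluate to the functor and the \<open>\<rho>\<close> of the morphism
  \<open>D j\<close>, so each law becomes a law of that morphism.\<close>

lemma pim_morphism:
  assumes j: "j \<in> Obj J"
  shows "pseudo_morphism T F P (pim j)"
proof -
  interpret m: typed_mor T F P "pim j" by (rule typed_mor_pim[OF j])
  show ?thesis
  proof (rule m.pseudo_morphismI)
    fix w ws xs assume f: "fits T w ws" and xs: "length xs = sum_list (map ar ws)" "set xs \<subseteq> Obj (acat F)"
    have w: "w \<in> words T" "length ws = ar w" "set ws \<subseteq> words T" using f by (auto simp: fits_def)
    have wi: "i < length ws \<Longrightarrow> ws ! i \<in> words T" for i using w by (rule_tac nth_in_set)
    have G: "tgamma T w ws \<in> words T" "ar (tgamma T w ws) = sum_list (map ar ws)" using f by auto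
    have ys: "length (map (gen j) xs) = sum_list (map ar ws)" "set (map (gen j) xs) \<subseteq> Ob" using xs gen_set[OF j xs(2)] by auto
    have o: "length (F.opb ws xs) = ar w" "set (F.opb ws xs) \<subseteq> Obj (acat F)" using w xs by auto
    have b: "length (blocks (map ar ws) xs ! i) = ar (ws ! i)" "set (blocks (map ar ws) xs ! i) \<subseteq> Obj (acat F)" if "i < length ws" for i
      using blocks_obj[of i "map ar ws" xs "Obj (acat F)"] xs that by auto
    note rb = m.rhob[OF w(3) xs]
    have a: "cpt (acmp P w ws) (map (gen j) xs) \<in> arrows XP (ob_map (aop P (tgamma T w ws)) (map (gen j) xs)) (ob_map (aop P w) (P.opb ws (map (gen j) xs)))"
      using P.acmp_simps[OF f ys(1)] ys by (simp add: arrows_iff)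
    have r: "cpt (mrho (pim j) (tgamma T w ws)) xs \<in> arrows XP (ob_map (mfun (pim j)) (ob_map (aop F (tgamma T w ws)) xs)) (ob_map (aop P (tgamma T w ws)) (map (gen j) xs))"
      using m.rho_arr(1)[OF G(1), of xs] G xs map_pim[OF xs(2)] by simp
    have d: "ar_map (aop P w) (m.rhob ws xs) \<in> arrows XP (ob_map (aop P w) (map (gen j) (F.opb ws xs))) (ob_map (aop P w) (P.opb ws (map (gen j) xs)))"
      using P.op_arr[OF w(1), of "m.rhob ws xs" "map (ob_map (mfun (pim j))) (F.opb ws xs)" "P.opb ws (map (ob_map (mfun (pim j))) xs)"]
        rb w map_pim[OF xs(2)] map_pim[OF o(2)] by (simp del: nth_map map_map)
    have e: "cpt (mrho (pim j) w) (F.opb ws xs) \<in> arrows XP (ob_map (mfun (pim j)) (ob_map (aop F w) (F.opb ws xs))) (ob_map (aop P w) (map (gen j) (F.opb ws xs)))"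
      using m.rho_arr(1)[OF w(1) o] map_pim[OF o(2)] by simp
    have cF: "cpt (acmp F w ws) xs \<in> arrows (acat F) (ob_map (aop F (tgamma T w ws)) xs) (ob_map (aop F w) (F.opb ws xs))"
      using F.acmp_simps[OF f xs] by (simp add: arrows_iff)
    have k: "ar_map (mfun (pim j)) (cpt (acmp F w ws) xs) \<in> arrows XP (ob_map (mfun (pim j)) (ob_map (aop F (tgamma T w ws)) xs)) (ob_map (mfun (pim j)) (ob_map (aop F w) (F.opb ws xs)))"
      using functor_arrows[OF m.H cF] by simp
    have rA: "set (m.rhob ws xs) \<subseteq> Arr XP" using rb(1,3) by (auto simp: in_set_conv_nth arrows_iff)
    have lr: "length (m.rhob ws xs) = ar w" using rb w by simp
    have gG: "gok (GR j (tgamma T w ws) xs)" and gW: "gok (GR j w (F.opb ws xs))" and gF: "gok (GF j (cpt (acmp F w ws) xs))"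
      using j G xs w o cF by (simp_all add: arrows_iff)
    have "Cmp XP (cpt (acmp P w ws) (map (gen j) xs)) (cpt (mrho (pim j) (tgamma T w ws)) xs) =
       Cmp XP (ar_map (aop P w) (m.rhob ws xs)) (Cmp XP (cpt (mrho (pim j) w) (F.opb ws xs)) (ar_map (mfun (pim j)) (cpt (acmp F w ws) xs)))"
    proof (rule faithful)
      fix M assume M: "M \<in> Mod"
      interpret D: mor T F "fst M" "ob_map (snd M) j" by (rule mod_mor[OF M j])
      have s: "map (ev M) (m.rhob ws xs) = D.rhob ws xs"
      proof (rule nth_equalityI)
        fix i assume "i < length (map (ev M) (m.rhob ws xs))"
        then have i: "i < length ws" using rb by simp
        have g: "gok (GR j (ws ! i) (blocks (map ar ws) xs ! i))" using j wi[OF i] b[OF i] by simp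
        show "map (ev M) (m.rhob ws xs) ! i = D.rhob ws xs ! i"
          using i rb(1,2) D.rhob(2)[OF w(3) xs i] garr(4)[OF g M] b[OF i] wi[OF i] by (simp add: pim_simps)
      qed (use rb(1) D.rhob(1)[OF w(3) xs] in simp)
      show "ev M (Cmp XP (cpt (acmp P w ws) (map (gen j) xs)) (cpt (mrho (pim j) (tgamma T w ws)) xs)) =
        ev M (Cmp XP (ar_map (aop P w) (m.rhob ws xs)) (Cmp XP (cpt (mrho (pim j) w) (F.opb ws xs)) (ar_map (mfun (pim j)) (cpt (acmp F w ws) xs))))"
        using D.mor_coh1[OF f xs] a r d e k M s G xs o w cF garr(4)[OF gG M] garr(4)[OF gW M] garr(4)[OF gF M] io_gen_map[OF j xs(2), of M]
        by (simp add: XP_Cmp arrows_iff ev_structure(1)[OF M f ys] ev_op[OF M w(1) lr rA] pim_simps del: map_map)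
    qed (use a r d e k in \<open>simp_all add: XP_Cmp arrows_iff\<close>)
    then show "Cmp (acat P) (cpt (acmp P w ws) (map (ob_map (mfun (pim j))) xs)) (cpt (mrho (pim j) (tgamma T w ws)) xs) =
       Cmp (acat P) (ar_map (aop P w) (m.rhob ws xs)) (Cmp (acat P) (cpt (mrho (pim j) w) (F.opb ws xs)) (ar_map (mfun (pim j)) (cpt (acmp F w ws) xs)))"
      by (simp add: map_pim[OF xs(2)])
  next
    fix x assume x: "x \<in> Obj (acat F)"
    note u = F.auni_simps[OF x]
    have g: "gok (GI (gen j x))" "gok (GR j (tunit T) [x])" "gok (GF j (cpt (auni F) [x]))" using j x u by simp_all
    have "Cmp XP (garr (GI (gen j x))) (garr (GR j (tunit T) [x])) = garr (GF j (cpt (auni F) [x]))"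
    proof (rule faithful)
      fix M assume M: "M \<in> Mod"
      interpret D: mor T F "fst M" "ob_map (snd M) j" by (rule mod_mor[OF M j])
      show "ev M (Cmp XP (garr (GI (gen j x))) (garr (GR j (tunit T) [x]))) = ev M (garr (GF j (cpt (auni F) [x])))"
        using D.mor_coh2[OF x] garr[OF g(1)] garr[OF g(2)] garr[OF g(3)] M j x by (simp add: XP_Cmp(4))
    qed (use garr(1-3)[OF g(1)] garr(1-3)[OF g(2)] garr(1-3)[OF g(3)] u in \<open>simp_all add: XP_Cmp\<close>)
    then show "Cmp (acat P) (cpt (auni P) [ob_map (mfun (pim j)) x]) (cpt (mrho (pim j) (tunit T)) [x]) = ar_map (mfun (pim j)) (cpt (auni F) [x])"
      using x j u by (simp add: pim_simps P_simps)
  next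
    fix w l f xs assume w: "w \<in> words T" "index_map (ar w) l f" and xs: "length xs = l" "set xs \<subseteq> Obj (acat F)"
    note u = F.asub_simps[OF w xs]
    have G: "tsub T w l f \<in> words T" "ar (tsub T w l f) = l" using w by auto
    have ys: "length (map (gen j) xs) = l" "set (map (gen j) xs) \<subseteq> Ob" using xs gen_set[OF j xs(2)] by auto
    have xf: "length (map ((!) xs) f) = ar w" "set (map ((!) xs) f) \<subseteq> Obj (acat F)" using index_set[OF w(2) xs] by auto
    have fx: "set f \<subseteq> {..<length xs}" using w xs by (auto simp: index_map_def)
    have g: "gok (GS w l f (map (gen j) xs))" "gok (GR j (tsub T w l f) xs)" "gok (GR j w (map ((!) xs) f))" "gok (GF j (cpt (asub F w l f) xs))"
      using j w G xs ys xf u by (simp_all del: set_map)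
    have "Cmp XP (garr (GS w l f (map (gen j) xs))) (garr (GR j (tsub T w l f) xs)) = Cmp XP (garr (GR j w (map ((!) xs) f))) (garr (GF j (cpt (asub F w l f) xs)))"
    proof (rule faithful)
      fix M assume M: "M \<in> Mod"
      interpret D: mor T F "fst M" "ob_map (snd M) j" by (rule mod_mor[OF M j])
      show "ev M (Cmp XP (garr (GS w l f (map (gen j) xs))) (garr (GR j (tsub T w l f) xs))) =
         ev M (Cmp XP (garr (GR j w (map ((!) xs) f))) (garr (GF j (cpt (asub F w l f) xs))))"
        using D.mor_coh3[OF w xs] garr[OF g(1)] garr[OF g(2)] garr[OF g(3)] garr[OF g(4)] M u io_gen_map[OF j xs(2), of M]
        by (simp add: XP_Cmp(4) del: map_map)
    qed (use garr(1-3)[OF g(1)] garr(1-3)[OF g(2)] garr(1-3)[OF g(3)] garr(1-3)[OF g(4)] u map_index_io[OF fx, of "gen j"]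
        in \<open>simp_all add: XP_Cmp del: map_map map_eq_conv\<close>)
    then show "Cmp (acat P) (cpt (asub P w l f) (map (ob_map (mfun (pim j))) xs)) (cpt (mrho (pim j) (tsub T w l f)) xs) =
       Cmp (acat P) (cpt (mrho (pim j) w) (map ((!) xs) f)) (ar_map (mfun (pim j)) (cpt (asub F w l f) xs))"
      using xs w G u xf ys by (simp add: map_pim[OF xs(2)] pim_simps P_simps del: map_map set_map)
  qed
qed

lemma pic_simps [simp]: "csrc (pic m) = pim (Dom J m)" "ctgt (pic m) = pim (Cod J m)"
  "nsrc (cnat (pic m)) = mfun (pim (Dom J m))" "ntgt (cnat (pic m)) = mfun (pim (Cod J m))"
  "x \<in> Obj (acat F) \<Longrightarrow> cpt (cnat (pic m)) x = garr (GJ m x)"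
  "cpt (cnat (pic m)) \<in> extensional (Obj (acat F))"
  by (simp_all add: pic_def)

text \<open>Naturality and the 2-cell law are, in each model, those of the 2-cell that the diagram
  assigns to \<open>m\<close>.\<close>

lemma pic_cell:
  assumes m: "m \<in> Arr J"
  shows "pseudo_cell T F P (pic m)"
proof (rule pseudo_cellI[OF F_palg P_palg])
  have jj: "Dom J m \<in> Obj J" "Cod J m \<in> Obj J" using m by auto
  show "pseudo_morphism T F P (csrc (pic m))" "pseudo_morphism T F P (ctgt (pic m))"
    using jj pim_morphism by auto
  have gj: "gok (GJ m x)" if "x \<in> Obj (acat F)" for x using m that by simp
  show "is_ntrans (acat F) (acat P) (cnat (pic m))"
  proof (rule is_ntransI)
    show "is_functor (acat F) (acat P) (nsrc (cnat (pic m)))" "is_functor (acat F) (acat P) (ntgt (cnat (pic m)))"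
      using pim_functor jj by auto
    fix a assume a: "a \<in> Arr (acat F)"
    have g: "gok (GJ m (Cod (acat F) a))" "gok (GF (Dom J m) a)" "gok (GF (Cod J m) a)" "gok (GJ m (Dom (acat F) a))" using a m by simp_all
    have "Cmp XP (garr (GJ m (Cod (acat F) a))) (garr (GF (Dom J m) a)) = Cmp XP (garr (GF (Cod J m) a)) (garr (GJ m (Dom (acat F) a)))"
    proof (rule faithful)
      fix M assume M: "M \<in> Mod"
      note c = pseudo_cellD[OF F_palg mod_palg[OF M] mod_cell(1)[OF M m]]
      show "ev M (Cmp XP (garr (GJ m (Cod (acat F) a))) (garr (GF (Dom J m) a))) = ev M (Cmp XP (garr (GF (Cod J m) a)) (garr (GJ m (Dom (acat F) a))))"
        using nt_nat[OF c(3) a] c(4,5) mod_cell(2,3)[OF M m] garr[OF g(1)] garr[OF g(2)] garr[OF g(3)] garr[OF g(4)] M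
        by (simp add: XP_Cmp(4))
    qed (use garr(1-3)[OF g(1)] garr(1-3)[OF g(2)] garr(1-3)[OF g(3)] garr(1-3)[OF g(4)] in \<open>simp_all add: XP_Cmp\<close>)
    then show "Cmp (acat P) (cpt (cnat (pic m)) (Cod (acat F) a)) (ar_map (nsrc (cnat (pic m))) a) =
       Cmp (acat P) (ar_map (ntgt (cnat (pic m))) a) (cpt (cnat (pic m)) (Dom (acat F) a))"
      using a by (simp add: pim_simps)
  qed (use garr(1-3)[OF gj] in \<open>simp_all add: pim_simps\<close>)
  fix w xs assume w: "w \<in> words T" and xs: "length xs = ar w" "set xs \<subseteq> Obj (acat F)"
  let ?l = "map (\<lambda>x. garr (GJ m x)) xs"
  have gx: "gok (GJ m x)" if "x \<in> set xs" for x using gj xs that by auto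
  have l: "length ?l = ar w" "set ?l \<subseteq> Arr XP" using xs garr(1)[OF gx] by auto
  have ld: "map (Dom XP) ?l = map (gen (Dom J m)) xs" "map (Cod XP) ?l = map (gen (Cod J m)) xs" using garr(2,3)[OF gx] by auto
  have e: "map (cpt (cnat (pic m))) xs = ?l" using xs by (auto simp: subset_iff)
  have g: "gok (GR (Cod J m) w xs)" "gok (GJ m (ob_map (aop F w) xs))" "gok (GR (Dom J m) w xs)" using m w xs by simp_all
  have "Cmp XP (garr (GR (Cod J m) w xs)) (garr (GJ m (ob_map (aop F w) xs))) = Cmp XP (appa w ?l) (garr (GR (Dom J m) w xs))"
  proof (rule faithful)
    fix M assume M: "M \<in> Mod"
    note c = pseudo_cellD[OF F_palg mod_palg[OF M] mod_cell(1)[OF M m]]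
    have "map (ev M) ?l = map (cpt (cnat (ar_map (snd M) m))) xs" using garr(4)[OF gx M] by auto
    then show "ev M (Cmp XP (garr (GR (Cod J m) w xs)) (garr (GJ m (ob_map (aop F w) xs)))) = ev M (Cmp XP (appa w ?l) (garr (GR (Dom J m) w xs)))"
      using c(6)[OF w xs] mod_cell(2,3)[OF M m] garr[OF g(1)] garr[OF g(2)] garr[OF g(3)] appa[OF w l] ld M
      by (simp add: XP_Cmp(4) del: map_map)
  qed (use garr(1-3)[OF g(1)] garr(1-3)[OF g(2)] garr(1-3)[OF g(3)] appa(1-3)[OF w l] ld in \<open>simp_all add: XP_Cmp del: map_map\<close>)
  then show "Cmp (acat P) (cpt (mrho (ctgt (pic m)) w) xs) (cpt (cnat (pic m)) (ob_map (aop F w) xs)) =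
     Cmp (acat P) (ar_map (aop P w) (map (cpt (cnat (pic m))) xs)) (cpt (mrho (csrc (pic m)) w) xs)"
    unfolding e using w xs l by (simp add: pim_simps P_simps)
qed simp_all

text \<open>The generators \<open>GJ\<close> are subject to no relations of their own; identities
  and composites of \<open>J\<close> are respected because every diagram in a model is a
  functor.\<close>

lemma pi_functor: "is_functor J (hom_PsAlg T F P) pi"
proof (rule is_functorI)
  fix j assume j: "j \<in> Obj J"
  have "cpt (cnat (pic (Idn J j))) x = Idn XP (gen j x)" if x: "x \<in> Obj (acat F)" for x
  proof -
    have g: "gok (GJ (Idn J j) x)" using j x by simp
    have "garr (GJ (Idn J j) x) = Idn XP (gen j x)"
    proof (rule faithful)
      fix M assume M: "M \<in> Mod"
      show "ev M (garr (GJ (Idn J j) x)) = ev M (Idn XP (gen j x))"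
        using garr(4)[OF g M] ftor_id[OF mod_functor[OF M] j] j x M by (simp add: ev_Idn)
    qed (use garr(1-3)[OF g] j x in simp_all)
    then show ?thesis using x by simp
  qed
  then have "pic (Idn J j) = Idn (hom_PsAlg T F P) (pim j)"
    using j by (intro pcell_eqI ntrans_eqI[where C="acat F"]) (simp_all add: pim_simps)
  then show "ar_map pi (Idn J j) = Idn (hom_PsAlg T F P) (ob_map pi j)" using j by (simp add: pi_def)
next
  fix m n assume mn: "m \<in> Arr J" "n \<in> Arr J" "Cod J m = Dom J n"
  have "cpt (cnat (pic (Cmp J n m))) x = Cmp XP (cpt (cnat (pic n)) x) (cpt (cnat (pic m)) x)" if x: "x \<in> Obj (acat F)" for x
  proof -
    have g: "gok (GJ (Cmp J n m) x)" "gok (GJ n x)" "gok (GJ m x)" using mn x by simp_all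
    have "garr (GJ (Cmp J n m) x) = Cmp XP (garr (GJ n x)) (garr (GJ m x))"
    proof (rule faithful)
      fix M assume M: "M \<in> Mod"
      show "ev M (garr (GJ (Cmp J n m) x)) = ev M (Cmp XP (garr (GJ n x)) (garr (GJ m x)))"
        using garr[OF g(1)] garr[OF g(2)] garr[OF g(3)] ftor_cmp[OF mod_functor[OF M] mn] mn x M by (simp add: XP_Cmp(4))
    qed (use garr(1-3)[OF g(1)] garr(1-3)[OF g(2)] garr(1-3)[OF g(3)] mn in \<open>simp_all add: XP_Cmp\<close>)
    then show ?thesis using x by simp
  qed
  then have "pic (Cmp J n m) = Cmp (hom_PsAlg T F P) (pic n) (pic m)"
    using mn by (intro pcell_eqI ntrans_eqI[where C="acat F"]) simp_all
  then show "ar_map pi (Cmp J n m) = Cmp (hom_PsAlg T F P) (ar_map pi n) (ar_map pi m)" using mn by (simp add: pi_def)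
qed (auto simp: pi_def pim_morphism pic_cell)

text \<open>The value of a formal application is by construction the operation of the model applied
  to the values. The square that \<open>\<rho>\<close> has to fill therefore commutes strictly, and
  \<open>\<rho>\<close> is taken to be the identity.\<close>

definition evm :: "('t, 'u) model \<Rightarrow> ('t, 'u, 'u) pmor" where
  "evm M = (let h = \<lparr>ob_map = (\<lambda>x\<in>Ob. io M x), ar_map = (\<lambda>a\<in>Arr XP. ev M a)\<rparr> in
    \<lparr>mfun = h, mrho = (\<lambda>w\<in>words T. nid (pow (ar w) XP) (acat (fst M)) (fcmp (pow (ar w) XP) h (aop P w)))\<rparr>)"

lemma evm_simps:
  "x \<in> Ob \<Longrightarrow> ob_map (mfun (evm M)) x = io M x"
  "a \<in> Arr XP \<Longrightarrow> ar_map (mfun (evm M)) a = ev M a"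
  "w \<in> words T \<Longrightarrow> mrho (evm M) w = nid (pow (ar w) XP) (acat (fst M)) (fcmp (pow (ar w) XP) (mfun (evm M)) (aop P w))"
  by (simp_all add: evm_def Let_def)

lemma evm_functor:
  assumes M: "M \<in> Mod"
  shows "is_functor XP (acat (fst M)) (mfun (evm M))"
  by (rule is_functorI)
    (use M XP_typed in \<open>simp_all add: evm_simps XP_Cmp ev_Idn, simp_all add: evm_def Let_def\<close>)

lemma evm_map: "set xs \<subseteq> Ob \<Longrightarrow> map (ob_map (mfun (evm M))) xs = map (io M) xs"
  by (auto simp: evm_simps)

lemma evm_rho:
  assumes "M \<in> Mod" "w \<in> words T" "length xs = ar w" "set xs \<subseteq> Ob"
  shows "cpt (mrho (evm M) w) xs = Idn (acat (fst M)) (ob_map (aop (fst M) w) (map (io M) xs))"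
  using assms by (simp add: evm_simps P_simps)

text \<open>The square of functors commutes on objects by the recursion for \<open>io\<close> and on
  arrows by the value of \<open>appa\<close>.\<close>

lemma typed_mor_evm:
  assumes M: "M \<in> Mod"
  shows "typed_mor T P (fst M) (evm M)"
proof -
  interpret A: palg T "fst M" by (rule mod_palg[OF M])
  show ?thesis
  proof unfold_locales
    show "is_functor (acat P) (acat (fst M)) (mfun (evm M))" using evm_functor[OF M] by simp
    show "mrho (evm M) \<in> extensional (words T)" by (simp add: evm_def Let_def)
    fix w assume w: "w \<in> words T"
    have L: "is_functor (pow (ar w) XP) (acat (fst M)) (fcmp (pow (ar w) XP) (mfun (evm M)) (aop P w))"
      using fcmp_functor[OF P.pow_cat P.op[OF w], of "acat (fst M)" "mfun (evm M)"] evm_functor[OF M] by simp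
    have R: "is_functor (pow (ar w) XP) (acat (fst M)) (fcmp (pow (ar w) XP) (aop (fst M) w) (fpow XP (ar w) (mfun (evm M))))"
      using fcmp_functor[OF P.pow_cat fpow_functor[OF P.cat] A.op[OF w], of "mfun (evm M)"] evm_functor[OF M] by simp
    have "fcmp (pow (ar w) XP) (mfun (evm M)) (aop P w) = fcmp (pow (ar w) XP) (aop (fst M) w) (fpow XP (ar w) (mfun (evm M)))"
    proof (rule functor_eqI[OF L R])
      fix xs assume "xs \<in> Obj (pow (ar w) XP)"
      then have xs: "length xs = ar w" "set xs \<subseteq> Ob" by auto
      show "ob_map (fcmp (pow (ar w) XP) (mfun (evm M)) (aop P w)) xs = ob_map (fcmp (pow (ar w) XP) (aop (fst M) w) (fpow XP (ar w) (mfun (evm M)))) xs"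
        using xs w by (simp add: evm_simps P_simps evm_map)
    next
      fix fs assume "fs \<in> Arr (pow (ar w) XP)"
      then have fs: "length fs = ar w" "set fs \<subseteq> Arr XP" by auto
      have "map (ar_map (mfun (evm M))) fs = map (ev M) fs" using fs by (auto simp: evm_simps)
      then show "ar_map (fcmp (pow (ar w) XP) (mfun (evm M)) (aop P w)) fs = ar_map (fcmp (pow (ar w) XP) (aop (fst M) w) (fpow XP (ar w) (mfun (evm M)))) fs"
        using fs w appa[OF w fs] M by (simp add: evm_simps P_simps del: map_eq_conv)
    qed
    then show "is_niso (pow (ar w) (acat P)) (acat (fst M)) (fcmp (pow (ar w) (acat P)) (mfun (evm M)) (aop P w))
       (fcmp (pow (ar w) (acat P)) (aop (fst M) w) (fpow (acat P) (ar w) (mfun (evm M)))) (mrho (evm M) w)"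
      using w nid_niso[OF P.pow_cat A.cat, of "ar w"] L by (simp add: evm_simps)
  qed
qed

text \<open>With identities for \<open>\<rho>\<close> the laws say that evaluation carries structure
  cells to structure cells, which is \<open>ev_structure\<close>.\<close>

lemma evm_morphism:
  assumes M: "M \<in> Mod"
  shows "pseudo_morphism T P (fst M) (evm M)"
proof -
  interpret A: palg T "fst M" by (rule mod_palg[OF M])
  interpret m: typed_mor T P "fst M" "evm M" by (rule typed_mor_evm[OF M])
  show ?thesis
  proof (rule m.pseudo_morphismI)
    fix w ws xs assume f: "fits T w ws" and xs: "length xs = sum_list (map ar ws)" "set xs \<subseteq> Obj (acat P)"
    have w: "w \<in> words T" "length ws = ar w" "set ws \<subseteq> words T" using f by (auto simp: fits_def)
    have wi: "i < length ws \<Longrightarrow> ws ! i \<in> words T" for i using w by (rule_tac nth_in_set)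
    have G: "tgamma T w ws \<in> words T" "ar (tgamma T w ws) = sum_list (map ar ws)" using f by auto
    have xO: "set xs \<subseteq> Ob" using xs by simp
    have o: "length (P.opb ws xs) = ar w" "set (P.opb ws xs) \<subseteq> Ob" using w P.opb_obj[OF w(3) xs] by auto
    have b: "length (blocks (map ar ws) xs ! i) = ar (ws ! i)" "set (blocks (map ar ws) xs ! i) \<subseteq> Ob" if "i < length ws" for i
      using blocks_obj[of i "map ar ws" xs Ob] xs that by auto
    have io: "length (map (io M) xs) = sum_list (map ar ws)" "set (map (io M) xs) \<subseteq> Obj (acat (fst M))" using xs io_set[OF M xO] by auto
    have Ao: "length (A.opb ws (map (io M) xs)) = ar w" "set (A.opb ws (map (io M) xs)) \<subseteq> Obj (acat (fst M))" using w A.opb_obj[OF w(3) io] by auto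
    note rb = m.rhob[OF w(3) xs]
    have "ar_map (aop (fst M) w) (m.rhob ws xs) = Idn (acat (fst M)) (ob_map (aop (fst M) w) (A.opb ws (map (io M) xs)))"
    proof (rule A.op_id)
      fix i assume "i < ar w"
      then have i: "i < length ws" using w by simp
      show "m.rhob ws xs ! i = Idn (acat (fst M)) (A.opb ws (map (io M) xs) ! i)"
        using rb(2)[OF i] evm_rho[OF M wi[OF i] b[OF i]] i by (simp add: blocks_map)
    qed (use w rb Ao in auto)
    then show "Cmp (acat (fst M)) (cpt (acmp (fst M) w ws) (map (ob_map (mfun (evm M))) xs)) (cpt (mrho (evm M) (tgamma T w ws)) xs) =
       Cmp (acat (fst M)) (ar_map (aop (fst M) w) (m.rhob ws xs))
        (Cmp (acat (fst M)) (cpt (mrho (evm M) w) (P.opb ws xs)) (ar_map (mfun (evm M)) (cpt (acmp P w ws) xs)))"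
      using evm_rho[OF M w(1) o] evm_rho[OF M G(1), of xs] G xs xO A.acmp_simps[OF f io] P.acmp_simps[OF f xs] ev_structure(1)[OF M f xs(1) xO]
        io_opb[OF M w(3) xs(1) xO] evm_map[OF xO] evm_simps(2)[of "cpt (acmp P w ws) xs" M] by (simp del: map_eq_conv)
  next
    fix x assume "x \<in> Obj (acat P)"
    then have x: "x \<in> Ob" by simp
    show "Cmp (acat (fst M)) (cpt (auni (fst M)) [ob_map (mfun (evm M)) x]) (cpt (mrho (evm M) (tunit T)) [x]) = ar_map (mfun (evm M)) (cpt (auni P) [x])"
      using x M A.auni_simps[of "io M x"] P.auni_simps[of x] evm_rho[OF M tunit_word(1), of "[x]"] ev_structure(2)[OF M x] by (simp add: evm_simps)
  next
    fix w l f xs assume w: "w \<in> words T" "index_map (ar w) l f" and xs: "length xs = l" "set xs \<subseteq> Obj (acat P)"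
    have xO: "set xs \<subseteq> Ob" using xs by simp
    have G: "tsub T w l f \<in> words T" "ar (tsub T w l f) = l" using w by auto
    have xf: "length (map ((!) xs) f) = ar w" "set (map ((!) xs) f) \<subseteq> Ob" using index_set[OF w(2) xs(1) xO] by auto
    have fx: "set f \<subseteq> {..<length xs}" using w xs by (auto simp: index_map_def)
    have io: "length (map (io M) xs) = l" "set (map (io M) xs) \<subseteq> Obj (acat (fst M))" using xs io_set[OF M xO] by auto
    show "Cmp (acat (fst M)) (cpt (asub (fst M) w l f) (map (ob_map (mfun (evm M))) xs)) (cpt (mrho (evm M) (tsub T w l f)) xs) =
       Cmp (acat (fst M)) (cpt (mrho (evm M) w) (map ((!) xs) f)) (ar_map (mfun (evm M)) (cpt (asub P w l f) xs))"
      using evm_rho[OF M w(1) xf] evm_rho[OF M G(1), of xs] G xs xO A.asub_simps[OF w io] P.asub_simps[OF w xs] ev_structure(3)[OF M w xs(1) xO]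
        map_index_io[OF fx, of "io M"] evm_map[OF xO] evm_simps(2)[of "cpt (asub P w l f) xs" M] by (simp del: map_map map_eq_conv)
  qed
qed

text \<open>Strict equality, as surjectivity on objects demands. The functors agree on generators,
  and since evaluation has identity constraints, the \<open>\<rho>\<close> of the composite is the
  value of \<open>GR j w xs\<close>, which is the \<open>\<rho>\<close> of the given
  morphism.\<close>

lemma evm_pim:
  assumes M: "M \<in> Mod" and j: "j \<in> Obj J"
  shows "mor_comp T F P (fst M) (evm M) (pim j) = ob_map (snd M) j"
proof -
  interpret D: mor T F "fst M" "ob_map (snd M) j" by (rule mod_mor[OF M j])
  show ?thesis
  proof (rule pmor_eqI[OF F_palg mod_palg[OF M] mor_comp_morphism[OF F_palg P_palg mod_palg[OF M] pim_morphism[OF j] evm_morphism[OF M]] D.pm])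
    show "mfun (mor_comp T F P (fst M) (evm M) (pim j)) = mfun (ob_map (snd M) j)"
    proof (simp, rule functor_eqI[OF fcmp_functor[OF F.cat pim_functor[OF j] evm_functor[OF M]] D.H])
      show "x \<in> Obj (acat F) \<Longrightarrow> ob_map (fcmp (acat F) (mfun (evm M)) (mfun (pim j))) x = ob_map (mfun (ob_map (snd M) j)) x" for x
        using j by (simp add: pim_simps evm_simps)
      show "a \<in> Arr (acat F) \<Longrightarrow> ar_map (fcmp (acat F) (mfun (evm M)) (mfun (pim j))) a = ar_map (mfun (ob_map (snd M) j)) a" for a
        using j M garr[of "GF j a"] by (simp add: pim_simps evm_simps)
    qed
    fix w xs assume w: "w \<in> words T" and xs: "length xs = ar w" "set xs \<subseteq> Obj (acat F)"
    have g: "gok (GR j w xs)" using j w xs by simp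
    have ys: "length (map (gen j) xs) = ar w" "set (map (gen j) xs) \<subseteq> Ob" using gen_set[OF j xs(2)] xs by auto
    show "cpt (mrho (mor_comp T F P (fst M) (evm M) (pim j)) w) xs = cpt (mrho (ob_map (snd M) j) w) xs"
      unfolding mor_comp_rho[OF F_palg P_palg mod_palg[OF M] pim_morphism[OF j] evm_morphism[OF M] w xs] map_pim[OF xs(2)] evm_rho[OF M w ys] io_gen_map[OF j xs(2)]
      using garr[OF g] D.rho_simps[OF w xs] w xs M by (simp add: pim_simps evm_simps)
  qed
qed

text \<open>The component at \<open>x\<close> is the value of the generator \<open>GJ m x\<close>,
  which was set to be the component of the given 2-cell.\<close>

lemma evm_pic:
  assumes M: "M \<in> Mod" and m: "m \<in> Arr J"
  shows "Cmp2 (PsAlg T) F P (fst M) (Idn (hom_PsAlg T P (fst M)) (evm M)) (pic m) = ar_map (snd M) m"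
proof (rule pcell_eqI)
  have jj: "Dom J m \<in> Obj J" "Cod J m \<in> Obj J" using m by auto
  note c = pseudo_cellD[OF F_palg mod_palg[OF M] mod_cell(1)[OF M m]]
  have e: "fcmp (acat F) (mfun (evm M)) (mfun (pim j)) = mfun (ob_map (snd M) j)" if "j \<in> Obj J" for j
    using arg_cong[OF evm_pim[OF M that], of mfun] by simp
  show "csrc (Cmp2 (PsAlg T) F P (fst M) (Idn (hom_PsAlg T P (fst M)) (evm M)) (pic m)) = csrc (ar_map (snd M) m)"
    "ctgt (Cmp2 (PsAlg T) F P (fst M) (Idn (hom_PsAlg T P (fst M)) (evm M)) (pic m)) = ctgt (ar_map (snd M) m)"
    using evm_pim[OF M] jj mod_cell[OF M m] by simp_all
  show "cnat (Cmp2 (PsAlg T) F P (fst M) (Idn (hom_PsAlg T P (fst M)) (evm M)) (pic m)) = cnat (ar_map (snd M) m)"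
  proof (rule ntrans_eqI[where C="acat F"])
    fix x assume x: "x \<in> Obj (acat F)"
    have g: "gok (GJ m x)" using m x by simp
    have "cpt (hcomp (acat F) (acat (fst M)) (nid XP (acat (fst M)) (mfun (evm M))) (cnat (pic m))) x = ar_map (mfun (evm M)) (cpt (cnat (pic m)) x)"
      using cpt_hcomp_nid_left[OF mod_cat[OF M] evm_functor[OF M], of "acat F" "cnat (pic m)" x] pseudo_cellD(3)[OF F_palg P_palg pic_cell[OF m]] x by simp
    then show "cpt (cnat (Cmp2 (PsAlg T) F P (fst M) (Idn (hom_PsAlg T P (fst M)) (evm M)) (pic m))) x = cpt (cnat (ar_map (snd M) m)) x"
      using garr[OF g] x M by (simp add: evm_simps del: hcomp_simps(3))
  qed (use c e jj mod_cell[OF M m] nt_ext[OF c(3)] in simp_all)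
qed

end

section \<open>Extension of 2-cells\<close>

text \<open>Two arbitrary morphisms \<open>b\<close> and \<open>b'\<close> out of the free algebra,
  and a transformation between their restrictions along \<open>pi\<close>, given by its components
  \<open>\<delta> j\<close>.\<close>

locale free_palg_cells = free_palg T J F gen app Ob
  for T :: "'t thy_data" and J :: "('u, 'u) cat" and F :: "('t, 'u, 'u) palg" and gen app Ob +
  fixes A :: "('t, 'u, 'u) palg" and b b' :: "('t, 'u, 'u) pmor" and \<delta> :: "'u \<Rightarrow> ('t, 'u, 'u) pcell"
  assumes A_palg: "palg T A"
    and b_mor: "pseudo_morphism T P A b" and b'_mor: "pseudo_morphism T P A b'"
    and \<delta>: "j \<in> Obj J \<Longrightarrow> \<delta> j \<in> arrows (hom_PsAlg T F A) (mor_comp T F P A b (pim j)) (mor_comp T F P A b' (pim j))"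
    and \<delta>_nat: "m \<in> Arr J \<Longrightarrow>
      Cmp (hom_PsAlg T F A) (\<delta> (Cod J m)) (Cmp2 (PsAlg T) F P A (Idn (hom_PsAlg T P A) b) (pic m)) =
      Cmp (hom_PsAlg T F A) (Cmp2 (PsAlg T) F P A (Idn (hom_PsAlg T P A) b') (pic m)) (\<delta> (Dom J m))"
begin

sublocale b: mor T P A b by (rule morI[OF P_palg A_palg b_mor])
sublocale b': mor T P A b' by (rule morI[OF P_palg A_palg b'_mor])

abbreviation "Y \<equiv> acat A"
abbreviation "bo \<equiv> ob_map (mfun b)"
abbreviation "bo' \<equiv> ob_map (mfun b')"
abbreviation "ba \<equiv> ar_map (mfun b)"
abbreviation "ba' \<equiv> ar_map (mfun b')"

section \<open>The given components and their squares at generators\<close>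

definition dl where "dl j x = cpt (cnat (\<delta> j)) x"

lemma \<delta>_cell:
  assumes "j \<in> Obj J"
  shows "pseudo_cell T F A (\<delta> j)" "csrc (\<delta> j) = mor_comp T F P A b (pim j)" "ctgt (\<delta> j) = mor_comp T F P A b' (pim j)"
  using \<delta>[OF assms] by (auto simp: arrows_iff)

lemma dl_arr:
  assumes "j \<in> Obj J" "x \<in> Obj (acat F)"
  shows "dl j x \<in> arrows Y (bo (gen j x)) (bo' (gen j x))"
  using cell_simps[OF F_palg A_palg \<delta>_cell(1)[OF assms(1)] assms(2)] \<delta>_cell[OF assms(1)] assms
  by (simp add: dl_def pim_simps)

lemma dl_GF:
  assumes "j \<in> Obj J" "a \<in> Arr (acat F)"
  shows "Cmp Y (dl j (Cod (acat F) a)) (ba (garr (GF j a))) = Cmp Y (ba' (garr (GF j a))) (dl j (Dom (acat F) a))"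
  using nt_nat[OF pseudo_cellD(3)[OF F_palg A_palg \<delta>_cell(1)[OF assms(1)]] assms(2)]
    pseudo_cellD(4,5)[OF F_palg A_palg \<delta>_cell(1)[OF assms(1)]] \<delta>_cell[OF assms(1)] assms
  by (simp add: dl_def pim_simps)

text \<open>The 2-cell law of \<open>\<delta> j\<close>, with the \<open>\<rho>\<close> of the two
  composite morphisms written out by \<open>mor_comp_rho\<close>.\<close>

lemma dl_GR:
  assumes j: "j \<in> Obj J" and w: "w \<in> words T" and xs: "length xs = ar w" "set xs \<subseteq> Obj (acat F)"
  shows "Cmp Y (Cmp Y (cpt (mrho b' w) (map (gen j) xs)) (ba' (garr (GR j w xs)))) (dl j (ob_map (aop F w) xs))
    = Cmp Y (ar_map (aop A w) (map (dl j) xs)) (Cmp Y (cpt (mrho b w) (map (gen j) xs)) (ba (garr (GR j w xs))))"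
  using pseudo_cellD(6)[OF F_palg A_palg \<delta>_cell(1)[OF j] w xs] w xs
  by (simp add: dl_def[abs_def] \<delta>_cell[OF j] mor_comp_rho[OF F_palg P_palg A_palg pim_morphism[OF j] b_mor w xs]
     mor_comp_rho[OF F_palg P_palg A_palg pim_morphism[OF j] b'_mor w xs] map_pim[OF xs(2)] pim_simps)

lemma dl_GJ:
  assumes m: "m \<in> Arr J" and x: "x \<in> Obj (acat F)"
  shows "Cmp Y (dl (Cod J m) x) (ba (garr (GJ m x))) = Cmp Y (ba' (garr (GJ m x))) (dl (Dom J m) x)"
proof -
  note n = pseudo_cellD(3)[OF F_palg P_palg pic_cell[OF m]]
  have "cpt (hcomp (acat F) Y (nid XP Y (mfun b)) (cnat (pic m))) x = ba (garr (GJ m x))"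
     "cpt (hcomp (acat F) Y (nid XP Y (mfun b')) (cnat (pic m))) x = ba' (garr (GJ m x))"
    using cpt_hcomp_nid_left[OF b.B.cat b.H n x] cpt_hcomp_nid_left[OF b.B.cat b'.H n x] x by simp_all
  then show ?thesis
    using arg_cong[OF \<delta>_nat[OF m], of "\<lambda>\<alpha>. cpt (cnat \<alpha>) x"] x by (simp add: dl_def del: hcomp_simps(3))
qed

text \<open>The value at \<open>app w xs\<close> is the 2-cell law at \<open>w\<close> and
  \<open>xs\<close>, solved for the component at the formal application by means of the inverse of
  the \<open>\<rho>\<close> of \<open>b'\<close>. The step of the recursion involves
  \<open>xs\<close> itself through both \<open>\<rho>\<close>.\<close>

definition lf where
  "lf = (SOME r. (\<forall>j\<in>Obj J. \<forall>x\<in>Obj (acat F). r (gen j x) = dl j x) \<and>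
    (\<forall>w\<in>words T. \<forall>xs. length xs = arity T w \<longrightarrow> set xs \<subseteq> Ob \<longrightarrow>
      r (app w xs) = Cmp Y (inverse_arrow Y (cpt (mrho b' w) xs)) (Cmp Y (ar_map (aop A w) (map r xs)) (cpt (mrho b w) xs))))"

lemma lf:
  shows "j \<in> Obj J \<Longrightarrow> x \<in> Obj (acat F) \<Longrightarrow> lf (gen j x) = dl j x"
    "w \<in> words T \<Longrightarrow> length xs = ar w \<Longrightarrow> set xs \<subseteq> Ob \<Longrightarrow>
      lf (app w xs) = Cmp Y (inverse_arrow Y (cpt (mrho b' w) xs)) (Cmp Y (ar_map (aop A w) (map lf xs)) (cpt (mrho b w) xs))"
  using someI_ex[OF Ob_rec[of dl "\<lambda>w xs rs. Cmp Y (inverse_arrow Y (cpt (mrho b' w) xs)) (Cmp Y (ar_map (aop A w) rs) (cpt (mrho b w) xs))"]]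
  unfolding lf_def[symmetric] by blast+

lemma lf_arr:
  assumes "x \<in> Ob"
  shows "lf x \<in> arrows Y (bo x) (bo' x)"
  using assms
proof (rule Ob_induct[rotated 2])
  fix j x assume "j \<in> Obj J" "x \<in> Obj (acat F)"
  then show "lf (gen j x) \<in> arrows Y (bo (gen j x)) (bo' (gen j x))" using lf(1) dl_arr by simp
next
  fix w xs assume w: "w \<in> words T" and xs: "length xs = ar w" "set xs \<subseteq> Ob" and IH: "\<And>x. x \<in> set xs \<Longrightarrow> lf x \<in> arrows Y (bo x) (bo' x)"
  have xp: "set xs \<subseteq> Obj (acat P)" using xs by simp
  have "ar_map (aop A w) (map lf xs) \<in> arrows Y (ob_map (aop A w) (map bo xs)) (ob_map (aop A w) (map bo' xs))"
    by (rule b.B.op_arr[OF w]) (use xs IH in auto)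
  then show "lf (app w xs) \<in> arrows Y (bo (app w xs)) (bo' (app w xs))"
    unfolding lf(2)[OF w xs] using b.rho_arr[OF w xs(1) xp] b'.rho_arr[OF w xs(1) xp] inverse_arrow[OF b'.rho_arr(2)[OF w xs(1) xp]] w xs
    by (simp add: arrows_iff P_simps)
qed

lemma lf_op:
  assumes w: "w \<in> words T" and xs: "length xs = ar w" "set xs \<subseteq> Ob"
  shows "ar_map (aop A w) (map lf xs) \<in> arrows Y (ob_map (aop A w) (map bo xs)) (ob_map (aop A w) (map bo' xs))"
  by (rule b.B.op_arr[OF w]) (use xs lf_arr nth_in_set[OF xs(2)] in auto)

lemma lf_cell:
  assumes w: "w \<in> words T" and xs: "length xs = ar w" "set xs \<subseteq> Ob"
  shows "Cmp Y (cpt (mrho b' w) xs) (lf (ob_map (aop P w) xs)) = Cmp Y (ar_map (aop A w) (map lf xs)) (cpt (mrho b w) xs)"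
proof -
  have xp: "set xs \<subseteq> Obj (acat P)" using xs by simp
  note r = b.rho_arr[OF w xs(1) xp] and r' = b'.rho_arr[OF w xs(1) xp]
  note i = inverse_arrow[OF r'(2)]
  have "Cmp Y (cpt (mrho b' w) xs) (lf (ob_map (aop P w) xs)) =
    Cmp Y (Cmp Y (cpt (mrho b' w) xs) (inverse_arrow Y (cpt (mrho b' w) xs))) (Cmp Y (ar_map (aop A w) (map lf xs)) (cpt (mrho b w) xs))"
    using i(1-3) r(1) r'(1) lf_op[OF w xs] w xs by (simp add: P_simps lf(2) cat_assoc arrows_iff)
  then show ?thesis using i r(1) r'(1) lf_op[OF w xs] by (simp add: arrows_iff)
qed

text \<open>Sandwiching the square at \<open>a\<close> between the images of its inverse
  \<open>c\<close> under \<open>b'\<close> and \<open>b\<close> turns it into the square at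
  \<open>c\<close>.\<close>

lemma inv_transfer:
  assumes a: "a \<in> Arr XP" and c: "c \<in> Arr XP" "Dom XP c = Cod XP a" "Cod XP c = Dom XP a"
    "Cmp XP c a = Idn XP (Dom XP a)" "Cmp XP a c = Idn XP (Cod XP a)"
    and q: "Cmp Y (lf (Cod XP a)) (ba a) = Cmp Y (ba' a) (lf (Dom XP a))"
  shows "Cmp Y (lf (Cod XP c)) (ba c) = Cmp Y (ba' c) (lf (Dom XP c))"
proof -
  have O: "Dom XP a \<in> Ob" "Cod XP a \<in> Ob" using XP_typed[OF a] by auto
  note l = lf_arr[OF O(1)] lf_arr[OF O(2)]
  have i: "Cmp Y (ba a) (ba c) = Idn Y (bo (Cod XP a))" "Cmp Y (ba' c) (ba' a) = Idn Y (bo' (Dom XP a))"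
    using b.H_cmp[of c a] b'.H_cmp[of a c] b.H_simps(5)[of "Cod XP a"] b'.H_simps(5)[of "Dom XP a"] a c O by simp_all
  have t: "ba a \<in> arrows Y (bo (Dom XP a)) (bo (Cod XP a))" "ba' a \<in> arrows Y (bo' (Dom XP a)) (bo' (Cod XP a))"
    "ba c \<in> arrows Y (bo (Cod XP a)) (bo (Dom XP a))" "ba' c \<in> arrows Y (bo' (Cod XP a)) (bo' (Dom XP a))"
    using a c b.H_simps b'.H_simps by (simp_all add: arrows_iff)
  have "Cmp Y (lf (Dom XP a)) (ba c) = Cmp Y (Cmp Y (Cmp Y (ba' c) (ba' a)) (lf (Dom XP a))) (ba c)"
    unfolding i using l t by (simp add: arrows_iff)
  also have "\<dots> = Cmp Y (Cmp Y (ba' c) (Cmp Y (ba' a) (lf (Dom XP a)))) (ba c)" using l t by (simp add: arrows_iff cat_assoc)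
  also have "\<dots> = Cmp Y (ba' c) (Cmp Y (lf (Cod XP a)) (Cmp Y (ba a) (ba c)))" unfolding q[symmetric] using l t by (simp add: arrows_iff cat_assoc)
  also have "\<dots> = Cmp Y (ba' c) (lf (Cod XP a))" unfolding i using l t by (simp add: arrows_iff)
  finally show ?thesis using c by simp
qed

text \<open>Both sides are compared after composition with the invertible arrow formed by
  \<open>?r'\<close> followed by \<open>?R'\<close>. The morphism laws of \<open>b\<close> and
  \<open>b'\<close> for \<open>c\<close> (\<open>e3\<close>, \<open>e3'\<close>), naturality of
  \<open>c\<close> in \<open>A\<close> (\<open>e4\<close>), and the 2-cell law at \<open>w\<close>,
  on the blocks and at the substituted word (\<open>e1\<close>, \<open>e2\<close>,
  \<open>e5\<close>) carry one side into the other.\<close>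

lemma lf_GC:
  assumes f: "fits T w ws" and xs: "length xs = sum_list (map ar ws)" "set xs \<subseteq> Ob"
  shows "Cmp Y (lf (ob_map (aop P w) (P.opb ws xs))) (ba (cpt (acmp P w ws) xs)) = Cmp Y (ba' (cpt (acmp P w ws) xs)) (lf (ob_map (aop P (tgamma T w ws)) xs))"
    (is "Cmp Y ?tw ?ba = Cmp Y ?ba' ?tg")
proof -
  have w: "w \<in> words T" "length ws = ar w" "set ws \<subseteq> words T" using f by (auto simp: fits_def)
  have wi: "i < length ws \<Longrightarrow> ws ! i \<in> words T" for i using w by (rule_tac nth_in_set)
  have G: "tgamma T w ws \<in> words T" "ar (tgamma T w ws) = sum_list (map ar ws)" using f by auto
  have xG: "length xs = ar (tgamma T w ws)" using xs G by simp
  have xp: "set xs \<subseteq> Obj (acat P)" using xs by simp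
  have o: "length (P.opb ws xs) = ar w" "set (P.opb ws xs) \<subseteq> Ob" using w P.opb_obj[OF w(3) xs(1)] xs by auto
  have op: "set (P.opb ws xs) \<subseteq> Obj (acat P)" using o by simp
  have b: "length (blocks (map ar ws) xs ! i) = ar (ws ! i)" "set (blocks (map ar ws) xs ! i) \<subseteq> Ob" if "i < length ws" for i
    using blocks_obj[of i "map ar ws" xs Ob] xs that by auto
  define ls where "ls = map2 (\<lambda>u. ar_map (aop A u)) ws (blocks (map ar ws) (map lf xs))"
  have li: "ls ! i = ar_map (aop A (ws ! i)) (map lf (blocks (map ar ws) xs ! i))" if "i < length ws" for i
    using that by (simp add: ls_def blocks_map)
  have ll: "length ls = ar w" by (simp add: ls_def w)
  have lt: "ls ! i \<in> arrows Y (b.B.opb ws (map bo xs) ! i) (b.B.opb ws (map bo' xs) ! i)" if "i < length ws" for i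
    using lf_op[OF wi[OF that] b[OF that]] li[OF that] that by (simp add: blocks_map)
  note rb = b.rhob[OF w(3) xs(1) xp] and rb' = b'.rhob[OF w(3) xs(1) xp]
  note cA = P.acmp_simps[OF f xs(1) xp]
  have cP: "cpt (acmp P w ws) xs \<in> arrows XP (ob_map (aop P (tgamma T w ws)) xs) (ob_map (aop P w) (P.opb ws xs))"
    using cA by (simp add: arrows_iff)
  have bs: "length (map bo xs) = sum_list (map ar ws)" "set (map bo xs) \<subseteq> Obj Y" and bs': "length (map bo' xs) = sum_list (map ar ws)" "set (map bo' xs) \<subseteq> Obj Y"
    using xs xp by auto
  let ?r' = "cpt (mrho b' w) (P.opb ws xs)" and ?r = "cpt (mrho b w) (P.opb ws xs)"
    and ?R' = "ar_map (aop A w) (b'.rhob ws xs)" and ?R = "ar_map (aop A w) (b.rhob ws xs)"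
    and ?L = "ar_map (aop A w) (map lf (P.opb ws xs))" and ?S = "ar_map (aop A w) ls"
    and ?c = "cpt (acmp A w ws) (map bo xs)" and ?c' = "cpt (acmp A w ws) (map bo' xs)"
    and ?g = "cpt (mrho b (tgamma T w ws)) xs" and ?g' = "cpt (mrho b' (tgamma T w ws)) xs"
    and ?LG = "ar_map (aop A (tgamma T w ws)) (map lf xs)"
  have oO: "ob_map (aop P w) (P.opb ws xs) \<in> Ob" "ob_map (aop P (tgamma T w ws)) xs \<in> Ob" using w o G xs by (simp_all add: P_simps)
  have ty: "?tw \<in> arrows Y (bo (ob_map (aop P w) (P.opb ws xs))) (bo' (ob_map (aop P w) (P.opb ws xs)))"
    "?tg \<in> arrows Y (bo (ob_map (aop P (tgamma T w ws)) xs)) (bo' (ob_map (aop P (tgamma T w ws)) xs))"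
    "?ba \<in> arrows Y (bo (ob_map (aop P (tgamma T w ws)) xs)) (bo (ob_map (aop P w) (P.opb ws xs)))"
    "?ba' \<in> arrows Y (bo' (ob_map (aop P (tgamma T w ws)) xs)) (bo' (ob_map (aop P w) (P.opb ws xs)))"
    "?r \<in> arrows Y (bo (ob_map (aop P w) (P.opb ws xs))) (ob_map (aop A w) (map bo (P.opb ws xs)))"
    "?r' \<in> arrows Y (bo' (ob_map (aop P w) (P.opb ws xs))) (ob_map (aop A w) (map bo' (P.opb ws xs)))"
    "?R \<in> arrows Y (ob_map (aop A w) (map bo (P.opb ws xs))) (ob_map (aop A w) (b.B.opb ws (map bo xs)))"
    "?R' \<in> arrows Y (ob_map (aop A w) (map bo' (P.opb ws xs))) (ob_map (aop A w) (b.B.opb ws (map bo' xs)))"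
    "?L \<in> arrows Y (ob_map (aop A w) (map bo (P.opb ws xs))) (ob_map (aop A w) (map bo' (P.opb ws xs)))"
    "?S \<in> arrows Y (ob_map (aop A w) (b.B.opb ws (map bo xs))) (ob_map (aop A w) (b.B.opb ws (map bo' xs)))"
    "?c \<in> arrows Y (ob_map (aop A (tgamma T w ws)) (map bo xs)) (ob_map (aop A w) (b.B.opb ws (map bo xs)))"
    "?c' \<in> arrows Y (ob_map (aop A (tgamma T w ws)) (map bo' xs)) (ob_map (aop A w) (b.B.opb ws (map bo' xs)))"
    "?g \<in> arrows Y (bo (ob_map (aop P (tgamma T w ws)) xs)) (ob_map (aop A (tgamma T w ws)) (map bo xs))"
    "?g' \<in> arrows Y (bo' (ob_map (aop P (tgamma T w ws)) xs)) (ob_map (aop A (tgamma T w ws)) (map bo' xs))"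
    "?LG \<in> arrows Y (ob_map (aop A (tgamma T w ws)) (map bo xs)) (ob_map (aop A (tgamma T w ws)) (map bo' xs))"
    subgoal by (rule lf_arr[OF oO(1)])
    subgoal by (rule lf_arr[OF oO(2)])
    subgoal using functor_arrows[OF b.H, of "cpt (acmp P w ws) xs"] cP by simp
    subgoal using functor_arrows[OF b'.H, of "cpt (acmp P w ws) xs"] cP by simp
    subgoal by (rule b.rho_arr(1)[OF w(1) o(1) op])
    subgoal by (rule b'.rho_arr(1)[OF w(1) o(1) op])
    subgoal by (rule b.B.op_arr[OF w(1)]) (use w rb in \<open>simp_all del: nth_map\<close>)
    subgoal by (rule b.B.op_arr[OF w(1)]) (use w rb' in \<open>simp_all del: nth_map\<close>)
    subgoal by (rule lf_op[OF w(1) o])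
    subgoal by (rule b.B.op_arr[OF w(1)]) (use w ll lt in simp_all)
    subgoal using b.B.acmp_simps[OF f bs] by (simp add: arrows_iff)
    subgoal using b.B.acmp_simps[OF f bs'] by (simp add: arrows_iff)
    subgoal by (rule b.rho_arr(1)[OF G(1) xG xp])
    subgoal by (rule b'.rho_arr(1)[OF G(1) xG xp])
    subgoal by (rule lf_op[OF G(1) xG xs(2)])
    done
  have e1: "Cmp Y ?r' ?tw = Cmp Y ?L ?r" by (rule lf_cell[OF w(1) o])
  have e2: "Cmp Y ?R' ?L = Cmp Y ?S ?R"
  proof -
    \<comment> \<open>On each block this is the 2-cell law of an inner word. \<open>ms\<close> lists
      the diagonals of these squares, and the operation \<open>aop A w\<close> is applied to both
      factorisations of it.\<close>
    define ms where "ms = map2 (Cmp Y) ls (b.rhob ws xs)"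
    have lm: "length ms = ar w" using ll rb(1) w by (simp add: ms_def)
    have mi: "ms ! i = Cmp Y (ls ! i) (b.rhob ws xs ! i)" if "i < ar w" for i using that ll rb(1) w by (simp add: ms_def)
    have ti: "lf (P.opb ws xs ! i) \<in> arrows Y (bo (P.opb ws xs ! i)) (bo' (P.opb ws xs ! i))" if "i < ar w" for i
      using lf_arr nth_in_set[OF o(2)] o(1) that by simp
    have A1: "ar_map (aop A w) ms = Cmp Y ?S ?R"
      by (rule b.B.op_comp[OF w(1)]) (use w rb lt ll mi lm in \<open>auto simp: arrows_iff simp del: b.B.opb_nth nth_map\<close>)
    have A2: "ar_map (aop A w) ms = Cmp Y ?R' ?L"
    proof (rule b.B.op_comp[OF w(1)])
      fix i assume i: "i < ar w"
      then have i': "i < length ws" using w by simp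
      show "map lf (P.opb ws xs) ! i \<in> Arr Y" "b'.rhob ws xs ! i \<in> Arr Y" "Cod Y (map lf (P.opb ws xs) ! i) = Dom Y (b'.rhob ws xs ! i)"
        using ti[OF i] rb'(3)[OF i'] i' o w by (auto simp: arrows_iff)
      show "ms ! i = Cmp Y (b'.rhob ws xs ! i) (map lf (P.opb ws xs) ! i)"
        using mi[OF i] lf_cell[OF wi[OF i'] b[OF i']] rb(2)[OF i'] rb'(2)[OF i'] li[OF i'] i' by simp
    qed (use w o rb' lm in auto)
    show ?thesis using A1 A2 by simp
  qed
  have e3: "Cmp Y ?c ?g = Cmp Y ?R (Cmp Y ?r ?ba)" by (rule b.mor_coh1[OF f xs(1) xp])
  have e3': "Cmp Y ?c' ?g' = Cmp Y ?R' (Cmp Y ?r' ?ba')" by (rule b'.mor_coh1[OF f xs(1) xp])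
  have tx: "lf x \<in> arrows Y (bo x) (bo' x)" if "x \<in> set xs" for x using lf_arr xs that by auto
  have e4: "Cmp Y ?c' ?LG = Cmp Y ?S ?c"
  proof -
    have "set (map lf xs) \<subseteq> Arr Y" "map (Dom Y) (map lf xs) = map bo xs" "map (Cod Y) (map lf xs) = map bo' xs"
      using tx by (auto simp: arrows_iff)
    then show ?thesis using b.B.acmp_nat[OF f, of "map lf xs"] xs by (simp add: ls_def del: map_map map_eq_conv set_map)
  qed
  have e5: "Cmp Y ?g' ?tg = Cmp Y ?LG ?g" by (rule lf_cell[OF G(1) xG xs(2)])
  have R'inv: "invertible_arrow Y ?R'" by (rule b.B.op_invertible[OF w(1)]) (use rb' w in auto)
  have r'inv: "invertible_arrow Y ?r'" by (rule b'.rho_arr(2)[OF w(1) o(1) op])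
  have inv: "invertible_arrow Y (Cmp Y ?R' ?r')" by (rule inv_arrow_cmp[OF b.B.cat r'inv R'inv]) (use ty in \<open>simp add: arrows_iff\<close>)
  have "Cmp Y (Cmp Y ?R' ?r') (Cmp Y ?tw ?ba) = Cmp Y ?R' (Cmp Y (Cmp Y ?r' ?tw) ?ba)" using ty by (simp add: arrows_iff cat_assoc)
  also have "\<dots> = Cmp Y (Cmp Y ?R' ?L) (Cmp Y ?r ?ba)" unfolding e1 using ty by (simp add: arrows_iff cat_assoc)
  also have "\<dots> = Cmp Y ?S (Cmp Y ?R (Cmp Y ?r ?ba))" unfolding e2 using ty by (simp add: arrows_iff cat_assoc)
  also have "\<dots> = Cmp Y (Cmp Y ?S ?c) ?g" unfolding e3[symmetric] using ty by (simp add: arrows_iff cat_assoc)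
  also have "\<dots> = Cmp Y ?c' (Cmp Y ?LG ?g)" unfolding e4[symmetric] using ty by (simp add: arrows_iff cat_assoc)
  also have "\<dots> = Cmp Y (Cmp Y ?c' ?g') ?tg" unfolding e5[symmetric] using ty by (simp add: arrows_iff cat_assoc)
  also have "\<dots> = Cmp Y (Cmp Y ?R' ?r') (Cmp Y ?ba' ?tg)" unfolding e3' using ty by (simp add: arrows_iff cat_assoc)
  finally have e: "Cmp Y (Cmp Y ?R' ?r') (Cmp Y ?tw ?ba) = Cmp Y (Cmp Y ?R' ?r') (Cmp Y ?ba' ?tg)" .
  show ?thesis
    by (rule mono_cancel[OF b.B.cat inv _ _ _ _ e]) (use ty in \<open>simp_all add: arrows_iff\<close>)
qed

text \<open>The unit laws of \<open>b\<close> and \<open>b'\<close> express the images of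
  \<open>I\<close> through \<open>I\<close> of \<open>A\<close>. Its naturality at
  \<open>lf x\<close> and the 2-cell law at the unit word give the rest, with no
  cancellation.\<close>

lemma lf_GI:
  assumes x: "x \<in> Ob"
  shows "Cmp Y (lf x) (ba (cpt (auni P) [x])) = Cmp Y (ba' (cpt (auni P) [x])) (lf (ob_map (aop P (tunit T)) [x]))"
proof -
  have xp: "x \<in> Obj (acat P)" using x by simp
  have u: "length [x] = ar (tunit T)" "set [x] \<subseteq> Ob" using x by auto
  have O: "ob_map (aop P (tunit T)) [x] \<in> Ob" using x by (simp add: P_simps)
  note l = lf_arr[OF x] lf_arr[OF O]
  note r = b.rho_arr(1)[OF tunit_word(1), of "[x]"] b'.rho_arr(1)[OF tunit_word(1), of "[x]"]
  have i: "cpt (auni A) [bo x] \<in> arrows Y (ob_map (aop A (tunit T)) [bo x]) (bo x)" "cpt (auni A) [bo' x] \<in> arrows Y (ob_map (aop A (tunit T)) [bo' x]) (bo' x)"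
    using b.B.auni_simps[of "bo x"] b.B.auni_simps[of "bo' x"] b.H_simps(1)[of x] b'.H_simps(1)[of x] x by (simp_all add: arrows_iff)
  let ?L = "ar_map (aop A (tunit T)) [lf x]"
  have L: "?L \<in> arrows Y (ob_map (aop A (tunit T)) [bo x]) (ob_map (aop A (tunit T)) [bo' x])"
    using lf_op[OF tunit_word(1) u] by simp
  have "Cmp Y (lf x) (ba (cpt (auni P) [x])) = Cmp Y (Cmp Y (lf x) (cpt (auni A) [bo x])) (cpt (mrho b (tunit T)) [x])"
    unfolding b.mor_coh2[OF xp, symmetric] using l r i x by (simp add: arrows_iff cat_assoc)
  also have "Cmp Y (lf x) (cpt (auni A) [bo x]) = Cmp Y (cpt (auni A) [bo' x]) ?L"
    using b.B.auni_nat[of "lf x"] l by (simp add: arrows_iff)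
  also have "Cmp Y \<dots> (cpt (mrho b (tunit T)) [x]) = Cmp Y (cpt (auni A) [bo' x]) (Cmp Y ?L (cpt (mrho b (tunit T)) [x]))"
    using L i r x by (simp add: arrows_iff cat_assoc)
  also have "Cmp Y ?L (cpt (mrho b (tunit T)) [x]) = Cmp Y (cpt (mrho b' (tunit T)) [x]) (lf (ob_map (aop P (tunit T)) [x]))"
    using lf_cell[OF tunit_word(1) u] by simp
  also have "Cmp Y (cpt (auni A) [bo' x]) \<dots> = Cmp Y (ba' (cpt (auni P) [x])) (lf (ob_map (aop P (tunit T)) [x]))"
    unfolding b'.mor_coh2[OF xp, symmetric] using l r i x by (simp add: arrows_iff cat_assoc)
  finally show ?thesis .
qed

text \<open>As for \<open>c\<close>, with one reindexed list in place of the blocks; cancelling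
  \<open>?r'\<close> is enough.\<close>

lemma lf_GS:
  assumes w: "w \<in> words T" "index_map (ar w) l f" and xs: "length xs = l" "set xs \<subseteq> Ob"
  shows "Cmp Y (lf (ob_map (aop P w) (map ((!) xs) f))) (ba (cpt (asub P w l f) xs)) = Cmp Y (ba' (cpt (asub P w l f) xs)) (lf (ob_map (aop P (tsub T w l f)) xs))"
    (is "Cmp Y ?tw ?ba = Cmp Y ?ba' ?tg")
proof -
  have G: "tsub T w l f \<in> words T" "ar (tsub T w l f) = l" using w by auto
  have xG: "length xs = ar (tsub T w l f)" using xs G by simp
  have xp: "set xs \<subseteq> Obj (acat P)" using xs by simp
  have f: "set f \<subseteq> {..<length xs}" using w xs by (auto simp: index_map_def)
  have o: "length (map ((!) xs) f) = ar w" "set (map ((!) xs) f) \<subseteq> Ob" using index_set[OF w(2) xs] by auto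
  have op: "set (map ((!) xs) f) \<subseteq> Obj (acat P)" using o by simp
  have bs: "length (map bo xs) = l" "set (map bo xs) \<subseteq> Obj Y" and bs': "length (map bo' xs) = l" "set (map bo' xs) \<subseteq> Obj Y"
    using xs xp by auto
  have cP: "cpt (asub P w l f) xs \<in> arrows XP (ob_map (aop P (tsub T w l f)) xs) (ob_map (aop P w) (map ((!) xs) f))"
    using P.asub_simps[OF w xs(1) xp] by (simp add: arrows_iff)
  let ?r' = "cpt (mrho b' w) (map ((!) xs) f)" and ?r = "cpt (mrho b w) (map ((!) xs) f)"
    and ?L = "ar_map (aop A w) (map lf (map ((!) xs) f))"
    and ?c = "cpt (asub A w l f) (map bo xs)" and ?c' = "cpt (asub A w l f) (map bo' xs)"
    and ?g = "cpt (mrho b (tsub T w l f)) xs" and ?g' = "cpt (mrho b' (tsub T w l f)) xs"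
    and ?LG = "ar_map (aop A (tsub T w l f)) (map lf xs)"
  have oO: "ob_map (aop P w) (map ((!) xs) f) \<in> Ob" "ob_map (aop P (tsub T w l f)) xs \<in> Ob" using w o G xs by (simp_all add: P_simps del: set_map)
  have ty: "?tw \<in> arrows Y (bo (ob_map (aop P w) (map ((!) xs) f))) (bo' (ob_map (aop P w) (map ((!) xs) f)))"
    "?tg \<in> arrows Y (bo (ob_map (aop P (tsub T w l f)) xs)) (bo' (ob_map (aop P (tsub T w l f)) xs))"
    "?ba \<in> arrows Y (bo (ob_map (aop P (tsub T w l f)) xs)) (bo (ob_map (aop P w) (map ((!) xs) f)))"
    "?ba' \<in> arrows Y (bo' (ob_map (aop P (tsub T w l f)) xs)) (bo' (ob_map (aop P w) (map ((!) xs) f)))"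
    "?r \<in> arrows Y (bo (ob_map (aop P w) (map ((!) xs) f))) (ob_map (aop A w) (map bo (map ((!) xs) f)))"
    "?r' \<in> arrows Y (bo' (ob_map (aop P w) (map ((!) xs) f))) (ob_map (aop A w) (map bo' (map ((!) xs) f)))"
    "?L \<in> arrows Y (ob_map (aop A w) (map bo (map ((!) xs) f))) (ob_map (aop A w) (map bo' (map ((!) xs) f)))"
    "?c \<in> arrows Y (ob_map (aop A (tsub T w l f)) (map bo xs)) (ob_map (aop A w) (map ((!) (map bo xs)) f))"
    "?c' \<in> arrows Y (ob_map (aop A (tsub T w l f)) (map bo' xs)) (ob_map (aop A w) (map ((!) (map bo' xs)) f))"
    "?g \<in> arrows Y (bo (ob_map (aop P (tsub T w l f)) xs)) (ob_map (aop A (tsub T w l f)) (map bo xs))"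
    "?g' \<in> arrows Y (bo' (ob_map (aop P (tsub T w l f)) xs)) (ob_map (aop A (tsub T w l f)) (map bo' xs))"
    "?LG \<in> arrows Y (ob_map (aop A (tsub T w l f)) (map bo xs)) (ob_map (aop A (tsub T w l f)) (map bo' xs))"
    subgoal by (rule lf_arr[OF oO(1)])
    subgoal by (rule lf_arr[OF oO(2)])
    subgoal using functor_arrows[OF b.H, of "cpt (asub P w l f) xs"] cP by simp
    subgoal using functor_arrows[OF b'.H, of "cpt (asub P w l f) xs"] cP by simp
    subgoal by (rule b.rho_arr(1)[OF w(1) o(1) op])
    subgoal by (rule b'.rho_arr(1)[OF w(1) o(1) op])
    subgoal by (rule lf_op[OF w(1) o])
    subgoal using b.B.asub_simps[OF w bs] by (simp add: arrows_iff)
    subgoal using b.B.asub_simps[OF w bs'] by (simp add: arrows_iff)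
    subgoal by (rule b.rho_arr(1)[OF G(1) xG xp])
    subgoal by (rule b'.rho_arr(1)[OF G(1) xG xp])
    subgoal by (rule lf_op[OF G(1) xG xs(2)])
    done
  \<comment> \<open>Rewrites the codomains of \<open>?c\<close> and \<open>?c'\<close> into images
    of the reindexed list, the form in which they match the codomains of \<open>?r\<close> and
    \<open>?r'\<close>.\<close>
  note ty' = ty[folded map_index_io[OF f]]
  have e1: "Cmp Y ?r' ?tw = Cmp Y ?L ?r" by (rule lf_cell[OF w(1) o])
  have e3: "Cmp Y ?c ?g = Cmp Y ?r ?ba" by (rule b.mor_coh3[OF w xs(1) xp])
  have e3': "Cmp Y ?c' ?g' = Cmp Y ?r' ?ba'" by (rule b'.mor_coh3[OF w xs(1) xp])
  have tx: "lf x \<in> arrows Y (bo x) (bo' x)" if "x \<in> set xs" for x using lf_arr xs that by auto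
  have e4: "Cmp Y ?c' ?LG = Cmp Y ?L ?c"
  proof -
    have "set (map lf xs) \<subseteq> Arr Y" "map (Dom Y) (map lf xs) = map bo xs" "map (Cod Y) (map lf xs) = map bo' xs"
      using tx by (auto simp: arrows_iff)
    then show ?thesis using b.B.asub_nat[OF w, of "map lf xs"] xs map_index_io[OF f, of lf] by (simp del: map_map map_eq_conv set_map)
  qed
  have e5: "Cmp Y ?g' ?tg = Cmp Y ?LG ?g" by (rule lf_cell[OF G(1) xG xs(2)])
  have r'inv: "invertible_arrow Y ?r'" by (rule b'.rho_arr(2)[OF w(1) o(1) op])
  have "Cmp Y ?r' (Cmp Y ?tw ?ba) = Cmp Y (Cmp Y ?r' ?tw) ?ba" using ty' by (simp add: arrows_iff cat_assoc del: map_map)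
  also have "\<dots> = Cmp Y ?L (Cmp Y ?r ?ba)" unfolding e1 using ty' by (simp add: arrows_iff cat_assoc del: map_map)
  also have "\<dots> = Cmp Y (Cmp Y ?L ?c) ?g" unfolding e3[symmetric] using ty' by (simp add: arrows_iff cat_assoc del: map_map)
  also have "\<dots> = Cmp Y ?c' (Cmp Y ?LG ?g)" unfolding e4[symmetric] using ty' by (simp add: arrows_iff cat_assoc del: map_map)
  also have "\<dots> = Cmp Y (Cmp Y ?c' ?g') ?tg" unfolding e5[symmetric] using ty' by (simp add: arrows_iff cat_assoc del: map_map)
  also have "\<dots> = Cmp Y ?r' (Cmp Y ?ba' ?tg)" unfolding e3' using ty' by (simp add: arrows_iff cat_assoc del: map_map)
  finally have e: "Cmp Y ?r' (Cmp Y ?tw ?ba) = Cmp Y ?r' (Cmp Y ?ba' ?tg)" .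
  show ?thesis
    by (rule mono_cancel[OF b.B.cat r'inv _ _ _ _ e]) (use ty' in \<open>simp_all add: arrows_iff del: map_map\<close>)
qed

text \<open>At a generator \<open>gen j x\<close> the extension is \<open>dl j x\<close>. After
  composition with the invertible \<open>\<rho>\<close> of \<open>b'\<close> the claim is therefore
  the 2-cell law \<open>dl_GR\<close>.\<close>

lemma lf_GR:
  assumes j: "j \<in> Obj J" and w: "w \<in> words T" and xs: "length xs = ar w" "set xs \<subseteq> Obj (acat F)"
  shows "Cmp Y (lf (app w (map (gen j) xs))) (ba (garr (GR j w xs))) = Cmp Y (ba' (garr (GR j w xs))) (lf (gen j (ob_map (aop F w) xs)))"
proof -
  let ?ys = "map (gen j) xs"
  have ys: "length ?ys = ar w" "set ?ys \<subseteq> Ob" using gen_set[OF j xs(2)] xs by auto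
  have yp: "set ?ys \<subseteq> Obj (acat P)" using ys by simp
  have g: "gok (GR j w xs)" using j w xs by simp
  have a: "garr (GR j w xs) \<in> arrows XP (gen j (ob_map (aop F w) xs)) (app w ?ys)" using garr_arrows[OF g] by simp
  have o: "ob_map (aop F w) xs \<in> Obj (acat F)" using w xs by simp
  have O: "app w ?ys \<in> Ob" "gen j (ob_map (aop F w) xs) \<in> Ob" using w ys j o by (simp_all del: set_map)
  have P: "ob_map (aop P w) ?ys = app w ?ys" using P_simps(1)[OF w ys] .
  have ba: "ba (garr (GR j w xs)) \<in> arrows Y (bo (gen j (ob_map (aop F w) xs))) (bo (app w ?ys))"
    "ba' (garr (GR j w xs)) \<in> arrows Y (bo' (gen j (ob_map (aop F w) xs))) (bo' (app w ?ys))"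
    using functor_arrows[OF b.H, of "garr (GR j w xs)"] functor_arrows[OF b'.H, of "garr (GR j w xs)"] a by simp_all
  note l = lf_arr[OF O(1)] lf_arr[OF O(2)] and r = b.rho_arr[OF w ys(1) yp, unfolded P] and r' = b'.rho_arr[OF w ys(1) yp, unfolded P]
  have m: "map lf ?ys = map (dl j) xs" using j xs lf(1) by (auto simp: subset_iff)
  note c = lf_cell[OF w ys, unfolded P m] and L = lf_op[OF w ys, unfolded m]
  have "Cmp Y (cpt (mrho b' w) ?ys) (Cmp Y (lf (app w ?ys)) (ba (garr (GR j w xs))))
     = Cmp Y (ar_map (aop A w) (map (dl j) xs)) (Cmp Y (cpt (mrho b w) ?ys) (ba (garr (GR j w xs))))"
    using l r(1) r'(1) ba L c by (simp add: arrows_iff del: map_map flip: cat_assoc)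
  also have "\<dots> = Cmp Y (cpt (mrho b' w) ?ys) (Cmp Y (ba' (garr (GR j w xs))) (lf (gen j (ob_map (aop F w) xs))))"
    unfolding dl_GR[OF j w xs, symmetric] lf(1)[OF j o, symmetric] using l r'(1) ba by (simp add: arrows_iff cat_assoc del: map_map)
  finally have e: "Cmp Y (cpt (mrho b' w) ?ys) (Cmp Y (lf (app w ?ys)) (ba (garr (GR j w xs)))) =
     Cmp Y (cpt (mrho b' w) ?ys) (Cmp Y (ba' (garr (GR j w xs))) (lf (gen j (ob_map (aop F w) xs))))" .
  show ?thesis
    by (rule mono_cancel[OF b.B.cat r'(2) _ _ _ _ e]) (use l r'(1) ba in \<open>simp_all add: arrows_iff del: map_map\<close>)
qed

text \<open>Induction over the generation of arrows: every generator has its own square, squares are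
  pasted for composites and reversed for inverses. For an operation, naturality of the
  \<open>\<rho>\<close> of \<open>b\<close> and of \<open>b'\<close> reduces the claim to the
  squares of the arguments, and the \<open>\<rho>\<close> of \<open>b'\<close> is cancelled at the
  end.\<close>

lemma lf_natural:
  assumes "a \<in> Arr XP"
  shows "Cmp Y (lf (Cod XP a)) (ba a) = Cmp Y (ba' a) (lf (Dom XP a))"
  using assms
proof (induction rule: arr_induct)
  case (gen g)
  note ga = garr[OF gen]
  show ?case
  proof (cases g)
    case (GId x)
    then have x: "x \<in> Ob" using gen by simp
    then show ?thesis using GId lf_arr[OF x] b.H_simps(5)[of x] b'.H_simps(5)[of x] by (simp add: ga XP_Idn[symmetric] arrows_iff)
  next
    case (GC w ws xs)
    then have f: "fits T w ws" and xs: "length xs = sum_list (map ar ws)" "set xs \<subseteq> Ob" using gen by auto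
    have w: "w \<in> words T" "length ws = ar w" "set ws \<subseteq> words T" using f by (auto simp: fits_def)
    show ?thesis using lf_GC[OF f xs] GC P_opb[OF w(3) xs] pob[OF w(3) xs] w f xs by (simp add: ga[unfolded GC] P_simps)
  next
    case (GI x)
    then have x: "x \<in> Ob" using gen by simp
    show ?thesis using lf_GI[OF x] GI x by (simp add: ga[unfolded GI] P_simps)
  next
    case (GS w l f xs)
    then have w: "w \<in> words T" "index_map (ar w) l f" and xs: "length xs = l" "set xs \<subseteq> Ob" using gen by auto
    show ?thesis using lf_GS[OF w xs] GS w xs index_set[OF w(2) xs] by (simp add: ga[unfolded GS] P_simps del: set_map)
  next
    case (GF j a)
    then show ?thesis using gen dl_GF[of j a] by (simp add: ga[unfolded GF] lf(1))
  next
    case (GR j w xs)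
    then show ?thesis using gen lf_GR[of j w xs] by (simp add: ga[unfolded GR])
  next
    case (GJ m x)
    then show ?thesis using gen dl_GJ[of m x] by (simp add: ga[unfolded GJ] lf(1))
  qed
next
  case (cmp a c)
  note O = XP_typed[OF cmp(1)] XP_typed[OF cmp(2)]
  have l: "lf (Dom XP a) \<in> arrows Y (bo (Dom XP a)) (bo' (Dom XP a))" "lf (Dom XP c) \<in> arrows Y (bo (Dom XP c)) (bo' (Dom XP c))"
    "lf (Cod XP c) \<in> arrows Y (bo (Cod XP c)) (bo' (Cod XP c))" using lf_arr O by auto
  have t: "ba a \<in> arrows Y (bo (Dom XP a)) (bo (Dom XP c))" "ba' a \<in> arrows Y (bo' (Dom XP a)) (bo' (Dom XP c))"
    "ba c \<in> arrows Y (bo (Dom XP c)) (bo (Cod XP c))" "ba' c \<in> arrows Y (bo' (Dom XP c)) (bo' (Cod XP c))"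
    using cmp(1-3) b.H_simps b'.H_simps by (simp_all add: arrows_iff)
  have "Cmp Y (lf (Cod XP c)) (Cmp Y (ba c) (ba a)) = Cmp Y (Cmp Y (lf (Cod XP c)) (ba c)) (ba a)" using l t by (simp add: arrows_iff cat_assoc)
  also have "\<dots> = Cmp Y (ba' c) (Cmp Y (lf (Dom XP c)) (ba a))" unfolding cmp(5) using l t by (simp add: arrows_iff cat_assoc)
  also have "Cmp Y (lf (Dom XP c)) (ba a) = Cmp Y (ba' a) (lf (Dom XP a))" using cmp(3,4) by simp
  also have "Cmp Y (ba' c) \<dots> = Cmp Y (Cmp Y (ba' c) (ba' a)) (lf (Dom XP a))" using l t by (simp add: arrows_iff cat_assoc)
  finally show ?case using cmp(1-3) b.H_cmp[of a c] b'.H_cmp[of a c] by (simp add: XP_Cmp)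
next
  case (op w fs)
  note w = op(1) and fs = op(2,3)
  have fp: "set fs \<subseteq> Arr (acat P)" using fs by simp
  let ?ds = "map (Dom XP) fs" and ?cs = "map (Cod XP) fs"
  have ds: "length ?ds = ar w" "set ?ds \<subseteq> Ob" and cs: "length ?cs = ar w" "set ?cs \<subseteq> Ob" using fs XP_Obs by auto
  have dp: "set ?ds \<subseteq> Obj (acat P)" and cp: "set ?cs \<subseteq> Obj (acat P)" using ds cs by simp_all
  have P: "ob_map (aop P w) ?ds = app w ?ds" "ob_map (aop P w) ?cs = app w ?cs" "ar_map (aop P w) fs = appa w fs"
    using P_simps(1)[OF w ds] P_simps(1)[OF w cs] P_simps(2)[OF w fs] by auto
  have fi: "fs ! i \<in> Arr XP" "fs ! i \<in> set fs" if "i < ar w" for i using fs that by (auto intro!: nth_in_set)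
  note ap = appa[OF w fs]
  have O: "app w ?ds \<in> Ob" "app w ?cs \<in> Ob" using XP_typed[OF ap(1)] ap(2,3) by auto
  note l = lf_arr[OF O(1)] lf_arr[OF O(2)]
  have t: "ba (appa w fs) \<in> arrows Y (bo (app w ?ds)) (bo (app w ?cs))" "ba' (appa w fs) \<in> arrows Y (bo' (app w ?ds)) (bo' (app w ?cs))"
    using ap b.H_simps b'.H_simps by (simp_all add: arrows_iff)
  note rd = b.rho_arr[OF w ds(1) dp, unfolded P] and rc = b.rho_arr[OF w cs(1) cp, unfolded P]
    and rd' = b'.rho_arr[OF w ds(1) dp, unfolded P] and rc' = b'.rho_arr[OF w cs(1) cp, unfolded P]
  let ?Lc = "ar_map (aop A w) (map lf ?cs)" and ?Ld = "ar_map (aop A w) (map lf ?ds)"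
    and ?B = "ar_map (aop A w) (map ba fs)" and ?B' = "ar_map (aop A w) (map ba' fs)"
  have B: "?B \<in> arrows Y (ob_map (aop A w) (map bo ?ds)) (ob_map (aop A w) (map bo ?cs))"
    by (rule b.B.op_arr[OF w]) (use fs fi b.H_simps in \<open>auto simp: arrows_iff\<close>)
  have B': "?B' \<in> arrows Y (ob_map (aop A w) (map bo' ?ds)) (ob_map (aop A w) (map bo' ?cs))"
    by (rule b.B.op_arr[OF w]) (use fs fi b'.H_simps in \<open>auto simp: arrows_iff\<close>)
  note L = lf_op[OF w ds] lf_op[OF w cs]
  have n: "Cmp Y (cpt (mrho b w) ?cs) (ba (appa w fs)) = Cmp Y ?B (cpt (mrho b w) ?ds)"
    using b.rho_nat[OF w fs(1) fp] P by simp
  have n': "Cmp Y (cpt (mrho b' w) ?cs) (ba' (appa w fs)) = Cmp Y ?B' (cpt (mrho b' w) ?ds)"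
    using b'.rho_nat[OF w fs(1) fp] P by simp
  have s: "Cmp Y ?Lc ?B = Cmp Y ?B' ?Ld"
  proof -
    \<comment> \<open>The diagonals of the argument squares, whose two factorisations are given by
      the induction hypothesis.\<close>
    define ms where "ms = map (\<lambda>f. Cmp Y (lf (Cod XP f)) (ba f)) fs"
    have l1: "lf (Cod XP f) \<in> arrows Y (bo (Cod XP f)) (bo' (Cod XP f))" "lf (Dom XP f) \<in> arrows Y (bo (Dom XP f)) (bo' (Dom XP f))"
      "ba f \<in> arrows Y (bo (Dom XP f)) (bo (Cod XP f))" "ba' f \<in> arrows Y (bo' (Dom XP f)) (bo' (Cod XP f))" if "f \<in> Arr XP" for f
      using that lf_arr XP_typed[OF that] b.H_simps b'.H_simps by (auto simp: arrows_iff)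
    have "ar_map (aop A w) ms = Cmp Y ?Lc ?B"
      by (rule b.B.op_comp[OF w]) (use fs l1[OF fi(1)] in \<open>auto simp: ms_def arrows_iff\<close>)
    moreover have "ar_map (aop A w) ms = Cmp Y ?B' ?Ld"
      by (rule b.B.op_comp[OF w]) (use fs l1[OF fi(1)] op(4)[OF fi(2)] in \<open>auto simp: ms_def arrows_iff\<close>)
    ultimately show ?thesis by simp
  qed
  have c: "Cmp Y (cpt (mrho b' w) ?cs) (lf (app w ?cs)) = Cmp Y ?Lc (cpt (mrho b w) ?cs)" using lf_cell[OF w cs] P by simp
  have d: "Cmp Y (cpt (mrho b' w) ?ds) (lf (app w ?ds)) = Cmp Y ?Ld (cpt (mrho b w) ?ds)" using lf_cell[OF w ds] P by simp
  note ty = l t rd(1) rc(1) rd'(1) rc'(1) B B' L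
  have "Cmp Y (cpt (mrho b' w) ?cs) (Cmp Y (lf (app w ?cs)) (ba (appa w fs))) = Cmp Y (Cmp Y (cpt (mrho b' w) ?cs) (lf (app w ?cs))) (ba (appa w fs))"
    using ty by (simp add: arrows_iff cat_assoc del: map_map)
  also have "\<dots> = Cmp Y ?Lc (Cmp Y (cpt (mrho b w) ?cs) (ba (appa w fs)))" unfolding c using ty by (simp add: arrows_iff cat_assoc del: map_map)
  also have "\<dots> = Cmp Y (Cmp Y ?Lc ?B) (cpt (mrho b w) ?ds)" unfolding n using ty by (simp add: arrows_iff cat_assoc del: map_map)
  also have "\<dots> = Cmp Y ?B' (Cmp Y ?Ld (cpt (mrho b w) ?ds))" unfolding s using ty by (simp add: arrows_iff cat_assoc del: map_map)
  also have "\<dots> = Cmp Y (Cmp Y ?B' (cpt (mrho b' w) ?ds)) (lf (app w ?ds))" unfolding d[symmetric] using ty by (simp add: arrows_iff cat_assoc del: map_map)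
  also have "\<dots> = Cmp Y (cpt (mrho b' w) ?cs) (Cmp Y (ba' (appa w fs)) (lf (app w ?ds)))" unfolding n'[symmetric] using ty by (simp add: arrows_iff cat_assoc del: map_map)
  finally have e: "Cmp Y (cpt (mrho b' w) ?cs) (Cmp Y (lf (app w ?cs)) (ba (appa w fs))) = Cmp Y (cpt (mrho b' w) ?cs) (Cmp Y (ba' (appa w fs)) (lf (app w ?ds)))" .
  show ?case unfolding ap(2,3)
    by (rule mono_cancel[OF b.B.cat rc'(2) _ _ _ _ e]) (use ty in \<open>simp_all add: arrows_iff del: map_map\<close>)
next
  case (inv a c)
  show ?case by (rule inv_transfer[OF inv(1-7)])
qed

section \<open>The extended 2-cell and its uniqueness\<close>

definition lift_cell :: "('t, 'u, 'u) pcell" where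
  "lift_cell = \<lparr>csrc = b, ctgt = b', cnat = \<lparr>nsrc = mfun b, ntgt = mfun b', cpt = (\<lambda>x\<in>Ob. lf x)\<rparr>\<rparr>"

lemma lift_cell: "pseudo_cell T P A lift_cell"
proof (rule pseudo_cellI[OF P_palg A_palg])
  show "is_ntrans (acat P) (acat A) (cnat lift_cell)"
  proof (rule is_ntransI)
    show "is_functor (acat P) Y (nsrc (cnat lift_cell))" "is_functor (acat P) Y (ntgt (cnat lift_cell))"
      using b.H b'.H by (simp_all add: lift_cell_def)
  qed (use lf_arr lf_natural XP_typed in \<open>simp_all add: lift_cell_def arrows_iff\<close>)
  fix w xs assume w: "w \<in> words T" and xs: "length xs = ar w" "set xs \<subseteq> Obj (acat P)"
  have xO: "set xs \<subseteq> Ob" using xs by simp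
  have m: "map (cpt (cnat lift_cell)) xs = map lf xs" using xO by (auto simp: lift_cell_def)
  have O: "ob_map (aop P w) xs \<in> Ob" using w xs by (simp add: P_simps)
  show "Cmp Y (cpt (mrho (ctgt lift_cell) w) xs) (cpt (cnat lift_cell) (ob_map (aop P w) xs)) =
     Cmp Y (ar_map (aop A w) (map (cpt (cnat lift_cell)) xs)) (cpt (mrho (csrc lift_cell) w) xs)"
    unfolding m using lf_cell[OF w xs(1) xO] O by (simp add: lift_cell_def)
qed (use b_mor b'_mor in \<open>simp_all add: lift_cell_def\<close>)

text \<open>This links restriction along \<open>pi\<close> with values at generators, and is used
  both for existence and for uniqueness of the extension.\<close>

lemma whisker_pim:
  assumes \<beta>: "pseudo_cell T P A \<beta>" "csrc \<beta> = b" and j: "j \<in> Obj J" and x: "x \<in> Obj (acat F)"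
  shows "cpt (hcomp (acat F) Y (cnat \<beta>) (nid (acat F) XP (mfun (pim j)))) x = cpt (cnat \<beta>) (gen j x)"
  using cpt_hcomp_nid_right[OF b.B.cat _ pim_functor[OF j] x, of "cnat \<beta>"] pseudo_cellD(3)[OF P_palg A_palg \<beta>(1)] x
  by (simp add: pim_simps)

lemma cell_exists_unique:
  "\<exists>!\<beta>. \<beta> \<in> arrows (hom_PsAlg T P A) b b' \<and> (\<forall>j\<in>Obj J. Cmp2 (PsAlg T) F P A \<beta> (Idn (hom_PsAlg T F P) (pim j)) = \<delta> j)"
proof (rule ex1I[of _ lift_cell])
  have l: "pseudo_cell T P A lift_cell" "csrc lift_cell = b" "ctgt lift_cell = b'" using lift_cell by (simp_all add: lift_cell_def)
  have "Cmp2 (PsAlg T) F P A lift_cell (Idn (hom_PsAlg T F P) (pim j)) = \<delta> j" if j: "j \<in> Obj J" for j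
  proof (rule pcell_eqI)
    note d = \<delta>_cell[OF j] and c = pseudo_cellD[OF F_palg A_palg \<delta>_cell(1)[OF j]]
    show "csrc (Cmp2 (PsAlg T) F P A lift_cell (Idn (hom_PsAlg T F P) (pim j))) = csrc (\<delta> j)"
      "ctgt (Cmp2 (PsAlg T) F P A lift_cell (Idn (hom_PsAlg T F P) (pim j))) = ctgt (\<delta> j)" using d l by simp_all
    show "cnat (Cmp2 (PsAlg T) F P A lift_cell (Idn (hom_PsAlg T F P) (pim j))) = cnat (\<delta> j)"
    proof (rule ntrans_eqI[where C="acat F"])
      fix x assume x: "x \<in> Obj (acat F)"
      have "cpt (cnat lift_cell) (gen j x) = dl j x" using j x by (simp add: lift_cell_def lf(1))
      then show "cpt (cnat (Cmp2 (PsAlg T) F P A lift_cell (Idn (hom_PsAlg T F P) (pim j)))) x = cpt (cnat (\<delta> j)) x"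
        using whisker_pim[OF l(1,2) j x] by (simp add: dl_def del: hcomp_simps(3))
    qed (use c d nt_ext[OF c(3)] in \<open>simp_all add: lift_cell_def\<close>)
  qed
  then show "lift_cell \<in> arrows (hom_PsAlg T P A) b b' \<and> (\<forall>j\<in>Obj J. Cmp2 (PsAlg T) F P A lift_cell (Idn (hom_PsAlg T F P) (pim j)) = \<delta> j)"
    using l by (simp add: arrows_iff)
next
  fix \<beta> assume B: "\<beta> \<in> arrows (hom_PsAlg T P A) b b' \<and> (\<forall>j\<in>Obj J. Cmp2 (PsAlg T) F P A \<beta> (Idn (hom_PsAlg T F P) (pim j)) = \<delta> j)"
  then have \<beta>: "pseudo_cell T P A \<beta>" "csrc \<beta> = b" "ctgt \<beta> = b'" by (auto simp: arrows_iff)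
  note c = pseudo_cellD[OF P_palg A_palg \<beta>(1), unfolded \<beta>(2,3)]
  \<comment> \<open>A competing 2-cell is fixed at generators by its restriction along
    \<open>pi\<close>. At a formal application its own 2-cell law leaves no choice, since the
    \<open>\<rho>\<close> of \<open>b'\<close> can be cancelled.\<close>
  have e: "cpt (cnat \<beta>) x = lf x" if "x \<in> Ob" for x
    using that
  proof (rule Ob_induct[rotated 2])
    fix j x assume j: "j \<in> Obj J" "x \<in> Obj (acat F)"
    have "Cmp2 (PsAlg T) F P A \<beta> (Idn (hom_PsAlg T F P) (pim j)) = \<delta> j" using B j by blast
    then have "cpt (cnat (Cmp2 (PsAlg T) F P A \<beta> (Idn (hom_PsAlg T F P) (pim j)))) x = dl j x" by (simp add: dl_def)
    then show "cpt (cnat \<beta>) (gen j x) = lf (gen j x)"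
      using whisker_pim[OF \<beta>(1,2) j] lf(1)[OF j] by (simp del: hcomp_simps(3))
  next
    fix w xs assume w: "w \<in> words T" and xs: "length xs = ar w" "set xs \<subseteq> Ob" and IH: "\<And>x. x \<in> set xs \<Longrightarrow> cpt (cnat \<beta>) x = lf x"
    have xp: "set xs \<subseteq> Obj (acat P)" using xs by simp
    have m: "map (cpt (cnat \<beta>)) xs = map lf xs" using IH by auto
    have O: "app w xs \<in> Ob" using w xs by simp
    note P = P_simps(1)[OF w xs]
    have "Cmp Y (cpt (mrho b' w) xs) (cpt (cnat \<beta>) (app w xs)) = Cmp Y (cpt (mrho b' w) xs) (lf (app w xs))"
      using c(6)[OF w xs(1) xp] lf_cell[OF w xs] m P by simp
    then show "cpt (cnat \<beta>) (app w xs) = lf (app w xs)"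
      by (rule mono_cancel[OF b.B.cat b'.rho_arr(2)[OF w xs(1) xp], rotated 4])
        (use cell_simps[OF P_palg A_palg \<beta>(1), of "app w xs"] lf_arr[OF O] b'.rho_arr(1)[OF w xs(1) xp] O P \<beta> in \<open>simp_all add: arrows_iff\<close>)
  qed
  show "\<beta> = lift_cell"
  proof (rule pcell_eqI)
    show "cnat \<beta> = cnat lift_cell"
      by (rule ntrans_eqI[where C=XP]) (use c e nt_ext[OF c(3)] in \<open>simp_all add: lift_cell_def\<close>)
  qed (use \<beta> in \<open>simp_all add: lift_cell_def\<close>)
qed

end

section \<open>The bitensor product property\<close>

context free_palg
begin

lemma bitensor: "bitensor_product (PsAlg T) J F P"
proof -
  interpret K: strict_twocat "PsAlg T :: (('t, 'u, 'u) palg, ('t, 'u, 'u) pmor, ('t, 'u, 'u) pcell) twocat"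
    by (rule PsAlg_strict_twocat[OF th])
  have pi [simp]: "j \<in> Obj J \<Longrightarrow> ob_map pi j = pim j" "m \<in> Arr J \<Longrightarrow> ar_map pi m = pic m" for j m by (simp_all add: pi_def)
  show ?thesis
  proof (rule K.bitensor_productI[OF J_cat F P_Obj0])
    show "is_functor J (HomC (PsAlg T) F P) pi" using pi_functor by simp
  next
    fix A D assume A: "A \<in> Obj0 (PsAlg T)" and D: "is_functor J (HomC (PsAlg T) F A) D"
    \<comment> \<open>The given algebra with the given diagram is itself one of the models, so
      evaluation at it is the required morphism.\<close>
    have M: "(A, D) \<in> Mod" using A D by (simp add: Mod_def)
    show "\<exists>b\<in>Obj (HomC (PsAlg T) P A). (\<forall>j\<in>Obj J. Cmp1 (PsAlg T) F P A b (ob_map pi j) = ob_map D j) \<and>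
           (\<forall>m\<in>Arr J. Cmp2 (PsAlg T) F P A (Idn (HomC (PsAlg T) P A) b) (ar_map pi m) = ar_map D m)"
    proof (intro bexI[of _ "evm (A, D)"] conjI ballI)
      show "evm (A, D) \<in> Obj (HomC (PsAlg T) P A)" using evm_morphism[OF M] by simp
    next
      fix j assume "j \<in> Obj J"
      then show "Cmp1 (PsAlg T) F P A (evm (A, D)) (ob_map pi j) = ob_map D j" using evm_pim[OF M] by simp
    next
      fix m assume "m \<in> Arr J"
      then show "Cmp2 (PsAlg T) F P A (Idn (HomC (PsAlg T) P A) (evm (A, D))) (ar_map pi m) = ar_map D m"
        using evm_pic[OF M] by simp
    qed
  next
    fix A b b' \<delta>
    assume A: "A \<in> Obj0 (PsAlg T)" and b: "b \<in> Obj (HomC (PsAlg T) P A)" "b' \<in> Obj (HomC (PsAlg T) P A)"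
      and d: "\<forall>j\<in>Obj J. \<delta> j \<in> arrows (HomC (PsAlg T) F A) (Cmp1 (PsAlg T) F P A b (ob_map pi j)) (Cmp1 (PsAlg T) F P A b' (ob_map pi j))"
      and n: "\<forall>m\<in>Arr J. Cmp (HomC (PsAlg T) F A) (\<delta> (Cod J m)) (Cmp2 (PsAlg T) F P A (Idn (HomC (PsAlg T) P A) b) (ar_map pi m)) =
          Cmp (HomC (PsAlg T) F A) (Cmp2 (PsAlg T) F P A (Idn (HomC (PsAlg T) P A) b') (ar_map pi m)) (\<delta> (Dom J m))"
    interpret c: free_palg_cells T J F gen app Ob A b b' \<delta>
    proof (intro free_palg_cells.intro free_palg_axioms free_palg_cells_axioms.intro)
      show "palg T A" using A th by (auto intro: palgI)
    qed (use b d n in simp_all)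
    show "\<exists>!\<beta>. \<beta> \<in> arrows (HomC (PsAlg T) P A) b b' \<and> (\<forall>j\<in>Obj J. Cmp2 (PsAlg T) F P A \<beta> (Idn (HomC (PsAlg T) F P) (ob_map pi j)) = \<delta> j)"
      using c.cell_exists_unique by simp
  qed
qed

end

theorem lemma11p7:
  fixes T :: "'t thy_data"
    and J :: "('u, 'u) cat"
    and F :: "('t, 'u, 'u) palg"
  assumes "uncountable (UNIV :: 'u set)"
    and "is_theory T" and "small TYPE('u) (Arr (tcat T))"
    and "small_category J"
    and "F \<in> Obj0 (PsAlg T)"
  shows "\<exists>P. bitensor_product (PsAlg T) J F P"
proof -
  \<comment> \<open>Smallness of the theory enters only through its words: terms and labels of
    arrows mention no other arrows of the theory.\<close>
  have W: "small TYPE('u) (words T)" by (rule small_subset[OF assms(3)]) (auto simp: words_def)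
  have JF: "small TYPE('u) (Obj J)" "small TYPE('u) (Obj (acat F))" using assms(4,5) by (auto simp: small_category_def)
  obtain gen :: "'u \<Rightarrow> 'u \<Rightarrow> 'u" and app :: "'t \<Rightarrow> 'u list \<Rightarrow> 'u" and Ob where
    sm: "small TYPE('u) Ob" and g: "\<forall>j\<in>Obj J. \<forall>x\<in>Obj (acat F). gen j x \<in> Ob"
    and a: "\<forall>w\<in>words T. \<forall>xs. length xs = arity T w \<longrightarrow> set xs \<subseteq> Ob \<longrightarrow> app w xs \<in> Ob"
    and i: "\<forall>Q. (\<forall>j\<in>Obj J. \<forall>x\<in>Obj (acat F). Q (gen j x)) \<longrightarrow>
       (\<forall>w\<in>words T. \<forall>xs. length xs = arity T w \<longrightarrow> set xs \<subseteq> Ob \<longrightarrow> (\<forall>x\<in>set xs. Q x) \<longrightarrow> Q (app w xs)) \<longrightarrow> (\<forall>x\<in>Ob. Q x)"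
    and r: "\<forall>(g :: 'u \<Rightarrow> 'u \<Rightarrow> 'u) (h :: 't \<Rightarrow> 'u list \<Rightarrow> 'u list \<Rightarrow> 'u). \<exists>r. (\<forall>j\<in>Obj J. \<forall>x\<in>Obj (acat F). r (gen j x) = g j x) \<and>
       (\<forall>w\<in>words T. \<forall>xs. length xs = arity T w \<longrightarrow> set xs \<subseteq> Ob \<longrightarrow> r (app w xs) = h w xs (map r xs))"
    using free_terms_exist[OF assms(1) JF W, of "arity T"] by (elim exE conjE) (rule that)
  interpret free_palg T J F gen app Ob
  proof
    fix Q x assume q: "\<And>j x. j \<in> Obj J \<Longrightarrow> x \<in> Obj (acat F) \<Longrightarrow> Q (gen j x)"
      "\<And>w xs. w \<in> words T \<Longrightarrow> length xs = arity T w \<Longrightarrow> set xs \<subseteq> Ob \<Longrightarrow> (\<And>x. x \<in> set xs \<Longrightarrow> Q x) \<Longrightarrow> Q (app w xs)" and x: "x \<in> Ob"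
    show "Q x" by (rule i[rule_format, OF _ _ x]) (use q in auto)
  qed (use assms W sm g a r in simp_all)
  show ?thesis using bitensor by blast
qed

end
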